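(* Let $t>1$ be an integer, $b$ an odd prime, and $0\le a<b$. Then as $n\to\infty$, $$p_t(a,b;n)\sim\frac{c_t(a,b;n)}{4\sqrt3\,n}\,e^{\pi\sqrt{\frac{2n}3}}.$$
   Context: For a partition $\lambda$, each cell of its Young diagram has a hook number: the number of cells directly to its right in its row plus the number of cells directly below it in its column, plus one for the cell itself. $\mathcal H_t(\lambda)$ is the multiset of hook numbers of $\lambda$ divisible by $t$, and $p_t(a,b;n)=\#\{\lambda\vdash n:\#\mathcal H_t(\lambda)\equiv a\pmod b\}$. The constants are $$c_t(a,b;n)=\frac1b+\begin{cases}0&\text{if } b\mid t,\\ (-1)^{\frac{(1-t)(b-1)}4}\,\mathbb I(a,b,t,n)\,b^{-\frac{t+1}2}\left(\frac tb\right)&\text{if } b\nmid t \text{ and } t\text{ is odd},\\ i^{\frac{(1-t)(b-1)}2}\,\varepsilon_b\,b^{-\frac t2}\left(\frac{\frac1{24}(1-t^2)(1-b^2)+at-n}{b}\right)&\text{if } b\nmid t\text{ and } t\text{ is even},\end{cases}$$ where $\left(\frac{\cdot}{b}\right)$ is the Legendre symbol, $\varepsilon_b=1$ if $b\equiv1\pmod4$ and $\varepsilon_b=i$ if $b\equiv3\pmod4$, and $\mathbb I(a,b,t,n)=b-1$ if $\frac1{24}(1-t^2)(1-b^2)+at-n\equiv0\pmod b$ and $\mathbb I(a,b,t,n)=-1$ otherwise (when $b\nmid t$ the number $\frac1{24}(1-t^2)(1-b^2)$ is an integer). $c_t(a,b;n)$ depends on $n$ only modulo $b$ and may vanish; $f(n)\sim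 g(n)$ means $f(n)=g(n)(1+o(1))$. *)

theory Defs
  imports
    Complex_Main
    "HOL-Library.Multiset"
    "HOL-Library.Landau_Symbols"
    "HOL-Number_Theory.Number_Theory"
begin

text \<open>Partitions are weakly decreasing lists of positive parts; cells are pairs
  (row, column), both counted from 0.\<close>

definition partitions_of :: "nat \<Rightarrow> nat list set" where
  "partitions_of n = {lam. sorted_wrt (\<ge>) lam \<and> 0 \<notin> set lam \<and> sum_list lam = n}"

definition young_diagram :: "nat list \<Rightarrow> (nat \<times> nat) set" where
  "young_diagram lam = {(i, j). i < length lam \<and> j < lam ! i}"

definition hook_number :: "nat list \<Rightarrow> nat \<times> nat \<Rightarrow> nat" where
  "hook_number lam = (\<lambda>(i, j).
     card {k. j < k \<and> (i, k) \<in> young_diagram lam} +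
     card {k. i < k \<and> (k, j) \<in> young_diagram lam} + 1)"

definition t_hooks :: "nat \<Rightarrow> nat list \<Rightarrow> nat multiset" where
  "t_hooks t lam =
     {#h \<in># image_mset (hook_number lam) (mset_set (young_diagram lam)). t dvd h#}"

definition p_hook :: "nat \<Rightarrow> nat \<Rightarrow> nat \<Rightarrow> nat \<Rightarrow> nat" where
  "p_hook t a b n = card {lam \<in> partitions_of n. [size (t_hooks t lam) = a] (mod b)}"

lemma finite_partitions_of: "finite (partitions_of n)"
proof (rule finite_subset)
  show "partitions_of n \<subseteq> {xs. set xs \<subseteq> {..n} \<and> length xs \<le> n}"
  proof
    fix lam assume lam: "lam \<in> partitions_of n"
    have "length xs \<le> sum_list xs" if "0 \<notin> set xs" for xs :: "nat list"
      using that by (induction xs) auto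
    then show "lam \<in> {xs. set xs \<subseteq> {..n} \<and> length xs \<le> n}"
      using lam member_le_sum_list by (auto simp: partitions_of_def)
  qed
  show "finite {xs::nat list. set xs \<subseteq> {..n} \<and> length xs \<le> n}"
    by (rule finite_lists_length_le) simp
qed

lemma finite_young_diagram: "finite (young_diagram lam)"
proof -
  have "young_diagram lam = Sigma {..<length lam} (\<lambda>i. {..<lam ! i})"
    by (auto simp: young_diagram_def)
  then show ?thesis by simp
qed

text \<open>The number \<open>(1 - t\<^sup>2)(1 - b\<^sup>2) / 24 + a t - n\<close>. The division is exact for
  odd primes \<open>b\<close> not dividing \<open>t\<close>, the only case in which it is used.\<close>

definition hook_arg :: "nat \<Rightarrow> nat \<Rightarrow> nat \<Rightarrow> nat \<Rightarrow> int" where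
  "hook_arg a b t n =
     ((1 - int t ^ 2) * (1 - int b ^ 2)) div 24 + int a * int t - int n"

lemma hook_arg_exact:
  assumes "prime b" "odd b" "\<not> b dvd t"
  shows "(24::int) dvd (1 - int t ^ 2) * (1 - int b ^ 2)"
proof -
  have 8: "(8::int) dvd 1 - int b ^ 2"
  proof -
    obtain k where k: "b = 2 * k + 1" using assms(2) oddE by blast
    have "even (int k * (int k + 1))" by simp
    then obtain m where "int k * (int k + 1) = 2 * m" by (elim evenE)
    then have "1 - int b ^ 2 = 8 * (- m)"
      by (simp add: k power2_eq_square algebra_simps)
    then show ?thesis by (metis dvd_triv_left)
  qed
  have sq: "(3::int) dvd 1 - int x ^ 2" if "\<not> 3 dvd x" for x
  proof -
    from that have "int x mod 3 = 1 \<or> int x mod 3 = 2" by presburger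
    then have "int x ^ 2 mod 3 = 1"
      by (auto simp: power2_eq_square mod_mult_eq[of "int x" 3 "int x", symmetric])
    then show ?thesis by presburger
  qed
  have "\<not> 3 dvd t \<or> \<not> 3 dvd b"
  proof (rule ccontr)
    assume "\<not> ?thesis"
    then have "3 dvd t" "3 dvd b" by auto
    moreover from \<open>3 dvd b\<close> assms(1) have "b = 3"
      using prime_nat_iff by auto
    ultimately show False using assms(3) by simp
  qed
  then have 3: "(3::int) dvd (1 - int t ^ 2) * (1 - int b ^ 2)"
    using sq by auto
  have 8: "(8::int) dvd (1 - int t ^ 2) * (1 - int b ^ 2)"
    using 8 by simp
  have "24 dvd x" if "3 dvd x" "8 dvd x" for x :: int
    using that by presburger
  with 3 8 show ?thesis by blast
qed

definition indicator_I :: "nat \<Rightarrow> nat \<Rightarrow> nat \<Rightarrow> nat \<Rightarrow> int" where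
  "indicator_I a b t n = (if [hook_arg a b t n = 0] (mod int b) then int b - 1 else - 1)"

definition eps :: "nat \<Rightarrow> complex" where
  "eps b = (if [b = 1] (mod 4) then 1 else \<i>)"

text \<open>The integer divisions in the exponents are exact for odd \<open>b\<close> and the respective parity
  of \<open>t\<close>. The constant is given by a complex expression, although its values are real.\<close>

definition c_hook :: "nat \<Rightarrow> nat \<Rightarrow> nat \<Rightarrow> nat \<Rightarrow> complex" where
  "c_hook t a b n = 1 / of_nat b +
     (if b dvd t then 0
      else if odd t then
        (- 1) powi ((1 - int t) * (int b - 1) div 4) * of_int (indicator_I a b t n)
          * of_nat b powi (- ((int t + 1) div 2)) * of_int (Legendre (int t) (int b))
      else
        \<i> powi ((1 - int t) * (int b - 1) div 2) * eps b
          * of_nat b powi (- (int t div 2)) * of_int (Legendre (hook_arg a b t n) (int b)))"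

end

theory Submission
  imports Defs "HOL-Probability.Probability" "HOL-Real_Asymp.Real_Asymp"
begin

text \<open>Encoding a partition as a Maya diagram and splitting the diagram into its \<open>t\<close> runners gives
  the \<open>t\<close>-core and the \<open>t\<close>-quotient. The number of hooks divisible by \<open>t\<close> is the size \<open>w\<close> of the
  quotient, and \<open>n = core + t w\<close>, so \<open>p_hook t a b n\<close> counts partitions of \<open>n\<close>
  whose core has size congruent to \<open>n - t a\<close> modulo \<open>t b\<close>. Cores are integer vectors of sum 0,
  and the core size is a quadratic polynomial in them.

  Each vector is weighted by the number of quotients of the complementary size. Along coordinate
  lines these weights are unimodal and vary slowly, hence the vectors are asymptotically
  equidistributed modulo \<open>t b\<close>. Therefore \<open>p_hook t a b n\<close> is asymptotic to the number of partitions times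
  the density of solutions of a quadratic congruence, which quadratic Gauss sums evaluate to
  \<open>c_hook t a b n\<close>.

  The Hardy--Ramanujan asymptotics come from the saddle point method. Counting 2-cores
  yields \<open>P(q) = \<theta>(q) P(q\<^sup>2)\<^sup>2\<close> with \<open>\<theta>(q)\<close> the sum of \<open>q\<close> to the triangular numbers.
  Iterating this relation gives the behaviour of the generating function \<open>P\<close> near \<open>q = 1\<close>
  including the constant, without modularity.\<close>

section \<open>Hooks and Maya diagrams\<close>

text \<open>The obstacle is that the core size must agree with \<open>n\<close> modulo
  \<open>t\<close>, so the true number of quotients lives on some residue classes only and cannot
  vary slowly. Rounding the quotient size down, in \<open>core_weight\<close>, extends the count to
  all integer vectors; the congruence modulo \<open>t\<close> then becomes a condition on residue
  classes like the one modulo \<open>b\<close>. The total of the extended weights is calibrated by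
  the same argument with \<open>b = 1\<close>: it is asymptotically \<open>t\<close> times the
  number of partitions. Slow variation rests on the ratio of consecutive counts tending to 1, a
  property that convolution preserves; the other error is polynomial in \<open>n\<close> and loses
  against the growth of the partition numbers. In the Gauss sums both parities of \<open>t\<close>
  lead to even powers of \<open>tau 1\<close>, so its square decides; the powers of
  \<open>\<i>\<close> in the constant become Legendre symbols of 2 and -1. As the constant may
  vanish for some \<open>n\<close>, the last step combines exact vanishing of the count there with a
  uniform lower bound for the density elsewhere.\<close>

definition part :: "nat list \<Rightarrow> nat \<Rightarrow> nat" where
  "part lam i = (if i < length lam then lam ! i else 0)"

definition conj_part :: "nat list \<Rightarrow> nat \<Rightarrow> nat" where
  "conj_part lam j = card {i. j < part lam i}"

text \<open>These are the positions of the vertical steps of the boundary path, read as beads on the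
  integers. The padding of \<open>part\<close> with zeros fills all sufficiently negative positions,
  and the empty partition becomes \<open>{..<0}\<close>.\<close>

definition beta_set :: "nat list \<Rightarrow> int set" where
  "beta_set lam = range (\<lambda>i. int (part lam i) - int i - 1)"

definition inversions :: "int set \<Rightarrow> (int \<times> int) set" where
  "inversions S = {(s, u). s \<in> S \<and> u \<notin> S \<and> u < s}"

lemma part_antimono:
  assumes "sorted_wrt (\<ge>) lam" "i \<le> k"
  shows "part lam k \<le> part lam i"
proof (cases "i < k \<and> k < length lam")
  case True
  then show ?thesis using sorted_wrt_nth_less[OF assms(1), of i k] by (simp add: part_def)
next
  case False
  then have "i = k \<or> \<not> k < length lam" using assms(2) by linarith
  then show ?thesis by (auto simp: part_def)
qed

lemma finite_part_gt: "finite {i. j < part lam i}"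
  by (rule finite_subset[of _ "{..<length lam}"]) (auto simp: part_def split: if_splits)

lemma downset_eq_lessThan_card:
  fixes D :: "nat set"
  assumes "finite D" "\<And>i k. k \<in> D \<Longrightarrow> i \<le> k \<Longrightarrow> i \<in> D"
  shows "D = {..<card D}"
proof -
  define m where "m = (LEAST m. m \<notin> D)"
  have "\<exists>m. m \<notin> D" using assms(1) ex_new_if_finite infinite_UNIV_nat by blast
  then have m: "m \<notin> D" unfolding m_def by (metis LeastI_ex)
  have "k \<in> D \<longleftrightarrow> k < m" for k
    using assms(2)[of k m] m not_less_Least[of k "\<lambda>m. m \<notin> D"] unfolding m_def[symmetric]
    by (metis not_le)
  then have "D = {..<m}" by blast
  then show ?thesis by (metis card_lessThan)
qed

text \<open>By monotonicity the rows longer than \<open>j\<close> form an initial segment of the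
  naturals, so membership is decided by its cardinality.\<close>

lemma less_conj_part_iff:
  assumes "sorted_wrt (\<ge>) lam"
  shows "i < conj_part lam j \<longleftrightarrow> j < part lam i"
proof -
  have "{i. j < part lam i} = {..<conj_part lam j}"
    unfolding conj_part_def
    by (rule downset_eq_lessThan_card[OF finite_part_gt])
      (use part_antimono[OF assms] in \<open>auto intro: less_le_trans\<close>)
  then show ?thesis by auto
qed

lemma young_diagram_part: "young_diagram lam = {(i, j). j < part lam i}"
  by (auto simp: young_diagram_def part_def split: if_splits)

lemma hook_number_eq:
  assumes "sorted_wrt (\<ge>) lam" "(i, j) \<in> young_diagram lam"
  shows "int (hook_number lam (i, j)) =
    (int (part lam i) - int i - 1) - (int j - int (conj_part lam j))"
proof -
  have "{k. j < k \<and> (i, k) \<in> young_diagram lam} = {j<..<part lam i}"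
    by (auto simp: young_diagram_part)
  moreover have "{k. i < k \<and> (k, j) \<in> young_diagram lam} = {i<..<conj_part lam j}"
    by (auto simp: young_diagram_part less_conj_part_iff[OF assms(1)])
  moreover have "j < part lam i" "i < conj_part lam j"
    using assms(2) by (auto simp: young_diagram_part less_conj_part_iff[OF assms(1)])
  ultimately show ?thesis by (simp add: hook_number_def)
qed

text \<open>The boundary path has one step at each integer, vertical for a row or horizontal for a
  column, so the gaps are the positions of the columns.\<close>

lemma notin_beta_set_iff:
  assumes "sorted_wrt (\<ge>) lam"
  shows "u \<notin> beta_set lam \<longleftrightarrow> (\<exists>j. u = int j - int (conj_part lam j))"
proof
  assume u: "u \<notin> beta_set lam"
  \<comment> \<open>\<open>i\<close> counts the beads above \<open>u\<close>; the horizontal step at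
    \<open>u\<close> then belongs to column \<open>u + i\<close>, which has exactly \<open>i\<close>
    cells.\<close>
  define i where "i = (LEAST i. int (part lam i) - int i - 1 \<le> u)"
  have "\<exists>i. int (part lam i) - int i - 1 \<le> u"
    by (rule exI[of _ "length lam + nat (-u)"]) (simp add: part_def)
  then have "int (part lam i) - int i - 1 \<le> u" unfolding i_def by (rule LeastI_ex)
  moreover have "int (part lam i) - int i - 1 \<noteq> u" using u by (auto simp: beta_set_def)
  ultimately have le: "int (part lam i) - int i - 1 < u" by simp
  define j where "j = nat (u + int i)"
  have j: "int j = u + int i" using le by (simp add: j_def)
  have iff: "k < conj_part lam j \<longleftrightarrow> k < i" for k
  proof
    assume "k < conj_part lam j"
    then have "j < part lam k" using less_conj_part_iff[OF assms] by simp
    moreover have "part lam i \<le> j" using le j by simp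
    ultimately show "k < i" using part_antimono[OF assms, of i k] by (meson leD le_trans not_le)
  next
    assume "k < i"
    then have "k \<le> i - 1" "i - 1 < i" by auto
    then have "\<not> int (part lam (i - 1)) - int (i - 1) - 1 \<le> u"
      using not_less_Least[of "i - 1" "\<lambda>i. int (part lam i) - int i - 1 \<le> u"]
      unfolding i_def[symmetric] by simp
    then have "int (part lam (i - 1)) > int j" using j \<open>k < i\<close> by (auto simp: of_nat_diff)
    then have "j < part lam k" using part_antimono[OF assms \<open>k \<le> i - 1\<close>] by simp
    then show "k < conj_part lam j" using less_conj_part_iff[OF assms] by simp
  qed
  have "conj_part lam j = i" using iff[of i] iff[of "conj_part lam j"] by simp
  then show "\<exists>j. u = int j - int (conj_part lam j)" using j by (intro exI[of _ j]) simp
next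
  assume "\<exists>j. u = int j - int (conj_part lam j)"
  then obtain j where u: "u = int j - int (conj_part lam j)" by blast
  have "u \<noteq> int (part lam i) - int i - 1" for i
    using less_conj_part_iff[OF assms, of i j] u by (cases "j < part lam i") auto
  then show "u \<notin> beta_set lam" by (auto simp: beta_set_def)
qed

text \<open>A cell in row \<open>i\<close> and column \<open>j\<close> is the pair formed by the last vertical step of row \<open>i\<close>
  and the last horizontal step of column \<open>j\<close> of the boundary path; the hook number is their distance.\<close>

lemma bij_betw_cells_inversions:
  assumes "sorted_wrt (\<ge>) lam"
  shows "bij_betw (\<lambda>(i, j). (int (part lam i) - int i - 1, int j - int (conj_part lam j)))
    (young_diagram lam) (inversions (beta_set lam))"
  unfolding bij_betw_def
proof
  have conj: "conj_part lam k \<le> conj_part lam j" if "j \<le> k" for j k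
    unfolding conj_part_def using that by (intro card_mono finite_part_gt) auto
  have i: "i = k" if "int (part lam i) - int i = int (part lam k) - int k" for i k
    using part_antimono[OF assms, of i k] part_antimono[OF assms, of k i] that by linarith
  have j: "j = k" if "int j - int (conj_part lam j) = int k - int (conj_part lam k)" for j k
    using conj[of j k] conj[of k j] that by linarith
  show "inj_on (\<lambda>(i, j). (int (part lam i) - int i - 1, int j - int (conj_part lam j)))
    (young_diagram lam)"
    using i j by (auto simp: inj_on_def)
  have lt: "int j - int (conj_part lam j) < int (part lam i) - int i - 1 \<longleftrightarrow> j < part lam i" for i j
    using less_conj_part_iff[OF assms, of i j] by (cases "j < part lam i") auto
  show "(\<lambda>(i, j). (int (part lam i) - int i - 1, int j - int (conj_part lam j))) ` young_diagram lam
      = inversions (beta_set lam)" (is "?f ` _ = _")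
  proof
    show "?f ` young_diagram lam \<subseteq> inversions (beta_set lam)"
    proof
      fix p assume "p \<in> ?f ` young_diagram lam"
      then obtain i j where ij: "j < part lam i"
        and p: "p = (int (part lam i) - int i - 1, int j - int (conj_part lam j))"
        by (auto simp: young_diagram_part)
      have "fst p \<in> beta_set lam" using p by (auto simp: beta_set_def)
      moreover have "snd p \<notin> beta_set lam" using p notin_beta_set_iff[OF assms] by auto
      ultimately show "p \<in> inversions (beta_set lam)"
        using ij p lt by (auto simp: inversions_def)
    qed
    show "inversions (beta_set lam) \<subseteq> ?f ` young_diagram lam"
    proof
      fix p assume "p \<in> inversions (beta_set lam)"
      then obtain s u where p: "p = (s, u)" "s \<in> beta_set lam" "u \<notin> beta_set lam" "u < s"
        by (auto simp: inversions_def)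
      then obtain i j where "s = int (part lam i) - int i - 1" "u = int j - int (conj_part lam j)"
        using notin_beta_set_iff[OF assms] by (auto simp: beta_set_def)
      then have "p = ?f (i, j)" "(i, j) \<in> young_diagram lam" using p lt
        by (auto simp: young_diagram_part)
      then show "p \<in> ?f ` young_diagram lam" by blast
    qed
  qed
qed

lemma size_t_hooks:
  assumes "sorted_wrt (\<ge>) lam"
  shows "size (t_hooks t lam) = card {(s, u) \<in> inversions (beta_set lam). int t dvd s - u}"
proof -
  let ?f = "\<lambda>(i, j). (int (part lam i) - int i - 1, int j - int (conj_part lam j))"
  have "size (t_hooks t lam) = card {c \<in> young_diagram lam. t dvd hook_number lam c}"
    by (simp add: t_hooks_def filter_mset_image_mset finite_young_diagram)
  also have "bij_betw ?f {c \<in> young_diagram lam. t dvd hook_number lam c}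
      {p \<in> inversions (beta_set lam). int t dvd fst p - snd p}"
  proof (rule bij_betw_Collect[OF bij_betw_cells_inversions[OF assms]])
    fix c assume c: "c \<in> young_diagram lam"
    obtain i j where ij: "c = (i, j)" by force
    have "fst (?f c) - snd (?f c) = int (hook_number lam c)"
      using hook_number_eq[OF assms] c unfolding ij by simp
    then show "(int t dvd fst (?f c) - snd (?f c)) = (t dvd hook_number lam c)" by simp
  qed
  then have "card {c \<in> young_diagram lam. t dvd hook_number lam c}
    = card {p \<in> inversions (beta_set lam). int t dvd fst p - snd p}"
    by (rule bij_betw_same_card)
  finally show ?thesis by (simp add: case_prod_unfold)
qed

lemma card_young_diagram: "card (young_diagram lam) = sum_list lam"
proof -
  have "young_diagram lam = Sigma {..<length lam} (\<lambda>i. {..<lam ! i})"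
    by (auto simp: young_diagram_def)
  then show ?thesis by (simp add: sum_list_sum_nth atLeast0LessThan)
qed

lemma card_inversions_beta_set:
  assumes "sorted_wrt (\<ge>) lam"
  shows "card (inversions (beta_set lam)) = sum_list lam"
  using bij_betw_same_card[OF bij_betw_cells_inversions[OF assms]] card_young_diagram[of lam]
  by metis

text \<open>The row index of a bead is the number of beads above it, so the set determines the
  function \<open>part lam\<close>; as zero parts are excluded, the length is the number of rows
  with a positive part.\<close>

lemma inj_on_beta_set: "inj_on beta_set {lam. sorted_wrt (\<ge>) lam \<and> 0 \<notin> set lam}"
proof (rule inj_onI)
  fix lam mu :: "nat list"
  assume a: "lam \<in> {lam. sorted_wrt (\<ge>) lam \<and> 0 \<notin> set lam}" "mu \<in> {lam. sorted_wrt (\<ge>) lam \<and> 0 \<notin> set lam}"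
    and eq: "beta_set lam = beta_set mu"
  let ?b = "\<lambda>lam i. int (part lam i) - int i - 1"
  have sm: "?b lam k < ?b lam i" if "sorted_wrt (\<ge>) lam" "i < k" for lam i k
    using part_antimono[OF that(1), of i k] that(2) by simp
  have rank: "card {s \<in> beta_set lam. s > ?b lam i} = i" if "sorted_wrt (\<ge>) lam" for lam i
  proof -
    have "{s \<in> beta_set lam. s > ?b lam i} = ?b lam ` {..<i}"
    proof (rule Set.set_eqI)
      fix s
      have "?b lam i < ?b lam k \<longleftrightarrow> k < i" for k
        using sm[OF that, of k i] sm[OF that, of i k] by (cases k i rule: linorder_cases) auto
      then show "s \<in> {s \<in> beta_set lam. s > ?b lam i} \<longleftrightarrow> s \<in> ?b lam ` {..<i}"
        unfolding beta_set_def by blast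
    qed
    moreover have "inj_on (?b lam) {..<i}"
    proof (rule inj_onI)
      fix k l assume "?b lam k = ?b lam l"
      then show "k = l" using sm[OF that, of k l] sm[OF that, of l k]
        by (cases k l rule: linorder_cases) auto
    qed
    ultimately show ?thesis by (simp add: card_image)
  qed
  have "part lam i = part mu i" for i
  proof -
    have "?b lam i \<in> beta_set mu" using eq by (auto simp: beta_set_def)
    then obtain j where j: "?b lam i = ?b mu j" by (auto simp: beta_set_def)
    then have "i = j" using rank[of lam i] rank[of mu j] a eq by simp
    then show ?thesis using j by simp
  qed
  then have p: "part lam = part mu" by blast
  have "length lam = card {i. 0 < part lam i}" if "0 \<notin> set lam" for lam
  proof -
    have "{i. 0 < part lam i} = {..<length lam}"
      using that by (auto simp: part_def) (metis gr0I nth_mem)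
    then show ?thesis by simp
  qed
  then have l: "length lam = length mu" using a p by auto
  moreover have "lam ! i = mu ! i" if "i < length lam" for i
    using p that l by (metis part_def)
  ultimately show "lam = mu" by (rule nth_equalityI)
qed

section \<open>Maya diagrams: charge, energy and translation\<close>

definition maya :: "int set \<Rightarrow> bool" where
  "maya S \<longleftrightarrow> finite {s \<in> S. 0 \<le> s} \<and> finite {s. s < 0 \<and> s \<notin> S}"

text \<open>Beads minus holes relative to the vacuum \<open>{..<0}\<close>: a finite substitute for
  the number of beads, just as \<open>energy\<close> is one for their sum. A unit translation raises
  the charge by 1 and the energy by the charge.\<close>

definition charge :: "int set \<Rightarrow> int" where
  "charge S = int (card {s \<in> S. 0 \<le> s}) - int (card {s. s < 0 \<and> s \<notin> S})"

definition energy :: "int set \<Rightarrow> int" where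
  "energy S = (\<Sum>s \<in> {s \<in> S. 0 \<le> s}. s) - (\<Sum>s \<in> {s. s < 0 \<and> s \<notin> S}. s)"

lemma finite_inversions:
  assumes "maya S" shows "finite (inversions S)"
proof -
  have f1: "finite {s \<in> S. 0 \<le> s}" and f2: "finite {s. s < 0 \<and> s \<notin> S}"
    using assms by (auto simp: maya_def)
  obtain M where M: "\<And>s. s \<in> S \<Longrightarrow> 0 \<le> s \<Longrightarrow> s < M"
  proof -
    obtain B where B: "\<forall>s \<in> {s \<in> S. 0 \<le> s}. s \<le> B"
      using bdd_above_finite[OF f1] unfolding bdd_above_def by blast
    show ?thesis by (rule that[of "B + 1"]) (use B in force)
  qed
  obtain N where N: "\<And>s. s \<notin> S \<Longrightarrow> s < 0 \<Longrightarrow> N \<le> s"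
    using bdd_below_finite[OF f2] unfolding bdd_below_def by auto
  have "inversions S \<subseteq> {min N 0..max M 0} \<times> {min N 0..max M 0}"
  proof
    fix p assume "p \<in> inversions S"
    then obtain s u where p: "p = (s,u)" "s \<in> S" "u \<notin> S" "u < s" by (auto simp: inversions_def)
    have "s \<le> max M 0" using M[of s] p by force
    moreover have "min N 0 \<le> u" using N[of u] p by force
    ultimately show "p \<in> {min N 0..max M 0} \<times> {min N 0..max M 0}" using p by auto
  qed
  then show ?thesis by (rule finite_subset) auto
qed

lemma maya_insert: "maya S \<Longrightarrow> maya (insert s S)"
  unfolding maya_def
  by (auto intro: finite_subset[of _ "insert s {s \<in> S. 0 \<le> s}"]
      finite_subset[of _ "{s. s < 0 \<and> s \<notin> S}"])

lemma
  assumes "maya S" "s \<notin> S"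
  shows charge_insert: "charge (insert s S) = charge S + 1"
    and energy_insert: "energy (insert s S) = energy S + s"
proof -
  have fin: "finite {s \<in> S. 0 \<le> s}" "finite {s. s < 0 \<and> s \<notin> S}"
    using assms(1) by (auto simp: maya_def)
  have "charge (insert s S) = charge S + 1 \<and> energy (insert s S) = energy S + s"
  proof (cases "0 \<le> s")
    case True
    then have "{r \<in> insert s S. 0 \<le> r} = insert s {s \<in> S. 0 \<le> s}"
      "{r. r < 0 \<and> r \<notin> insert s S} = {s. s < 0 \<and> s \<notin> S}" by auto
    then show ?thesis using assms fin by (simp add: charge_def energy_def)
  next
    case False
    then have 1: "{r \<in> insert s S. 0 \<le> r} = {s \<in> S. 0 \<le> s}"
      and 2: "{s. s < 0 \<and> s \<notin> S} = insert s {r. r < 0 \<and> r \<notin> insert s S}"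
      using assms(2) by auto
    have "finite {r. r < 0 \<and> r \<notin> insert s S}" by (rule finite_subset[OF _ fin(2)]) auto
    then show ?thesis unfolding charge_def energy_def 1 2 by simp
  qed
  then show "charge (insert s S) = charge S + 1" "energy (insert s S) = energy S + s" by auto
qed

definition translate :: "int \<Rightarrow> int set \<Rightarrow> int set" where
  "translate c S = {s. s - c \<in> S}"

lemma translate_0 [simp]: "translate 0 S = S"
  and translate_translate [simp]: "translate c (translate d S) = translate (c + d) S"
  by (auto simp: translate_def algebra_simps)

lemma maya_translate:
  assumes "maya S" shows "maya (translate c S)"
proof -
  have fin: "finite {s \<in> S. 0 \<le> s}" "finite {s. s < 0 \<and> s \<notin> S}"
    using assms(1) by (auto simp: maya_def)
  have "{s \<in> translate c S. 0 \<le> s} \<subseteq> (\<lambda>s. s + c) ` ({s \<in> S. 0 \<le> s} \<union> {-\<bar>c\<bar>..\<bar>c\<bar>})"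
  proof
    fix s assume s: "s \<in> {s \<in> translate c S. 0 \<le> s}"
    then have "s - c \<in> {s \<in> S. 0 \<le> s} \<union> {-\<bar>c\<bar>..\<bar>c\<bar>}" by (auto simp: translate_def)
    then show "s \<in> (\<lambda>s. s + c) ` ({s \<in> S. 0 \<le> s} \<union> {-\<bar>c\<bar>..\<bar>c\<bar>})"
      by (intro image_eqI[of _ _ "s - c"]) auto
  qed
  moreover have "{s. s < 0 \<and> s \<notin> translate c S}
      \<subseteq> (\<lambda>s. s + c) ` ({s. s < 0 \<and> s \<notin> S} \<union> {-\<bar>c\<bar>..\<bar>c\<bar>})"
  proof
    fix s assume s: "s \<in> {s. s < 0 \<and> s \<notin> translate c S}"
    then have "s - c \<in> {s. s < 0 \<and> s \<notin> S} \<union> {-\<bar>c\<bar>..\<bar>c\<bar>}" by (auto simp: translate_def)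
    then show "s \<in> (\<lambda>s. s + c) ` ({s. s < 0 \<and> s \<notin> S} \<union> {-\<bar>c\<bar>..\<bar>c\<bar>})"
      by (intro image_eqI[of _ _ "s - c"]) auto
  qed
  ultimately show ?thesis using fin unfolding maya_def
    by (meson finite_Un finite_atLeastAtMost_int finite_imageI finite_subset)
qed

lemma
  assumes "maya S"
  shows charge_translate_1: "charge (translate 1 S) = charge S + 1"
    and energy_translate_1: "energy (translate 1 S) = energy S + charge S"
proof -
  let ?P = "{s \<in> S. 0 \<le> s}" and ?H = "{s. s < 0 \<and> s \<notin> S}"
  let ?f = "\<lambda>s::int. s + 1"
  have fin: "finite ?P" "finite ?H" using assms(1) by (auto simp: maya_def)
  have inj: "inj_on ?f A" for A by (auto simp: inj_on_def)
  have sum: "(\<Sum>s \<in> ?f ` A. s) = (\<Sum>s\<in>A. s) + int (card A)" if "finite A" for A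
    using that by (simp add: sum.reindex[OF inj] sum.distrib)
  have card: "card (?f ` A) = card A" for A by (rule card_image[OF inj])
  have img: "s \<in> ?f ` A \<longleftrightarrow> s - 1 \<in> A" for s A by (force simp: image_iff)
  have "charge (translate 1 S) = charge S + 1 \<and> energy (translate 1 S) = energy S + charge S"
  \<comment> \<open>Under the unit shift only the site -1 crosses the origin: a bead arriving at 0
    raises the bead count, a gap arriving there removes a hole.\<close>
  proof (cases "-1 \<in> S")
    case True
    have 1: "{s \<in> translate 1 S. 0 \<le> s} = insert 0 (?f ` ?P)"
      using True by (auto simp: img translate_def)
    have 2: "{s. s < 0 \<and> s \<notin> translate 1 S} = ?f ` ?H"
    proof (intro Set.set_eqI)
      fix s show "s \<in> {s. s < 0 \<and> s \<notin> translate 1 S} \<longleftrightarrow> s \<in> ?f ` ?H"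
        using True by (cases "s = 0") (auto simp: img translate_def)
    qed
    have "0 \<notin> ?f ` ?P" by (auto simp: img)
    then show ?thesis unfolding charge_def energy_def 1 2 using fin by (simp add: sum card)
  next
    case False
    have 1: "{s \<in> translate 1 S. 0 \<le> s} = ?f ` ?P"
    proof (intro Set.set_eqI)
      fix s show "s \<in> {s \<in> translate 1 S. 0 \<le> s} \<longleftrightarrow> s \<in> ?f ` ?P"
        using False by (cases "s = 0") (auto simp: img translate_def)
    qed
    have 2: "{s. s < 0 \<and> s \<notin> translate 1 S} = ?f ` (?H - {-1})"
      by (auto simp: img translate_def)
    have 3: "-1 \<in> ?H" using False by simp
    have "card ?H > 0" using 3 fin(2) card_gt_0_iff by blast
    then have "int (card (?H - {-1})) = int (card ?H) - 1"
      using card_Diff_singleton[OF 3] by (simp add: of_nat_diff)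
    moreover have "(\<Sum>s\<in>?H - {-1}. s) = (\<Sum>s\<in>?H. s) + 1"
      using sum.remove[OF fin(2) 3, of "\<lambda>s. s"] by simp
    ultimately show ?thesis unfolding charge_def energy_def 1 2 using fin
      by (subst (1 2) sum) (auto simp: card)
  qed
  then show "charge (translate 1 S) = charge S + 1"
    "energy (translate 1 S) = energy S + charge S" by auto
qed

text \<open>Iterates the unit translation in both directions. The energy gains the successive
  charges \<open>charge S\<close>, \<open>charge S + 1\<close> and so on, whence the term
  \<open>c * (c - 1)\<close>; the factor 2 avoids a division.\<close>

lemma charge_energy_translate:
  assumes "maya S"
  shows "charge (translate c S) = charge S + c \<and>
    2 * energy (translate c S) = 2 * energy S + 2 * c * charge S + c * (c - 1)"
proof (induction c rule: int_induct[where k = 0])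
  case base then show ?case by simp
next
  case (step1 c)
  have "translate (c + 1) S = translate 1 (translate c S)" by (simp add: add.commute)
  then show ?case using step1 charge_translate_1[OF maya_translate[OF assms, of c]]
      energy_translate_1[OF maya_translate[OF assms, of c]]
    by (simp add: algebra_simps)
next
  case (step2 c)
  have "translate c S = translate 1 (translate (c - 1) S)" by simp
  then show ?case using step2 charge_translate_1[OF maya_translate[OF assms, of "c - 1"]]
      energy_translate_1[OF maya_translate[OF assms, of "c - 1"]]
    by (simp add: algebra_simps)
qed

lemmas charge_translate = charge_energy_translate[THEN conjunct1]
lemmas energy_translate = charge_energy_translate[THEN conjunct2]

lemma card_inversions_translate: "card (inversions (translate c S)) = card (inversions S)"
  by (rule bij_betw_same_card[of "\<lambda>(s, u). (s - c, u - c)"],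
      rule bij_betw_byWitness[of _ "\<lambda>(s, u). (s + c, u + c)"])
    (auto simp: inversions_def translate_def)

lemma beta_set_Nil: "beta_set [] = {..<0}"
proof -
  have "s \<in> beta_set []" if "s < 0" for s
    unfolding beta_set_def by (rule image_eqI[of _ _ "nat (-s - 1)"]) (use that in \<open>auto simp: part_def\<close>)
  then show ?thesis by (auto simp: beta_set_def part_def)
qed

text \<open>All old rows move down by one, which lowers their beads by 1, and the new row 0
  contributes the bead \<open>int x - 1\<close>. This opens the way to induction on the
  list.\<close>

lemma beta_set_Cons: "beta_set (x # lam) = insert (int x - 1) (translate (-1) (beta_set lam))"
proof (intro Set.set_eqI)
  fix s
  have "s \<in> beta_set (x # lam) \<longleftrightarrow> (\<exists>i. s = int (part (x # lam) i) - int i - 1)"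
    unfolding beta_set_def by blast
  also have "\<dots> \<longleftrightarrow> s = int (part (x # lam) 0) - int 0 - 1 \<or>
      (\<exists>i. s = int (part (x # lam) (Suc i)) - int (Suc i) - 1)"
    by (metis not0_implies_Suc)
  also have "\<dots> \<longleftrightarrow> s = int x - 1 \<or> (\<exists>i. s + 1 = int (part lam i) - int i - 1)"
    by (simp add: part_def algebra_simps)
  also have "\<dots> \<longleftrightarrow> s \<in> insert (int x - 1) (translate (-1) (beta_set lam))"
    unfolding beta_set_def translate_def by auto
  finally show "s \<in> beta_set (x # lam) \<longleftrightarrow> s \<in> insert (int x - 1) (translate (-1) (beta_set lam))" .
qed

lemma beta_set_bound:
  assumes "sorted_wrt (\<ge>) (x # lam)" "s \<in> beta_set lam"
  shows "s < int x"
proof -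
  obtain i where "s = int (part lam i) - int i - 1" using assms(2) by (auto simp: beta_set_def)
  moreover have "part lam i \<le> x" using assms(1) by (auto simp: part_def)
  ultimately show ?thesis by simp
qed

lemma maya_beta_set:
  assumes "sorted_wrt (\<ge>) lam"
  shows "maya (beta_set lam) \<and> charge (beta_set lam) = 0 \<and> energy (beta_set lam) = sum_list lam"
  using assms
proof (induction lam)
  case Nil
  have e: "{s \<in> {..<0}. 0 \<le> s} = ({}::int set)" "{s. s < 0 \<and> s \<notin> {..<0}} = ({}::int set)" by auto
  show ?case unfolding beta_set_Nil maya_def charge_def energy_def e by simp
next
  case (Cons x lam)
  then have IH: "maya (beta_set lam)" "charge (beta_set lam) = 0" "energy (beta_set lam) = sum_list lam"
    by auto
  have new: "int x - 1 \<notin> translate (-1) (beta_set lam)"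
    using beta_set_bound[OF Cons.prems, of "int x"] by (auto simp: translate_def)
  show ?case unfolding beta_set_Cons
    using charge_insert[OF maya_translate[OF IH(1)] new] energy_insert[OF maya_translate[OF IH(1)] new]
      maya_insert[OF maya_translate[OF IH(1), of "-1"], of "int x - 1"]
      charge_translate[OF IH(1), of "-1"] energy_translate[OF IH(1), of "-1"] IH
    by simp
qed

text \<open>Peels off the largest part: removing the top bead \<open>m\<close> and translating by 1
  restores charge 0. A nonnegative bead forces a negative hole \<open>u\<close>, and the inversions
  of the new diagram embed into those of \<open>S\<close> without hitting \<open>(m, u)\<close>, so
  the induction measure drops.\<close>

lemma beta_set_surj:
  assumes "maya S" "charge S = 0"
  shows "\<exists>lam. sorted_wrt (\<ge>) lam \<and> 0 \<notin> set lam \<and> beta_set lam = S"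
  using assms
proof (induction "card (inversions S)" arbitrary: S rule: less_induct)
  case less
  have fin: "finite {s \<in> S. 0 \<le> s}" "finite {s. s < 0 \<and> s \<notin> S}"
    using less.prems by (auto simp: maya_def)
  show ?case
  proof (cases "{s \<in> S. 0 \<le> s} = {}")
    case True
    have "card {s. s < 0 \<and> s \<notin> S} = 0" using less.prems(2) unfolding charge_def True by simp
    then have "{s. s < 0 \<and> s \<notin> S} = {}" using fin(2) by simp
    with True have "S = {..<0}" by force
    then show ?thesis by (intro exI[of _ "[]"]) (simp add: beta_set_Nil)
  next
    case False
    define m where "m = Max {s \<in> S. 0 \<le> s}"
    have m: "m \<in> S" "0 \<le> m" using Max_in[OF fin(1) False] by (auto simp: m_def)
    have max: "s \<le> m" if "s \<in> S" for s
      using Max_ge[OF fin(1), of s] that m by (cases "0 \<le> s") (auto simp: m_def)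
    have "card {s \<in> S. 0 \<le> s} > 0" using fin(1) False card_gt_0_iff by blast
    then have "card {s. s < 0 \<and> s \<notin> S} > 0" using less.prems(2) by (simp add: charge_def)
    then have "{s. s < 0 \<and> s \<notin> S} \<noteq> {}" unfolding card_gt_0_iff by blast
    then obtain u where u: "u < 0" "u \<notin> S" by blast
    define S0 where "S0 = S - {m}"
    have S0: "maya S0" unfolding maya_def S0_def
    proof
      show "finite {s \<in> S - {m}. 0 \<le> s}" by (rule finite_subset[OF _ fin(1)]) auto
      show "finite {s. s < 0 \<and> s \<notin> S - {m}}"
        by (rule finite_subset[of _ "insert m {s. s < 0 \<and> s \<notin> S}"]) (use fin(2) in auto)
    qed
    have S: "S = insert m S0" "m \<notin> S0" using m by (auto simp: S0_def)
    have c0: "charge S0 = -1" using charge_insert[OF S0 S(2)] less.prems(2) S(1) by simp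
    define S' where "S' = translate 1 S0"
    have S': "maya S'" "charge S' = 0"
      unfolding S'_def using maya_translate[OF S0] charge_translate_1[OF S0] c0 by auto
    let ?f = "\<lambda>(s, u). (s - 1, u - (1::int))"
    have "?f ` inversions S' \<subseteq> inversions S - {(m, u)}"
    proof
      fix p assume "p \<in> ?f ` inversions S'"
      then obtain s v where p: "p = (s, v)" and sv: "(s + 1, v + 1) \<in> inversions S'" by auto
      then have "s \<in> S" "s \<noteq> m" "v < s" "v \<notin> S0"
        by (auto simp: inversions_def S'_def translate_def S0_def)
      moreover have "v \<notin> S" using calculation max[of s] unfolding S0_def by simp
      ultimately show "p \<in> inversions S - {(m, u)}" by (auto simp: p inversions_def)
    qed
    moreover have "(m, u) \<in> inversions S" using m u by (auto simp: inversions_def)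
    moreover have "inj_on ?f (inversions S')" by (auto simp: inj_on_def)
    moreover note fin_inv = finite_inversions[OF less.prems(1)]
    ultimately have "card (inversions S') < card (inversions S)"
      using card_mono[OF finite_Diff[OF fin_inv], of "?f ` inversions S'" "{(m, u)}"]
        card_Diff1_less[OF fin_inv, of "(m, u)"] card_image[of ?f "inversions S'"]
      by linarith
    from less.hyps[OF this S'] obtain lam where
      lam: "sorted_wrt (\<ge>) lam" "0 \<notin> set lam" "beta_set lam = S'" by blast
    \<comment> \<open>This makes the extended list sorted: the first bead of \<open>lam\<close> lies
      in \<open>S'\<close>, and after removing \<open>m\<close> and shifting by 1 nothing lies above
      \<open>m\<close>.\<close>
    have "x \<le> nat (m + 1)" if "x \<in> set lam" for x
    proof -
      have "x \<le> part lam 0"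
        using that lam(1) by (cases lam) (auto simp: part_def)
      moreover have "int (part lam 0) - 1 \<in> S'" unfolding lam(3)[symmetric] beta_set_def
        by (rule range_eqI[of _ _ 0]) simp
      then have "int (part lam 0) - 1 \<le> m + 1" using max[of "int (part lam 0) - 2"]
        by (auto simp: S'_def translate_def S0_def)
      then have "int (part lam 0) - 2 \<noteq> m"
        using \<open>int (part lam 0) - 1 \<in> S'\<close> by (auto simp: S'_def translate_def S0_def)
      ultimately show ?thesis using \<open>int (part lam 0) - 1 \<le> m + 1\<close> by linarith
    qed
    moreover have "beta_set (nat (m + 1) # lam) = S"
      unfolding beta_set_Cons lam(3) S'_def using m S(1) by simp
    ultimately show ?thesis using lam m by (intro exI[of _ "nat (m + 1) # lam"]) auto
  qed
qed

lemma bij_betw_beta_set: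
  "bij_betw beta_set (partitions_of n) {S. maya S \<and> charge S = 0 \<and> card (inversions S) = n}"
  unfolding bij_betw_def
proof
  show "inj_on beta_set (partitions_of n)"
    by (rule inj_on_subset[OF inj_on_beta_set]) (auto simp: partitions_of_def)
  show "beta_set ` partitions_of n = {S. maya S \<and> charge S = 0 \<and> card (inversions S) = n}"
  proof
    show "beta_set ` partitions_of n \<subseteq> {S. maya S \<and> charge S = 0 \<and> card (inversions S) = n}"
      using maya_beta_set card_inversions_beta_set by (auto simp: partitions_of_def)
    show "{S. maya S \<and> charge S = 0 \<and> card (inversions S) = n} \<subseteq> beta_set ` partitions_of n"
    proof
      fix S assume S: "S \<in> {S. maya S \<and> charge S = 0 \<and> card (inversions S) = n}"
      then obtain lam where lam: "sorted_wrt (\<ge>) lam" "0 \<notin> set lam" "beta_set lam = S"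
        using beta_set_surj by blast
      then have "lam \<in> partitions_of n"
        using S card_inversions_beta_set[OF lam(1)] by (simp add: partitions_of_def)
      then show "S \<in> beta_set ` partitions_of n" using lam by blast
    qed
  qed
qed

lemma bij_betw_translate:
  "bij_betw (translate c) {S. maya S \<and> charge S = 0 \<and> card (inversions S) = n}
    {S. maya S \<and> charge S = c \<and> card (inversions S) = n}"
  by (rule bij_betw_byWitness[of _ "translate (-c)"])
    (auto simp: maya_translate charge_translate card_inversions_translate)

text \<open>Translation identifies the charge sectors with each other and preserves inversions, so
  every sector is a copy of the partitions, which sit at charge 0.\<close>

lemma card_maya_charge:
  "finite {S. maya S \<and> charge S = c \<and> card (inversions S) = n}"
  "card {S. maya S \<and> charge S = c \<and> card (inversions S) = n} = card (partitions_of n)"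
proof -
  have bij: "bij_betw (translate c \<circ> beta_set) (partitions_of n)
      {S. maya S \<and> charge S = c \<and> card (inversions S) = n}"
    by (rule bij_betw_trans[OF bij_betw_beta_set bij_betw_translate])
  show "finite {S. maya S \<and> charge S = c \<and> card (inversions S) = n}"
    using bij_betw_finite[OF bij] finite_partitions_of by simp
  show "card {S. maya S \<and> charge S = c \<and> card (inversions S) = n} = card (partitions_of n)"
    using bij_betw_same_card[OF bij] by simp
qed

text \<open>Translating to charge 0 gives a partition, where inversions and energy agree; half of
  \<open>charge S * (charge S - 1)\<close> is the energy of the translated vacuum.\<close>

lemma card_inversions_energy:
  assumes "maya S"
  shows "2 * int (card (inversions S)) = 2 * energy S - charge S * (charge S - 1)"
proof -
  let ?T = "translate (- charge S) S"
  have T: "maya ?T" "charge ?T = 0"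
    using maya_translate[OF assms] charge_translate[OF assms, of "- charge S"] by auto
  then obtain lam where lam: "sorted_wrt (\<ge>) lam" "beta_set lam = ?T"
    using beta_set_surj by blast
  have "int (card (inversions ?T)) = energy ?T"
    using card_inversions_beta_set[OF lam(1)] maya_beta_set[OF lam(1)] lam(2) by simp
  then show ?thesis
    using energy_translate[OF assms, of "- charge S"]
    by (simp add: card_inversions_translate algebra_simps)
qed

section \<open>Cores and quotients\<close>

definition runner :: "nat \<Rightarrow> nat \<Rightarrow> int set \<Rightarrow> int set" where
  "runner t r S = {k. int t * k + int r \<in> S}"

lemma residue_split:
  fixes A :: "int set"
  assumes "t > 0"
  shows "A = (\<Union>r<t. (\<lambda>k. int t * k + int r) ` {k. int t * k + int r \<in> A})"
proof -
  have "s \<in> (\<Union>r<t. (\<lambda>k. int t * k + int r) ` {k. int t * k + int r \<in> A})" if "s \<in> A" for s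
  proof (rule UN_I[of "nat (s mod int t)"])
    have eq: "int t * (s div int t) + int (nat (s mod int t)) = s" using assms by simp
    show "nat (s mod int t) \<in> {..<t}" using assms by (simp add: nat_less_iff)
    show "s \<in> (\<lambda>k. int t * k + int (nat (s mod int t))) ` {k. int t * k + int (nat (s mod int t)) \<in> A}"
      by (rule image_eqI[of _ _ "s div int t"]) (use eq that in \<open>simp_all only: mem_Collect_eq\<close>)
  qed
  then show ?thesis by blast
qed

lemma residue_unique:
  assumes "int t * k + int r = int t * l + int q" "r < t" "q < t"
  shows "r = q" "k = l"
proof -
  have "(int t * k + int r) mod int t = int r" "(int t * l + int q) mod int t = int q"
    using assms(2,3) by auto
  then show "r = q" using assms(1) by simp
  then show "k = l" using assms by simp
qed

lemma
  fixes A :: "int set"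
  assumes "t > 0"
  shows finite_residue_split: "finite A \<longleftrightarrow> (\<forall>r<t. finite {k. int t * k + int r \<in> A})"
    and sum_residue_split: "finite A \<Longrightarrow>
      sum g A = (\<Sum>r<t. \<Sum>k \<in> {k. int t * k + int r \<in> A}. g (int t * k + int r))"
proof -
  have inj: "inj_on (\<lambda>k. int t * k + int r) B" for B r using assms by (auto simp: inj_on_def)
  show fin: "finite A \<longleftrightarrow> (\<forall>r<t. finite {k. int t * k + int r \<in> A})"
  proof
    assume "finite A"
    show "\<forall>r<t. finite {k. int t * k + int r \<in> A}"
    proof (intro allI impI)
      fix r show "finite {k. int t * k + int r \<in> A}"
        by (rule inj_on_finite[OF inj _ \<open>finite A\<close>]) auto
    qed
  next
    assume "\<forall>r<t. finite {k. int t * k + int r \<in> A}"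
    then show "finite A" by (subst residue_split[OF assms]) auto
  qed
  assume "finite A"
  then have f: "\<forall>r\<in>{..<t}. finite ((\<lambda>k. int t * k + int r) ` {k. int t * k + int r \<in> A})"
    using fin by auto
  have disj: "\<forall>r\<in>{..<t}. \<forall>q\<in>{..<t}. r \<noteq> q \<longrightarrow> (\<lambda>k. int t * k + int r) ` {k. int t * k + int r \<in> A}
    \<inter> (\<lambda>k. int t * k + int q) ` {k. int t * k + int q \<in> A} = {}"
    using residue_unique(1)[of t] by blast
  show "sum g A = (\<Sum>r<t. \<Sum>k \<in> {k. int t * k + int r \<in> A}. g (int t * k + int r))"
    by (subst residue_split[OF assms], subst sum.UNION_disjoint[OF finite_lessThan f disj])
      (simp add: sum.reindex[OF inj])
qed

lemma runner_parts:
  assumes "r < t"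
  shows "{k. int t * k + int r \<in> {s \<in> S. 0 \<le> s}} = {k \<in> runner t r S. 0 \<le> k}"
    and "{k. int t * k + int r \<in> {s. s < 0 \<and> s \<notin> S}} = {k. k < 0 \<and> k \<notin> runner t r S}"
proof -
  have "0 \<le> int t * k + int r \<longleftrightarrow> 0 \<le> k" for k
  proof
    assume "0 \<le> int t * k + int r"
    then have "int t * k > - int t" using assms by linarith
    then have "int t * (k + 1) > 0" by (simp add: algebra_simps)
    then show "0 \<le> k" by (simp add: zero_less_mult_iff)
  qed simp
  then show "{k. int t * k + int r \<in> {s \<in> S. 0 \<le> s}} = {k \<in> runner t r S. 0 \<le> k}"
    "{k. int t * k + int r \<in> {s. s < 0 \<and> s \<notin> S}} = {k. k < 0 \<and> k \<notin> runner t r S}"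
    by (auto simp: runner_def not_le[symmetric] simp del: not_le not_less)
qed

lemma maya_runner_iff:
  assumes "t > 0"
  shows "maya S \<longleftrightarrow> (\<forall>r<t. maya (runner t r S))"
  unfolding maya_def finite_residue_split[OF assms, of "{s \<in> S. 0 \<le> s}"]
    finite_residue_split[OF assms, of "{s. s < 0 \<and> s \<notin> S}"]
  using runner_parts[of _ t S] by auto

lemma
  assumes "t > 0" "maya S"
  shows charge_runner: "charge S = (\<Sum>r<t. charge (runner t r S))"
    and energy_runner: "energy S = (\<Sum>r<t. int t * energy (runner t r S) + int r * charge (runner t r S))"
proof -
  have fin: "finite {s \<in> S. 0 \<le> s}" "finite {s. s < 0 \<and> s \<notin> S}"
    using assms by (auto simp: maya_def)
  have P: "sum g {s \<in> S. 0 \<le> s} = (\<Sum>r<t. \<Sum>k \<in> {k \<in> runner t r S. 0 \<le> k}. g (int t * k + int r))"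
    and H: "sum g {s. s < 0 \<and> s \<notin> S} = (\<Sum>r<t. \<Sum>k \<in> {k. k < 0 \<and> k \<notin> runner t r S}. g (int t * k + int r))"
    for g :: "int \<Rightarrow> int"
    using sum_residue_split[OF assms(1) fin(1), of g] sum_residue_split[OF assms(1) fin(2), of g]
      runner_parts[of _ t S] by auto
  show "charge S = (\<Sum>r<t. charge (runner t r S))"
    using P[of "\<lambda>_. 1"] H[of "\<lambda>_. 1"] by (simp add: charge_def sum_subtractf)
  have "energy S = (\<Sum>r<t. (\<Sum>k \<in> {k \<in> runner t r S. 0 \<le> k}. int t * k + int r)
      - (\<Sum>k \<in> {k. k < 0 \<and> k \<notin> runner t r S}. int t * k + int r))"
    unfolding energy_def by (simp add: P[of "\<lambda>s. s"] H[of "\<lambda>s. s"] sum_subtractf)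
  also have "\<dots> = (\<Sum>r<t. int t * energy (runner t r S) + int r * charge (runner t r S))"
    by (intro sum.cong) (simp_all add: energy_def charge_def sum.distrib sum_distrib_left algebra_simps)
  finally show "energy S = (\<Sum>r<t. int t * energy (runner t r S) + int r * charge (runner t r S))" .
qed

text \<open>Two positions lie on the same runner exactly when \<open>t\<close> divides their
  difference. Together with \<open>size_t_hooks\<close> this makes the number of hooks divisible by
  \<open>t\<close> the size of the quotient.\<close>

lemma card_inversions_runner:
  assumes "t > 0" "maya S"
  shows "card {(s, u) \<in> inversions S. int t dvd s - u} = (\<Sum>r<t. card (inversions (runner t r S)))"
proof -
  let ?f = "\<lambda>r (k, l). (int t * k + int r, int t * l + int r)"
  have eq: "{(s, u) \<in> inversions S. int t dvd s - u} = (\<Union>r<t. ?f r ` inversions (runner t r S))"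
  proof
    show "{(s, u) \<in> inversions S. int t dvd s - u} \<subseteq> (\<Union>r<t. ?f r ` inversions (runner t r S))"
    proof
      fix p assume "p \<in> {(s, u) \<in> inversions S. int t dvd s - u}"
      then obtain s u where p: "p = (s, u)" "s \<in> S" "u \<notin> S" "u < s" "int t dvd s - u"
        by (auto simp: inversions_def)
      define r where "r = nat (s mod int t)"
      have r: "r < t" "int r = s mod int t" using assms(1) by (auto simp: r_def nat_less_iff)
      have "u mod int t = s mod int t" using p(5) by (metis mod_eq_dvd_iff)
      then have s: "int t * (s div int t) + int r = s" and u: "int t * (u div int t) + int r = u"
        using r by (metis mult_div_mod_eq)+
      have "int t * (u div int t) < int t * (s div int t)" using s u p(4) by linarith
      then have "u div int t < s div int t" using assms(1) by simp
      then have "(s div int t, u div int t) \<in> inversions (runner t r S)"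
        using p(2,3) s u by (simp add: inversions_def runner_def)
      then have "p \<in> ?f r ` inversions (runner t r S)"
        using s u p(1) by (intro image_eqI[of _ _ "(s div int t, u div int t)"]) auto
      then show "p \<in> (\<Union>r<t. ?f r ` inversions (runner t r S))" using r(1) by blast
    qed
    have "int t dvd (int t * k + int r) - (int t * l + int r)" for k l r
      by (rule dvdI[of _ _ "k - l"]) (simp add: algebra_simps)
    then show "(\<Union>r<t. ?f r ` inversions (runner t r S)) \<subseteq> {(s, u) \<in> inversions S. int t dvd s - u}"
      using assms(1) by (auto simp: inversions_def runner_def)
  qed
  have inj: "inj_on (?f r) B" for r B using assms(1) by (auto simp: inj_on_def)
  have "\<forall>r\<in>{..<t}. finite (?f r ` inversions (runner t r S))"
    using maya_runner_iff[OF assms(1)] assms(2) finite_inversions by blast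
  moreover have "\<forall>r\<in>{..<t}. \<forall>q\<in>{..<t}. r \<noteq> q \<longrightarrow>
    ?f r ` inversions (runner t r S) \<inter> ?f q ` inversions (runner t q S) = {}"
    using residue_unique(1)[of t] by fastforce
  ultimately show ?thesis
    unfolding eq by (subst card_UN_disjoint) (auto simp: card_image[OF inj])
qed

lemma bij_betw_runner:
  assumes "t > 0"
  shows "bij_betw (\<lambda>S. \<lambda>r\<in>{..<t}. runner t r S) {S. maya S} ({..<t} \<rightarrow>\<^sub>E {S. maya S})"
proof (rule bij_betw_byWitness[of _ "\<lambda>f. {s. s div int t \<in> f (nat (s mod int t))}"])
  let ?g = "\<lambda>f. {s. s div int t \<in> f (nat (s mod int t))}"
  have run: "runner t r (?g f) = f r" if "r < t" for r f
  proof -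
    have "(int t * k + int r) div int t = k" "(int t * k + int r) mod int t = int r" for k
      using that by simp_all
    then show ?thesis by (simp add: runner_def)
  qed
  have id: "{s. s div int t \<in> (\<lambda>r\<in>{..<t}. runner t r S) (nat (s mod int t))} = S" for S
  proof -
    have "nat (s mod int t) < t" "int t * (s div int t) + int (nat (s mod int t)) = s" for s
      using assms by (simp_all add: nat_less_iff)
    then show ?thesis by (simp add: runner_def)
  qed
  then show "\<forall>S\<in>{S. maya S}. ?g (\<lambda>r\<in>{..<t}. runner t r S) = S" by blast
  show "\<forall>f\<in>{..<t} \<rightarrow>\<^sub>E {S. maya S}. (\<lambda>r\<in>{..<t}. runner t r (?g f)) = f"
  proof (intro ballI ext)
    fix f r assume "f \<in> {..<t} \<rightarrow>\<^sub>E {S. maya S}"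
    then show "(\<lambda>r\<in>{..<t}. runner t r (?g f)) r = f r"
      using run[of r f] PiE_arb[of f "{..<t}" "\<lambda>_. {S. maya S}" r] by (cases "r < t") simp_all
  qed
  show "(\<lambda>S. \<lambda>r\<in>{..<t}. runner t r S) ` {S. maya S} \<subseteq> {..<t} \<rightarrow>\<^sub>E {S. maya S}"
    using maya_runner_iff[OF assms, THEN iffD1] by (intro image_subsetI) (simp add: PiE_iff)
  show "?g ` ({..<t} \<rightarrow>\<^sub>E {S. maya S}) \<subseteq> {S. maya S}"
  proof (intro image_subsetI)
    fix f assume f: "f \<in> {..<t} \<rightarrow>\<^sub>E {S. maya S}"
    have "\<forall>r<t. maya (runner t r (?g f))" using f run[of _ f] by (simp add: PiE_iff)
    then show "?g f \<in> {S. maya S}" using maya_runner_iff[OF assms, THEN iffD2] by blast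
  qed
qed

text \<open>The size of the \<open>t\<close>-core whose runners have the charges \<open>x 0, \<dots>, x (t - 1)\<close>.\<close>

definition core_size :: "nat \<Rightarrow> (nat \<Rightarrow> int) \<Rightarrow> int" where
  "core_size t x = (\<Sum>r<t. int t * (x r * (x r - 1) div 2) + int r * x r)"

text \<open>Charge 0 identifies the size with the energy, which adds up over the runners; on each
  runner \<open>card_inversions_energy\<close> splits it into inversions and a term that depends on
  the charge alone.\<close>

lemma card_inversions_core_quotient:
  assumes "t > 0" "maya S" "charge S = 0"
  shows "int (card (inversions S)) = int t * int (\<Sum>r<t. card (inversions (runner t r S)))
    + core_size t (\<lambda>r. charge (runner t r S))"
proof -
  have e: "energy S = int (card (inversions S))"
    using card_inversions_energy[OF assms(2)] assms(3) by simp
  have m: "maya (runner t r S)" if "r < t" for r using maya_runner_iff[OF assms(1)] assms(2) that by blast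
  have "energy (runner t r S) = int (card (inversions (runner t r S)))
      + charge (runner t r S) * (charge (runner t r S) - 1) div 2" if "r < t" for r
    using card_inversions_energy[OF m[OF that]] by linarith
  then show ?thesis
    unfolding e[symmetric] energy_runner[OF assms(1,2)] core_size_def
    by (simp add: sum_distrib_left sum.distrib[symmetric] algebra_simps)
qed

section \<open>Counting quotients and cores\<close>

fun multipartitions :: "nat \<Rightarrow> nat \<Rightarrow> nat" where
  "multipartitions 0 w = (if w = 0 then 1 else 0)"
| "multipartitions (Suc t) w = (\<Sum>k\<le>w. card (partitions_of k) * multipartitions t (w - k))"

text \<open>Kept abstract in the sets \<open>A r\<close> and the weight, since it is applied to
  charge sectors that differ from runner to runner but have the same level counts.\<close>

lemma card_tuples:
  fixes A :: "nat \<Rightarrow> 'a set" and wt :: "'a \<Rightarrow> nat"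
  assumes "\<And>r w. r < t \<Longrightarrow> finite {a \<in> A r. wt a = w}"
    and "\<And>r w. r < t \<Longrightarrow> card {a \<in> A r. wt a = w} = card (partitions_of w)"
  shows "finite {f \<in> PiE {..<t} A. (\<Sum>r<t. wt (f r)) = w} \<and>
    card {f \<in> PiE {..<t} A. (\<Sum>r<t. wt (f r)) = w} = multipartitions t w"
  using assms
proof (induction t arbitrary: w)
  case 0
  then show ?case by (cases "w = 0") auto
next
  case (Suc t)
  let ?F = "\<lambda>w. {f \<in> PiE {..<t} A. (\<Sum>r<t. wt (f r)) = w}"
  let ?B = "\<Union>k\<le>w. {a \<in> A t. wt a = k} \<times> ?F (w - k)"
  have IH: "finite (?F w) \<and> card (?F w) = multipartitions t w" for w
    by (rule Suc.IH) (use Suc.prems in auto)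
  have s: "(\<Sum>r<t. wt ((f(t := a)) r)) = (\<Sum>r<t. wt (f r))" for f a by (intro sum.cong) auto
  have eq: "{f \<in> PiE {..<Suc t} A. (\<Sum>r<Suc t. wt (f r)) = w} = (\<lambda>(a, f). f(t := a)) ` ?B" (is "?L = ?R")
  proof
    show "?R \<subseteq> ?L"
    proof
      fix h assume "h \<in> ?R"
      then obtain p where p: "h = (\<lambda>(a, f). f(t := a)) p" "p \<in> ?B" by (rule imageE)
      obtain a f where "p = (a, f)" by (cases p)
      with p have af: "h = f(t := a)" "a \<in> A t" "f \<in> PiE {..<t} A" "(\<Sum>r<t. wt (f r)) + wt a = w"
        by auto
      have "h \<in> PiE {..<Suc t} A"
        unfolding lessThan_Suc af(1) by (rule PiE_fun_upd[OF af(2,3)])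
      moreover have "(\<Sum>r<Suc t. wt (h r)) = w" using af s[of f a] by simp
      ultimately show "h \<in> ?L" by blast
    qed
    show "?L \<subseteq> ?R"
    proof
      fix h assume h: "h \<in> ?L"
      define a f where "a = h t" and "f = h(t := undefined)"
      have "h \<in> PiE (insert t {..<t}) A" using h unfolding lessThan_Suc by blast
      then have af: "a \<in> A t" "f \<in> PiE {..<t} A" "h = f(t := a)"
        unfolding a_def f_def using fun_upd_in_PiE[of t "{..<t}" h A] by (simp_all add: PiE_mem)
      have "(\<Sum>r<t. wt (f r)) + wt a = w" using h af(3) s[of f a] by simp
      then have "(a, f) \<in> ?B" using af by (intro UN_I[of "wt a"]) auto
      then show "h \<in> ?R" using af(3) by (intro image_eqI[of _ _ "(a, f)"]) simp_all
    qed
  qed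
  have inj: "inj_on (\<lambda>(a, f). f(t := a)) ?B"
    by (rule inj_on_subset[OF inj_combinator[of t "{..<t}" A]]) auto
  have fin: "\<forall>k\<in>{..w}. finite ({a \<in> A t. wt a = k} \<times> ?F (w - k))"
    using IH Suc.prems(1)[of t] by auto
  have "card ?B = (\<Sum>k\<le>w. card ({a \<in> A t. wt a = k} \<times> ?F (w - k)))"
    by (rule card_UN_disjoint) (use fin in auto)
  also have "\<dots> = multipartitions (Suc t) w"
    using IH Suc.prems(2)[of t] by (simp add: card_cartesian_product)
  finally show ?case unfolding eq using fin by (auto simp: card_image[OF inj])
qed

lemma card_Maya_tuples:
  fixes t :: nat
  shows "card {f \<in> PiE {..<t} (\<lambda>r. {S. maya S \<and> charge S = x r}). (\<Sum>r<t. card (inversions (f r))) = w}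
    = multipartitions t w"
  using card_tuples[of t "\<lambda>r. {S. maya S \<and> charge S = x r}" "\<lambda>S. card (inversions S)" w]
    card_maya_charge by (simp add: conj_assoc)

lemma finite_Maya_tuples:
  fixes t :: nat
  shows "finite {f \<in> PiE {..<t} (\<lambda>r. {S. maya S \<and> charge S = x r}). (\<Sum>r<t. card (inversions (f r))) = w}"
  using card_tuples[of t "\<lambda>r. {S. maya S \<and> charge S = x r}" "\<lambda>S. card (inversions S)" w]
    card_maya_charge by (simp add: conj_assoc)

text \<open>As \<open>r < t\<close>, the linear term cannot outweigh the quadratic one at integers:
  for \<open>x \<ge> 1\<close> both are nonnegative, and for \<open>x \<le> 0\<close> the triangular
  number is at least \<open>- x\<close>, which leaves \<open>(t - r) * (- x)\<close>. The linear
  growth makes the vectors of bounded core size finite in number.\<close>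

lemma core_size_term_ge:
  assumes "r < t"
  shows "\<bar>x\<bar> - 1 \<le> int t * (x * (x - 1) div 2) + int r * x" (is ?A)
    and "0 \<le> int t * (x * (x - 1) div 2) + int r * x" (is ?B)
proof -
  define T where "T = x * (x - 1) div 2"
  have "even (x * (x - 1))" by auto
  then have T: "2 * T = x * (x - 1)" unfolding T_def by auto
  have "?A \<and> ?B"
  proof (cases "x \<ge> 1")
    case True
    have "2 * (x - 1) \<le> x * (x - 1) \<or> x = 1"
      using True mult_right_mono[of 2 x "x - 1"] by auto
    then have "T \<ge> x - 1" using T by auto
    moreover have "T \<le> int t * T" using \<open>T \<ge> x - 1\<close> True assms mult_right_mono[of 1 "int t" T] by simp
    moreover have "0 \<le> int r * x" using True by simp
    ultimately show ?thesis unfolding T_def[symmetric] using True by (intro conjI) linarith+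
  next
    case False
    have "0 \<le> x * (x + 1)" using False by (cases "x = 0") (auto intro: mult_nonpos_nonpos)
    then have "T \<ge> - x" using T by (simp add: algebra_simps)
    have "int t * T \<ge> int t * (- x)" using \<open>T \<ge> - x\<close> by (intro mult_left_mono) auto
    moreover have "(int t - int r) * (- x) \<ge> 1 * (- x)" using assms False by (intro mult_right_mono) auto
    ultimately show ?thesis unfolding T_def[symmetric] using False by (simp add: algebra_simps)
  qed
  then show ?A ?B by auto
qed

lemma core_size_nonneg: "0 \<le> core_size t x"
  unfolding core_size_def by (intro sum_nonneg) (use core_size_term_ge(2) in auto)

lemma abs_le_core_size:
  assumes "r < t" shows "\<bar>x r\<bar> \<le> core_size t x + 1"
proof -
  have "int t * (x r * (x r - 1) div 2) + int r * x r \<le> core_size t x"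
    unfolding core_size_def
    using assms core_size_term_ge(2)[of _ t]
    by (intro member_le_sum[of r "{..<t}" "\<lambda>r. int t * (x r * (x r - 1) div 2) + int r * x r"]) simp_all
  then show ?thesis using core_size_term_ge(1)[OF assms, of "x r"] by linarith
qed

definition core_vectors :: "nat \<Rightarrow> nat \<Rightarrow> (nat \<Rightarrow> int) set" where
  "core_vectors t n = {x \<in> {..<t} \<rightarrow>\<^sub>E UNIV. (\<Sum>r<t. x r) = 0 \<and> core_size t x \<le> int n}"

lemma finite_core_vectors: "finite (core_vectors t n)"
proof (rule finite_subset)
  show "core_vectors t n \<subseteq> {..<t} \<rightarrow>\<^sub>E {- int n - 1..int n + 1}"
  proof
    fix x assume x: "x \<in> core_vectors t n"
    have "x r \<in> {- int n - 1..int n + 1}" if "r < t" for r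
    proof -
      have "core_size t x \<le> int n" using x by (simp add: core_vectors_def)
      then show ?thesis using abs_le_core_size[OF that, of x] unfolding atLeastAtMost_iff by linarith
    qed
    then show "x \<in> {..<t} \<rightarrow>\<^sub>E {- int n - 1..int n + 1}"
      using x by (auto simp: core_vectors_def PiE_iff)
  qed
qed (rule finite_PiE; simp)

text \<open>Sorts the diagrams of charge 0 by the charges of their runners. Given the charges,
  \<open>n\<close> forces the quotient size, and the remaining freedom is a multipartition of that
  size.\<close>

lemma p_hook_core_quotient:
  assumes "t > 0" "b > 0"
  shows "p_hook t a b n =
    (\<Sum>x \<in> {x \<in> core_vectors t n. [core_size t x = int n - int t * int a] (mod (int t * int b))}.
      multipartitions t (nat ((int n - core_size t x) div int t)))"
proof -
  let ?inv = "\<lambda>S. card (inversions S)"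
  let ?X = "{x \<in> core_vectors t n. [core_size t x = int n - int t * int a] (mod (int t * int b))}"
  let ?W = "\<lambda>x. nat ((int n - core_size t x) div int t)"
  let ?G = "\<lambda>x. {f \<in> PiE {..<t} (\<lambda>r. {S. maya S \<and> charge S = x r}). (\<Sum>r<t. ?inv (f r)) = ?W x}"
  let ?f = "\<lambda>S. \<lambda>r\<in>{..<t}. runner t r S"
  have "p_hook t a b n = card {lam \<in> partitions_of n. [card {(s, u) \<in> inversions (beta_set lam). int t dvd s - u} = a] (mod b)}"
    unfolding p_hook_def
  proof (intro arg_cong[of _ _ card] Collect_cong conj_cong refl)
    fix lam assume "lam \<in> partitions_of n"
    then have "sorted_wrt (\<ge>) lam" by (simp add: partitions_of_def)
    then show "[size (t_hooks t lam) = a] (mod b) \<longleftrightarrow>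
      [card {(s, u) \<in> inversions (beta_set lam). int t dvd s - u} = a] (mod b)"
      by (simp only: size_t_hooks)
  qed
  also have "\<dots> = card {S \<in> {S. maya S \<and> charge S = 0 \<and> ?inv S = n}.
      [card {(s, u) \<in> inversions S. int t dvd s - u} = a] (mod b)}"
    by (rule bij_betw_same_card[OF bij_betw_Collect[OF bij_betw_beta_set]]) auto
  also have "\<dots> = card {S \<in> {S. maya S}. charge S = 0 \<and> ?inv S = n \<and>
      [card {(s, u) \<in> inversions S. int t dvd s - u} = a] (mod b)}"
    by (rule arg_cong[of _ _ card]) auto
  also have "\<dots> = card {f \<in> {..<t} \<rightarrow>\<^sub>E {S. maya S}. (\<Sum>r<t. charge (f r)) = 0 \<and>
      int t * int (\<Sum>r<t. ?inv (f r)) + core_size t (\<lambda>r. charge (f r)) = int n \<and>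
      [(\<Sum>r<t. ?inv (f r)) = a] (mod b)}" (is "_ = card ?Y")
  proof (rule bij_betw_same_card[OF bij_betw_Collect[OF bij_betw_runner[OF assms(1)]]])
    fix S assume "S \<in> {S. maya S}"
    then have S: "maya S" by simp
    have 1: "(\<Sum>r<t. charge (?f S r)) = charge S" using charge_runner[OF assms(1) S] by simp
    have 2: "(\<Sum>r<t. ?inv (?f S r)) = card {(s, u) \<in> inversions S. int t dvd s - u}"
      using card_inversions_runner[OF assms(1) S] by simp
    have "core_size t (\<lambda>r. charge (?f S r)) = core_size t (\<lambda>r. charge (runner t r S))"
      by (auto simp: core_size_def)
    then have 3: "int t * int (\<Sum>r<t. ?inv (?f S r)) + core_size t (\<lambda>r. charge (?f S r)) = int (?inv S)"
      if "charge S = 0" using card_inversions_core_quotient[OF assms(1) S that] by simp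
    show "((\<Sum>r<t. charge (?f S r)) = 0 \<and>
      int t * int (\<Sum>r<t. ?inv (?f S r)) + core_size t (\<lambda>r. charge (?f S r)) = int n \<and>
      [(\<Sum>r<t. ?inv (?f S r)) = a] (mod b)) = (charge S = 0 \<and> ?inv S = n \<and>
      [card {(s, u) \<in> inversions S. int t dvd s - u} = a] (mod b))"
      unfolding 1 2[symmetric] using 3 by auto
  qed
  also have "?Y = (\<Union>x\<in>?X. ?G x)"
  proof -
    \<comment> \<open>The equation \<open>t * w = n - c\<close> turns the condition on
      \<open>w\<close> modulo \<open>b\<close> into one on \<open>c\<close> modulo
      \<open>t * b\<close>, which also contains the divisibility of \<open>n - c\<close> by
      \<open>t\<close>.\<close>
    have key: "int t * int w + c = int n \<and> [w = a] (mod b) \<longleftrightarrow>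
      c \<le> int n \<and> [c = int n - int t * int a] (mod (int t * int b)) \<and> w = nat ((int n - c) div int t)" for w c
    proof
      assume l: "int t * int w + c = int n \<and> [w = a] (mod b)"
      then have "[int w = int a] (mod int b)" by (simp add: cong_int_iff)
      then obtain k where k: "int w - int a = int b * k" unfolding cong_iff_dvd_diff by (elim dvdE)
      have "c - (int n - int t * int a) = - (int t * (int w - int a))" using l by (simp add: algebra_simps)
      then have "int t * int b dvd c - (int n - int t * int a)" unfolding k by simp
      moreover have c: "c = int n - int t * int w" using l by simp
      moreover have "int t * int w \<ge> 0" by simp
      moreover have "w = nat ((int n - c) div int t)" unfolding c using assms(1) by simp
      ultimately show "c \<le> int n \<and> [c = int n - int t * int a] (mod (int t * int b)) \<and> w = nat ((int n - c) div int t)"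
        unfolding cong_iff_dvd_diff by linarith
    next
      assume r: "c \<le> int n \<and> [c = int n - int t * int a] (mod (int t * int b)) \<and> w = nat ((int n - c) div int t)"
      then obtain k where k: "c - (int n - int t * int a) = int t * int b * k"
        by (auto simp: cong_iff_dvd_diff)
      then have nc: "int n - c = int t * (int a - int b * k)" by (simp add: algebra_simps)
      then have w: "w = nat (int a - int b * k)" using r assms(1) by simp
      have "0 \<le> int t * (int a - int b * k)" using r nc by linarith
      then have "0 \<le> int a - int b * k" using assms(1) by (simp add: zero_le_mult_iff)
      then have w': "int w = int a - int b * k" using w by simp
      then have "[int w = int a] (mod int b)" by (simp add: cong_iff_dvd_diff)
      then have "[w = a] (mod b)" by (simp only: cong_int_iff)
      moreover have "int t * int w + c = int n" unfolding w' using nc by linarith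
      ultimately show "int t * int w + c = int n \<and> [w = a] (mod b)" by blast
    qed
    show ?thesis
    proof (intro Set.set_eqI iffI)
      fix f assume f: "f \<in> ?Y"
      let ?x = "\<lambda>r\<in>{..<t}. charge (f r)"
      have c: "core_size t ?x = core_size t (\<lambda>r. charge (f r))" by (simp add: core_size_def)
      from f have "int t * int (\<Sum>r<t. ?inv (f r)) + core_size t ?x = int n \<and> [(\<Sum>r<t. ?inv (f r)) = a] (mod b)"
        unfolding c mem_Collect_eq by (elim conjE) (intro conjI; assumption)
      then have k: "core_size t ?x \<le> int n" "[core_size t ?x = int n - int t * int a] (mod (int t * int b))"
        "(\<Sum>r<t. ?inv (f r)) = ?W ?x" unfolding key by simp_all
      have "(\<Sum>r<t. ?x r) = 0" using f by simp
      then have "?x \<in> ?X" using k by (simp add: core_vectors_def)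
      moreover have "f \<in> ?G ?x" using f k(3) by (simp add: PiE_iff)
      ultimately show "f \<in> (\<Union>x\<in>?X. ?G x)" by (rule UN_I[of ?x ?X f ?G])
    next
      fix f assume "f \<in> (\<Union>x\<in>?X. ?G x)"
      then obtain x where x: "x \<in> ?X" "f \<in> ?G x" by (rule UN_E)
      have ch: "charge (f r) = x r" if "r < t" for r using x(2) that by (auto simp: PiE_iff)
      then have c: "core_size t (\<lambda>r. charge (f r)) = core_size t x" by (simp add: core_size_def)
      have s: "(\<Sum>r<t. charge (f r)) = (\<Sum>r<t. x r)" using ch by simp
      have "core_size t x \<le> int n \<and> [core_size t x = int n - int t * int a] (mod (int t * int b))
          \<and> (\<Sum>r<t. ?inv (f r)) = ?W x" using x by (simp add: core_vectors_def)
      then have "int t * int (\<Sum>r<t. ?inv (f r)) + core_size t x = int n \<and> [(\<Sum>r<t. ?inv (f r)) = a] (mod b)"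
        unfolding key .
      moreover have "(\<Sum>r<t. charge (f r)) = 0" unfolding s using x(1) by (simp add: core_vectors_def)
      moreover have "f \<in> {..<t} \<rightarrow>\<^sub>E {S. maya S}" using x(2) by (simp add: PiE_iff)
      ultimately show "f \<in> ?Y"
        unfolding c mem_Collect_eq by (elim conjE) (intro conjI; assumption)
    qed
  qed
  also have "card (\<Union>x\<in>?X. ?G x) = (\<Sum>x\<in>?X. card (?G x))"
  proof (rule card_UN_disjoint)
    show "finite ?X" using finite_core_vectors by simp
    show "\<forall>x\<in>?X. finite (?G x)" using finite_Maya_tuples by blast
    have eq: "x = y" if "x \<in> ?X" "y \<in> ?X" "f \<in> ?G x" "f \<in> ?G y" for x y f
    proof (rule PiE_ext[of x "{..<t}" "\<lambda>_. UNIV" y])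
      fix r assume "r \<in> {..<t}"
      then have "charge (f r) = x r" "charge (f r) = y r" using that(3,4) by (auto simp: PiE_iff)
      then show "x r = y r" by simp
    qed (use that(1,2) in \<open>simp_all add: core_vectors_def\<close>)
    show "\<forall>x\<in>?X. \<forall>y\<in>?X. x \<noteq> y \<longrightarrow> ?G x \<inter> ?G y = {}"
    proof (intro ballI impI equals0I)
      fix x y f assume xy: "x \<in> ?X" "y \<in> ?X" "x \<noteq> y" and f: "f \<in> ?G x \<inter> ?G y"
      show False using eq[OF xy(1,2) IntD1[OF f] IntD2[OF f]] xy(3) by contradiction
    qed
  qed
  finally show ?thesis by (simp only: card_Maya_tuples)
qed

section \<open>The generating function of partitions\<close>

text \<open>Bounding the parts makes the generating function a finite product; the counts stabilise
  because the bound is vacuous for \<open>n \<le> k\<close>.\<close>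

definition bounded_partitions :: "nat \<Rightarrow> nat \<Rightarrow> nat list set" where
  "bounded_partitions k n = {lam \<in> partitions_of n. \<forall>x\<in>set lam. x \<le> k}"

lemma finite_bounded_partitions: "finite (bounded_partitions k n)"
  unfolding bounded_partitions_def using finite_partitions_of by simp

lemma bounded_partitions_0: "bounded_partitions 0 n = (if n = 0 then {[]} else {})"
proof -
  have "lam \<in> bounded_partitions 0 n \<longleftrightarrow> lam = [] \<and> n = 0" for lam
    by (cases lam) (auto simp: bounded_partitions_def partitions_of_def)
  then show ?thesis by auto
qed

lemma card_bounded_partitions_Suc:
  "card (bounded_partitions (Suc k) n) = card (bounded_partitions k n) +
    (if Suc k \<le> n then card (bounded_partitions (Suc k) (n - Suc k)) else 0)"
proof -
  let ?C = "if Suc k \<le> n then (#) (Suc k) ` bounded_partitions (Suc k) (n - Suc k) else {}"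
  have "bounded_partitions (Suc k) n = bounded_partitions k n \<union> ?C"
  proof
    show "bounded_partitions (Suc k) n \<subseteq> bounded_partitions k n \<union> ?C"
    proof
      fix lam assume lam: "lam \<in> bounded_partitions (Suc k) n"
      show "lam \<in> bounded_partitions k n \<union> ?C"
      proof (cases "Suc k \<in> set lam")
        case True
        then obtain y mu where y: "lam = y # mu" by (cases lam) auto
        have "y = Suc k"
          using lam True by (force simp: y bounded_partitions_def partitions_of_def)
        then show ?thesis using lam by (auto simp: y bounded_partitions_def partitions_of_def)
      next
        case False
        have "x \<le> k" if "x \<in> set lam" for x
          using lam that False by (metis (mono_tags, lifting) bounded_partitions_def le_SucE mem_Collect_eq)
        then show ?thesis using lam by (simp add: bounded_partitions_def)
      qed
    qed
    show "bounded_partitions k n \<union> ?C \<subseteq> bounded_partitions (Suc k) n"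
      by (auto simp: bounded_partitions_def partitions_of_def le_SucI split: if_splits)
  qed
  moreover have "bounded_partitions k n \<inter> ?C = {}" by (auto simp: bounded_partitions_def)
  moreover have "finite ?C" using finite_bounded_partitions by simp
  moreover have "card ?C = (if Suc k \<le> n then card (bounded_partitions (Suc k) (n - Suc k)) else 0)"
    by (simp add: card_image)
  ultimately show ?thesis using finite_bounded_partitions by (simp add: card_Un_disjoint)
qed

lemma bounded_partitions_eq:
  assumes "n \<le> k" shows "bounded_partitions k n = partitions_of n"
  unfolding bounded_partitions_def partitions_of_def using assms member_le_sum_list by fastforce

lemma card_bounded_partitions_le: "card (bounded_partitions k n) \<le> card (partitions_of n)"
  by (intro card_mono finite_partitions_of) (auto simp: bounded_partitions_def)

text \<open>Unrolls the recursion in \<open>n\<close>: the copies of the part \<open>Suc k\<close>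
  use up a multiple of \<open>Suc k\<close>, so they are counted by the coefficients of a geometric
  series, in the shape of a Cauchy product.\<close>

lemma card_bounded_partitions_convolution:
  "card (bounded_partitions (Suc k) n) =
    (\<Sum>i\<le>n. card (bounded_partitions k i) * (if Suc k dvd n - i then 1 else 0))"
proof (induction n rule: less_induct)
  case (less n)
  let ?g = "\<lambda>n i. card (bounded_partitions k i) * (if Suc k dvd n - i then 1 else 0)"
  show ?case
  proof (cases "Suc k \<le> n")
    case True
    have "(\<Sum>i\<in>{..n}. ?g n i) = (\<Sum>i\<in>insert n {..n - Suc k}. ?g n i)"
    proof (rule sum.mono_neutral_right)
      show "\<forall>i\<in>{..n} - insert n {..n - Suc k}. ?g n i = 0"
      proof
        fix i assume i: "i \<in> {..n} - insert n {..n - Suc k}"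
        then have "0 < n - i" "n - i < Suc k" by auto
        then have "\<not> Suc k dvd n - i" by (auto dest: dvd_imp_le)
        then show "?g n i = 0" by simp
      qed
    qed auto
    also have "\<dots> = card (bounded_partitions k n) + (\<Sum>i\<le>n - Suc k. ?g n i)"
      using True by (subst sum.insert) auto
    also have "(\<Sum>i\<le>n - Suc k. ?g n i) = (\<Sum>i\<le>n - Suc k. ?g (n - Suc k) i)"
    proof (intro sum.cong refl)
      fix i assume "i \<in> {..n - Suc k}"
      then have "n - i = (n - Suc k - i) + Suc k" using True by auto
      then show "?g n i = ?g (n - Suc k) i" by (simp only: dvd_add_triv_right_iff)
    qed
    also have "\<dots> = card (bounded_partitions (Suc k) (n - Suc k))"
      using less.IH[of "n - Suc k"] True by simp
    finally show ?thesis using True by (simp add: card_bounded_partitions_Suc[of k n])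
  next
    case False
    have "(\<Sum>i\<in>{..n}. ?g n i) = (\<Sum>i\<in>{n}. ?g n i)"
    proof (rule sum.mono_neutral_right)
      show "\<forall>i\<in>{..n} - {n}. ?g n i = 0"
      proof
        fix i assume i: "i \<in> {..n} - {n}"
        then have "0 < n - i" "n - i < Suc k" using False by auto
        then have "\<not> Suc k dvd n - i" by (auto dest: dvd_imp_le)
        then show "?g n i = 0" by simp
      qed
    qed auto
    then show ?thesis using False by (simp add: card_bounded_partitions_Suc[of k n])
  qed
qed

lemma bounded_partitions_sums_step:
  fixes q :: "'a :: {real_normed_field, banach}"
  assumes "norm q < 1" "summable (\<lambda>n. norm (of_nat (card (bounded_partitions k n)) * q ^ n))"
    and "(\<lambda>n. of_nat (card (bounded_partitions k n)) * q ^ n) sums P"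
  shows "(\<lambda>n. of_nat (card (bounded_partitions (Suc k) n)) * q ^ n) sums (P * (1 / (1 - q ^ Suc k)))"
proof -
  define b where "b x n = (if Suc k dvd n then x ^ n else 0)" for x :: 'a and n :: nat
  have sm: "strict_mono (\<lambda>i. i * Suc k)" by (auto simp: strict_mono_def intro: add_less_le_mono mult_right_mono less_imp_le)
  have nrm: "norm (q ^ Suc k) < 1" using assms(1) power_less_one_iff[of "norm q" "Suc k"]
    by (simp add: norm_power del: power_Suc)
  have "(\<lambda>i. b q (i * Suc k)) sums (1 / (1 - q ^ Suc k))"
    using geometric_sums[OF nrm] by (simp add: b_def power_mult[symmetric] mult.commute del: power_Suc mult_Suc_right mult_Suc)
  then have b: "b q sums (1 / (1 - q ^ Suc k))"
    by (subst (asm) sums_mono_reindex[OF sm]) (auto simp: b_def dvd_def mult.commute)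
  have "summable (\<lambda>n. norm (b q n))"
    by (rule summable_comparison_test'[OF summable_geometric[of "norm q"], of 0])
      (use assms(1) in \<open>auto simp: b_def norm_power\<close>)
  then have "(\<lambda>n. \<Sum>i\<le>n. (of_nat (card (bounded_partitions k i)) * q ^ i) * b q (n - i)) sums
      ((\<Sum>n. of_nat (card (bounded_partitions k n)) * q ^ n) * (\<Sum>n. b q n))"
    by (rule Cauchy_product_sums[OF assms(2)])
  moreover have "(\<Sum>i\<le>n. (of_nat (card (bounded_partitions k i)) * q ^ i) * b q (n - i)) =
      of_nat (card (bounded_partitions (Suc k) n)) * q ^ n" for n
    unfolding card_bounded_partitions_convolution of_nat_sum sum_distrib_right
    by (intro sum.cong) (auto simp: b_def power_add[symmetric])
  ultimately show ?thesis using sums_unique[OF assms(3)] sums_unique[OF b] by simp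
qed

lemma bounded_partitions_sums_real:
  fixes r :: real
  assumes "0 \<le> r" "r < 1"
  shows "(\<lambda>n. of_nat (card (bounded_partitions k n)) * r ^ n) sums (\<Prod>j<k. 1 / (1 - r ^ Suc j))"
proof (induction k)
  case 0
  have "(\<lambda>n. if n = 0 then (1::real) else 0) sums 1" using sums_single[of 0 "\<lambda>_. 1::real"] by simp
  moreover have "(\<lambda>n. of_nat (card (bounded_partitions 0 n)) * r ^ n) = (\<lambda>n. if n = 0 then (1::real) else 0)"
    by (auto simp: bounded_partitions_0)
  ultimately show ?case by simp
next
  case (Suc k)
  have "summable (\<lambda>n. norm (of_nat (card (bounded_partitions k n)) * r ^ n))"
    using sums_summable[OF Suc] assms by (simp add: norm_mult norm_power)
  from bounded_partitions_sums_step[OF _ this Suc] assms show ?case by simp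
qed

lemma bounded_partitions_sums_complex:
  fixes q :: complex
  assumes "norm q < 1"
  shows "(\<lambda>n. of_nat (card (bounded_partitions k n)) * q ^ n) sums (\<Prod>j<k. 1 / (1 - q ^ Suc j))"
proof (induction k)
  case 0
  have "(\<lambda>n. if n = 0 then (1::complex) else 0) sums 1" using sums_single[of 0 "\<lambda>_. 1::complex"] by simp
  moreover have "(\<lambda>n. of_nat (card (bounded_partitions 0 n)) * q ^ n) = (\<lambda>n. if n = 0 then (1::complex) else 0)"
    by (auto simp: bounded_partitions_0)
  ultimately show ?case by simp
next
  case (Suc k)
  have "summable (\<lambda>n. norm (of_nat (card (bounded_partitions k n)) * q ^ n))"
    using sums_summable[OF bounded_partitions_sums_real[of "norm q" k]] assms by (simp add: norm_mult norm_power)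
  from bounded_partitions_sums_step[OF assms this Suc] show ?case by simp
qed

text \<open>A partial sum up to \<open>N\<close> sees only parts at most \<open>N\<close>, so the
  finite Euler product bounds it. The inequality
  \<open>1 / (1 - x) = 1 + x / (1 - x) \<le> exp (x / (1 - x))\<close> makes this bound uniform in
  \<open>N\<close>.\<close>

lemma summable_partitions:
  fixes r :: real
  assumes "0 \<le> r" "r < 1"
  shows "summable (\<lambda>n. of_nat (card (partitions_of n)) * r ^ n)"
proof (rule bounded_imp_summable)
  show "0 \<le> of_nat (card (partitions_of n)) * r ^ n" for n using assms by simp
  fix N
  have "(\<Sum>n\<le>N. of_nat (card (partitions_of n)) * r ^ n)
      = (\<Sum>n\<le>N. of_nat (card (bounded_partitions N n)) * r ^ n)"
    by (intro sum.cong) (simp_all add: bounded_partitions_eq)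
  also have "\<dots> \<le> (\<Prod>j<N. 1 / (1 - r ^ Suc j))"
    using sums_unique[OF bounded_partitions_sums_real[OF assms, of N]]
      sum_le_suminf[OF sums_summable[OF bounded_partitions_sums_real[OF assms, of N]], of "{..N}"] assms
    by simp
  also have "\<dots> \<le> (\<Prod>j<N. exp (r ^ Suc j / (1 - r)))"
  proof (rule prod_mono)
    fix j assume "j \<in> {..<N}"
    have le: "r ^ Suc j \<le> r" using assms mult_left_mono[of "r ^ j" 1 r] by (simp add: power_le_one)
    then have pos: "0 < 1 - r ^ Suc j" using assms by linarith
    have "1 / (1 - r ^ Suc j) = 1 + r ^ Suc j / (1 - r ^ Suc j)" using pos by (simp add: field_simps)
    also have "\<dots> \<le> exp (r ^ Suc j / (1 - r ^ Suc j))" by (rule exp_ge_add_one_self)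
    also have "\<dots> \<le> exp (r ^ Suc j / (1 - r))"
      using le assms pos by (subst exp_le_cancel_iff) (intro divide_left_mono, auto)
    finally show "0 \<le> 1 / (1 - r ^ Suc j) \<and> 1 / (1 - r ^ Suc j) \<le> exp (r ^ Suc j / (1 - r))"
      using pos by simp
  qed
  also have "\<dots> = exp ((\<Sum>j<N. r ^ Suc j) / (1 - r))" by (simp add: exp_sum sum_divide_distrib)
  also have "(\<Sum>j<N. r ^ Suc j) \<le> 1 / (1 - r)"
  proof -
    have "(\<Sum>j<N. r ^ Suc j) \<le> (\<Sum>j<N. r ^ j)"
      using assms by (intro sum_mono) (simp add: mult_left_le_one_le)
    also have "\<dots> \<le> (\<Sum>j. r ^ j)" using assms by (intro sum_le_suminf summable_geometric) auto
    finally show ?thesis using suminf_geometric[of r] assms by simp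
  qed
  then have "exp ((\<Sum>j<N. r ^ Suc j) / (1 - r)) \<le> exp (1 / (1 - r) / (1 - r))"
    unfolding exp_le_cancel_iff using assms by (intro divide_right_mono) simp_all
  finally show "(\<Sum>n\<le>N. of_nat (card (partitions_of n)) * r ^ n) \<le> exp (1 / (1 - r) / (1 - r))" .
qed

text \<open>The coefficients for bounded parts never exceed the full ones and eventually equal them,
  so Tannery's theorem applies with the full series at \<open>norm q\<close> as majorant.\<close>

lemma partitions_product_tendsto:
  fixes q :: complex
  assumes "norm q < 1"
  shows "(\<lambda>k. \<Prod>j<k. 1 / (1 - q ^ Suc j)) \<longlonglongrightarrow> (\<Sum>n. of_nat (card (partitions_of n)) * q ^ n)"
proof -
  have "((\<lambda>k. suminf (\<lambda>n. of_nat (card (bounded_partitions k n)) * q ^ n)) \<longlongrightarrow>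
      suminf (\<lambda>n. of_nat (card (partitions_of n)) * q ^ n)) sequentially"
  proof (rule tannerys_theorem[THEN conjunct2, THEN conjunct2])
    show "((\<lambda>k. of_nat (card (bounded_partitions k n)) * q ^ n) \<longlongrightarrow> of_nat (card (partitions_of n)) * q ^ n) sequentially" for n
      by (rule tendsto_eventually, rule eventually_sequentiallyI[of n]) (simp add: bounded_partitions_eq)
    show "\<forall>\<^sub>F (n, k) in sequentially \<times>\<^sub>F sequentially.
        norm (of_nat (card (bounded_partitions k n)) * q ^ n) \<le> of_nat (card (partitions_of n)) * norm q ^ n"
      by (intro always_eventually)
        (auto simp: norm_mult norm_power card_bounded_partitions_le intro!: mult_right_mono)
  qed (use summable_partitions[of "norm q"] assms in auto)
  then show ?thesis using sums_unique[OF bounded_partitions_sums_complex[OF assms]] by simp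
qed

text \<open>The double series for the logarithm of the Euler product at
  \<open>q = exp (- z)\<close>: the pair \<open>(j, m)\<close> stands for the term of degree
  \<open>m + 1\<close> in the expansion of \<open>- Ln (1 - q ^ (j + 1))\<close>. Taking the series
  as definition fixes a branch.\<close>

definition log_term :: "complex \<Rightarrow> nat \<times> nat \<Rightarrow> complex" where
  "log_term z = (\<lambda>(j, m). exp (- (of_nat (Suc j * Suc m) * z)) / of_nat (Suc m))"

definition part_log :: "complex \<Rightarrow> complex" where
  "part_log z = infsum (log_term z) UNIV"

lemma norm_log_term: "norm (log_term z (j, m)) = exp (- (real (Suc j * Suc m) * Re z)) / real (Suc m)"
  unfolding log_term_def by (simp add: norm_divide del: of_nat_Suc of_nat_mult) 

lemma summable_on_exp_product:
  assumes "0 < \<epsilon>"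
  shows "(\<lambda>(j, m). exp (- (real (Suc j * Suc m) * \<epsilon>))) summable_on (UNIV :: (nat \<times> nat) set)"
proof -
  let ?r = "exp (- \<epsilon>)"
  have r: "norm ?r < 1" using assms by simp
  have s: "(\<lambda>j. ?r ^ j) summable_on UNIV"
    using summable_geometric[OF r] by (subst summable_on_UNIV_nonneg_real_iff) auto
  have "(\<lambda>x. norm (case x of (j, m) \<Rightarrow> ?r ^ j * ?r ^ m)) summable_on (Sigma (UNIV :: nat set) (\<lambda>_. UNIV :: nat set))"
    unfolding Infinite_Sum.abs_summable_on_Sigma_iff
  proof (intro conjI ballI)
    show "(\<lambda>m. norm (case (j, m) of (j, m) \<Rightarrow> ?r ^ j * ?r ^ m)) summable_on (UNIV :: nat set)" for j :: nat
      using summable_on_cmult_right[OF s, of "?r ^ j"] by (simp add: abs_mult)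
    have "(\<Sum>\<^sub>\<infinity>m. norm (case (j, m) of (j, m) \<Rightarrow> ?r ^ j * ?r ^ m)) = ?r ^ j * (\<Sum>\<^sub>\<infinity>m. ?r ^ m)" for j :: nat
      by (simp add: abs_mult infsum_cmult_right[OF s])
    moreover have "0 \<le> (\<Sum>\<^sub>\<infinity>m :: nat. ?r ^ m)" by (rule infsum_nonneg) simp
    ultimately show "(\<lambda>j. norm (\<Sum>\<^sub>\<infinity>m. norm (case (j, m) of (j, m) \<Rightarrow> ?r ^ j * ?r ^ m))) summable_on (UNIV :: nat set)"
      using summable_on_cmult_left[OF s] by (simp add: abs_mult)
  qed
  then have "(\<lambda>x. norm (case x of (j, m) \<Rightarrow> ?r ^ j * ?r ^ m)) summable_on (UNIV :: (nat \<times> nat) set)" by simp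
  then show ?thesis
  proof (rule summable_on_comparison_test)
    fix x :: "nat \<times> nat"
    obtain j m where x: "x = (j, m)" by force
    \<comment> \<open>\<open>(j + 1) * (m + 1) \<ge> j + m\<close> reduces the double series to a
      product of two geometric ones.\<close>
    have "real j + real m \<le> real (Suc j * Suc m)" by (simp add: algebra_simps)
    then have "(real j + real m) * \<epsilon> \<le> real (Suc j * Suc m) * \<epsilon>" using assms by (intro mult_right_mono) auto
    then have "exp (- (real (Suc j * Suc m) * \<epsilon>)) \<le> exp (- ((real j + real m) * \<epsilon>))" by simp
    also have "\<dots> = ?r ^ j * ?r ^ m"
      by (simp add: exp_of_nat_mult[symmetric] exp_add[symmetric] algebra_simps)
    finally show "(case x of (j, m) \<Rightarrow> exp (- (real (Suc j * Suc m) * \<epsilon>))) \<le>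
      norm (case x of (j, m) \<Rightarrow> ?r ^ j * ?r ^ m)" by (simp add: x del: of_nat_Suc of_nat_mult)
    show "0 \<le> (case x of (j, m) \<Rightarrow> exp (- (real (Suc j * Suc m) * \<epsilon>)))" by (simp add: x)
  qed
qed

lemma log_term_abs_summable:
  assumes "0 < Re z" shows "(\<lambda>x. norm (log_term z x)) summable_on UNIV"
proof (rule Infinite_Sum.abs_summable_on_comparison_test'[OF summable_on_exp_product[OF assms]])
  fix x :: "nat \<times> nat"
  obtain j m where x: "x = (j, m)" by force
  have "exp (- (real (Suc j * Suc m) * Re z)) / real (Suc m) \<le> exp (- (real (Suc j * Suc m) * Re z)) / 1"
    by (intro divide_left_mono) auto
  then show "norm (log_term z x) \<le> (case x of (j, m) \<Rightarrow> exp (- (real (Suc j * Suc m) * Re z)))"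
    unfolding x norm_log_term by (simp del: of_nat_Suc of_nat_mult)
qed

definition part_gf :: "complex \<Rightarrow> complex" where
  "part_gf z = (\<Sum>n. of_nat (card (partitions_of n)) * exp (- z) ^ n)"

text \<open>Summing over \<open>m\<close> first gives the logarithms of the Euler factors;
  exponentiating the partial sums over \<open>j\<close> returns the finite products, whose limit is
  known.\<close>

lemma part_gf_eq_exp:
  assumes "0 < Re z" shows "part_gf z = exp (part_log z)"
proof -
  let ?q = "exp (- z)"
  have q: "norm ?q < 1" using assms by simp
  have row: "((\<lambda>m. log_term z (j, m)) has_sum - Ln (1 - ?q ^ Suc j)) UNIV" for j
  proof (rule norm_summable_imp_has_sum)
    have nq: "norm (?q ^ Suc j) < 1" using q power_less_one_iff[of "norm ?q" "Suc j"]
      by (simp add: norm_power del: power_Suc)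
    have "(\<lambda>n. - ((- (- (?q ^ Suc j))) ^ n) / of_nat n) sums Ln (1 + - (?q ^ Suc j))"
      by (rule Ln_series') (use nq in simp)
    then have "(\<lambda>n. ((?q ^ Suc j) ^ n) / of_nat n) sums - Ln (1 - ?q ^ Suc j)"
      using sums_minus by fastforce
    then have "(\<lambda>n. ((?q ^ Suc j) ^ Suc n) / of_nat (Suc n)) sums - Ln (1 - ?q ^ Suc j)"
      by (subst sums_Suc_iff) simp
    moreover have "(?q ^ Suc j) ^ Suc m = exp (- (of_nat (Suc j * Suc m) * z))" for m
      by (simp only: power_mult[symmetric] exp_of_nat_mult[symmetric] mult_minus_right mult_minus_left of_nat_mult mult_ac)
    ultimately show "(\<lambda>m. log_term z (j, m)) sums - Ln (1 - ?q ^ Suc j)"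
      by (simp only: log_term_def prod.case)
    have "(\<lambda>m. norm (log_term z (j, m))) summable_on UNIV"
      using log_term_abs_summable[OF assms] Infinite_Sum.abs_summable_on_Sigma_iff[of "log_term z" UNIV "\<lambda>_. UNIV"] by simp
    then show "summable (\<lambda>m. norm (log_term z (j, m)))" by (rule summable_on_imp_summable)
  qed
  have "((log_term z) has_sum part_log z) (Sigma UNIV (\<lambda>_. UNIV))"
    unfolding part_log_def using abs_summable_summable[OF log_term_abs_summable[OF assms]] by simp
  from has_sum_Sigma'[OF this row] have "(\<lambda>j. - Ln (1 - ?q ^ Suc j)) sums part_log z"
    by (rule has_sum_imp_sums)
  then have "(\<lambda>k. exp (\<Sum>j<k. - Ln (1 - ?q ^ Suc j))) \<longlonglongrightarrow> exp (part_log z)"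
    unfolding sums_def by (rule tendsto_exp)
  moreover have "exp (\<Sum>j<k. - Ln (1 - ?q ^ Suc j)) = (\<Prod>j<k. 1 / (1 - ?q ^ Suc j))" for k
  proof -
    have "1 - ?q ^ Suc j \<noteq> 0" for j
    proof
      assume "1 - ?q ^ Suc j = 0"
      then have "norm (?q ^ Suc j) = 1" by (metis norm_one right_minus_eq)
      then show False using q power_less_one_iff[of "norm ?q" "Suc j"] by (simp add: norm_power del: power_Suc)
    qed
    then show ?thesis by (simp add: exp_sum exp_minus inverse_eq_divide del: power_Suc)
  qed
  ultimately have "(\<lambda>k. \<Prod>j<k. 1 / (1 - ?q ^ Suc j)) \<longlonglongrightarrow> exp (part_log z)" by simp
  then show ?thesis
    unfolding part_gf_def using partitions_product_tendsto[OF q] LIMSEQ_unique by blast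
qed

definition part_gf_real :: "real \<Rightarrow> real" where
  "part_gf_real \<epsilon> = (\<Sum>n. real (card (partitions_of n)) * exp (- \<epsilon>) ^ n)"

lemma part_gf_of_real: "part_gf (of_real \<epsilon>) = of_real (part_gf_real \<epsilon>)" if "0 < \<epsilon>"
proof -
  have "summable (\<lambda>n. real (card (partitions_of n)) * exp (- \<epsilon>) ^ n)"
    using summable_partitions[of "exp (- \<epsilon>)"] that by simp
  then have "(\<lambda>n. of_real (real (card (partitions_of n)) * exp (- \<epsilon>) ^ n) :: complex) sums of_real (part_gf_real \<epsilon>)"
    unfolding part_gf_real_def by (intro sums_of_real summable_sums)
  then show ?thesis unfolding part_gf_def by (intro sums_unique[symmetric]) (simp add: exp_of_real[symmetric])
qed

section \<open>The constant of the generating function at 1\<close>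

definition triangular :: "nat \<Rightarrow> nat" where "triangular m = m * (m + 1) div 2"

lemma two_triangular: "2 * triangular m = m * (m + 1)"
  by (simp add: triangular_def)

lemma triangular_ge: "m \<le> triangular m"
proof (cases m)
  case (Suc k)
  have "2 * m \<le> m * (m + 1)" using Suc by simp
  then show ?thesis using two_triangular[of m] by linarith
qed simp

lemma strict_mono_triangular: "strict_mono triangular"
proof (rule strict_monoI_Suc)
  fix m show "triangular m < triangular (Suc m)"
    using two_triangular[of m] two_triangular[of "Suc m"] by (simp add: algebra_simps)
qed

lemma core_size_2:
  assumes "x 0 + x 1 = 0" shows "core_size 2 x = 2 * (x 1 * x 1) + x 1"
proof -
  have x0: "x 0 = - x 1" using assms by simp
  have "2 * (x r * (x r - 1) div 2) = x r * (x r - 1)" for r by simp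
  then show ?thesis unfolding core_size_def
    by (simp add: numeral_2_eq_2 x0) (simp add: algebra_simps)
qed

text \<open>With \<open>b = 1\<close> every partition is counted, so this is the core and quotient
  decomposition for \<open>t = 2\<close>. The core vectors \<open>(- i, i)\<close> have sizes
  \<open>2 * i * i + i\<close>, which run through the triangular numbers once each.\<close>

lemma partitions_2_core:
  "card (partitions_of n) = (\<Sum>m | triangular m \<le> n \<and> even (n - triangular m). multipartitions 2 ((n - triangular m) div 2))"
proof -
  let ?X = "{x \<in> core_vectors 2 n. [core_size 2 x = int n - int 2 * int 0] (mod (int 2 * int 1))}"
  \<comment> \<open>\<open>2 * k * k + k\<close> is the triangular number of \<open>2 * k\<close>
    for \<open>k \<ge> 0\<close> and of \<open>- 2 * k - 1\<close> for \<open>k < 0\<close>; the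
    next definition inverts this enumeration.\<close>
  define m where "m k = (if 0 \<le> k then nat (2 * k) else nat (- 2 * k - 1))" for k :: int
  define k where "k l = (if even l then int (l div 2) else - int ((l + 1) div 2))" for l :: nat
  define v where "v i = (\<lambda>r\<in>{..<2::nat}. if r = 0 then - i else i)" for i :: int
  have v: "v i 0 = - i" "v i 1 = i" "v i \<in> {..<2} \<rightarrow>\<^sub>E UNIV" for i by (auto simp: v_def)
  have sum2: "(\<Sum>r<2. x r) = x 0 + x (1::nat)" for x :: "nat \<Rightarrow> int" by (simp add: numeral_2_eq_2)
  have tri: "int (triangular l) = 2 * (k l * k l) + k l" for l
  proof -
    have "int (2 * triangular l) = int (l * (l + 1))" by (simp only: two_triangular)
    then have 2: "2 * int (triangular l) = int l * (int l + 1)"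
      by (simp only: of_nat_mult of_nat_add of_nat_numeral of_nat_1)
    show ?thesis
    proof (cases "even l")
      case True
      then obtain i where "l = 2 * i" by (rule evenE)
      then show ?thesis using 2 by (simp add: k_def algebra_simps)
    next
      case False
      then obtain i where "l = 2 * i + 1" by (rule oddE)
      then show ?thesis using 2 by (simp add: k_def algebra_simps)
    qed
  qed
  have km: "k (m i) = i" for i
  proof (cases "0 \<le> i")
    case True
    then obtain l where l: "i = int l" using nonneg_int_cases by blast
    have "nat (2 * int l) = 2 * l" by simp
    then show ?thesis by (simp add: l m_def k_def)
  next
    case False
    then obtain l where l: "i = - int (Suc l)" by (metis not_le negD)
    have "m i = 2 * l + 1" using False by (simp add: m_def l)
    then show ?thesis by (simp add: k_def l)
  qed
  have mk: "m (k l) = l" for l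
    by (cases "even l") (auto simp: m_def k_def elim!: evenE oddE)
  have core: "core_size 2 x = int (triangular (m (x 1)))" if "x 0 + x 1 = 0" for x
    unfolding core_size_2[of x, OF that] tri km by simp
  have "card (partitions_of n) = p_hook 2 0 1 n" unfolding p_hook_def by simp
  also have "\<dots> = (\<Sum>x\<in>?X. multipartitions 2 (nat ((int n - core_size 2 x) div int 2)))"
    by (rule p_hook_core_quotient) auto
  also have "\<dots> = (\<Sum>m | triangular m \<le> n \<and> even (n - triangular m). multipartitions 2 ((n - triangular m) div 2))"
  proof (rule sum.reindex_bij_witness[of _ "\<lambda>l. v (k l)" "\<lambda>x. m (x 1)"])
    fix x assume "x \<in> ?X"
    then have x: "x \<in> {..<2} \<rightarrow>\<^sub>E UNIV" "x 0 + x 1 = 0" "core_size 2 x \<le> int n" "2 dvd core_size 2 x - int n"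
      by (auto simp: core_vectors_def sum2 cong_iff_dvd_diff)
    show "v (k (m (x 1))) = x"
    proof (rule PiE_ext[OF v(3) x(1)])
      fix r :: nat assume "r \<in> {..<2}"
      then consider "r = 0" | "r = 1" by fastforce
      then show "v (k (m (x 1))) r = x r" unfolding km using x(2) v by cases auto
    qed
    have le: "triangular (m (x 1)) \<le> n" using x(3) core[OF x(2)] by simp
    have "int n - core_size 2 x = int (n - triangular (m (x 1)))" using core[OF x(2)] le by (simp add: of_nat_diff)
    moreover have "2 dvd int n - core_size 2 x" using x(4) by (simp only: dvd_diff_commute)
    ultimately show "m (x 1) \<in> {m. triangular m \<le> n \<and> even (n - triangular m)}"
      "multipartitions 2 ((n - triangular (m (x 1))) div 2) = multipartitions 2 (nat ((int n - core_size 2 x) div int 2))"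
      using le by (simp_all only: mem_Collect_eq even_of_nat zdiv_int[symmetric] nat_int simp_thms)
  next
    fix l assume l: "l \<in> {m. triangular m \<le> n \<and> even (n - triangular m)}"
    show "m (v (k l) 1) = l" unfolding v by (rule mk)
    have s: "v (k l) 0 + v (k l) 1 = 0" unfolding v by simp
    have c: "core_size 2 (v (k l)) = int (triangular l)" using core[OF s] unfolding v mk .
    have "int n - int (triangular l) = int (n - triangular l)" using l by (simp add: of_nat_diff)
    moreover have "even (int (n - triangular l))" using l by (simp only: mem_Collect_eq even_of_nat)
    ultimately have "2 dvd core_size 2 (v (k l)) - int n" unfolding c by (metis dvd_diff_commute)
    then show "v (k l) \<in> ?X"
      using l s c v(3) by (simp add: core_vectors_def sum2 cong_iff_dvd_diff)
  qed
  finally show ?thesis .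
qed

lemma multipartitions_1: "multipartitions (Suc 0) w = card (partitions_of w)"
proof -
  have "(\<Sum>k\<le>w. card (partitions_of k) * (if w - k = 0 then 1 else 0)) = (\<Sum>k\<in>{w}. card (partitions_of k) * (if w - k = 0 then 1 else 0))"
    by (intro sum.mono_neutral_right) auto
  then show ?thesis by simp
qed

definition triangular_theta :: "real \<Rightarrow> real" where
  "triangular_theta \<epsilon> = (\<Sum>m. exp (- (\<epsilon> * real (triangular m))))"

lemma summable_triangular_theta:
  assumes "0 < \<epsilon>" shows "summable (\<lambda>m. exp (- (\<epsilon> * real (triangular m))))"
proof (rule summable_comparison_test'[OF summable_geometric[of "exp (- \<epsilon>)"], of 0])
  fix m
  have "\<epsilon> * real m \<le> \<epsilon> * real (triangular m)" using assms triangular_ge by simp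
  then show "norm (exp (- (\<epsilon> * real (triangular m)))) \<le> exp (- \<epsilon>) ^ m"
    by (simp add: exp_of_nat_mult[symmetric] mult.commute)
qed (use assms in simp)

text \<open>Gauss's identity for triangular numbers, obtained by counting 2-cores.\<close>

lemma part_gf_triangular_theta:
  assumes "0 < \<epsilon>"
  shows "part_gf_real \<epsilon> = triangular_theta \<epsilon> * part_gf_real (2 * \<epsilon>) ^ 2"
proof -
  let ?r = "exp (- \<epsilon>)" and ?p = "\<lambda>n. real (card (partitions_of n))"
  have r: "0 < ?r" "?r < 1" using assms by auto
  have s2: "exp (- (2 * \<epsilon>)) = ?r ^ 2" by (simp add: exp_of_nat_mult[symmetric])
  have r2: "0 \<le> ?r ^ 2" "?r ^ 2 < 1" using r by (auto simp: power_less_one_iff)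
  have sm: "summable (\<lambda>n. ?p n * (?r ^ 2) ^ n)" by (rule summable_partitions[OF r2])
  have "(\<lambda>n. \<Sum>i\<le>n. (?p i * (?r ^ 2) ^ i) * (?p (n - i) * (?r ^ 2) ^ (n - i))) sums (part_gf_real (2 * \<epsilon>) * part_gf_real (2 * \<epsilon>))"
    unfolding part_gf_real_def s2 by (rule Cauchy_product_sums) (use sm in \<open>simp_all add: norm_mult\<close>)
  moreover have "(\<Sum>i\<le>n. (?p i * (?r ^ 2) ^ i) * (?p (n - i) * (?r ^ 2) ^ (n - i))) = real (multipartitions 2 n) * (?r ^ 2) ^ n" for n
  proof -
    have "(\<Sum>i\<le>n. (?p i * (?r ^ 2) ^ i) * (?p (n - i) * (?r ^ 2) ^ (n - i))) = (\<Sum>i\<le>n. ?p i * ?p (n - i) * (?r ^ 2) ^ n)"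
      by (intro sum.cong refl) (simp add: power_add[symmetric])
    then show ?thesis
      by (simp only: numeral_2_eq_2 multipartitions.simps(2)[of "Suc 0"] multipartitions_1 of_nat_sum of_nat_mult sum_distrib_right)
  qed
  ultimately have M: "(\<lambda>n. real (multipartitions 2 n) * (?r ^ 2) ^ n) sums (part_gf_real (2 * \<epsilon>)) ^ 2"
    by (simp add: power2_eq_square)
  \<comment> \<open>Both series are spread over all exponents, with zeros in the gaps, so that an
    ordinary Cauchy product applies.\<close>
  define b where "b n = (if even n then real (multipartitions 2 (n div 2)) * ?r ^ n else 0)" for n
  define t where "t n = (if n \<in> range triangular then ?r ^ n else 0)" for n
  have sm2: "strict_mono (\<lambda>n::nat. 2 * n)" by (auto simp: strict_mono_def)
  have "(\<lambda>n. b (2 * n)) sums (part_gf_real (2 * \<epsilon>)) ^ 2" using M by (simp add: b_def power_mult)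
  then have b: "b sums (part_gf_real (2 * \<epsilon>)) ^ 2"
    by (subst (asm) sums_mono_reindex[OF sm2]) (auto simp: b_def elim!: evenE)
  have "(\<lambda>m. t (triangular m)) sums triangular_theta \<epsilon>"
    using summable_sums[OF summable_triangular_theta[OF assms]]
    by (simp add: t_def triangular_theta_def exp_of_nat_mult[symmetric] mult.commute)
  then have t: "t sums triangular_theta \<epsilon>"
    by (subst (asm) sums_mono_reindex[OF strict_mono_triangular]) (auto simp: t_def)
  have "0 \<le> t n" "0 \<le> b n" for n using r by (auto simp: t_def b_def)
  then have "(\<lambda>n. \<Sum>i\<le>n. t i * b (n - i)) sums ((\<Sum>n. t n) * (\<Sum>n. b n))"
    using t b by (intro Cauchy_product_sums) (auto simp: sums_iff)
  moreover have "(\<Sum>i\<le>n. t i * b (n - i)) = ?p n * ?r ^ n" for n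
  proof -
    let ?S = "{m. triangular m \<le> n \<and> even (n - triangular m)}"
    have inj: "inj_on triangular A" for A
      using strict_mono_imp_inj_on[OF strict_mono_triangular] by (rule inj_on_subset[OF _ subset_UNIV])
    have "(\<Sum>i\<le>n. t i * b (n - i)) = (\<Sum>i\<in>triangular ` ?S. t i * b (n - i))"
      by (rule sum.mono_neutral_right) (auto simp: t_def b_def)
    also have "\<dots> = (\<Sum>m\<in>?S. t (triangular m) * b (n - triangular m))" by (simp add: sum.reindex[OF inj])
    also have "\<dots> = (\<Sum>m\<in>?S. real (multipartitions 2 ((n - triangular m) div 2)) * ?r ^ n)"
      by (intro sum.cong refl) (auto simp: t_def b_def power_add[symmetric])
    also have "\<dots> = ?p n * ?r ^ n"
      unfolding partitions_2_core[of n] by (simp add: sum_distrib_right)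
    finally show ?thesis .
  qed
  ultimately have "(\<lambda>n. ?p n * ?r ^ n) sums (triangular_theta \<epsilon> * part_gf_real (2 * \<epsilon>) ^ 2)"
    using sums_unique[OF t] sums_unique[OF b] by simp
  then show ?thesis unfolding part_gf_real_def[of \<epsilon>] by (rule sums_unique[symmetric])
qed

definition part_log_real :: "real \<Rightarrow> real" where
  "part_log_real \<epsilon> = Re (part_log (of_real \<epsilon>))"

lemma log_term_of_real:
  "log_term (of_real \<epsilon>) (j, m) = of_real (exp (- (real (Suc j * Suc m) * \<epsilon>)) / real (Suc m))"
  unfolding log_term_def by (simp only: prod.case of_real_divide exp_of_real[symmetric] of_real_minus of_real_mult of_real_of_nat_eq)

lemma part_log_of_real:
  assumes "0 < \<epsilon>" shows "part_log (of_real \<epsilon>) = of_real (part_log_real \<epsilon>)"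
proof -
  have sm: "log_term (of_real \<epsilon>) summable_on UNIV"
    by (rule abs_summable_summable[OF log_term_abs_summable]) (use assms in simp)
  have "Im (log_term (of_real \<epsilon>) x) = 0" for x
    by (cases x) (simp only: log_term_of_real Im_complex_of_real)
  then have "Im (part_log (of_real \<epsilon>)) = 0"
    unfolding part_log_def infsum_Im[OF sm, symmetric] by simp
  then show ?thesis by (simp add: part_log_real_def complex_eq_iff)
qed

lemma exp_part_log_real:
  assumes "0 < \<epsilon>" shows "exp (part_log_real \<epsilon>) = part_gf_real \<epsilon>"
proof -
  have "part_gf (of_real \<epsilon>) = exp (part_log (of_real \<epsilon>))" by (rule part_gf_eq_exp) (use assms in simp)
  then have "complex_of_real (part_gf_real \<epsilon>) = of_real (exp (part_log_real \<epsilon>))"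
    unfolding part_gf_of_real[OF assms] part_log_of_real[OF assms] by (simp add: exp_of_real)
  then show ?thesis by (simp only: of_real_eq_iff)
qed

text \<open>Sums the double series over \<open>j\<close> first, in the order opposite to
  \<open>part_gf_eq_exp\<close>; the rows are geometric and the resulting Lambert series is suited
  to the limit at 0.\<close>

lemma part_log_real_sums:
  assumes "0 < \<epsilon>"
  shows "(\<lambda>m. (1 / real (Suc m)) * (exp (- (real (Suc m) * \<epsilon>)) / (1 - exp (- (real (Suc m) * \<epsilon>))))) sums part_log_real \<epsilon>"
proof -
  have "((\<lambda>x. Re (log_term (of_real \<epsilon>) x)) has_sum part_log_real \<epsilon>) UNIV"
    unfolding part_log_real_def part_log_def
    by (intro has_sum_Re has_sum_infsum abs_summable_summable[OF log_term_abs_summable]) (use assms in simp)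
  then have "((\<lambda>x. Re (log_term (of_real \<epsilon>) (prod.swap x))) has_sum part_log_real \<epsilon>) UNIV"
    by (subst has_sum_reindex_bij_betw[of prod.swap UNIV UNIV]) auto
  then have hs: "((\<lambda>x. Re (log_term (of_real \<epsilon>) (prod.swap x))) has_sum part_log_real \<epsilon>) (Sigma UNIV (\<lambda>_. UNIV))" by simp
  have row: "((\<lambda>j. Re (log_term (of_real \<epsilon>) (prod.swap (m, j)))) has_sum
    (1 / real (Suc m)) * (exp (- (real (Suc m) * \<epsilon>)) / (1 - exp (- (real (Suc m) * \<epsilon>))))) UNIV" for m
  proof (rule norm_summable_imp_has_sum)
    let ?x = "exp (- (real (Suc m) * \<epsilon>))"
    have x: "norm ?x < 1" using assms by (simp del: of_nat_Suc)
    have eq: "Re (log_term (of_real \<epsilon>) (prod.swap (m, j))) = (1 / real (Suc m)) * (?x * ?x ^ j)" for j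
      by (simp only: swap_simp log_term_of_real Re_complex_of_real)
        (simp add: exp_of_nat_mult[symmetric] exp_add[symmetric] algebra_simps)
    show "(\<lambda>j. Re (log_term (of_real \<epsilon>) (prod.swap (m, j)))) sums ((1 / real (Suc m)) * (?x / (1 - ?x)))"
      unfolding eq using sums_mult[OF sums_mult[OF geometric_sums[OF x], of ?x], of "1 / real (Suc m)"] by simp
    then show "summable (\<lambda>j. norm (Re (log_term (of_real \<epsilon>) (prod.swap (m, j)))))"
      using sums_summable unfolding eq by (fastforce simp: abs_mult)
  qed
  show ?thesis by (rule has_sum_imp_sums[OF has_sum_Sigma'[OF hs row]])
qed

lemma inverse_squares_sums_real: "(\<lambda>n. 1 / (real n + 1)\<^sup>2) sums (pi\<^sup>2 / 6)"
  using inverse_squares_sums by (simp add: add.commute)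

text \<open>With \<open>u = (m + 1) * \<epsilon>\<close>, the inequality
  \<open>u * exp (- u) \<le> 1 - exp (- u)\<close> bounds each scaled term by the inverse square of
  \<open>m + 1\<close>, which is also its limit; Tannery's theorem and the sum of inverse squares do
  the rest.\<close>

lemma part_log_real_leading: "((\<lambda>\<epsilon>. \<epsilon> * part_log_real \<epsilon>) \<longlongrightarrow> pi\<^sup>2 / 6) (at_right 0)"
proof -
  let ?a = "\<lambda>m \<epsilon>. \<epsilon> * ((1 / real (Suc m)) * (exp (- (real (Suc m) * \<epsilon>)) / (1 - exp (- (real (Suc m) * \<epsilon>)))))"
  have "((\<lambda>\<epsilon>. suminf (\<lambda>m. ?a m \<epsilon>)) \<longlongrightarrow> suminf (\<lambda>m. 1 / (real m + 1)\<^sup>2)) (at_right 0)"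
  proof (rule tannerys_theorem[THEN conjunct2, THEN conjunct2])
    show "((\<lambda>\<epsilon>. ?a m \<epsilon>) \<longlongrightarrow> 1 / (real m + 1)\<^sup>2) (at_right 0)" for m
    proof -
      define c where "c = real (Suc m)"
      have "c > 0" by (simp add: c_def)
      then have "((\<lambda>\<epsilon>. \<epsilon> * ((1 / c) * (exp (- (c * \<epsilon>)) / (1 - exp (- (c * \<epsilon>)))))) \<longlongrightarrow> inverse c / c) (at_right 0)"
        by real_asymp
      then show ?thesis by (simp add: c_def add.commute power2_eq_square divide_inverse)
    qed
    have "norm (?a m \<epsilon>) \<le> 1 / (real m + 1)\<^sup>2" if "0 < \<epsilon>" for m \<epsilon>
    proof -
      define u where "u = real (Suc m) * \<epsilon>"
      have u: "0 < u" using that by (simp add: u_def)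
      have "u * exp (- u) \<le> 1 - exp (- u)"
      proof -
        have "(1 + u) * exp (- u) \<le> exp u * exp (- u)" by (intro mult_right_mono exp_ge_add_one_self) simp
        then show ?thesis by (simp add: exp_minus algebra_simps)
      qed
      moreover have "0 < 1 - exp (- u)" using u by simp
      ultimately have "u * (exp (- u) / (1 - exp (- u))) \<le> 1" by (simp add: field_simps)
      then have "u * (exp (- u) / (1 - exp (- u))) / real (Suc m) ^ 2 \<le> 1 / real (Suc m) ^ 2" by (rule divide_right_mono) simp
      moreover have eq: "?a m \<epsilon> = u * (exp (- u) / (1 - exp (- u))) / real (Suc m) ^ 2"
        unfolding u_def by (simp add: power2_eq_square del: of_nat_Suc)
      moreover have nn: "0 \<le> ?a m \<epsilon>" using that u by (simp add: u_def[symmetric] del: of_nat_Suc)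
      ultimately show ?thesis
        unfolding real_norm_def abs_of_nonneg[OF nn] eq by (simp only: of_nat_Suc add.commute)
    qed
    then show "\<forall>\<^sub>F (m, \<epsilon>) in sequentially \<times>\<^sub>F at_right 0. norm (?a m \<epsilon>) \<le> 1 / (real m + 1)\<^sup>2"
      unfolding eventually_prod_filter case_prod_conv
      by (intro exI[of _ "\<lambda>_. True"] exI[of _ "\<lambda>\<epsilon>. 0 < \<epsilon>"]) (auto simp: eventually_at_right_less)
    show "summable (\<lambda>m. 1 / (real m + 1)\<^sup>2)" using inverse_squares_sums_real by (rule sums_summable)
  qed simp
  also have "suminf (\<lambda>m. 1 / (real m + 1)\<^sup>2) = pi\<^sup>2 / 6" using inverse_squares_sums_real by (rule sums_unique[symmetric])
  finally show ?thesis
  proof (rule Lim_transform_eventually)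
    show "\<forall>\<^sub>F \<epsilon> in at_right 0. suminf (\<lambda>m. ?a m \<epsilon>) = \<epsilon> * part_log_real \<epsilon>"
      using eventually_at_right_less[of 0]
      by eventually_elim (rule sums_unique[symmetric], rule sums_mult[OF part_log_real_sums])
  qed
qed

section \<open>The theta series near 0, by comparison with a Gaussian integral\<close>

lemma has_bochner_integral_half_gaussian:
  assumes "0 < (a::real)"
  shows "has_bochner_integral lborel (\<lambda>x. indicator {0..} x *\<^sub>R exp (- (a * x\<^sup>2))) (sqrt (pi / a) / 2)"
proof -
  let ?s = "sqrt a"
  have s: "0 < ?s" using assms by simp
  have "has_bochner_integral lborel (\<lambda>x. indicator {0..} (0 + ?s * x) *\<^sub>R exp (- (0 + ?s * x)\<^sup>2)) ((sqrt pi / 2) /\<^sub>R \<bar>?s\<bar>)"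
    using gaussian_moment_0 s by (subst lborel_has_bochner_integral_real_affine_iff[symmetric]) auto
  moreover have "indicator {0..} (0 + ?s * x) *\<^sub>R exp (- (0 + ?s * x)\<^sup>2) = indicator {0..} x *\<^sub>R exp (- (a * x\<^sup>2))" for x
    using s assms by (auto simp: indicator_def power_mult_distrib zero_le_mult_iff)
  moreover have "(sqrt pi / 2) /\<^sub>R \<bar>?s\<bar> = sqrt (pi / a) / 2"
    using s by (simp add: real_sqrt_divide field_simps)
  ultimately show ?thesis by simp
qed

text \<open>\<open>triangular m\<close> lies between half the square of \<open>m\<close> and half
  the square of \<open>m + 1\<close>. This places the theta value between \<open>S - 1\<close> and
  \<open>S\<close>, where \<open>S\<close> sums a Gaussian over the naturals, and monotonicity
  places \<open>S\<close> at most 1 above the Gaussian integral. An absolute error of 1 is harmless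
  because the main term grows like \<open>1 / sqrt \<epsilon>\<close>.\<close>

lemma triangular_theta_bounds:
  assumes "0 < \<epsilon>"
  shows "\<bar>triangular_theta \<epsilon> - sqrt (pi / (2 * \<epsilon>))\<bar> \<le> 1"
proof -
  let ?f = "\<lambda>x::real. exp (- (\<epsilon> / 2 * x\<^sup>2))"
  define I where "I = sqrt (pi / (\<epsilon> / 2)) / 2"
  have I: "I = sqrt (pi / (2 * \<epsilon>))"
  proof -
    have "sqrt (pi / (\<epsilon> / 2)) = sqrt (4 * (pi / (2 * \<epsilon>)))" by (simp add: field_simps)
    also have "\<dots> = 2 * sqrt (pi / (2 * \<epsilon>))" by (simp only: real_sqrt_mult real_sqrt_four)
    finally show ?thesis by (simp add: I_def)
  qed
  have f0: "?f (real m) \<le> ?f (real n)" if "n \<le> m" for m n :: nat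
    using that assms by (simp add: power_mono)
  interpret antimono_fun_sum_integral_diff ?f
    by standard (use assms in \<open>auto intro!: continuous_intros power_mono\<close>)
  have hb: "has_bochner_integral lborel (\<lambda>x. indicator {0..} x *\<^sub>R ?f x) I"
    unfolding I_def using has_bochner_integral_half_gaussian[of "\<epsilon> / 2"] assms by simp
  have int: "integral {0..real n} ?f = (\<integral>x. indicator {..real n} x *\<^sub>R (indicator {0..} x *\<^sub>R ?f x) \<partial>lborel)" for n
  proof -
    have "set_integrable lborel {0..real n} ?f"
      by (intro borel_integrable_atLeastAtMost') (auto intro!: continuous_intros)
    from set_borel_integral_eq_integral(2)[OF this]
    have "integral {0..real n} ?f = (LINT x:{0..real n}|lborel. ?f x)" by simp
    also have "\<dots> = (\<integral>x. indicator {..real n} x *\<^sub>R (indicator {0..} x *\<^sub>R ?f x) \<partial>lborel)"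
      unfolding set_lebesgue_integral_def by (intro Bochner_Integration.integral_cong) (auto simp: indicator_def)
    finally show ?thesis .
  qed
  have "((\<lambda>y. \<integral>x. indicator {..y} x *\<^sub>R (indicator {0..} x *\<^sub>R ?f x) \<partial>lborel) \<longlongrightarrow> I) at_top"
    using tendsto_integral_at_top[of lborel "\<lambda>x. indicator {0..} x *\<^sub>R ?f x"] hb
    by (simp add: has_bochner_integral_iff)
  then have lim_int: "(\<lambda>n. integral {0..real n} ?f) \<longlonglongrightarrow> I"
    unfolding int by (rule filterlim_compose[OF _ filterlim_real_sequentially])
  have sm: "summable (\<lambda>m. ?f (real m))"
  proof (rule summable_comparison_test'[OF summable_geometric[of "exp (- (\<epsilon> / 2))"], of 0])
    fix m :: nat
    have "real m \<le> real m ^ 2" by (cases m) (auto simp: power2_eq_square)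
    then have "\<epsilon> / 2 * real m \<le> \<epsilon> / 2 * real m ^ 2" using assms by (intro mult_left_mono) auto
    then show "norm (?f (real m)) \<le> exp (- (\<epsilon> / 2)) ^ m"
      by (simp add: exp_of_nat_mult[symmetric] mult.commute)
  qed (use assms in simp)
  define S where "S = (\<Sum>m. ?f (real m))"
  have "(\<lambda>n. (\<Sum>m\<le>n. ?f (real m)) - integral {0..real n} ?f) \<longlonglongrightarrow> S - I"
    unfolding S_def by (intro tendsto_diff summable_LIMSEQ' sm lim_int)
  then have lim: "sum_integral_diff_series \<longlonglongrightarrow> S - I" unfolding sum_integral_diff_series_def by simp
  have "0 \<le> S - I" by (rule LIMSEQ_le_const[OF lim]) (use sum_integral_diff_series_nonneg in auto)
  moreover have "S - I \<le> 1"
  proof (rule LIMSEQ_le_const2[OF lim])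
    have "sum_integral_diff_series 0 = 1" unfolding sum_integral_diff_series_def by simp
    then show "\<exists>N. \<forall>n\<ge>N. sum_integral_diff_series n \<le> 1"
      using sum_integral_diff_series_antimono[of 0] by auto
  qed
  moreover have tri: "real (triangular m) = real m * (real m + 1) / 2" for m
  proof -
    have "real (2 * triangular m) = real (m * (m + 1))" by (simp only: two_triangular)
    then have "2 * real (triangular m) = real m * (real m + 1)"
      by (simp only: of_nat_mult of_nat_add of_nat_numeral of_nat_1)
    then show ?thesis by simp
  qed
  have sm': "summable (\<lambda>m. ?f (real (Suc m)))"
    using summable_Suc_iff[of "\<lambda>m. ?f (real m)"] sm by (simp only:)
  have "triangular_theta \<epsilon> \<le> S"
    unfolding triangular_theta_def S_def
  proof (rule suminf_le[OF _ summable_triangular_theta[OF assms] sm])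
    fix m have "\<epsilon> / 2 * (real m)\<^sup>2 \<le> \<epsilon> * real (triangular m)"
      using assms by (simp add: tri power2_eq_square algebra_simps)
    then show "exp (- (\<epsilon> * real (triangular m))) \<le> ?f (real m)" by simp
  qed
  moreover have "S - 1 \<le> triangular_theta \<epsilon>"
  proof -
    have "S - 1 = (\<Sum>m. ?f (real (Suc m)))"
      unfolding S_def using suminf_split_head[OF sm] by simp
    also have "\<dots> \<le> triangular_theta \<epsilon>"
      unfolding triangular_theta_def
    proof (rule suminf_le)
      fix m have "\<epsilon> * real (triangular m) \<le> \<epsilon> / 2 * (real (Suc m))\<^sup>2"
        using assms by (simp add: tri power2_eq_square algebra_simps)
      then show "?f (real (Suc m)) \<le> exp (- (\<epsilon> * real (triangular m)))" by simp
    qed (rule sm' summable_triangular_theta[OF assms])+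
    finally show ?thesis .
  qed
  ultimately show ?thesis unfolding I by linarith
qed

lemma triangular_theta_asymp:
  "((\<lambda>\<epsilon>. triangular_theta \<epsilon> * sqrt (2 * \<epsilon> / pi)) \<longlongrightarrow> 1) (at_right 0)"
proof -
  have "((\<lambda>\<epsilon>. triangular_theta \<epsilon> * sqrt (2 * \<epsilon> / pi) - 1) \<longlongrightarrow> 0) (at_right 0)"
  proof (rule Lim_null_comparison)
    show "((\<lambda>\<epsilon>. sqrt (2 * \<epsilon> / pi)) \<longlongrightarrow> 0) (at_right 0)" by real_asymp
    show "\<forall>\<^sub>F \<epsilon> in at_right 0. norm (triangular_theta \<epsilon> * sqrt (2 * \<epsilon> / pi) - 1) \<le> sqrt (2 * \<epsilon> / pi)"
      using eventually_at_right_less[of 0]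
    proof eventually_elim
      fix \<epsilon> :: real assume e: "0 < \<epsilon>"
      have "sqrt (pi / (2 * \<epsilon>)) * sqrt (2 * \<epsilon> / pi) = 1"
        using e by (simp add: real_sqrt_mult[symmetric])
      then have "triangular_theta \<epsilon> * sqrt (2 * \<epsilon> / pi) - 1 = (triangular_theta \<epsilon> - sqrt (pi / (2 * \<epsilon>))) * sqrt (2 * \<epsilon> / pi)"
        by (simp add: algebra_simps)
      also have "norm \<dots> = \<bar>triangular_theta \<epsilon> - sqrt (pi / (2 * \<epsilon>))\<bar> * sqrt (2 * \<epsilon> / pi)"
        using e by (simp add: abs_mult)
      also have "\<dots> \<le> 1 * sqrt (2 * \<epsilon> / pi)"
        by (intro mult_right_mono triangular_theta_bounds) (use e in auto)
      finally show "norm (triangular_theta \<epsilon> * sqrt (2 * \<epsilon> / pi) - 1) \<le> sqrt (2 * \<epsilon> / pi)" by simp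
    qed
  qed
  then show ?thesis by (simp add: LIM_zero_iff)
qed

text \<open>Iterating \<open>D x \<approx> D (x/2) / 2\<close> towards 0 makes the leading term negligible.\<close>

lemma tendsto_zero_doubling:
  fixes D :: "real \<Rightarrow> real"
  assumes "((\<lambda>x. D x - 2 * D (2 * x)) \<longlongrightarrow> 0) (at_right 0)"
    and "((\<lambda>x. x * D x) \<longlongrightarrow> 0) (at_right 0)"
  shows "(D \<longlongrightarrow> 0) (at_right 0)"
proof (rule tendstoI)
  fix \<eta> :: real assume "0 < \<eta>"
  then have "\<forall>\<^sub>F x in at_right 0. dist (D x - 2 * D (2 * x)) 0 < \<eta> / 2"
    by (intro tendstoD[OF assms(1)]) simp
  then obtain d where d: "0 < d" "\<And>x. 0 < x \<Longrightarrow> x < d \<Longrightarrow> \<bar>D x - 2 * D (2 * x)\<bar> < \<eta> / 2"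
    unfolding eventually_at_right_field by auto
  have "\<bar>D x\<bar> < \<eta>" if x: "0 < x" "x < d" for x
  proof -
    \<comment> \<open>Each halving of the argument costs an error \<open>\<eta> / 4\<close>; with
      the weights \<open>1 / 2 ^ j\<close> these errors add up to less than
      \<open>\<eta> / 2\<close> however many steps are taken.\<close>
    have iter: "\<bar>D x\<bar> \<le> \<bar>D (x / 2 ^ j)\<bar> / 2 ^ j + \<eta> / 2 * (1 - 1 / 2 ^ j)" for j
    proof (induction j)
      case (Suc j)
      have "(1::real) \<le> 2 ^ Suc j" by (rule one_le_power) simp
      then have "x / 2 ^ Suc j \<le> x / 1" using x by (intro divide_left_mono) (auto simp del: power_Suc)
      then have "\<bar>D (x / 2 ^ Suc j) - 2 * D (2 * (x / 2 ^ Suc j))\<bar> < \<eta> / 2"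
        using x by (intro d(2)) auto
      moreover have h: "2 * (x / 2 ^ Suc j) = x / 2 ^ j" by simp
      ultimately have "\<bar>D (x / 2 ^ Suc j) - 2 * D (x / 2 ^ j)\<bar> < \<eta> / 2" by (simp only: h)
      then have "\<bar>D (x / 2 ^ j)\<bar> \<le> \<bar>D (x / 2 ^ Suc j)\<bar> / 2 + \<eta> / 4" by linarith
      then have "\<bar>D (x / 2 ^ j)\<bar> / 2 ^ j \<le> (\<bar>D (x / 2 ^ Suc j)\<bar> / 2 + \<eta> / 4) / 2 ^ j"
        by (rule divide_right_mono) simp
      with Suc show ?case by (simp add: field_simps)
    qed simp
    have "filterlim (\<lambda>j. x / 2 ^ j) (at_right 0) sequentially"
      unfolding filterlim_at using x by (auto intro!: eventuallyI) real_asymp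
    \<comment> \<open>The weighted value after \<open>j\<close> halvings is
      \<open>y * D y / x\<close> at \<open>y = x / 2 ^ j\<close>, which the second hypothesis sends
      to 0.\<close>
    then have "(\<lambda>j. x / 2 ^ j * D (x / 2 ^ j)) \<longlonglongrightarrow> 0"
      by (rule filterlim_compose[OF assms(2)])
    moreover have "(\<lambda>j. 1 / 2 ^ j :: real) \<longlonglongrightarrow> 0" by real_asymp
    ultimately have "(\<lambda>j. \<bar>1 / x * (x / 2 ^ j * D (x / 2 ^ j))\<bar> + \<eta> / 2 * (1 - 1 / 2 ^ j)) \<longlonglongrightarrow> \<bar>1 / x * 0\<bar> + \<eta> / 2 * (1 - 0)"
      by (intro tendsto_intros)
    moreover have "\<bar>1 / x * (x / 2 ^ j * D (x / 2 ^ j))\<bar> = \<bar>D (x / 2 ^ j)\<bar> / 2 ^ j" for j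
      using x by (simp add: abs_mult)
    ultimately have "(\<lambda>j. \<bar>D (x / 2 ^ j)\<bar> / 2 ^ j + \<eta> / 2 * (1 - 1 / 2 ^ j)) \<longlonglongrightarrow> \<eta> / 2" by simp
    then have "\<bar>D x\<bar> \<le> \<eta> / 2" by (rule LIMSEQ_le_const) (use iter in auto)
    then show ?thesis using \<open>0 < \<eta>\<close> by simp
  qed
  then show "\<forall>\<^sub>F x in at_right 0. dist (D x) 0 < \<eta>"
    unfolding eventually_at_right_field using d(1) by auto
qed

text \<open>The theta asymptotics demand a solution of \<open>f \<epsilon> - 2 * f (2 * \<epsilon>)
  = ln (sqrt (pi / (2 * \<epsilon>)))\<close>, and
  \<open>f \<epsilon> = ln (\<epsilon> / (2 * pi)) / 2\<close> is one; this is the origin of the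
  constant \<open>2 * pi\<close>. The term in \<open>1 / \<epsilon>\<close> solves the homogeneous
  relation and is fixed by \<open>part_log_real_leading\<close>.\<close>

definition part_log_error :: "real \<Rightarrow> real" where
  "part_log_error \<epsilon> = part_log_real \<epsilon> - (pi\<^sup>2 / 6) / \<epsilon> - ln (\<epsilon> / (2 * pi)) / 2"

lemma part_log_error_tendsto: "(part_log_error \<longlongrightarrow> 0) (at_right 0)"
proof (rule tendsto_zero_doubling)
  have "((\<lambda>\<epsilon>. ln (triangular_theta \<epsilon> * sqrt (2 * \<epsilon> / pi))) \<longlongrightarrow> ln 1) (at_right 0)"
    by (intro tendsto_ln triangular_theta_asymp) simp
  then have "((\<lambda>\<epsilon>. ln (triangular_theta \<epsilon> * sqrt (2 * \<epsilon> / pi))) \<longlongrightarrow> 0) (at_right 0)" by simp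
  then show "((\<lambda>\<epsilon>. part_log_error \<epsilon> - 2 * part_log_error (2 * \<epsilon>)) \<longlongrightarrow> 0) (at_right 0)"
  proof (rule Lim_transform_eventually)
    show "\<forall>\<^sub>F \<epsilon> in at_right 0. ln (triangular_theta \<epsilon> * sqrt (2 * \<epsilon> / pi)) = part_log_error \<epsilon> - 2 * part_log_error (2 * \<epsilon>)"
      using eventually_at_right_less[of 0]
    proof eventually_elim
      fix \<epsilon> :: real assume e: "0 < \<epsilon>"
      then have e2: "0 < 2 * \<epsilon>" by simp
      have eq: "exp (part_log_real \<epsilon>) = triangular_theta \<epsilon> * exp (part_log_real (2 * \<epsilon>)) ^ 2"
        unfolding exp_part_log_real[OF e] exp_part_log_real[OF e2] by (rule part_gf_triangular_theta[OF e])
      have pos: "0 < triangular_theta \<epsilon>"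
        unfolding triangular_theta_def by (rule suminf_pos[OF summable_triangular_theta[OF e]]) simp
      have "triangular_theta \<epsilon> = exp (part_log_real \<epsilon> - 2 * part_log_real (2 * \<epsilon>))"
        using eq by (simp add: exp_diff exp_double)
      then have "ln (triangular_theta \<epsilon>) = part_log_real \<epsilon> - 2 * part_log_real (2 * \<epsilon>)" by simp
      then show "ln (triangular_theta \<epsilon> * sqrt (2 * \<epsilon> / pi)) = part_log_error \<epsilon> - 2 * part_log_error (2 * \<epsilon>)"
      proof -
        assume lt: "ln (triangular_theta \<epsilon>) = part_log_real \<epsilon> - 2 * part_log_real (2 * \<epsilon>)"
        have "ln (triangular_theta \<epsilon> * sqrt (2 * \<epsilon> / pi)) = ln (triangular_theta \<epsilon>) + (ln 2 + ln \<epsilon> - ln pi) / 2"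
          using e pos by (simp add: ln_mult ln_sqrt ln_div)
        moreover have "ln (\<epsilon> / (2 * pi)) = ln \<epsilon> - (ln 2 + ln pi)" "ln (2 * \<epsilon> / (2 * pi)) = ln \<epsilon> - ln pi"
          using e by (simp_all add: ln_mult ln_div)
        moreover have "2 * (pi\<^sup>2 / 6 / (2 * \<epsilon>)) = pi\<^sup>2 / 6 / \<epsilon>" by simp
        ultimately show ?thesis unfolding part_log_error_def lt by argo
      qed
    qed
  qed
  have "((\<lambda>\<epsilon>. \<epsilon> * part_log_real \<epsilon> - pi\<^sup>2 / 6 - \<epsilon> * (ln (\<epsilon> / (2 * pi)) / 2)) \<longlongrightarrow> pi\<^sup>2 / 6 - pi\<^sup>2 / 6 - 0) (at_right 0)"
  proof (intro tendsto_diff part_log_real_leading tendsto_const)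
    show "((\<lambda>\<epsilon>. \<epsilon> * (ln (\<epsilon> / (2 * pi)) / 2)) \<longlongrightarrow> 0) (at_right 0)" by real_asymp
  qed
  then have "((\<lambda>\<epsilon>. \<epsilon> * part_log_real \<epsilon> - pi\<^sup>2 / 6 - \<epsilon> * (ln (\<epsilon> / (2 * pi)) / 2)) \<longlongrightarrow> 0) (at_right 0)" by simp
  then show "((\<lambda>\<epsilon>. \<epsilon> * part_log_error \<epsilon>) \<longlongrightarrow> 0) (at_right 0)"
  proof (rule Lim_transform_eventually)
    show "\<forall>\<^sub>F \<epsilon> in at_right 0. \<epsilon> * part_log_real \<epsilon> - pi\<^sup>2 / 6 - \<epsilon> * (ln (\<epsilon> / (2 * pi)) / 2) = \<epsilon> * part_log_error \<epsilon>"
      using eventually_at_right_less[of 0]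
      by eventually_elim (simp add: part_log_error_def algebra_simps)
  qed
qed

section \<open>The saddle point method\<close>

text \<open>Up to the sign \<open>(-1) ^ i\<close>, the \<open>i\<close>-th derivative of
  \<open>part_log_real\<close>, differentiated term by term.\<close>

definition log_moment :: "nat \<Rightarrow> real \<Rightarrow> real" where
  "log_moment i \<epsilon> = (\<Sum>\<^sub>\<infinity>x. real (Suc (fst x) * Suc (snd x)) ^ i * exp (- (real (Suc (fst x) * Suc (snd x)) * \<epsilon>)) / real (Suc (snd x)))"

text \<open>This is \<open>x \<le> exp x\<close> at \<open>x = l * e / i\<close>, raised to the
  power \<open>i\<close>.\<close>

lemma power_exp_bound:
  fixes l e :: real
  assumes "0 \<le> l" "0 < e" "i > 0"
  shows "l ^ i * exp (- (l * e)) \<le> (real i / e) ^ i"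
proof -
  have "l * e / real i \<le> exp (l * e / real i)" using exp_ge_add_one_self[of "l * e / real i"] by linarith
  then have "(l * e / real i) ^ i \<le> exp (l * e / real i) ^ i" using assms by (intro power_mono) auto
  also have "\<dots> = exp (l * e)" using assms by (simp add: exp_of_nat_mult[symmetric])
  finally have "l ^ i * exp (- (l * e)) \<le> ((real i / e) ^ i * exp (l * e)) * exp (- (l * e))"
    using assms by (intro mult_right_mono) (auto simp: field_simps power_mult_distrib)
  then show ?thesis by (simp add: mult.assoc exp_minus_inverse exp_minus)
qed

lemma log_moment_has_sum:
  assumes "0 < \<epsilon>" "i > 0"
  shows "((\<lambda>x. real (Suc (fst x) * Suc (snd x)) ^ i * exp (- (real (Suc (fst x) * Suc (snd x)) * \<epsilon>)) / real (Suc (snd x)))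
    has_sum log_moment i \<epsilon>) UNIV"
  unfolding log_moment_def
proof (intro has_sum_infsum)
  let ?K = "(real i / (\<epsilon> / 2)) ^ i"
  let ?g = "\<lambda>x :: nat \<times> nat. ?K * (case x of (j, m) \<Rightarrow> exp (- (real (Suc j * Suc m) * (\<epsilon> / 2))))"
  have "?g summable_on UNIV"
    by (intro summable_on_cmult_right summable_on_exp_product) (use assms in simp)
  then show "(\<lambda>x. real (Suc (fst x) * Suc (snd x)) ^ i * exp (- (real (Suc (fst x) * Suc (snd x)) * \<epsilon>)) / real (Suc (snd x))) summable_on UNIV"
  proof (rule summable_on_comparison_test)
    fix x :: "nat \<times> nat"
    define l where "l = real (Suc (fst x) * Suc (snd x))"
    have "l ^ i * exp (- (l * \<epsilon>)) / real (Suc (snd x)) \<le> l ^ i * exp (- (l * \<epsilon>)) / 1"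
      by (intro divide_left_mono) (auto simp: l_def)
    \<comment> \<open>Half of the exponential absorbs the power of \<open>l\<close>, the other half
      keeps the series summable.\<close>
    also have "\<dots> = l ^ i * (exp (- (l * (\<epsilon> / 2))) * exp (- (l * (\<epsilon> / 2)))) / 1"
      by (simp add: exp_add[symmetric])
    also have "l ^ i * (exp (- (l * (\<epsilon> / 2))) * exp (- (l * (\<epsilon> / 2)))) / 1 \<le> ?K * exp (- (l * (\<epsilon> / 2)))"
      using mult_right_mono[OF power_exp_bound[of l "\<epsilon> / 2" i], of "exp (- (l * (\<epsilon> / 2)))"] assms
      by (simp add: l_def mult.assoc del: of_nat_Suc of_nat_mult)
    finally show "real (Suc (fst x) * Suc (snd x)) ^ i * exp (- (real (Suc (fst x) * Suc (snd x)) * \<epsilon>)) / real (Suc (snd x)) \<le> ?g x"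
      by (simp only: l_def case_prod_unfold)
  qed simp
qed

lemma part_log_real_has_sum:
  assumes "0 < \<epsilon>"
  shows "((\<lambda>x. exp (- (real (Suc (fst x) * Suc (snd x)) * \<epsilon>)) / real (Suc (snd x))) has_sum part_log_real \<epsilon>) UNIV"
proof -
  have "((\<lambda>x. Re (log_term (of_real \<epsilon>) x)) has_sum part_log_real \<epsilon>) UNIV"
    unfolding part_log_real_def part_log_def
    by (intro has_sum_Re has_sum_infsum abs_summable_summable[OF log_term_abs_summable]) (use assms in simp)
  moreover have "Re (log_term (of_real \<epsilon>) x) = exp (- (real (Suc (fst x) * Suc (snd x)) * \<epsilon>)) / real (Suc (snd x))" for x
    by (cases x) (simp only: log_term_of_real Re_complex_of_real fst_conv snd_conv)
  ultimately show ?thesis by simp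
qed

lemma part_log_has_sum:
  assumes "0 < Re z" shows "(log_term z has_sum part_log z) UNIV"
  unfolding part_log_def
  by (intro has_sum_infsum abs_summable_summable[OF log_term_abs_summable[OF assms]])

lemma has_sum_diff_real_vector:
  fixes f g :: "'a \<Rightarrow> 'b :: real_normed_vector"
  assumes "(f has_sum a) A" "(g has_sum b) A"
  shows "((\<lambda>x. f x - g x) has_sum (a - b)) A"
  using has_sum_add[OF assms(1), of "\<lambda>x. - g x" "- b"] assms(2) by (simp add: has_sum_uminus)

text \<open>Expands the exponential to second order in every term of the double series. The cubic
  remainder suffices because at the scale \<open>\<epsilon> * sqrt \<epsilon>\<close> it is of order
  \<open>sqrt \<epsilon>\<close>.\<close>

lemma part_log_taylor:
  assumes "0 < \<epsilon>" "\<bar>Re w\<bar> \<le> \<epsilon> / 2"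
  shows "norm (part_log (of_real \<epsilon> - w) - part_log (of_real \<epsilon>) - w * of_real (log_moment 1 \<epsilon>)
    - w\<^sup>2 * of_real (log_moment 2 \<epsilon>) / 2) \<le> 864 * norm w ^ 3 / \<epsilon> ^ 3 * part_log_real (\<epsilon> / 4)"
proof -
  let ?l = "\<lambda>x :: nat \<times> nat. real (Suc (fst x) * Suc (snd x))"
  let ?d = "\<lambda>x :: nat \<times> nat. real (Suc (snd x))"
  define f where "f x = log_term (of_real \<epsilon> - w) x - log_term (of_real \<epsilon>) x
      - w * of_real (?l x ^ 1 * exp (- (?l x * \<epsilon>)) / ?d x)
      - w\<^sup>2 * of_real (?l x ^ 2 * exp (- (?l x * \<epsilon>)) / ?d x) / 2" for x
  define S where "S = part_log (of_real \<epsilon> - w) - part_log (of_real \<epsilon>) - w * of_real (log_moment 1 \<epsilon>)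
    - w\<^sup>2 * of_real (log_moment 2 \<epsilon>) / 2"
  have hs: "(f has_sum S) UNIV"
    unfolding f_def S_def using assms
    by (intro has_sum_diff_real_vector part_log_has_sum has_sum_cmult_right has_sum_divide_const has_sum_of_real log_moment_has_sum) auto
  have feq: "f x = of_real (exp (- (?l x * \<epsilon>)) / ?d x) * (exp (of_real (?l x) * w) - (\<Sum>k\<le>2. (of_real (?l x) * w) ^ k / fact k))" for x
  proof -
    obtain j m where x: "x = (j, m)" by force
    let ?L = "complex_of_real (real (Suc j * Suc m))"
    have t: "(\<Sum>k\<le>2. z ^ k / fact k) = 1 + z + z\<^sup>2 / 2" for z :: complex
    proof -
      have "{..2::nat} = {0, 1, 2}" by auto
      then show ?thesis by simp
    qed
    have alg: "c * E - c - w * (L ^ 1 * c) - w\<^sup>2 * (L\<^sup>2 * c) / 2 = c * (E - (1 + L * w + (L * w)\<^sup>2 / 2))" for c E L :: complex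
      by (simp add: algebra_simps power2_eq_square)
    have "log_term (of_real \<epsilon> - w) x = of_real (exp (- (?l x * \<epsilon>)) / ?d x) * exp (?L * w)"
      unfolding x log_term_def
      by (simp only: prod.case fst_conv snd_conv of_real_divide exp_of_real[symmetric] of_real_minus of_real_mult
        of_real_of_nat_eq times_divide_eq_left exp_add[symmetric]) (simp add: algebra_simps)
    moreover have "log_term (of_real \<epsilon>) x = of_real (exp (- (?l x * \<epsilon>)) / ?d x)"
      unfolding x by (simp only: log_term_of_real fst_conv snd_conv)
    moreover have "complex_of_real (?l x ^ i * exp (- (?l x * \<epsilon>)) / ?d x) = ?L ^ i * of_real (exp (- (?l x * \<epsilon>)) / ?d x)" for i
      unfolding x fst_conv snd_conv by (simp only: of_real_mult of_real_power of_real_divide times_divide_eq_right)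
    ultimately show ?thesis unfolding f_def x fst_conv snd_conv t
      by (simp only: alg)
  qed
  have le: "norm (f x) \<le> (864 * norm w ^ 3 / \<epsilon> ^ 3) * (exp (- (?l x * (\<epsilon> / 4))) / ?d x)" for x
  proof -
    define l where "l = ?l x"
    have l: "0 \<le> l" by (simp add: l_def)
    have "norm (exp (of_real l * w) - (\<Sum>k\<le>2. (of_real l * w) ^ k / fact k)) \<le>
        exp \<bar>Re (of_real l * w)\<bar> * norm (of_real l * w) ^ Suc 2 / fact 2"
      by (rule Taylor_exp)
    also have "\<dots> = exp (l * \<bar>Re w\<bar>) * (l ^ 3 * norm w ^ 3) / 2"
      using l by (simp add: abs_mult norm_mult power_mult_distrib numeral_3_eq_3 fact_2 numeral_2_eq_2)
    also have "\<dots> \<le> exp (l * (\<epsilon> / 2)) * (l ^ 3 * norm w ^ 3) / 2"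
      using l mult_left_mono[OF assms(2) l] by (intro divide_right_mono mult_right_mono) simp_all
    finally have 1: "norm (exp (of_real l * w) - (\<Sum>k\<le>2. (of_real l * w) ^ k / fact k)) \<le>
      exp (l * (\<epsilon> / 2)) * (l ^ 3 * norm w ^ 3) / 2" .
    have "norm (f x) = exp (- (l * \<epsilon>)) / ?d x * norm (exp (of_real l * w) - (\<Sum>k\<le>2. (of_real l * w) ^ k / fact k))"
      unfolding feq l_def norm_mult norm_of_real by simp
    also have "\<dots> \<le> exp (- (l * \<epsilon>)) / ?d x * (exp (l * (\<epsilon> / 2)) * (l ^ 3 * norm w ^ 3) / 2)"
      by (intro mult_left_mono 1) simp
    \<comment> \<open>Of the decay \<open>exp (- (l * \<epsilon>))\<close>, one half pays for the
      growth of the exponential of \<open>w\<close>. One quarter absorbs \<open>l ^ 3\<close> at the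
      cost \<open>(3 / (\<epsilon> / 4)) ^ 3\<close>, half of which is
      \<open>864 / \<epsilon> ^ 3\<close>, and one quarter remains as a term of
      \<open>part_log_real (\<epsilon> / 4)\<close>.\<close>
    also have "\<dots> = (l ^ 3 * exp (- (l * (\<epsilon> / 4)))) * (exp (- (l * (\<epsilon> / 4))) / ?d x * norm w ^ 3 / 2)"
    proof -
      have "exp (- (l * \<epsilon>)) * exp (l * (\<epsilon> / 2)) = exp (- (l * (\<epsilon> / 4))) * exp (- (l * (\<epsilon> / 4)))"
        by (simp add: exp_add[symmetric])
      then show ?thesis by (simp add: field_simps)
    qed
    also have "\<dots> \<le> (real 3 / (\<epsilon> / 4)) ^ 3 * (exp (- (l * (\<epsilon> / 4))) / ?d x * norm w ^ 3 / 2)"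
      using power_exp_bound[of l "\<epsilon> / 4" 3] l assms(1) by (intro mult_right_mono) simp_all
    also have "\<dots> = (864 * norm w ^ 3 / \<epsilon> ^ 3) * (exp (- (l * (\<epsilon> / 4))) / ?d x)"
    proof -
      have "(real 3 / (\<epsilon> / 4)) ^ 3 * (X * Y / 2) = (864 * Y / \<epsilon> ^ 3) * X" for X Y
        by (simp add: power_divide power_mult_distrib)
      then show ?thesis .
    qed
    finally show ?thesis unfolding l_def .
  qed
  have hg: "((\<lambda>x. (864 * norm w ^ 3 / \<epsilon> ^ 3) * (exp (- (?l x * (\<epsilon> / 4))) / ?d x)) has_sum
      864 * norm w ^ 3 / \<epsilon> ^ 3 * part_log_real (\<epsilon> / 4)) UNIV"
    by (intro has_sum_cmult_right part_log_real_has_sum) (use assms in simp)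
  have ab: "(\<lambda>x. norm (f x)) summable_on UNIV"
    by (rule summable_on_comparison_test[OF has_sum_imp_summable[OF hg]]) (use le in auto)
  have "norm S \<le> (\<Sum>\<^sub>\<infinity>x. norm (f x))"
    using norm_infsum_bound[OF ab] infsumI[OF hs] by simp
  also have "\<dots> \<le> 864 * norm w ^ 3 / \<epsilon> ^ 3 * part_log_real (\<epsilon> / 4)"
    unfolding infsumI[OF hg, symmetric]
    by (rule infsum_mono[OF ab has_sum_imp_summable[OF hg]]) (rule le)
  finally show ?thesis unfolding S_def .
qed

text \<open>The limit of \<open>\<epsilon> * part_log_real \<epsilon>\<close> is below 2, so
  \<open>part_log_real (\<epsilon> / 4) \<le> 8 / \<epsilon>\<close> near 0, and
  \<open>6912 = 864 * 8\<close>.\<close>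

lemma part_log_taylor_ev:
  "\<forall>\<^sub>F \<epsilon> in at_right 0. \<forall>w. \<bar>Re w\<bar> \<le> \<epsilon> / 2 \<longrightarrow>
    norm (part_log (of_real \<epsilon> - w) - part_log (of_real \<epsilon>) - w * of_real (log_moment 1 \<epsilon>)
      - w\<^sup>2 * of_real (log_moment 2 \<epsilon>) / 2) \<le> 6912 * norm w ^ 3 / \<epsilon> ^ 4"
proof -
  have "pi\<^sup>2 / 6 < 2" using pi_less_4 power_strict_mono[of pi "3.3" 2] pi_approx by (simp add: power2_eq_square)
  then have "\<forall>\<^sub>F \<epsilon> in at_right 0. \<epsilon> * part_log_real \<epsilon> < 2"
    using order_tendstoD(2)[OF part_log_real_leading] by blast
  moreover have "filterlim (\<lambda>\<epsilon>::real. \<epsilon> / 4) (at_right 0) (at_right 0)" by real_asymp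
  ultimately have "\<forall>\<^sub>F \<epsilon> in at_right 0. \<epsilon> / 4 * part_log_real (\<epsilon> / 4) < 2"
    by (rule eventually_compose_filterlim)
  then show ?thesis using eventually_at_right_less[of 0]
  proof eventually_elim
    fix \<epsilon> :: real assume b: "\<epsilon> / 4 * part_log_real (\<epsilon> / 4) < 2" and e: "0 < \<epsilon>"
    show "\<forall>w. \<bar>Re w\<bar> \<le> \<epsilon> / 2 \<longrightarrow> norm (part_log (of_real \<epsilon> - w) - part_log (of_real \<epsilon>) - w * of_real (log_moment 1 \<epsilon>)
      - w\<^sup>2 * of_real (log_moment 2 \<epsilon>) / 2) \<le> 6912 * norm w ^ 3 / \<epsilon> ^ 4"
    proof (intro allI impI)
      fix w :: complex assume w: "\<bar>Re w\<bar> \<le> \<epsilon> / 2"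
      have "part_log_real (\<epsilon> / 4) \<le> 8 / \<epsilon>" using b e by (simp add: field_simps)
      then have "864 * norm w ^ 3 / \<epsilon> ^ 3 * part_log_real (\<epsilon> / 4) \<le> 864 * norm w ^ 3 / \<epsilon> ^ 3 * (8 / \<epsilon>)"
        using e by (intro mult_left_mono) auto
      also have "\<dots> = 6912 * norm w ^ 3 / \<epsilon> ^ 4" by (simp add: power_Suc[of \<epsilon> 3, simplified] eval_nat_numeral)
      finally show "norm (part_log (of_real \<epsilon> - w) - part_log (of_real \<epsilon>) - w * of_real (log_moment 1 \<epsilon>)
        - w\<^sup>2 * of_real (log_moment 2 \<epsilon>) / 2) \<le> 6912 * norm w ^ 3 / \<epsilon> ^ 4"
        using part_log_taylor[OF e w] by linarith
    qed
  qed
qed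

text \<open>With \<open>h = \<epsilon> * sqrt \<epsilon>\<close> and
  \<open>c = pi\<^sup>2 / 6\<close>, the second-order term of \<open>c / \<epsilon>\<close> is
  \<open>c * h\<^sup>2 / \<epsilon> ^ 3 = c\<close>, so \<open>h\<close> is the width of the saddle.
  The logarithmic term and the error vary by \<open>o(1)\<close> at this scale.\<close>

lemma part_log_real_shift:
  fixes s :: real
  assumes "s = 1 \<or> s = -1"
  shows "((\<lambda>\<epsilon>. part_log_real (\<epsilon> - s * (\<epsilon> * sqrt \<epsilon>)) - part_log_real \<epsilon> - (pi\<^sup>2 / 6) / \<epsilon>\<^sup>2 * (s * (\<epsilon> * sqrt \<epsilon>)))
    \<longlongrightarrow> pi\<^sup>2 / 6) (at_right 0)"
proof -
  define c where "c = pi\<^sup>2 / 6"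
  have c: "c > 0" by (simp add: c_def)
  have fl: "filterlim (\<lambda>\<epsilon>::real. \<epsilon> - s * (\<epsilon> * sqrt \<epsilon>)) (at_right 0) (at_right 0)"
    using assms by (elim disjE) (simp_all, real_asymp+)
  have lim: "((\<lambda>\<epsilon>. c / (\<epsilon> - s * (\<epsilon> * sqrt \<epsilon>)) - c / \<epsilon> - c / \<epsilon>\<^sup>2 * (s * (\<epsilon> * sqrt \<epsilon>))
      + (ln ((\<epsilon> - s * (\<epsilon> * sqrt \<epsilon>)) / (2 * pi)) / 2 - ln (\<epsilon> / (2 * pi)) / 2)) \<longlongrightarrow> c) (at_right 0)"
    using assms by (elim disjE) (simp_all, real_asymp+)
  have "((\<lambda>\<epsilon>. (c / (\<epsilon> - s * (\<epsilon> * sqrt \<epsilon>)) - c / \<epsilon> - c / \<epsilon>\<^sup>2 * (s * (\<epsilon> * sqrt \<epsilon>))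
      + (ln ((\<epsilon> - s * (\<epsilon> * sqrt \<epsilon>)) / (2 * pi)) / 2 - ln (\<epsilon> / (2 * pi)) / 2))
      + (part_log_error (\<epsilon> - s * (\<epsilon> * sqrt \<epsilon>)) - part_log_error \<epsilon>)) \<longlongrightarrow> c + (0 - 0)) (at_right 0)"
    by (intro tendsto_add lim tendsto_diff part_log_error_tendsto filterlim_compose[OF part_log_error_tendsto fl])
  then show ?thesis by (simp add: part_log_error_def c_def algebra_simps)
qed

text \<open>The first two Taylor coefficients are read off from the real asymptotics at
  \<open>w = \<plusminus>\<epsilon> powr (3/2)\<close>.\<close>

lemma log_moments_tendsto:
  shows "((\<lambda>\<epsilon>. \<epsilon> * sqrt \<epsilon> * (log_moment 1 \<epsilon> - (pi\<^sup>2 / 6) / \<epsilon>\<^sup>2)) \<longlongrightarrow> 0) (at_right 0)" (is ?A)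
    and "((\<lambda>\<epsilon>. (\<epsilon> * sqrt \<epsilon>)\<^sup>2 * log_moment 2 \<epsilon> / 2) \<longlongrightarrow> pi\<^sup>2 / 6) (at_right 0)" (is ?B)
proof -
  let ?h = "\<lambda>\<epsilon>::real. \<epsilon> * sqrt \<epsilon>"
  let ?R = "\<lambda>s \<epsilon>. part_log_real (\<epsilon> - s * ?h \<epsilon>) - part_log_real \<epsilon> - (pi\<^sup>2 / 6) / \<epsilon>\<^sup>2 * (s * ?h \<epsilon>)"
  let ?al = "\<lambda>\<epsilon>. ?h \<epsilon> * (log_moment 1 \<epsilon> - (pi\<^sup>2 / 6) / \<epsilon>\<^sup>2)" and ?be = "\<lambda>\<epsilon>. (?h \<epsilon>)\<^sup>2 * log_moment 2 \<epsilon> / 2"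
  have T: "((\<lambda>\<epsilon>. s * ?al \<epsilon> + ?be \<epsilon>) \<longlongrightarrow> pi\<^sup>2 / 6) (at_right 0)" if s: "s = 1 \<or> s = -1" for s :: real
  proof -
    have "((\<lambda>\<epsilon>. ?R s \<epsilon> - (s * ?al \<epsilon> + ?be \<epsilon>)) \<longlongrightarrow> 0) (at_right 0)"
    proof (rule Lim_null_comparison)
      show "((\<lambda>\<epsilon>. 6912 * sqrt \<epsilon>) \<longlongrightarrow> 0) (at_right 0)" by real_asymp
      have "\<forall>\<^sub>F \<epsilon> :: real in at_right 0. sqrt \<epsilon> \<le> 1 / 2" by real_asymp
      then show "\<forall>\<^sub>F \<epsilon> in at_right 0. norm (?R s \<epsilon> - (s * ?al \<epsilon> + ?be \<epsilon>)) \<le> 6912 * sqrt \<epsilon>"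
        using part_log_taylor_ev eventually_at_right_less[of 0]
      proof eventually_elim
        fix \<epsilon> :: real
        assume sq: "sqrt \<epsilon> \<le> 1 / 2" and e: "0 < \<epsilon>"
          and tay: "\<forall>w. \<bar>Re w\<bar> \<le> \<epsilon> / 2 \<longrightarrow> norm (part_log (of_real \<epsilon> - w) - part_log (of_real \<epsilon>) - w * of_real (log_moment 1 \<epsilon>)
            - w\<^sup>2 * of_real (log_moment 2 \<epsilon>) / 2) \<le> 6912 * norm w ^ 3 / \<epsilon> ^ 4"
        let ?w = "of_real (s * ?h \<epsilon>) :: complex"
        have hle: "?h \<epsilon> \<le> \<epsilon> / 2" using mult_left_mono[OF sq, of \<epsilon>] e by simp
        have abs: "\<bar>s * ?h \<epsilon>\<bar> = ?h \<epsilon>" using s e by auto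
        have pos: "0 < \<epsilon> - s * ?h \<epsilon>" using hle abs e by linarith
        have "norm (part_log (of_real \<epsilon> - ?w) - part_log (of_real \<epsilon>) - ?w * of_real (log_moment 1 \<epsilon>)
            - ?w\<^sup>2 * of_real (log_moment 2 \<epsilon>) / 2) \<le> 6912 * norm ?w ^ 3 / \<epsilon> ^ 4"
          using tay[rule_format, of ?w] abs hle by simp
        also have "part_log (of_real \<epsilon> - ?w) - part_log (of_real \<epsilon>) - ?w * of_real (log_moment 1 \<epsilon>)
            - ?w\<^sup>2 * of_real (log_moment 2 \<epsilon>) / 2 = of_real (part_log_real (\<epsilon> - s * ?h \<epsilon>) - part_log_real \<epsilon>
            - (s * ?h \<epsilon>) * log_moment 1 \<epsilon> - (s * ?h \<epsilon>)\<^sup>2 * log_moment 2 \<epsilon> / 2)"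
          using part_log_of_real[OF pos] part_log_of_real[OF e] by simp
        also have "(s * ?h \<epsilon>)\<^sup>2 = (?h \<epsilon>)\<^sup>2" using s by auto
        also have "norm ?w = ?h \<epsilon>" using abs by (simp only: norm_of_real)
        also have "?h \<epsilon> ^ 3 = sqrt \<epsilon> * \<epsilon> ^ 4"
        proof -
          have "?h \<epsilon> ^ 3 = \<epsilon> ^ 3 * (sqrt \<epsilon> * (sqrt \<epsilon> * sqrt \<epsilon>))" by (simp only: power_mult_distrib power3_eq_cube mult_ac)
          also have "\<dots> = sqrt \<epsilon> * \<epsilon> ^ 4" using e by (simp add: eval_nat_numeral)
          finally show ?thesis .
        qed
        finally have "norm (part_log_real (\<epsilon> - s * ?h \<epsilon>) - part_log_real \<epsilon>
            - (s * ?h \<epsilon>) * log_moment 1 \<epsilon> - (?h \<epsilon>)\<^sup>2 * log_moment 2 \<epsilon> / 2) \<le> 6912 * sqrt \<epsilon>"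
          unfolding norm_of_real real_norm_def using e by simp
        moreover have "a - b - N * (s * h) - (s * (h * (M - N)) + Q) = a - b - (s * h) * M - Q" for a b N h M Q :: real
          by (simp add: algebra_simps)
        ultimately show "norm (?R s \<epsilon> - (s * ?al \<epsilon> + ?be \<epsilon>)) \<le> 6912 * sqrt \<epsilon>"
          by (simp only:)
      qed
    qed
    from tendsto_diff[OF part_log_real_shift[OF s] this] show ?thesis by simp
  qed
  \<comment> \<open>Half the difference of the cases \<open>s = 1\<close> and \<open>s = -1\<close>
    isolates the first moment, half their sum the second.\<close>
  have "((\<lambda>\<epsilon>. ((1 * ?al \<epsilon> + ?be \<epsilon>) - (-1 * ?al \<epsilon> + ?be \<epsilon>)) / 2) \<longlongrightarrow> (pi\<^sup>2 / 6 - pi\<^sup>2 / 6) / 2) (at_right 0)"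
    by (intro tendsto_divide tendsto_diff T tendsto_const) auto
  moreover have "((1 * a + b) - (-1 * a + b)) / 2 = a" for a b :: real by simp
  ultimately show ?A by (simp only: diff_self div_0)
  have "((\<lambda>\<epsilon>. ((1 * ?al \<epsilon> + ?be \<epsilon>) + (-1 * ?al \<epsilon> + ?be \<epsilon>)) / 2) \<longlongrightarrow> (pi\<^sup>2 / 6 + pi\<^sup>2 / 6) / 2) (at_right 0)"
    by (intro tendsto_divide tendsto_add T tendsto_const) auto
  moreover have "((1 * a + b) + (-1 * a + b)) / 2 = b" "(b + b) / 2 = b" for a b :: real by simp_all
  ultimately show ?B by (simp only:)
qed

text \<open>For a purely imaginary displacement the second-order Taylor term turns negative and
  becomes the Gaussian exponent. The limit of the first moment allows its replacement by
  \<open>(pi\<^sup>2 / 6) / \<epsilon>\<^sup>2\<close> at this scale.\<close>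

lemma part_log_vertical:
  fixes y :: real
  shows "((\<lambda>\<epsilon>. part_log (of_real \<epsilon> - \<i> * of_real (\<epsilon> * sqrt \<epsilon> * y)) - part_log (of_real \<epsilon>)
      - \<i> * of_real (\<epsilon> * sqrt \<epsilon> * y * ((pi\<^sup>2 / 6) / \<epsilon>\<^sup>2))) \<longlongrightarrow> of_real (- (pi\<^sup>2 / 6 * y\<^sup>2))) (at_right 0)"
proof -
  let ?h = "\<lambda>\<epsilon>::real. \<epsilon> * sqrt \<epsilon>"
  let ?al = "\<lambda>\<epsilon>. ?h \<epsilon> * (log_moment 1 \<epsilon> - (pi\<^sup>2 / 6) / \<epsilon>\<^sup>2)" and ?be = "\<lambda>\<epsilon>. (?h \<epsilon>)\<^sup>2 * log_moment 2 \<epsilon> / 2"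
  let ?w = "\<lambda>\<epsilon>. \<i> * of_real (?h \<epsilon> * y)"
  let ?G = "\<lambda>\<epsilon>. part_log (of_real \<epsilon> - ?w \<epsilon>) - part_log (of_real \<epsilon>) - \<i> * of_real (?h \<epsilon> * y * ((pi\<^sup>2 / 6) / \<epsilon>\<^sup>2))"
  let ?M = "\<lambda>\<epsilon>. \<i> * of_real (y * ?al \<epsilon>) - of_real (y\<^sup>2 * ?be \<epsilon>)"
  have "((\<lambda>\<epsilon>. ?G \<epsilon> - ?M \<epsilon>) \<longlongrightarrow> 0) (at_right 0)"
  proof (rule Lim_null_comparison)
    show "((\<lambda>\<epsilon>. 6912 * \<bar>y\<bar> ^ 3 * sqrt \<epsilon>) \<longlongrightarrow> 0) (at_right 0)" by (cases "y = 0") (simp, real_asymp)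
    show "\<forall>\<^sub>F \<epsilon> in at_right 0. norm (?G \<epsilon> - ?M \<epsilon>) \<le> 6912 * \<bar>y\<bar> ^ 3 * sqrt \<epsilon>"
      using part_log_taylor_ev eventually_at_right_less[of 0]
    proof eventually_elim
      fix \<epsilon> :: real
      assume e: "0 < \<epsilon>"
        and tay: "\<forall>w. \<bar>Re w\<bar> \<le> \<epsilon> / 2 \<longrightarrow> norm (part_log (of_real \<epsilon> - w) - part_log (of_real \<epsilon>) - w * of_real (log_moment 1 \<epsilon>)
          - w\<^sup>2 * of_real (log_moment 2 \<epsilon>) / 2) \<le> 6912 * norm w ^ 3 / \<epsilon> ^ 4"
      have "norm (part_log (of_real \<epsilon> - ?w \<epsilon>) - part_log (of_real \<epsilon>) - ?w \<epsilon> * of_real (log_moment 1 \<epsilon>)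
          - (?w \<epsilon>)\<^sup>2 * of_real (log_moment 2 \<epsilon>) / 2) \<le> 6912 * norm (?w \<epsilon>) ^ 3 / \<epsilon> ^ 4"
        using tay[rule_format, of "?w \<epsilon>"] e by simp
      also have "part_log (of_real \<epsilon> - ?w \<epsilon>) - part_log (of_real \<epsilon>) - ?w \<epsilon> * of_real (log_moment 1 \<epsilon>)
          - (?w \<epsilon>)\<^sup>2 * of_real (log_moment 2 \<epsilon>) / 2 = ?G \<epsilon> - ?M \<epsilon>"
        by (simp add: power_mult_distrib algebra_simps)
      also have "norm (?w \<epsilon>) = ?h \<epsilon> * \<bar>y\<bar>" using e by (simp add: norm_mult abs_mult)
      also have "(?h \<epsilon> * \<bar>y\<bar>) ^ 3 = \<bar>y\<bar> ^ 3 * sqrt \<epsilon> * \<epsilon> ^ 4"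
      proof -
        have "(?h \<epsilon> * \<bar>y\<bar>) ^ 3 = \<bar>y\<bar> ^ 3 * (\<epsilon> ^ 3 * (sqrt \<epsilon> * (sqrt \<epsilon> * sqrt \<epsilon>)))" by (simp only: power_mult_distrib power3_eq_cube mult_ac)
        also have "\<dots> = \<bar>y\<bar> ^ 3 * sqrt \<epsilon> * \<epsilon> ^ 4" using e by (simp add: eval_nat_numeral)
        finally show ?thesis .
      qed
      finally show "norm (?G \<epsilon> - ?M \<epsilon>) \<le> 6912 * \<bar>y\<bar> ^ 3 * sqrt \<epsilon>" using e by simp
    qed
  qed
  moreover have "(?M \<longlongrightarrow> \<i> * of_real (y * 0) - of_real (y\<^sup>2 * (pi\<^sup>2 / 6))) (at_right 0)"
    by (intro tendsto_intros log_moments_tendsto)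
  ultimately have "((\<lambda>\<epsilon>. (?G \<epsilon> - ?M \<epsilon>) + ?M \<epsilon>) \<longlongrightarrow> 0 + (\<i> * of_real (y * 0) - of_real (y\<^sup>2 * (pi\<^sup>2 / 6)))) (at_right 0)"
    by (rule tendsto_add)
  then show ?thesis by (simp add: mult.commute)
qed

text \<open>The real part of each term of the double series is at most its absolute value, which is
  the corresponding term at \<open>\<theta> = 0\<close>. Keeping only the differences with
  \<open>m = 0\<close> leaves two geometric series in closed form. This controls the generating
  function on the whole circle.\<close>

lemma Re_part_log_bound:
  fixes \<epsilon> \<theta> :: real
  assumes "0 < \<epsilon>"
  defines "r \<equiv> exp (- \<epsilon>)" and "d \<equiv> 1 - cos \<theta>"
  shows "Re (part_log (of_real \<epsilon> - \<i> * of_real \<theta>)) - part_log_real \<epsilon>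
    \<le> - (r * (1 + r) * d / ((1 - r) * ((1 - r)\<^sup>2 + 2 * r * d)))"
proof -
  let ?z = "of_real \<epsilon> - \<i> * of_real \<theta> :: complex"
  define q where "q = exp (- ?z)"
  let ?B = "range (\<lambda>j::nat. (j, 0::nat))"
  define f where "f x = Re (log_term ?z x) - Re (log_term (of_real \<epsilon>) x)" for x
  have z: "0 < Re ?z" "0 < Re (complex_of_real \<epsilon>)" using assms(1) by auto
  have f: "(f has_sum (Re (part_log ?z) - part_log_real \<epsilon>)) UNIV"
    unfolding f_def part_log_real_def
    by (intro has_sum_diff_real_vector has_sum_Re part_log_has_sum z)
  have q: "norm q = r" "Re q = r * cos \<theta>" by (simp_all add: q_def r_def Re_exp)
  have r: "0 < r" "r < 1" using assms(1) by (auto simp: r_def)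
  have fB: "f (j, 0) = Re (q ^ Suc j) - r ^ Suc j" for j
    unfolding f_def log_term_def q_def r_def
    by (simp add: exp_of_nat_mult[symmetric] exp_of_real[symmetric] of_real_exp algebra_simps del: power_Suc)
      (simp add: exp_of_nat_mult[symmetric] Re_exp algebra_simps del: power_Suc)
  have g: "((\<lambda>j. f (j, 0)) has_sum (Re (q / (1 - q)) - r / (1 - r))) UNIV"
  proof (rule norm_summable_imp_has_sum)
    have "(\<lambda>j. q * q ^ j) sums (q * (1 / (1 - q)))" using q(1) r by (intro sums_mult geometric_sums) simp
    then have "(\<lambda>j. Re (q ^ Suc j)) sums Re (q / (1 - q))" using sums_Re by fastforce
    moreover have "(\<lambda>j. r * r ^ j) sums (r * (1 / (1 - r)))" using r by (intro sums_mult geometric_sums) simp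
    ultimately show "(\<lambda>j. f (j, 0)) sums (Re (q / (1 - q)) - r / (1 - r))"
      unfolding fB using sums_diff by fastforce
    show "summable (\<lambda>j. norm (f (j, 0)))"
    proof (rule summable_comparison_test'[of "\<lambda>j. 2 * r ^ j" 0])
      show "summable (\<lambda>j. 2 * r ^ j)" using r by (intro summable_mult summable_geometric) simp
      fix j
      have "\<bar>Re (q ^ Suc j)\<bar> \<le> r ^ Suc j" using abs_Re_le_cmod[of "q ^ Suc j"] q(1) by (simp add: norm_power del: power_Suc)
      moreover have "r ^ Suc j \<le> r ^ j" using r by (simp add: mult_left_le_one_le)
      moreover have "0 < r ^ Suc j" using r by simp
      ultimately show "norm (norm (f (j, 0))) \<le> 2 * r ^ j" unfolding fB real_norm_def by linarith
    qed
  qed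
  have inj: "inj_on (\<lambda>j::nat. (j, 0::nat)) UNIV" by (auto simp: inj_on_def)
  have gB: "(f has_sum (Re (q / (1 - q)) - r / (1 - r))) ?B"
    using g has_sum_reindex[OF inj, of f] by (simp add: o_def)
  have neg: "f x \<le> 0" for x
  proof -
    obtain j m where x: "x = (j, m)" by force
    have "norm (log_term ?z x) = Re (log_term (of_real \<epsilon>) x)"
      unfolding x norm_log_term log_term_of_real by simp
    then show ?thesis using complex_Re_le_cmod[of "log_term ?z x"] by (simp add: f_def)
  qed
  have le: "Re (part_log ?z) - part_log_real \<epsilon> \<le> Re (q / (1 - q)) - r / (1 - r)"
    by (rule has_sum_mono_neutral[OF f gB]) (use neg in auto)
  have d0: "0 \<le> d" by (simp add: d_def)
  have P: "0 < (1 - r)\<^sup>2 + 2 * r * d" using r d0 by (intro add_pos_nonneg) auto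
  have im: "(Im q)\<^sup>2 = r\<^sup>2 - (r * cos \<theta>)\<^sup>2" using cmod_power2[of q] q by simp
  have n1: "(Re (1 - q))\<^sup>2 + (Im (1 - q))\<^sup>2 = (1 - r)\<^sup>2 + 2 * r * d"
    unfolding minus_complex.sel one_complex.sel q(2) using im by (simp add: d_def power2_eq_square algebra_simps)
  have num: "Re q * Re (1 - q) + Im q * Im (1 - q) = r * cos \<theta> - r\<^sup>2"
    unfolding minus_complex.sel one_complex.sel q(2) using im by (simp add: power2_eq_square algebra_simps)
  have "Re (q / (1 - q)) = (r * cos \<theta> - r\<^sup>2) / ((1 - r)\<^sup>2 + 2 * r * d)"
    unfolding Re_divide n1 num[symmetric] by simp
  also have "r * cos \<theta> - r\<^sup>2 = r * (1 - r) - r * d" by (simp add: d_def power2_eq_square algebra_simps)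
  finally have "Re (q / (1 - q)) - r / (1 - r) = (r * (1 - r) - r * d) / ((1 - r)\<^sup>2 + 2 * r * d) - r / (1 - r)" by simp
  also have "\<dots> = - (r * (1 + r) * d / ((1 - r) * ((1 - r)\<^sup>2 + 2 * r * d)))"
  proof -
    have "(r * (1 - r) - r * d) / X - r / (1 - r) = ((r * (1 - r) - r * d) * (1 - r) - r * X) / ((1 - r) * X)" if "X > 0" for X
      using that r by (simp add: divide_simps)
    from this[OF P] show ?thesis
      by (simp only: minus_divide_left) (simp add: power2_eq_square algebra_simps)
  qed
  finally show ?thesis using le by linarith
qed

text \<open>Concavity of the sine gives Jordan's inequality \<open>sin x \<ge> 2 * x / pi\<close> on
  the first quarter period, and \<open>1 - cos \<theta>\<close> is twice the squared sine of the
  half angle.\<close>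

lemma one_minus_cos_lower:
  assumes "\<bar>\<theta>\<bar> \<le> pi" shows "2 * \<theta>\<^sup>2 / pi\<^sup>2 \<le> 1 - cos \<theta>"
proof -
  have half: "2 * x / pi \<le> sin x" if "0 \<le> x" "x \<le> pi / 2" for x
  proof -
    have cv: "convex_on {0..pi} (\<lambda>x. - sin x)"
    proof (rule f''_ge0_imp_convex[where f' = "\<lambda>x. - cos x" and f'' = sin])
      show "DERIV (\<lambda>x. - sin x) x :> - cos x" for x by (auto intro!: derivative_eq_intros)
      show "DERIV (\<lambda>x. - cos x) x :> sin x" for x by (auto intro!: derivative_eq_intros)
    qed (auto simp: sin_ge_zero)
    have "- sin ((1 - 2 * x / pi) *\<^sub>R 0 + (2 * x / pi) *\<^sub>R (pi / 2)) \<le> (1 - 2 * x / pi) * - sin 0 + (2 * x / pi) * - sin (pi / 2)"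
      by (rule convex_onD[OF cv]) (use that in \<open>auto simp: field_simps\<close>)
    then show ?thesis by simp
  qed
  have "(2 * (\<bar>\<theta>\<bar> / 2) / pi)\<^sup>2 \<le> (sin (\<bar>\<theta>\<bar> / 2))\<^sup>2"
    using half[of "\<bar>\<theta>\<bar> / 2"] assms by (intro power_mono) auto
  moreover have "cos (2 * (\<bar>\<theta>\<bar> / 2)) = 1 - 2 * (sin (\<bar>\<theta>\<bar> / 2))\<^sup>2" by (rule cos_double_sin)
  moreover have "cos (2 * (\<bar>\<theta>\<bar> / 2)) = cos \<theta>" by simp
  ultimately show ?thesis by (simp add: power_divide)
qed

lemma Re_part_log_scaled_bound:
  assumes e: "0 < \<epsilon>" "\<epsilon> \<le> 1 / 2" and y: "\<bar>\<epsilon> * sqrt \<epsilon> * y\<bar> \<le> pi"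
  shows "Re (part_log (of_real \<epsilon> - \<i> * of_real (\<epsilon> * sqrt \<epsilon> * y))) - part_log_real \<epsilon>
    \<le> - (3 / 2 * y\<^sup>2 / (pi\<^sup>2 + 4 * \<epsilon> * y\<^sup>2))"
proof -
  define r where "r = exp (- \<epsilon>)"
  define d where "d = 1 - cos (\<epsilon> * sqrt \<epsilon> * y)"
  \<comment> \<open>The lower bound for \<open>d\<close> from \<open>one_minus_cos_lower\<close>;
    the expression to be bounded increases with \<open>d\<close>. From
    \<open>\<epsilon> \<le> 1 / 2\<close> follows \<open>r \<ge> 1 / 2\<close>, whence the factor
    \<open>r * (1 + r) \<ge> 3 / 4\<close>.\<close>
  define D where "D = 2 * \<epsilon> ^ 3 * y\<^sup>2 / pi\<^sup>2"
  have "(\<epsilon> * sqrt \<epsilon> * y)\<^sup>2 = \<epsilon> ^ 3 * y\<^sup>2" using e by (simp add: power_mult_distrib eval_nat_numeral)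
  then have dD: "D \<le> d" using one_minus_cos_lower[OF y] by (simp add: d_def D_def mult.assoc)
  have D0: "0 \<le> D" using e by (simp add: D_def)
  have r1: "1 - r \<le> \<epsilon>" using exp_ge_add_one_self[of "- \<epsilon>"] by (simp add: r_def)
  then have r2: "1 / 2 \<le> r" "r < 1" using e by (auto simp: r_def)
  have key: "3 / 4 * D / (\<epsilon> * (\<epsilon>\<^sup>2 + 2 * D)) \<le> r * (1 + r) * d / ((1 - r) * ((1 - r)\<^sup>2 + 2 * r * d))"
  proof (cases "D = 0")
    case True
    have "0 \<le> d" using D0 dD by linarith
    then show ?thesis using True r2 by (auto intro!: divide_nonneg_nonneg mult_nonneg_nonneg)
  next
    case False
    then have D: "0 < D" and d: "0 < d" using D0 dD by auto
    have "3 / 4 * D / (\<epsilon> * (\<epsilon>\<^sup>2 + 2 * D)) = (3 / 4) / (\<epsilon> * (\<epsilon>\<^sup>2 / D + 2))"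
      using D e by (simp add: field_simps)
    also have "\<dots> \<le> (r * (1 + r)) / ((1 - r) * ((1 - r)\<^sup>2 / d + 2 * r))"
    proof (rule frac_le)
      show "0 \<le> r * (1 + r)" using r2 by simp
      show "3 / 4 \<le> r * (1 + r)" using mult_mono[of "1/2" r "3/2" "1 + r"] r2 by simp
      show "0 < (1 - r) * ((1 - r)\<^sup>2 / d + 2 * r)" using r2 d by (intro mult_pos_pos add_nonneg_pos) auto
      have "(1 - r)\<^sup>2 / d \<le> \<epsilon>\<^sup>2 / D"
        using r1 r2 dD D by (intro frac_le power_mono) auto
      then show "(1 - r) * ((1 - r)\<^sup>2 / d + 2 * r) \<le> \<epsilon> * (\<epsilon>\<^sup>2 / D + 2)"
        using r1 r2 d e by (intro mult_mono) (auto intro!: add_nonneg_nonneg divide_nonneg_nonneg)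
    qed
    also have "\<dots> = r * (1 + r) * d / ((1 - r) * ((1 - r)\<^sup>2 + 2 * r * d))"
    proof -
      have "(1 - r)\<^sup>2 + 2 * r * d = d * ((1 - r)\<^sup>2 / d + 2 * r)" using d by (simp add: field_simps)
      then show ?thesis using d by simp
    qed
    finally show ?thesis .
  qed
  have "3 / 4 * D / (\<epsilon> * (\<epsilon>\<^sup>2 + 2 * D)) = 3 / 2 * y\<^sup>2 / (pi\<^sup>2 + 4 * \<epsilon> * y\<^sup>2)"
  proof -
    have "\<epsilon> * (\<epsilon>\<^sup>2 + 2 * D) = \<epsilon> ^ 3 * ((pi\<^sup>2 + 4 * \<epsilon> * y\<^sup>2) / pi\<^sup>2)"
      by (simp add: D_def field_simps eval_nat_numeral)
    moreover have "3 / 4 * D = \<epsilon> ^ 3 * (3 / 2 * y\<^sup>2 / pi\<^sup>2)" by (simp add: D_def)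
    ultimately show ?thesis using e by simp
  qed
  then show ?thesis
    using key Re_part_log_bound[OF e(1), of "\<epsilon> * sqrt \<epsilon> * y"] unfolding r_def[symmetric] d_def[symmetric] by linarith
qed

text \<open>Write \<open>C = 4 * pi ^ 6 + 256 * pi\<^sup>2\<close> and let \<open>- E\<close> be the
  bound of \<open>Re_part_log_scaled_bound\<close>. For \<open>\<bar>y\<bar> \<ge> 1\<close> both
  \<open>y\<^sup>2 * exp (- E)\<close> and \<open>exp (- E)\<close> are at most
  \<open>8 * C\<close>, which makes \<open>16 * C\<close>; the summand 2 covers
  \<open>\<bar>y\<bar> < 1\<close>.\<close>

definition dom_const :: real where
  "dom_const = 16 * (4 * pi ^ 6 + 256 * pi\<^sup>2) + 2"

text \<open>The exponent is not uniformly quadratic: for large \<open>\<epsilon> * y\<^sup>2\<close>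
  it is only of order \<open>1 / \<epsilon>\<close>. But
  \<open>\<bar>\<theta>\<bar> \<le> pi\<close> means
  \<open>\<epsilon> ^ 3 * y\<^sup>2 \<le> pi\<^sup>2\<close>, which bounds the cube of its
  denominator by a multiple of \<open>y ^ 4\<close>. So \<open>E ^ 3\<close> is at least a multiple
  of \<open>y\<^sup>2\<close>, enough for an integrable majorant that is independent of
  \<open>\<epsilon>\<close>.\<close>

lemma exp_part_log_dominated:
  assumes e: "0 < \<epsilon>" "\<epsilon> \<le> 1 / 2" and y: "\<bar>\<epsilon> * sqrt \<epsilon> * y\<bar> \<le> pi"
  shows "exp (Re (part_log (of_real \<epsilon> - \<i> * of_real (\<epsilon> * sqrt \<epsilon> * y))) - part_log_real \<epsilon>)
    \<le> dom_const * inverse (1 + y\<^sup>2)"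
proof -
  let ?C = "4 * pi ^ 6 + 256 * pi\<^sup>2"
  define E where "E = 3 / 2 * y\<^sup>2 / (pi\<^sup>2 + 4 * \<epsilon> * y\<^sup>2)"
  have "exp (Re (part_log (of_real \<epsilon> - \<i> * of_real (\<epsilon> * sqrt \<epsilon> * y))) - part_log_real \<epsilon>) \<le> exp (- E)"
    unfolding exp_le_cancel_iff E_def by (rule Re_part_log_scaled_bound[OF e y])
  also have "exp (- E) \<le> dom_const * inverse (1 + y\<^sup>2)"
  proof (cases "\<bar>y\<bar> < 1")
    case True
    then have "y\<^sup>2 < 1" by (simp add: abs_square_less_1)
    have "0 \<le> 16 * (4 * pi ^ 6 + 256 * pi\<^sup>2)" by (intro mult_nonneg_nonneg add_nonneg_nonneg) auto
    then have "2 \<le> dom_const" unfolding dom_const_def by simp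
    with \<open>y\<^sup>2 < 1\<close> have "1 + y\<^sup>2 \<le> dom_const" by simp
    moreover have "0 < 1 + y\<^sup>2" by (simp add: add_pos_nonneg)
    ultimately have "1 \<le> dom_const * inverse (1 + y\<^sup>2)" by (simp add: field_simps)
    moreover have "exp (- E) \<le> 1" unfolding E_def using e by (simp add: divide_nonneg_nonneg)
    ultimately show ?thesis by linarith
  next
    case False
    then have y1: "1 \<le> y\<^sup>2" by (simp add: abs_square_less_1 not_less[symmetric])
    then have y4: "1 \<le> y ^ 4" using power_mono[of 1 "y\<^sup>2" 2] by simp
    have ey: "\<epsilon> ^ 3 * y\<^sup>2 \<le> pi\<^sup>2"
    proof -
      have "\<bar>\<epsilon> * sqrt \<epsilon> * y\<bar>\<^sup>2 \<le> pi\<^sup>2" using y by (intro power_mono) auto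
      moreover have "(\<epsilon> * sqrt \<epsilon> * y)\<^sup>2 = \<epsilon> ^ 3 * y\<^sup>2" using e by (simp add: power_mult_distrib eval_nat_numeral)
      ultimately show ?thesis by simp
    qed
    define Q where "Q = pi\<^sup>2 + 4 * \<epsilon> * y\<^sup>2"
    have Q: "0 < Q" using e by (simp add: Q_def add_pos_nonneg)
    have "Q ^ 3 \<le> 4 * ((pi\<^sup>2) ^ 3 + (4 * \<epsilon> * y\<^sup>2) ^ 3)"
    proof -
      have cube: "(a + b) ^ 3 \<le> 4 * (a ^ 3 + b ^ 3)" if "0 \<le> a" "0 \<le> b" for a b :: real
      proof -
        have "4 * (a ^ 3 + b ^ 3) - (a + b) ^ 3 = 3 * (a + b) * (a - b)\<^sup>2"
          by (simp add: power2_eq_square power3_eq_cube algebra_simps)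
        moreover have "0 \<le> 3 * (a + b) * (a - b)\<^sup>2" using that by simp
        ultimately show ?thesis by linarith
      qed
      show ?thesis unfolding Q_def by (rule cube) (use e in auto)
    qed
    also have "(4 * \<epsilon> * y\<^sup>2) ^ 3 = 64 * (\<epsilon> ^ 3 * y\<^sup>2) * y ^ 4" by (simp add: power_mult_distrib eval_nat_numeral)
    also have "64 * (\<epsilon> ^ 3 * y\<^sup>2) * y ^ 4 \<le> 64 * pi\<^sup>2 * y ^ 4"
      using ey by (intro mult_right_mono) auto
    also have "4 * ((pi\<^sup>2) ^ 3 + 64 * pi\<^sup>2 * y ^ 4) \<le> ?C * y ^ 4"
    proof -
      have "(pi\<^sup>2) ^ 3 * 1 \<le> pi ^ 6 * y ^ 4" by (intro mult_mono y4) (auto simp: power_mult[symmetric])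
      then show ?thesis by (simp add: algebra_simps)
    qed
    finally have Q3: "Q ^ 3 \<le> ?C * y ^ 4" by simp
    have Cpos: "0 < ?C" by (simp add: add_pos_pos)
    have E: "0 < E" unfolding E_def Q_def[symmetric] using Q y1 by (intro divide_pos_pos) auto
    have "y\<^sup>2 / ?C \<le> y ^ 6 / Q ^ 3"
    proof -
      have "y\<^sup>2 * Q ^ 3 \<le> y\<^sup>2 * (?C * y ^ 4)" by (intro mult_left_mono Q3) simp
      then show ?thesis using Q Cpos by (simp add: field_simps eval_nat_numeral)
    qed
    also have "\<dots> \<le> 8 / 27 * E ^ 3"
      unfolding E_def Q_def[symmetric] by (simp add: power_divide power_mult_distrib power_mult[symmetric])
    finally have yE: "y\<^sup>2 / ?C \<le> 8 / 27 * E ^ 3" .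
    have "E ^ 3 * exp (- (E * 1)) \<le> (real 3 / 1) ^ 3" by (rule power_exp_bound) (use E in auto)
    then have "E ^ 3 * exp (- E) \<le> 27" by simp
    moreover have "y\<^sup>2 / ?C * exp (- E) \<le> 8 / 27 * E ^ 3 * exp (- E)" by (rule mult_right_mono[OF yE]) simp
    ultimately have "y\<^sup>2 / ?C * exp (- E) \<le> 8" by linarith
    then have "y\<^sup>2 * exp (- E) \<le> 8 * ?C" using Cpos by (simp add: field_simps)
    moreover have "1 * exp (- E) \<le> y\<^sup>2 * exp (- E)" by (rule mult_right_mono[OF y1]) simp
    ultimately have "(1 + y\<^sup>2) * exp (- E) \<le> dom_const" unfolding dom_const_def distrib_right by linarith
    moreover have "0 < 1 + y\<^sup>2" by (simp add: add_pos_nonneg)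
    ultimately show ?thesis by (simp add: field_simps)
  qed
  finally show ?thesis .
qed

section \<open>Partition numbers as Fourier integrals\<close>

lemma integral_exp_i_int:
  "(LINT \<theta>|lborel. indicator {-pi..pi} \<theta> *\<^sub>R exp (\<i> * of_real (of_int k * \<theta>))) = (if k = 0 then of_real (2 * pi) else 0)"
proof (cases "k = 0")
  case False
  let ?F = "\<lambda>\<theta>::real. exp (\<i> * of_real (of_int k * \<theta>)) / (\<i> * of_int k) :: complex"
  have "(LINT \<theta>|lborel. indicator {-pi..pi} \<theta> *\<^sub>R exp (\<i> * of_real (of_int k * \<theta>))) = ?F pi - ?F (- pi)"
  proof (rule integral_FTC_atLeastAtMost)
    show "(?F has_vector_derivative exp (\<i> * of_real (of_int k * x))) (at x within {-pi..pi})" for x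
    proof -
      have "((\<lambda>z. exp (\<i> * (of_int k * z)) / (\<i> * of_int k)) has_field_derivative exp (\<i> * (of_int k * of_real x))) (at (of_real x))"
      proof -
        have "- (\<i> * (c * \<i>)) = c" for c by (simp add: mult.commute[of c] mult.assoc[symmetric])
        then show ?thesis using False by (auto intro!: derivative_eq_intros)
      qed
      from has_vector_derivative_real_field[OF this] show ?thesis
        by (auto intro: has_vector_derivative_at_within simp: o_def)
    qed
    show "continuous_on {-pi..pi} (\<lambda>x. exp (\<i> * of_real (of_int k * x)) :: complex)"
      by (intro continuous_intros)
  qed simp
  also have "?F pi = ?F (- pi)"
  proof -
    have "exp (\<i> * of_real (of_int k * pi)) = exp (\<i> * of_real (of_int k * (- pi)) :: complex)"
      by (rule exp_eq[THEN iffD2]) (auto intro!: exI[of _ k])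
    then show ?thesis by simp
  qed
  finally show ?thesis using False by simp
next
  case True
  have "(LINT \<theta>|lborel. indicator {-pi..pi} \<theta> *\<^sub>R (1::complex)) = of_real (2 * pi)"
    by (subst integral_scaleR_left) (simp_all add: scaleR_conv_of_real)
  then show ?thesis using True by simp
qed

text \<open>The absolute values of the terms do not depend on \<open>\<theta>\<close> and are
  summable, so the series is integrated term by term, and orthogonality leaves the coefficient of
  index \<open>n\<close>.\<close>

lemma part_gf_fourier:
  assumes e: "0 < \<epsilon>"
  shows "(LINT \<theta>|lborel. indicator {-pi..pi} \<theta> *\<^sub>R (part_gf (of_real \<epsilon> - \<i> * of_real \<theta>) * exp (- (\<i> * of_real (real n * \<theta>)))))
    = of_real (2 * pi * (real (card (partitions_of n)) * exp (- (real n * \<epsilon>))))"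
proof -
  let ?p = "\<lambda>k. real (card (partitions_of k))"
  let ?f = "\<lambda>k \<theta>. indicator {-pi..pi} \<theta> *\<^sub>R ((of_real (?p k * exp (- \<epsilon>) ^ k)) * exp (\<i> * of_real (of_int (int k - int n) * \<theta>)) :: complex)"
  have sm: "summable (\<lambda>k. ?p k * exp (- \<epsilon>) ^ k)" by (rule summable_partitions) (use e in auto)
  have int1: "integrable lborel (\<lambda>\<theta>. indicator {-pi..pi} \<theta> *\<^sub>R exp (\<i> * of_real (of_int k * \<theta>)) :: complex)" for k
    using borel_integrable_atLeastAtMost'[of "-pi" pi "\<lambda>\<theta>. exp (\<i> * of_real (of_int k * \<theta>))"]
    unfolding set_integrable_def by (simp add: continuous_intros)
  have eq: "?f k = (\<lambda>\<theta>. of_real (?p k * exp (- \<epsilon>) ^ k) * (indicator {-pi..pi} \<theta> *\<^sub>R exp (\<i> * of_real (of_int (int k - int n) * \<theta>))))" for k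
    by (simp add: fun_eq_iff)
  have int: "integrable lborel (?f k)" for k
    unfolding eq by (intro integrable_mult_right int1)
  have nf: "norm (?f k \<theta>) = indicator {-pi..pi} \<theta> * (?p k * exp (- \<epsilon>) ^ k)" for k \<theta>
    by (simp add: norm_mult abs_mult indicator_def norm_power)
  have "(\<lambda>k. integral\<^sup>L lborel (?f k)) sums (LINT \<theta>|lborel. (\<Sum>k. ?f k \<theta>))"
  proof (rule sums_integral[OF int])
    show "AE \<theta> in lborel. summable (\<lambda>k. norm (?f k \<theta>))"
      unfolding nf by (intro AE_I2 summable_mult sm)
    have "integral\<^sup>L lborel (\<lambda>\<theta>. norm (?f k \<theta>)) = 2 * pi * (?p k * exp (- \<epsilon>) ^ k)" for k
      unfolding nf by simp
    then show "summable (\<lambda>k. integral\<^sup>L lborel (\<lambda>\<theta>. norm (?f k \<theta>)))"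
      by (simp add: summable_mult sm)
  qed
  moreover have "integral\<^sup>L lborel (?f k) = (if k = n then of_real (2 * pi * (?p n * exp (- \<epsilon>) ^ n)) else 0)" for k
    unfolding eq integral_mult_right_zero integral_exp_i_int by (simp add: mult_ac)
  ultimately have s: "(\<lambda>k. if k = n then of_real (2 * pi * (?p n * exp (- \<epsilon>) ^ n)) else 0) sums (LINT \<theta>|lborel. (\<Sum>k. ?f k \<theta>))" by simp
  have "(LINT \<theta>|lborel. (\<Sum>k. ?f k \<theta>)) = of_real (2 * pi * (?p n * exp (- \<epsilon>) ^ n))"
    using sums_unique2[OF s sums_single[of n "\<lambda>k. of_real (2 * pi * (?p n * exp (- \<epsilon>) ^ n))"]] by simp
  moreover have "(\<Sum>k. ?f k \<theta>) = indicator {-pi..pi} \<theta> *\<^sub>R (part_gf (of_real \<epsilon> - \<i> * of_real \<theta>) * exp (- (\<i> * of_real (real n * \<theta>))))" for \<theta>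
  proof -
    let ?q = "exp (- (of_real \<epsilon> - \<i> * of_real \<theta>)) :: complex"
    have "norm ?q = exp (- \<epsilon>)" by simp
    then have "summable (\<lambda>k. of_nat (card (partitions_of k)) * ?q ^ k)"
      using sm by (intro summable_norm_cancel[of "\<lambda>k. of_nat (card (partitions_of k)) * ?q ^ k"]) (simp add: norm_mult norm_power)
    then have "(\<lambda>k. indicator {-pi..pi} \<theta> *\<^sub>R ((of_nat (card (partitions_of k)) * ?q ^ k) * exp (- (\<i> * of_real (real n * \<theta>))))) sums
        (indicator {-pi..pi} \<theta> *\<^sub>R (part_gf (of_real \<epsilon> - \<i> * of_real \<theta>) * exp (- (\<i> * of_real (real n * \<theta>)))))"
      unfolding part_gf_def by (intro sums_scaleR_right sums_mult2 summable_sums)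
    moreover have "(of_nat (card (partitions_of k)) * ?q ^ k) * exp (- (\<i> * of_real (real n * \<theta>)))
        = of_real (?p k * exp (- \<epsilon>) ^ k) * exp (\<i> * of_real (of_int (int k - int n) * \<theta>))" for k
    proof -
      have "?q ^ k * exp (- (\<i> * of_real (real n * \<theta>))) = exp (of_real (- (real k * \<epsilon>)) + \<i> * of_real (of_int (int k - int n) * \<theta>))"
        by (simp add: exp_of_nat_mult[symmetric] exp_add[symmetric] algebra_simps)
      also have "\<dots> = of_real (exp (- \<epsilon>) ^ k) * exp (\<i> * of_real (of_int (int k - int n) * \<theta>))"
        unfolding exp_add by (simp only: exp_of_real exp_of_nat_mult[symmetric] mult_minus_right)
      finally show ?thesis by (simp only: of_real_mult of_real_of_nat_eq mult.assoc)
    qed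
    ultimately show ?thesis by (simp only: sums_iff)
  qed
  ultimately show ?thesis by (simp add: exp_of_nat_mult[symmetric])
qed

lemma integrable_inverse_square: "integrable lborel (\<lambda>y::real. inverse (1 + y\<^sup>2))"
  using integrable_inverse_1_plus_square by (simp add: set_integrable_def)

lemma integral_gaussian_full:
  assumes "0 < (a::real)"
  shows "(LINT y|lborel. complex_of_real (exp (- (a * y\<^sup>2)))) = of_real (sqrt (pi / a))"
proof -
  have "has_bochner_integral lborel (\<lambda>y. exp (- (a * y\<^sup>2))) (2 *\<^sub>R (sqrt (pi / a) / 2))"
    by (rule has_bochner_integral_even_function[OF has_bochner_integral_half_gaussian[OF assms]]) simp
  then have "(LINT y|lborel. exp (- (a * y\<^sup>2))) = sqrt (pi / a)"
    by (simp add: has_bochner_integral_integral_eq)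
  then show ?thesis by (simp only: integral_complex_of_real)
qed

text \<open>\<open>\<epsilon> n\<close> solves
  \<open>(pi\<^sup>2 / 6) / \<epsilon>\<^sup>2 = n\<close>, so the linear phase of the generating
  function cancels the phase of the coefficient integral. In the variable \<open>y\<close> with
  \<open>\<theta> = \<epsilon> * sqrt \<epsilon> * y\<close> the integrand tends to a Gaussian, and
  dominated convergence applies.\<close>

lemma partitions_saddle_point:
  defines "\<epsilon> \<equiv> \<lambda>n. pi / sqrt (6 * real n)"
  shows "(\<lambda>n. real (card (partitions_of n)) * exp (- (real n * \<epsilon> n)) * exp (- part_log_real (\<epsilon> n))
    / (\<epsilon> n * sqrt (\<epsilon> n))) \<longlonglongrightarrow> sqrt (pi / (pi\<^sup>2 / 6)) / (2 * pi)"
proof -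
  let ?h = "\<lambda>n. \<epsilon> n * sqrt (\<epsilon> n)"
  let ?z = "\<lambda>n y. of_real (\<epsilon> n) - \<i> * of_real (?h n * y) :: complex"
  define G where "G n y = indicator {-pi..pi} (?h n * y) *\<^sub>R
    exp (part_log (?z n y) - part_log (of_real (\<epsilon> n)) - \<i> * of_real (?h n * y * real n))" for n y
  have ev: "\<forall>\<^sub>F n in sequentially. 0 < \<epsilon> n \<and> \<epsilon> n \<le> 1 / 2 \<and> 0 < real n"
  proof (intro eventually_conj)
    show "\<forall>\<^sub>F n in sequentially. 0 < \<epsilon> n" unfolding \<epsilon>_def by real_asymp
    show "\<forall>\<^sub>F n in sequentially. \<epsilon> n \<le> 1 / 2" unfolding \<epsilon>_def by real_asymp
    show "\<forall>\<^sub>F n in sequentially. 0 < real n" by real_asymp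
  qed
  then obtain N where N: "\<And>n. n \<ge> N \<Longrightarrow> 0 < \<epsilon> n \<and> \<epsilon> n \<le> 1 / 2 \<and> 0 < real n"
    unfolding eventually_sequentially by auto
  have n_eq: "(pi\<^sup>2 / 6) / (\<epsilon> n)\<^sup>2 = real n" if "n \<ge> N" for n
    using N[OF that] by (simp add: \<epsilon>_def power_divide)
  have fl: "filterlim \<epsilon> (at_right 0) sequentially" unfolding \<epsilon>_def by real_asymp
  \<comment> \<open>Through \<open>part_gf_eq_exp\<close> the integrand becomes a power series, for
    which measurability is immediate.\<close>
  have meas: "G n \<in> borel_measurable lborel" if "n \<ge> N" for n
  proof -
    have e: "0 < \<epsilon> n" using N[OF that] by simp
    have "G n y = indicator {-pi..pi} (?h n * y) *\<^sub>R (part_gf (?z n y) * exp (- part_log (of_real (\<epsilon> n)))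
        * exp (- (\<i> * of_real (?h n * y * real n))))" for y
      unfolding G_def by (subst part_gf_eq_exp) (use e in \<open>auto simp: exp_diff exp_minus divide_inverse\<close>)
    then have "G n = (\<lambda>y. indicator {-pi..pi} (?h n * y) *\<^sub>R (part_gf (?z n y) * exp (- part_log (of_real (\<epsilon> n)))
        * exp (- (\<i> * of_real (?h n * y * real n)))))" by blast
    then show ?thesis unfolding part_gf_def by simp
  qed
  \<comment> \<open>The offset \<open>N\<close> makes the bounds available at every index;
    \<open>LIMSEQ_offset\<close> removes it afterwards.\<close>
  have lim: "(\<lambda>n. LINT y|lborel. G (n + N) y) \<longlonglongrightarrow> (LINT y|lborel. complex_of_real (exp (- (pi\<^sup>2 / 6 * y\<^sup>2))))"
  proof (rule integral_dominated_convergence[where w = "\<lambda>y. dom_const * inverse (1 + y\<^sup>2)"])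
    show "(\<lambda>y. complex_of_real (exp (- (pi\<^sup>2 / 6 * y\<^sup>2)))) \<in> borel_measurable lborel" by measurable
    show "G (n + N) \<in> borel_measurable lborel" for n by (rule meas) simp
    show "integrable lborel (\<lambda>y. dom_const * inverse (1 + y\<^sup>2))" by (intro integrable_mult_right integrable_inverse_square)
    show "AE y in lborel. (\<lambda>n. G (n + N) y) \<longlonglongrightarrow> complex_of_real (exp (- (pi\<^sup>2 / 6 * y\<^sup>2)))"
    proof (rule AE_I2)
      fix y :: real
      have "((\<lambda>n. part_log (?z n y) - part_log (of_real (\<epsilon> n)) - \<i> * of_real (?h n * y * ((pi\<^sup>2 / 6) / (\<epsilon> n)\<^sup>2)))
          \<longlonglongrightarrow> of_real (- (pi\<^sup>2 / 6 * y\<^sup>2)))"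
        by (rule filterlim_compose[OF part_log_vertical fl])
      then have "(\<lambda>n. exp (part_log (?z n y) - part_log (of_real (\<epsilon> n)) - \<i> * of_real (?h n * y * ((pi\<^sup>2 / 6) / (\<epsilon> n)\<^sup>2))))
          \<longlonglongrightarrow> exp (of_real (- (pi\<^sup>2 / 6 * y\<^sup>2)))"
        by (rule tendsto_exp)
      then have "(\<lambda>n. G n y) \<longlonglongrightarrow> exp (of_real (- (pi\<^sup>2 / 6 * y\<^sup>2)))"
      proof (rule Lim_transform_eventually)
        have "(\<lambda>n. ?h n * y) \<longlonglongrightarrow> 0" unfolding \<epsilon>_def by (cases "y = 0") (simp, real_asymp)
        then have "\<forall>\<^sub>F n in sequentially. \<bar>?h n * y\<bar> < pi"
          using order_tendstoD(2)[OF tendsto_rabs, of "\<lambda>n. ?h n * y" 0 sequentially pi] by simp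
        then show "\<forall>\<^sub>F n in sequentially. exp (part_log (?z n y) - part_log (of_real (\<epsilon> n)) - \<i> * of_real (?h n * y * ((pi\<^sup>2 / 6) / (\<epsilon> n)\<^sup>2))) = G n y"
          using eventually_ge_at_top[of N]
        proof eventually_elim
          fix n assume "\<bar>?h n * y\<bar> < pi" "N \<le> n"
          then have "?h n * y \<in> {-pi..pi}" by auto
          then show "exp (part_log (?z n y) - part_log (of_real (\<epsilon> n)) - \<i> * of_real (?h n * y * ((pi\<^sup>2 / 6) / (\<epsilon> n)\<^sup>2))) = G n y"
            unfolding G_def n_eq[OF \<open>N \<le> n\<close>] by simp
        qed
      qed
      then show "(\<lambda>n. G (n + N) y) \<longlonglongrightarrow> complex_of_real (exp (- (pi\<^sup>2 / 6 * y\<^sup>2)))"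
        unfolding exp_of_real by (rule LIMSEQ_ignore_initial_segment)
    qed
    show "AE y in lborel. norm (G (n + N) y) \<le> dom_const * inverse (1 + y\<^sup>2)" for n
    proof (rule AE_I2)
      fix y :: real
      have e: "0 < \<epsilon> (n + N)" "\<epsilon> (n + N) \<le> 1 / 2" using N[of "n + N"] by auto
      show "norm (G (n + N) y) \<le> dom_const * inverse (1 + y\<^sup>2)"
      proof (cases "?h (n + N) * y \<in> {-pi..pi}")
        case True
        then have "norm (G (n + N) y) = exp (Re (part_log (?z (n + N) y)) - part_log_real (\<epsilon> (n + N)))"
          unfolding G_def part_log_real_def by (simp add: norm_exp_eq_Re)
        also have "\<dots> \<le> dom_const * inverse (1 + y\<^sup>2)"
          by (rule exp_part_log_dominated[OF e]) (use True in auto)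
        finally show ?thesis .
      next
        case False
        have "0 \<le> dom_const" unfolding dom_const_def by (intro add_nonneg_nonneg mult_nonneg_nonneg) auto
        moreover have "0 \<le> inverse (1 + y\<^sup>2)" by simp
        ultimately show ?thesis using False by (simp add: G_def)
      qed
    qed
  qed
  \<comment> \<open>Substitution \<open>\<theta> = ?h n * y\<close> in the coefficient integral; its
    Jacobian is the denominator in the claim.\<close>
  have val: "of_real (?h n) * (LINT y|lborel. G n y) = of_real (2 * pi * (real (card (partitions_of n)) * exp (- (real n * \<epsilon> n)) * exp (- part_log_real (\<epsilon> n))))"
    if "n \<ge> N" for n
  proof -
    have e: "0 < \<epsilon> n" using N[OF that] by simp
    have h: "0 < ?h n" using e by simp
    define H where "H \<theta> = indicator {-pi..pi} \<theta> *\<^sub>R (part_gf (of_real (\<epsilon> n) - \<i> * of_real \<theta>) * exp (- (\<i> * of_real (real n * \<theta>))))" for \<theta>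
    have "(LINT \<theta>|lborel. H \<theta>) = \<bar>?h n\<bar> *\<^sub>R (LINT y|lborel. H (0 + ?h n * y))"
      by (rule lborel_integral_real_affine[OF less_imp_neq[OF h, symmetric]])
    moreover have "H (0 + ?h n * y) = exp (part_log (of_real (\<epsilon> n))) * G n y" for y
      unfolding H_def G_def add_0 by (subst part_gf_eq_exp) (use e in \<open>auto simp: exp_diff exp_minus divide_inverse mult_ac\<close>)
    ultimately have "(LINT \<theta>|lborel. H \<theta>) = of_real (?h n) * (exp (part_log (of_real (\<epsilon> n))) * (LINT y|lborel. G n y))"
      unfolding abs_of_pos[OF h] scaleR_conv_of_real by simp
    also have "(LINT \<theta>|lborel. H \<theta>) = of_real (2 * pi * (real (card (partitions_of n)) * exp (- (real n * \<epsilon> n))))"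
      unfolding H_def by (rule part_gf_fourier[OF e])
    finally have "of_real (?h n) * (LINT y|lborel. G n y) * exp (part_log (of_real (\<epsilon> n))) = of_real (2 * pi * (real (card (partitions_of n)) * exp (- (real n * \<epsilon> n))))"
      by (simp add: mult_ac)
    moreover have "exp (part_log (of_real (\<epsilon> n))) = of_real (exp (part_log_real (\<epsilon> n)))"
      unfolding part_log_of_real[OF e] by (rule exp_of_real)
    ultimately have "of_real (?h n) * (LINT y|lborel. G n y) * of_real (exp (part_log_real (\<epsilon> n))) * of_real (exp (- part_log_real (\<epsilon> n)))
      = of_real (2 * pi * (real (card (partitions_of n)) * exp (- (real n * \<epsilon> n)))) * of_real (exp (- part_log_real (\<epsilon> n)))" by simp
    moreover have "complex_of_real (exp (part_log_real (\<epsilon> n))) * of_real (exp (- part_log_real (\<epsilon> n))) = 1"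
      unfolding of_real_mult[symmetric] exp_minus_inverse by simp
    ultimately show ?thesis by (simp only: mult.assoc mult_1_right of_real_mult)
  qed
  have "(\<lambda>n. LINT y|lborel. G n y) \<longlonglongrightarrow> of_real (sqrt (pi / (pi\<^sup>2 / 6)))"
  proof (rule LIMSEQ_offset)
    have g: "(LINT y|lborel. complex_of_real (exp (- (pi\<^sup>2 / 6 * y\<^sup>2)))) = of_real (sqrt (pi / (pi\<^sup>2 / 6)))"
      by (rule integral_gaussian_full) simp
    show "(\<lambda>n. LINT y|lborel. G (n + N) y) \<longlonglongrightarrow> of_real (sqrt (pi / (pi\<^sup>2 / 6)))"
      using lim unfolding g .
  qed
  then have "(\<lambda>n. (LINT y|lborel. G n y) / of_real (2 * pi)) \<longlonglongrightarrow> of_real (sqrt (pi / (pi\<^sup>2 / 6))) / of_real (2 * pi)"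
    by (intro tendsto_divide tendsto_const) auto
  then have "(\<lambda>n. complex_of_real (real (card (partitions_of n)) * exp (- (real n * \<epsilon> n)) * exp (- part_log_real (\<epsilon> n)) / ?h n))
      \<longlonglongrightarrow> of_real (sqrt (pi / (pi\<^sup>2 / 6)) / (2 * pi))"
    unfolding of_real_divide[symmetric]
  proof (rule Lim_transform_eventually)
    show "\<forall>\<^sub>F n in sequentially. (LINT y|lborel. G n y) / of_real (2 * pi) =
        complex_of_real (real (card (partitions_of n)) * exp (- (real n * \<epsilon> n)) * exp (- part_log_real (\<epsilon> n)) / ?h n)"
      using eventually_ge_at_top[of N]
    proof eventually_elim
      fix n assume n: "N \<le> n"
      have "complex_of_real (?h n) \<noteq> 0" using N[OF n] by simp
      then have "(LINT y|lborel. G n y) = of_real (2 * pi * (real (card (partitions_of n)) * exp (- (real n * \<epsilon> n)) * exp (- part_log_real (\<epsilon> n)))) / of_real (?h n)"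
        using val[OF n] by (metis nonzero_mult_div_cancel_left)
      then show "(LINT y|lborel. G n y) / of_real (2 * pi) =
        complex_of_real (real (card (partitions_of n)) * exp (- (real n * \<epsilon> n)) * exp (- part_log_real (\<epsilon> n)) / ?h n)"
        by (simp add: of_real_divide)
    qed
  qed
  then show ?thesis by (simp only: tendsto_of_real_iff)
qed

text \<open>At the saddle \<open>n * \<epsilon>\<close> and
  \<open>(pi\<^sup>2 / 6) / \<epsilon>\<close> coincide and add up to
  \<open>pi * sqrt (2 * n / 3)\<close>. The factor \<open>sqrt (\<epsilon> / (2 * pi))\<close>
  hidden in \<open>part_log_error\<close> combines with the Jacobian and the Gaussian integral to
  \<open>1 / (4 * sqrt 3 * n)\<close>.\<close>

lemma partitions_asymp:
  "(\<lambda>n. real (card (partitions_of n)) / (exp (pi * sqrt (2 * real n / 3)) / (4 * sqrt 3 * real n))) \<longlonglongrightarrow> 1"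
proof -
  let ?e = "\<lambda>n. pi / sqrt (6 * real n)"
  let ?A = "\<lambda>n. real (card (partitions_of n)) * exp (- (real n * ?e n)) * exp (- part_log_real (?e n)) / (?e n * sqrt (?e n))"
  have fl: "filterlim ?e (at_right 0) sequentially" by real_asymp
  have "(\<lambda>n. exp (part_log_error (?e n))) \<longlonglongrightarrow> exp 0"
    by (intro tendsto_exp filterlim_compose[OF part_log_error_tendsto fl])
  then have "(\<lambda>n. ?A n * exp (part_log_error (?e n)) * (2 * pi / sqrt (pi / (pi\<^sup>2 / 6)))) \<longlonglongrightarrow>
      sqrt (pi / (pi\<^sup>2 / 6)) / (2 * pi) * exp 0 * (2 * pi / sqrt (pi / (pi\<^sup>2 / 6)))"
    by (intro tendsto_mult partitions_saddle_point tendsto_const)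
  then have "(\<lambda>n. ?A n * exp (part_log_error (?e n)) * (2 * pi / sqrt (pi / (pi\<^sup>2 / 6)))) \<longlonglongrightarrow> 1" by simp
  then show ?thesis
  proof (rule Lim_transform_eventually)
    show "\<forall>\<^sub>F n in sequentially. ?A n * exp (part_log_error (?e n)) * (2 * pi / sqrt (pi / (pi\<^sup>2 / 6))) =
      real (card (partitions_of n)) / (exp (pi * sqrt (2 * real n / 3)) / (4 * sqrt 3 * real n))"
      using eventually_gt_at_top[of 0]
    proof eventually_elim
      fix n :: nat assume "0 < n"
      then have n: "0 < real n" by simp
      define e where "e = ?e n"
      have e: "0 < e" using n by (simp add: e_def)
      have e2: "e\<^sup>2 = pi\<^sup>2 / (6 * real n)" using n by (simp add: e_def power_divide)
      have ne: "real n * e = pi\<^sup>2 / 6 / e" using e2 e n by (simp add: field_simps power2_eq_square)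
      have "real n * e + pi\<^sup>2 / 6 / e = 2 * (real n * e)" unfolding ne by simp
      also have "\<dots> = pi * sqrt (2 * real n / 3)"
      proof -
        have "real n / sqrt (6 * real n) = sqrt (real n / 6)"
          using n by (simp add: real_sqrt_mult real_sqrt_divide field_simps)
        moreover have "2 * sqrt (real n / 6) = sqrt (4 * (real n / 6))" by (simp only: real_sqrt_mult real_sqrt_four)
        moreover have "2 * (real n * e) = pi * (2 * (real n / sqrt (6 * real n)))" by (simp add: e_def)
        moreover have "4 * (real n / 6) = 2 * real n / 3" by simp
        ultimately show ?thesis by (simp only:)
      qed
      finally have ex: "real n * e + pi\<^sup>2 / 6 / e = pi * sqrt (2 * real n / 3)" .
      have s: "exp (ln (e / (2 * pi)) / 2) = sqrt (e / (2 * pi))"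
        using e by (simp add: ln_sqrt[symmetric])
      have "exp (- (real n * e)) * exp (- part_log_real e) * exp (part_log_error e) = exp (- (real n * e + pi\<^sup>2 / 6 / e)) / exp (ln (e / (2 * pi)) / 2)"
        unfolding part_log_error_def by (simp add: exp_add[symmetric] exp_diff[symmetric] exp_minus[symmetric])
      also have "\<dots> = exp (- (pi * sqrt (2 * real n / 3))) / sqrt (e / (2 * pi))" unfolding ex s ..
      finally have 1: "exp (- (real n * e)) * exp (- part_log_real e) * exp (part_log_error e) = exp (- (pi * sqrt (2 * real n / 3))) / sqrt (e / (2 * pi))" .
      have 2: "1 / sqrt (e / (2 * pi)) / (e * sqrt e) * (2 * pi / sqrt (pi / (pi\<^sup>2 / 6))) = 4 * sqrt 3 * real n"
      proof -
        have X: "1 / sqrt (e / (2 * pi)) / (e * sqrt e) = sqrt (2 * pi) / e\<^sup>2"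
          using e by (simp add: real_sqrt_divide power2_eq_square)
        have Y: "pi / (pi\<^sup>2 / 6) = 6 / pi" by (simp add: power2_eq_square)
        have Z: "sqrt (2 * pi) / sqrt (6 / pi) = pi / sqrt 3"
        proof -
          have "sqrt (2 * pi) / sqrt (6 / pi) = sqrt (pi\<^sup>2 / 3)"
          proof -
            have "2 * pi / (6 / pi) = pi\<^sup>2 / 3" by (simp add: power2_eq_square)
            then show ?thesis using real_sqrt_divide[of "2 * pi" "6 / pi"] by metis
          qed
          then show ?thesis by (simp add: real_sqrt_divide)
        qed
        have W: "1 / e\<^sup>2 = 6 * real n / pi\<^sup>2" unfolding e2 by simp
        have "1 / sqrt (e / (2 * pi)) / (e * sqrt e) * (2 * pi / sqrt (pi / (pi\<^sup>2 / 6))) =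
            (1 / e\<^sup>2) * (2 * pi) * (sqrt (2 * pi) / sqrt (6 / pi))"
          unfolding X Y by simp
        also have "\<dots> = (6 * real n / pi\<^sup>2) * (2 * pi) * (pi / sqrt 3)" unfolding W Z ..
        also have "\<dots> = 12 * real n / sqrt 3" by (simp add: power2_eq_square)
        also have "\<dots> = 4 * sqrt 3 * real n"
          by (simp add: field_simps)
        finally show ?thesis .
      qed
      have "?A n * exp (part_log_error (?e n)) * (2 * pi / sqrt (pi / (pi\<^sup>2 / 6))) =
        real (card (partitions_of n)) * (exp (- (real n * e)) * exp (- part_log_real e) * exp (part_log_error e)) * (1 / (e * sqrt e)) * (2 * pi / sqrt (pi / (pi\<^sup>2 / 6)))"
        unfolding e_def by simp
      also have "\<dots> = real (card (partitions_of n)) * exp (- (pi * sqrt (2 * real n / 3))) * (1 / sqrt (e / (2 * pi)) / (e * sqrt e) * (2 * pi / sqrt (pi / (pi\<^sup>2 / 6))))"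
        unfolding 1 by simp
      also have "\<dots> = real (card (partitions_of n)) * exp (- (pi * sqrt (2 * real n / 3))) * (4 * sqrt 3 * real n)" unfolding 2 ..
      also have "\<dots> = real (card (partitions_of n)) / (exp (pi * sqrt (2 * real n / 3)) / (4 * sqrt 3 * real n))"
      proof -
        have "p * exp (- x) * c = p / (exp x / c)" for p x c :: real
          by (simp add: exp_minus divide_inverse)
        then show ?thesis .
      qed
      finally show "?A n * exp (part_log_error (?e n)) * (2 * pi / sqrt (pi / (pi\<^sup>2 / 6))) =
        real (card (partitions_of n)) / (exp (pi * sqrt (2 * real n / 3)) / (4 * sqrt 3 * real n))" .
    qed
  qed
qed

section \<open>Slowly growing sequences\<close>

lemma card_partitions_pos: "0 < card (partitions_of n)"
proof -
  have "replicate n 1 \<in> partitions_of n"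
    by (auto simp: partitions_of_def sum_list_replicate sorted_wrt_iff_nth_less)
  then show ?thesis using finite_partitions_of card_gt_0_iff by blast
qed

lemma card_partitions_Suc: "card (partitions_of n) \<le> card (partitions_of (Suc n))"
proof (rule card_inj_on_le[of "\<lambda>lam. lam @ [1]"])
  have "lam @ [1] \<in> partitions_of (Suc n)" if "lam \<in> partitions_of n" for lam
  proof -
    have "0 \<notin> set lam" using that by (simp add: partitions_of_def)
    then have "1 \<le> x" if "x \<in> set lam" for x using that by (cases "x = 0") auto
    then show ?thesis using that by (simp add: partitions_of_def sorted_wrt_append)
  qed
  then show "(\<lambda>lam. lam @ [1]) ` partitions_of n \<subseteq> partitions_of (Suc n)" by blast
qed (auto simp: inj_on_def finite_partitions_of)

lemma mono_card_partitions: "mono (\<lambda>n. card (partitions_of n))"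
  by (rule incseq_SucI) (rule card_partitions_Suc)

text \<open>For a nondecreasing positive sequence this says that consecutive ratios tend to 1, in a
  form without division.\<close>

definition slowly_growing :: "(nat \<Rightarrow> nat) \<Rightarrow> bool" where
  "slowly_growing u \<longleftrightarrow> mono u \<and> (\<forall>n. 0 < u n) \<and>
    (\<forall>\<delta>>0. \<forall>\<^sub>F n in sequentially. real (u (Suc n)) \<le> (1 + \<delta>) * real (u n))"

lemma slowly_growing_partitions: "slowly_growing (\<lambda>n. card (partitions_of n))"
  unfolding slowly_growing_def
proof (intro conjI allI impI mono_card_partitions card_partitions_pos)
  fix \<delta> :: real assume \<delta>: "0 < \<delta>"
  let ?p = "\<lambda>n. real (card (partitions_of n))"
  let ?A = "\<lambda>n::nat. exp (pi * sqrt (2 * real n / 3)) / (4 * sqrt 3 * real n)"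
  have "(\<lambda>n. ?p (Suc n) / ?A (Suc n)) \<longlonglongrightarrow> 1"
    using partitions_asymp by (rule LIMSEQ_Suc)
  moreover have "(\<lambda>n. ?A (Suc n) / ?A n) \<longlonglongrightarrow> 1" by real_asymp
  ultimately have "(\<lambda>n. (?p (Suc n) / ?A (Suc n)) * (?A (Suc n) / ?A n) / (?p n / ?A n)) \<longlonglongrightarrow> 1 * 1 / 1"
    by (intro tendsto_divide tendsto_mult partitions_asymp) auto
  moreover have "1 * 1 / 1 = (1::real)" by simp
  ultimately have "(\<lambda>n. (?p (Suc n) / ?A (Suc n)) * (?A (Suc n) / ?A n) / (?p n / ?A n)) \<longlonglongrightarrow> 1" by (simp only:)
  then have "(\<lambda>n. ?p (Suc n) / ?p n) \<longlonglongrightarrow> 1"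
  proof (rule Lim_transform_eventually)
    show "\<forall>\<^sub>F n in sequentially. (?p (Suc n) / ?A (Suc n)) * (?A (Suc n) / ?A n) / (?p n / ?A n) = ?p (Suc n) / ?p n"
      using eventually_gt_at_top[of 0]
    proof eventually_elim
      fix n :: nat assume "0 < n"
      then have "?A n \<noteq> 0" "?A (Suc n) \<noteq> 0" by (simp_all del: of_nat_Suc)
      moreover have "(a / A') * (A' / A) / (b / A) = a / b" if "A \<noteq> 0" "A' \<noteq> 0" for a b A A' :: real
        using that by (cases "b = 0") (auto simp: field_simps)
      ultimately show "(?p (Suc n) / ?A (Suc n)) * (?A (Suc n) / ?A n) / (?p n / ?A n) = ?p (Suc n) / ?p n" by blast
    qed
  qed
  then have "\<forall>\<^sub>F n in sequentially. ?p (Suc n) / ?p n < 1 + \<delta>"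
    by (rule order_tendstoD) (use \<delta> in simp)
  then show "\<forall>\<^sub>F n in sequentially. ?p (Suc n) \<le> (1 + \<delta>) * ?p n"
    by eventually_elim (use card_partitions_pos in \<open>simp add: pos_divide_less_eq less_imp_le\<close>)
qed

lemma slowly_growing_shift:
  assumes "slowly_growing u"
  shows "\<forall>\<^sub>F n in sequentially. \<forall>s\<le>K. real (u n) \<le> 2 * real (u (n - s))"
proof -
  \<comment> \<open>Chosen so that \<open>Suc K\<close> consecutive ratios multiply to at most
    2.\<close>
  define \<delta> where "\<delta> = root (Suc K) 2 - 1"
  have \<delta>: "0 < \<delta>" by (simp add: \<delta>_def)
  then have pow: "(1 + \<delta>) ^ s \<le> 2" if "s \<le> K" for s
  proof -
    have "(1 + \<delta>) ^ s \<le> (1 + \<delta>) ^ Suc K" using \<delta> that by (intro power_increasing) auto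
    also have "\<dots> = 2" by (simp add: \<delta>_def del: power_Suc)
    finally show ?thesis .
  qed
  obtain N where N: "\<And>n. n \<ge> N \<Longrightarrow> real (u (Suc n)) \<le> (1 + \<delta>) * real (u n)"
    using assms \<delta> unfolding slowly_growing_def eventually_sequentially by blast
  have iter: "real (u (n + s)) \<le> (1 + \<delta>) ^ s * real (u n)" if "n \<ge> N" for n s
  proof (induction s)
    case (Suc s)
    have "real (u (n + Suc s)) \<le> (1 + \<delta>) * real (u (n + s))" using N[of "n + s"] that by simp
    also have "\<dots> \<le> (1 + \<delta>) * ((1 + \<delta>) ^ s * real (u n))" using Suc \<delta> by (intro mult_left_mono) auto
    finally show ?case by (simp add: mult.assoc)
  qed simp
  show ?thesis
  proof (rule eventually_sequentiallyI[of "N + K"], intro allI impI)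
    fix n s assume n: "N + K \<le> n" and s: "s \<le> K"
    have "real (u (n - s + s)) \<le> (1 + \<delta>) ^ s * real (u (n - s))" by (rule iter) (use n s in simp)
    also have "\<dots> \<le> 2 * real (u (n - s))" by (intro mult_right_mono pow s) simp
    finally show "real (u n) \<le> 2 * real (u (n - s))" using n s by simp
  qed
qed

text \<open>Matching \<open>a (k + 1) * b (n - k)\<close> with \<open>a k * b (n - k)\<close> costs
  a factor \<open>1 + \<delta> / 2\<close> once \<open>k \<ge> k0\<close>. The finitely many
  remaining terms are at most a constant times \<open>b (n + 1)\<close>; they are negligible because
  the convolution at \<open>n\<close> has \<open>K\<close> terms, each at least half of
  \<open>b (n + 1)\<close>.\<close>

lemma slowly_growing_convolution:
  assumes a: "slowly_growing a" and b: "slowly_growing b"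
  shows "slowly_growing (\<lambda>n. \<Sum>k\<le>n. a k * b (n - k))"
  unfolding slowly_growing_def
proof (intro conjI allI impI)
  let ?c = "\<lambda>n. \<Sum>k\<le>n. a k * b (n - k)"
  have pos: "0 < a n" "0 < b n" for n using a b by (auto simp: slowly_growing_def)
  have mono: "a m \<le> a n" "b m \<le> b n" if "m \<le> n" for m n
    using a b that by (auto simp: slowly_growing_def mono_def)
  show "mono ?c"
  proof (rule incseq_SucI)
    fix n
    have "?c n \<le> (\<Sum>k\<le>n. a k * b (Suc n - k))"
      by (intro sum_mono mult_left_mono mono(2)) auto
    then show "?c n \<le> ?c (Suc n)" by simp
  qed
  show "0 < ?c n" for n
    by (rule sum_pos2[of _ 0]) (use pos in auto)
  fix \<delta> :: real assume \<delta>: "0 < \<delta>"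
  have "0 < \<delta> / 2" using \<delta> by simp
  then obtain k0 where k0: "\<And>n. n \<ge> k0 \<Longrightarrow> real (a (Suc n)) \<le> (1 + \<delta> / 2) * real (a n)"
    using a unfolding slowly_growing_def eventually_sequentially by blast
  \<comment> \<open>The \<open>k0 + 1\<close> initial terms are at most
    \<open>a k0 * b (n + 1)\<close> each, and \<open>K / 2\<close> copies of
    \<open>b (n + 1)\<close> bound the convolution at \<open>n\<close> from below; this
    \<open>K\<close> makes the former at most \<open>\<delta> / 2\<close> times the latter.\<close>
  define K where "K = nat \<lceil>2 * real (Suc k0) * real (a k0) / (\<delta> / 2)\<rceil>"
  have K: "2 * real (Suc k0) * real (a k0) \<le> real K * (\<delta> / 2)"
  proof -
    have "2 * real (Suc k0) * real (a k0) / (\<delta> / 2) \<le> real K" unfolding K_def by linarith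
    then show ?thesis using \<delta> by (simp add: pos_divide_le_eq del: of_nat_Suc)
  qed
  have "\<forall>\<^sub>F n in sequentially. \<forall>s\<le>Suc K. real (b n) \<le> 2 * real (b (n - s))"
    by (rule slowly_growing_shift[OF b])
  then have "\<forall>\<^sub>F n in sequentially. \<forall>s\<le>Suc K. real (b (Suc n)) \<le> 2 * real (b (Suc n - s))"
    by (subst eventually_sequentially_Suc)
  then show "\<forall>\<^sub>F n in sequentially. real (?c (Suc n)) \<le> (1 + \<delta>) * real (?c n)"
    using eventually_ge_at_top[of "K + k0"]
  proof eventually_elim
    fix n assume sh: "\<forall>s\<le>Suc K. real (b (Suc n)) \<le> 2 * real (b (Suc n - s))" and n: "K + k0 \<le> n"
    have "real (?c (Suc n)) = (\<Sum>k\<le>k0. real (a k) * real (b (Suc n - k))) + (\<Sum>k\<in>{Suc k0..Suc n}. real (a k) * real (b (Suc n - k)))"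
    proof -
      have "{..Suc n} = {..k0} \<union> {Suc k0..Suc n}" using n by auto
      then show ?thesis by (simp only: of_nat_sum of_nat_mult) (subst sum.union_disjoint, auto)
    qed
    also have "(\<Sum>k\<le>k0. real (a k) * real (b (Suc n - k))) \<le> (\<Sum>k\<le>k0. real (a k0) * real (b (Suc n)))"
      by (intro sum_mono mult_mono) (use mono in auto)
    also have "\<dots> = real (Suc k0) * real (a k0) * real (b (Suc n))" by simp
    also have "\<dots> \<le> \<delta> / 2 * real (?c n)"
    proof -
      have "real K * real (b (Suc n)) \<le> (\<Sum>k<K. 2 * (real (a k) * real (b (n - k))))"
      proof -
        have "(\<Sum>k<K. real (b (Suc n))) \<le> (\<Sum>k<K. 2 * (real (a k) * real (b (n - k))))"
        proof (intro sum_mono)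
          fix k assume "k \<in> {..<K}"
          then have "real (b (Suc n)) \<le> 2 * real (b (n - k))" using sh[rule_format, of "Suc k"] by simp
          also have "\<dots> \<le> 2 * (real (a k) * real (b (n - k)))" using mult_right_mono[of 1 "real (a k)" "real (b (n - k))"] pos(1)[of k] by simp
          finally show "real (b (Suc n)) \<le> 2 * (real (a k) * real (b (n - k)))" .
        qed
        then show ?thesis by simp
      qed
      also have "\<dots> \<le> (\<Sum>k\<le>n. 2 * (real (a k) * real (b (n - k))))"
        by (intro sum_mono2) (use n in auto)
      also have "\<dots> = 2 * real (?c n)" by (simp add: sum_distrib_left)
      finally have "real K * (\<delta> / 2) * real (b (Suc n)) \<le> \<delta> * real (?c n)"
        using mult_left_mono[of "real K * real (b (Suc n))" "2 * real (?c n)" "\<delta> / 2"] \<delta> by (simp add: mult_ac)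
      moreover have "2 * real (Suc k0) * real (a k0) * real (b (Suc n)) \<le> real K * (\<delta> / 2) * real (b (Suc n))"
        by (intro mult_right_mono K) simp
      ultimately show ?thesis by argo
    qed
    also have "(\<Sum>k\<in>{Suc k0..Suc n}. real (a k) * real (b (Suc n - k))) = (\<Sum>k\<in>{k0..n}. real (a (Suc k)) * real (b (n - k)))"
      by (subst sum.shift_bounds_cl_Suc_ivl) simp
    also have "\<dots> \<le> (\<Sum>k\<in>{k0..n}. (1 + \<delta> / 2) * (real (a k) * real (b (n - k))))"
      by (intro sum_mono) (use k0 in \<open>simp add: mult_right_mono mult.assoc[symmetric]\<close>)
    also have "\<dots> \<le> (\<Sum>k\<le>n. (1 + \<delta> / 2) * (real (a k) * real (b (n - k))))"
      by (intro sum_mono2) (use \<delta> in auto)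
    also have "\<dots> = (1 + \<delta> / 2) * real (?c n)" by (simp add: sum_distrib_left)
    finally show "real (?c (Suc n)) \<le> (1 + \<delta>) * real (?c n)" by (simp add: algebra_simps)
  qed
qed

lemma slowly_growing_multipartitions: "slowly_growing (multipartitions (Suc t))"
proof (induction t)
  case 0
  have "multipartitions (Suc 0) = (\<lambda>n. card (partitions_of n))" by (rule ext) (rule multipartitions_1)
  then show ?case using slowly_growing_partitions by simp
next
  case (Suc t)
  have "multipartitions (Suc (Suc t)) = (\<lambda>n. \<Sum>k\<le>n. card (partitions_of k) * multipartitions (Suc t) (n - k))"
    by (rule ext) (rule multipartitions.simps(2))
  then show ?case using slowly_growing_convolution[OF slowly_growing_partitions Suc] by simp
qed

lemma partitions_le_multipartitions: "card (partitions_of n) \<le> multipartitions (Suc t) n"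
proof (cases t)
  case 0 then show ?thesis using multipartitions_1 by simp
next
  case (Suc s)
  have "card (partitions_of n) * multipartitions (Suc s) (n - n) \<le> (\<Sum>k\<le>n. card (partitions_of k) * multipartitions (Suc s) (n - k))"
    by (rule member_le_sum) auto
  moreover have "0 < multipartitions (Suc s) 0" using slowly_growing_multipartitions[of s] by (simp only: slowly_growing_def)
  ultimately have "card (partitions_of n) \<le> (\<Sum>k\<le>n. card (partitions_of k) * multipartitions (Suc s) (n - k))"
    by (metis Suc_leI diff_self_eq_0 le_trans mult.right_neutral mult_le_mono2 One_nat_def)
  then show ?thesis unfolding Suc multipartitions.simps(2)[of "Suc s"] .
qed

text \<open>Since \<open>pi * sqrt (2 / 3) > 1\<close>, the partition numbers outgrow
  \<open>exp (sqrt n)\<close> and hence every power of \<open>n\<close>.\<close>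

lemma polynomial_over_partitions:
  "(\<lambda>n. real n ^ k / real (card (partitions_of n))) \<longlonglongrightarrow> 0"
proof -
  let ?p = "\<lambda>n. real (card (partitions_of n))"
  let ?A = "\<lambda>n::nat. exp (pi * sqrt (2 * real n / 3)) / (4 * sqrt 3 * real n)"
  have fl: "filterlim (\<lambda>n::nat. sqrt (real n)) at_top sequentially" by real_asymp
  have "(\<lambda>n. sqrt (real n) ^ (2 * (k + 1)) / exp (sqrt (real n))) \<longlonglongrightarrow> 0"
    by (rule filterlim_compose[OF tendsto_power_div_exp_0 fl])
  moreover have "(\<lambda>n::nat. exp (sqrt (real n)) / exp (pi * sqrt (2 * real n / 3))) \<longlonglongrightarrow> 0"
  proof -
    have "(\<lambda>n::nat. exp (sqrt (real n) - pi * sqrt (2 * real n / 3))) \<longlonglongrightarrow> 0"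
    proof (rule filterlim_compose[OF exp_at_bot])
      have "filterlim (\<lambda>n::nat. (pi * sqrt (2 / 3) - 1) * sqrt (real n)) at_top sequentially"
      proof (rule filterlim_tendsto_pos_mult_at_top[OF tendsto_const _ fl])
        have "1 = sqrt (3 / 2) * sqrt (2 / 3)" by (simp add: real_sqrt_mult[symmetric])
        also have "\<dots> < pi * sqrt (2 / 3)"
          using pi_gt3 real_sqrt_less_mono[of "3/2" 4] by (intro mult_strict_right_mono) auto
        finally show "0 < pi * sqrt (2 / 3) - 1" by simp
      qed
      then have "filterlim (\<lambda>n::nat. - ((pi * sqrt (2 / 3) - 1) * sqrt (real n))) at_bot sequentially"
        unfolding filterlim_uminus_at_top .
      moreover have "sqrt (real n) - pi * sqrt (2 * real n / 3) = - ((pi * sqrt (2 / 3) - 1) * sqrt (real n))" for n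
      proof -
        have "sqrt (2 * real n / 3) = sqrt (2 / 3) * sqrt (real n)" by (simp add: real_sqrt_mult[symmetric])
        then show ?thesis by (simp add: algebra_simps)
      qed
      ultimately show "filterlim (\<lambda>n::nat. sqrt (real n) - pi * sqrt (2 * real n / 3)) at_bot sequentially"
        by (simp only:)
    qed
    then show ?thesis by (simp add: exp_diff)
  qed
  ultimately have "(\<lambda>n. (sqrt (real n) ^ (2 * (k + 1)) / exp (sqrt (real n))) * (exp (sqrt (real n)) / exp (pi * sqrt (2 * real n / 3)))
      * (4 * sqrt 3) / (?p n / ?A n)) \<longlonglongrightarrow> 0 * 0 * (4 * sqrt 3) / 1"
    by (intro tendsto_divide tendsto_mult tendsto_const partitions_asymp) auto
  then have "(\<lambda>n. (sqrt (real n) ^ (2 * (k + 1)) / exp (sqrt (real n))) * (exp (sqrt (real n)) / exp (pi * sqrt (2 * real n / 3)))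
      * (4 * sqrt 3) / (?p n / ?A n)) \<longlonglongrightarrow> 0" by simp
  then show ?thesis
  proof (rule Lim_transform_eventually)
    show "\<forall>\<^sub>F n in sequentially. (sqrt (real n) ^ (2 * (k + 1)) / exp (sqrt (real n))) * (exp (sqrt (real n)) / exp (pi * sqrt (2 * real n / 3)))
      * (4 * sqrt 3) / (?p n / ?A n) = real n ^ k / ?p n"
      using eventually_gt_at_top[of 0]
    proof eventually_elim
      fix n :: nat assume n: "0 < n"
      have "sqrt (real n) ^ (2 * (k + 1)) = real n ^ k * real n" by (simp add: power_mult)
      moreover have "(X * N / E) * (E / D) * c / (p / (D / (c * N))) = X / p" if "N > 0" "E > 0" "D > 0" "c > 0" for X N E D c p :: real
        using that by simp
      ultimately show "(sqrt (real n) ^ (2 * (k + 1)) / exp (sqrt (real n))) * (exp (sqrt (real n)) / exp (pi * sqrt (2 * real n / 3)))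
        * (4 * sqrt 3) / (?p n / ?A n) = real n ^ k / ?p n" using n by simp
    qed
  qed
qed

section \<open>Equidistribution of core vectors\<close>

text \<open>Solving the condition of sum 0 for coordinate 0 leaves \<open>t - 1\<close> free
  integers, each of which can be moved on its own.\<close>

definition core_ext :: "nat \<Rightarrow> (nat \<Rightarrow> int) \<Rightarrow> nat \<Rightarrow> int" where
  "core_ext t y = (\<lambda>r\<in>{..<t}. if r = 0 then - (\<Sum>i\<in>{1..<t}. y i) else y r)"

definition core_form :: "nat \<Rightarrow> (nat \<Rightarrow> int) \<Rightarrow> int" where
  "core_form t y = core_size t (core_ext t y)"

lemma sum_lessThan_split_0:
  fixes f :: "nat \<Rightarrow> 'a::comm_monoid_add"
  assumes "t > 0" shows "(\<Sum>r<t. f r) = f 0 + (\<Sum>r\<in>{1..<t}. f r)"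
proof -
  have "{..<t} = insert 0 {1..<t}" using assms by auto
  then show ?thesis by simp
qed

lemma core_ext_sum:
  assumes "t > 0" shows "(\<Sum>r<t. core_ext t y r) = 0"
proof -
  have "(\<Sum>r\<in>{1..<t}. core_ext t y r) = (\<Sum>r\<in>{1..<t}. y r)"
    by (intro sum.cong) (auto simp: core_ext_def)
  moreover have "core_ext t y 0 = - (\<Sum>r\<in>{1..<t}. y r)" using assms by (simp add: core_ext_def)
  ultimately show ?thesis unfolding sum_lessThan_split_0[OF assms] by simp
qed

lemma core_form_eq:
  assumes "t > 0"
  shows "core_form t y = int t * ((\<Sum>i\<in>{1..<t}. y i) * ((\<Sum>i\<in>{1..<t}. y i) + 1) div 2)
    + (\<Sum>r\<in>{1..<t}. int t * (y r * (y r - 1) div 2) + int r * y r)"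
proof -
  let ?Y = "\<Sum>i\<in>{1..<t}. y i"
  have "(- ?Y) * (- ?Y - 1) = ?Y * (?Y + 1)" by (simp add: algebra_simps)
  moreover have "(\<Sum>r\<in>{1..<t}. int t * (core_ext t y r * (core_ext t y r - 1) div 2) + int r * core_ext t y r)
    = (\<Sum>r\<in>{1..<t}. int t * (y r * (y r - 1) div 2) + int r * y r)"
    by (intro sum.cong) (auto simp: core_ext_def)
  moreover have "core_ext t y 0 = - ?Y" using assms by (simp add: core_ext_def)
  ultimately show ?thesis unfolding core_form_def core_size_def sum_lessThan_split_0[OF assms] by simp
qed

text \<open>Moving coordinate \<open>i\<close> moves coordinate 0 in the opposite direction. The
  half-integral parts of the two triangular terms combine to \<open>t * d * d\<close>, so every
  increment is an integer multiple of \<open>d\<close>.\<close>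

lemma core_form_line:
  assumes "i \<in> {1..<t}"
  shows "core_form t (y(i := k + d)) = core_form t (y(i := k)) + int t * d * d
    + int t * d * (2 * k + (\<Sum>j\<in>{1..<t} - {i}. y j)) + int i * d"
proof -
  have t: "t > 0" using assms by auto
  let ?Y = "\<Sum>j\<in>{1..<t} - {i}. y j"
  let ?R = "\<Sum>r\<in>{1..<t} - {i}. int t * (y r * (y r - 1) div 2) + int r * y r"
  have sumY: "(\<Sum>j\<in>{1..<t}. (y(i := k)) j) = k + ?Y" for k
    by (subst sum.remove[OF _ assms]) (auto intro!: sum.cong)
  have sumR: "(\<Sum>r\<in>{1..<t}. int t * ((y(i := k)) r * ((y(i := k)) r - 1) div 2) + int r * (y(i := k)) r)
     = int t * (k * (k - 1) div 2) + int i * k + ?R" for k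
    by (subst sum.remove[OF _ assms]) (auto intro!: sum.cong)
  have Q: "2 * core_form t (y(i := k)) = int t * ((k + ?Y) * (k + ?Y + 1)) + int t * (k * (k - 1)) + 2 * (int i * k) + 2 * ?R" for k
  proof -
    have "even ((k + ?Y) * (k + ?Y + 1))" "even (k * (k - 1))" by auto
    then obtain a b where ab: "(k + ?Y) * (k + ?Y + 1) = 2 * a" "k * (k - 1) = 2 * b" by (elim evenE)
    show ?thesis unfolding core_form_eq[OF t] sumY sumR ab by simp
  qed
  have "2 * core_form t (y(i := k + d)) = 2 * (core_form t (y(i := k)) + int t * d * d
    + int t * d * (2 * k + ?Y) + int i * d)"
    unfolding distrib_left[of 2] Q by (simp add: algebra_simps)
  then show ?thesis by simp
qed

text \<open>The floor division gives a weight also to vectors whose core size is not congruent to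
  \<open>n\<close> modulo \<open>t\<close>. Only so does the weight vary slowly from one integer
  vector to the next; the congruence is imposed later by selecting residue classes.\<close>

definition core_weight :: "nat \<Rightarrow> nat \<Rightarrow> (nat \<Rightarrow> int) \<Rightarrow> real" where
  "core_weight t n y = (if core_form t y \<le> int n then real (multipartitions t (nat ((int n - core_form t y) div int t))) else 0)"

lemma core_weight_nonneg: "0 \<le> core_weight t n y" by (simp add: core_weight_def)

text \<open>One unit wider than the support found in \<open>core_weight_support\<close>, so the
  weight vanishes at both ends of each coordinate line.\<close>

definition core_box :: "nat \<Rightarrow> int set" where
  "core_box n = {- int n - 2..int n + 2}"

lemma core_weight_support:
  assumes "core_weight t n y \<noteq> 0" "i \<in> {1..<t}"
  shows "\<bar>y i\<bar> \<le> int n + 1"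
proof -
  have "core_form t y \<le> int n" using assms(1) by (auto simp: core_weight_def split: if_splits)
  moreover have "core_ext t y i = y i" using assms(2) by (simp add: core_ext_def)
  ultimately show ?thesis
    using abs_le_core_size[of i t "core_ext t y"] assms(2) by (auto simp: core_form_def)
qed

lemma sum_core_vectors:
  assumes "t > 0"
  shows "(\<Sum>x \<in> {x \<in> core_vectors t n. P (core_size t x)}. multipartitions t (nat ((int n - core_size t x) div int t)))
    = (\<Sum>y \<in> {y \<in> {1..<t} \<rightarrow>\<^sub>E core_box n. P (core_form t y)}. core_weight t n y)"
proof -
  let ?Y = "{y \<in> {1..<t} \<rightarrow>\<^sub>E core_box n. P (core_form t y) \<and> core_form t y \<le> int n}"
  have fin: "finite ({1..<t} \<rightarrow>\<^sub>E core_box n)" by (intro finite_PiE) (auto simp: core_box_def)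
  have ext: "core_ext t (restrict x {1..<t}) = x" if "x \<in> core_vectors t n" for x
  proof
    fix r
    have x: "x \<in> {..<t} \<rightarrow>\<^sub>E UNIV" "(\<Sum>r<t. x r) = 0" using that by (auto simp: core_vectors_def)
    have "(\<Sum>i\<in>{1..<t}. restrict x {1..<t} i) = (\<Sum>i\<in>{1..<t}. x i)" by simp
    then have "- (\<Sum>i\<in>{1..<t}. restrict x {1..<t} i) = x 0" using x(2) unfolding sum_lessThan_split_0[OF assms] by simp
    then show "core_ext t (restrict x {1..<t}) r = x r"
      using PiE_arb[OF x(1), of r] by (auto simp: core_ext_def)
  qed
  have "(\<Sum>x \<in> {x \<in> core_vectors t n. P (core_size t x)}. real (multipartitions t (nat ((int n - core_size t x) div int t))))
    = (\<Sum>y \<in> ?Y. core_weight t n y)"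
  proof (rule sum.reindex_bij_witness[of _ "core_ext t" "\<lambda>x. restrict x {1..<t}"])
    fix x assume x: "x \<in> {x \<in> core_vectors t n. P (core_size t x)}"
    then have e: "core_ext t (restrict x {1..<t}) = x" using ext by simp
    show "core_ext t (restrict x {1..<t}) = x" by (rule e)
    have f: "core_form t (restrict x {1..<t}) = core_size t x" unfolding core_form_def e ..
    have le: "core_size t x \<le> int n" using x by (simp add: core_vectors_def)
    have "\<bar>x i\<bar> \<le> int n + 1" if "i \<in> {1..<t}" for i
      using abs_le_core_size[of i t x] that le by auto
    then have "restrict x {1..<t} \<in> {1..<t} \<rightarrow>\<^sub>E core_box n" by (force simp: core_box_def abs_le_iff)
    then show "restrict x {1..<t} \<in> ?Y" using x f le by simp
    show "core_weight t n (restrict x {1..<t}) = real (multipartitions t (nat ((int n - core_size t x) div int t)))"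
      unfolding core_weight_def f using le by simp
  next
    fix y assume y: "y \<in> ?Y"
    show "restrict (core_ext t y) {1..<t} = y"
    proof
      fix r show "restrict (core_ext t y) {1..<t} r = y r"
        using y PiE_arb[of y "{1..<t}" "\<lambda>_. core_box n" r] by (auto simp: core_ext_def)
    qed
    show "core_ext t y \<in> {x \<in> core_vectors t n. P (core_size t x)}"
    proof -
      have "core_ext t y \<in> {..<t} \<rightarrow>\<^sub>E UNIV" unfolding core_ext_def by (rule restrict_PiE_iff[THEN iffD2]) simp
      moreover have "P (core_size t (core_ext t y))" "core_size t (core_ext t y) \<le> int n"
        using y by (simp_all add: core_form_def)
      ultimately show ?thesis
        unfolding core_vectors_def mem_Collect_eq using core_ext_sum[OF assms, of y] by (intro conjI)
    qed
  qed
  also have "\<dots> = (\<Sum>y \<in> {y \<in> {1..<t} \<rightarrow>\<^sub>E core_box n. P (core_form t y)}. core_weight t n y)"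
    by (rule sum.mono_neutral_left) (use fin in \<open>auto simp: core_weight_def\<close>)
  finally show ?thesis by simp
qed

section \<open>Variation of the weights along coordinate lines\<close>

lemma unimodal_variation:
  fixes f :: "int \<Rightarrow> real"
  assumes "\<And>k. 0 \<le> f k" "\<And>k. k \<ge> k0 \<Longrightarrow> f (k + 1) \<le> f k" "\<And>k. k < k0 \<Longrightarrow> f k \<le> f (k + 1)"
    and "finite A"
  shows "(\<Sum>k\<in>A. \<bar>f (k + 1) - f k\<bar>) \<le> 2 * f k0"
proof -
  \<comment> \<open>Both sides of the peak telescope; \<open>L\<close> below reaches far enough to
    cover \<open>A\<close>.\<close>
  have right: "(\<Sum>j<N. \<bar>f (k0 + int j + 1) - f (k0 + int j)\<bar>) = f k0 - f (k0 + int N)" for N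
  proof (induction N)
    case (Suc N)
    then show ?case using assms(2)[of "k0 + int N"] by (simp add: add_ac)
  qed simp
  have left: "(\<Sum>j<N. \<bar>f (k0 - int j) - f (k0 - int j - 1)\<bar>) = f k0 - f (k0 - int N)" for N
  proof (induction N)
    case (Suc N)
    have "k0 - int N - 1 = k0 - int (Suc N)" by simp
    then show ?case using Suc assms(3)[of "k0 - int N - 1"] by (simp add: algebra_simps)
  qed simp
  obtain L where L: "\<And>k. k \<in> A \<Longrightarrow> \<bar>k - k0\<bar> < int L"
  proof -
    define M where "M = Max (insert 0 ((\<lambda>k. \<bar>k - k0\<bar>) ` A))"
    have "\<bar>k - k0\<bar> \<le> M" if "k \<in> A" for k unfolding M_def using assms(4) that by (intro Max_ge) auto
    moreover have "0 \<le> M" unfolding M_def using assms(4) by (intro Max_ge) auto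
    ultimately show ?thesis by (intro that[of "nat (M + 1)"]) force
  qed
  let ?g = "\<lambda>k. \<bar>f (k + 1) - f k\<bar>"
  have "(\<Sum>k\<in>A. ?g k) \<le> (\<Sum>k\<in>(\<lambda>j. k0 + int j) ` {..<L} \<union> (\<lambda>j. k0 - int j - 1) ` {..<L}. ?g k)"
  proof (rule sum_mono2)
    show "A \<subseteq> (\<lambda>j. k0 + int j) ` {..<L} \<union> (\<lambda>j. k0 - int j - 1) ` {..<L}"
    proof
      fix k assume "k \<in> A"
      then have k: "\<bar>k - k0\<bar> < int L" by (rule L)
      show "k \<in> (\<lambda>j. k0 + int j) ` {..<L} \<union> (\<lambda>j. k0 - int j - 1) ` {..<L}"
      proof (cases "k0 \<le> k")
        case True
        then show ?thesis using k by (intro UnI1 image_eqI[of _ _ "nat (k - k0)"]) auto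
      next
        case False
        then show ?thesis using k by (intro UnI2 image_eqI[of _ _ "nat (k0 - k - 1)"]) auto
      qed
    qed
  qed auto
  also have "\<dots> = (\<Sum>k\<in>(\<lambda>j. k0 + int j) ` {..<L}. ?g k) + (\<Sum>k\<in>(\<lambda>j. k0 - int j - 1) ` {..<L}. ?g k)"
    by (rule sum.union_disjoint) auto
  also have "(\<Sum>k\<in>(\<lambda>j. k0 + int j) ` {..<L}. ?g k) = (\<Sum>j<L. \<bar>f (k0 + int j + 1) - f (k0 + int j)\<bar>)"
    by (subst sum.reindex) (auto simp: inj_on_def)
  also have "(\<Sum>k\<in>(\<lambda>j. k0 - int j - 1) ` {..<L}. ?g k) = (\<Sum>j<L. \<bar>f (k0 - int j) - f (k0 - int j - 1)\<bar>)"
    by (subst sum.reindex) (auto simp: inj_on_def)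
  finally show ?thesis unfolding right left using assms(1)[of "k0 + int L"] assms(1)[of "k0 - int L"] by linarith
qed

text \<open>Pairs \<open>k\<close> with \<open>k + 1\<close>; because \<open>f\<close> vanishes at
  the ends, the unmatched boundary points contribute nothing. The bound is the total variation,
  which is at most twice the peak for a unimodal function.\<close>

lemma residue_shift_bound:
  fixes f :: "int \<Rightarrow> real"
  assumes "f (- L) = 0" "f L = 0" "0 < L"
  shows "\<bar>(\<Sum>k | k \<in> {-L..L} \<and> [k = c] (mod m). f k) - (\<Sum>k | k \<in> {-L..L} \<and> [k = c + 1] (mod m). f k)\<bar>
    \<le> (\<Sum>k\<in>{-L..<L}. \<bar>f (k + 1) - f k\<bar>)"
proof -
  let ?A = "{k \<in> {-L..<L}. [k = c] (mod m)}"
  have 1: "(\<Sum>k | k \<in> {-L..L} \<and> [k = c] (mod m). f k) = (\<Sum>k\<in>?A. f k)"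
  proof (rule sum.mono_neutral_right)
    show "\<forall>i\<in>{k \<in> {-L..L}. [k = c] (mod m)} - ?A. f i = 0"
    proof
      fix i assume "i \<in> {k \<in> {-L..L}. [k = c] (mod m)} - ?A"
      then have "i = L" by auto
      then show "f i = 0" using assms(2) by simp
    qed
  qed (auto intro: finite_subset[of _ "{-L..L}"])
  have "(\<Sum>k | k \<in> {-L..L} \<and> [k = c + 1] (mod m). f k) = (\<Sum>k\<in>(\<lambda>k. k + 1) ` ?A. f k)"
  proof (rule sum.mono_neutral_right)
    show "\<forall>i\<in>{k \<in> {-L..L}. [k = c + 1] (mod m)} - (\<lambda>k. k + 1) ` ?A. f i = 0"
    proof
      fix i assume i: "i \<in> {k \<in> {-L..L}. [k = c + 1] (mod m)} - (\<lambda>k. k + 1) ` ?A"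
      have "i = - L"
      proof (rule ccontr)
        assume "i \<noteq> - L"
        have "[i = c + 1] (mod m)" using i by simp
        then have "[i - 1 = c] (mod m)" by (simp add: cong_iff_dvd_diff algebra_simps)
        then have "i - 1 \<in> ?A" using i \<open>i \<noteq> - L\<close> by simp
        then have "i \<in> (\<lambda>k. k + 1) ` ?A" by (intro image_eqI[of _ _ "i - 1"]) simp_all
        with i show False by simp
      qed
      then show "f i = 0" using assms(1) by simp
    qed
    show "(\<lambda>k. k + 1) ` ?A \<subseteq> {k \<in> {-L..L}. [k = c + 1] (mod m)}"
      by (auto simp: cong_iff_dvd_diff)
  qed (auto intro: finite_subset[of _ "{-L..L}"])
  also have "\<dots> = (\<Sum>k\<in>?A. f (k + 1))" by (subst sum.reindex) (auto simp: inj_on_def)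
  finally have 2: "(\<Sum>k | k \<in> {-L..L} \<and> [k = c + 1] (mod m). f k) = (\<Sum>k\<in>?A. f (k + 1))" .
  have "\<bar>(\<Sum>k\<in>?A. f k) - (\<Sum>k\<in>?A. f (k + 1))\<bar> \<le> (\<Sum>k\<in>?A. \<bar>f k - f (k + 1)\<bar>)"
    unfolding sum_subtractf[symmetric] by (rule sum_abs)
  also have "\<dots> \<le> (\<Sum>k\<in>{-L..<L}. \<bar>f (k + 1) - f k\<bar>)"
    by (subst abs_minus_commute, rule sum_mono2) auto
  finally show ?thesis unfolding 1 2 .
qed

text \<open>The variation is at most twice the peak value. If the quotient size at the peak is at
  least \<open>W\<close>, then \<open>J\<close> consecutive points carry at least half the peak
  weight, so the peak is at most \<open>2 / J\<close> times the sum along the line; otherwise it is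
  bounded by the constant \<open>multipartitions t W\<close>.\<close>

lemma core_weight_line:
  assumes t: "t > 1" and i: "i \<in> {1..<t}" and J: "J > 0"
    and W: "J * J + J \<le> W" "\<And>w s. w \<ge> W \<Longrightarrow> s \<le> J * J + J \<Longrightarrow> real (multipartitions t w) \<le> 2 * real (multipartitions t (w - s))"
  shows "(\<Sum>k\<in>{- (int n + 2)..<int n + 2}. \<bar>core_weight t n (y(i := k + 1)) - core_weight t n (y(i := k))\<bar>)
    \<le> 4 / real J * (\<Sum>k\<in>core_box n. core_weight t n (y(i := k))) + 2 * real (multipartitions t W)"
proof -
  let ?q = "\<lambda>k. core_form t (y(i := k))" and ?f = "\<lambda>k. core_weight t n (y(i := k))"
  have sg: "slowly_growing (multipartitions t)" using slowly_growing_multipartitions[of "t - 1"] t by simp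
  then have mono: "multipartitions t v \<le> multipartitions t w" if "v \<le> w" for v w
    using that by (auto simp: slowly_growing_def mono_def)
  have q0: "0 \<le> ?q k" for k unfolding core_form_def by (rule core_size_nonneg)
  obtain k0 where k0: "\<And>k. ?q k0 \<le> ?q k"
  proof -
    define k0 where "k0 = (ARG_MIN (\<lambda>k. nat (?q k)) k. True)"
    have "nat (?q k0) \<le> nat (?q k)" for k unfolding k0_def by (rule arg_min_nat_le) simp
    then show ?thesis using q0 by (intro that[of k0]) (metis nat_le_eq_zle q0 dual_order.trans nat_0_le order_refl)
  qed
  \<comment> \<open>The linear coefficient of the form at its integer minimum \<open>k0\<close>.
    Minimality against both neighbours gives \<open>\<bar>B\<bar> \<le> t\<close>, so the form is
    monotone on either side of \<open>k0\<close>.\<close>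
  define B where "B = 2 * int t * k0 + int t * (\<Sum>j\<in>{1..<t} - {i}. y j) + int i"
  have q: "?q (k0 + d) = ?q k0 + int t * d * d + B * d" for d
    unfolding core_form_line[OF i] B_def by (simp add: algebra_simps)
  have B: "\<bar>B\<bar> \<le> int t" using k0[of "k0 + 1"] k0[of "k0 + (-1)"] q[of 1] q[of "-1"] by simp
  have anti: "?f k \<le> ?f l" if "?q l \<le> ?q k" for k l
  proof (cases "?q k \<le> int n")
    case True
    have "nat ((int n - ?q k) div int t) \<le> nat ((int n - ?q l) div int t)"
      using that t by (intro nat_mono zdiv_mono1) auto
    then show ?thesis using True that mono by (simp add: core_weight_def)
  next
    case False then show ?thesis by (simp add: core_weight_def)
  qed
  have up: "?f (k + 1) \<le> ?f k" if "k \<ge> k0" for k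
  proof (rule anti)
    define d where "d = k - k0"
    have d: "0 \<le> d" "k = k0 + d" "k + 1 = k0 + (d + 1)" using that by (auto simp: d_def)
    have "0 \<le> 2 * int t * d + (int t + B)" using d(1) B by simp
    then show "?q k \<le> ?q (k + 1)" unfolding d(3) unfolding d(2) q by (simp add: algebra_simps)
  qed
  have down: "?f k \<le> ?f (k + 1)" if "k < k0" for k
  proof (rule anti)
    define d where "d = k0 - k"
    have d: "1 \<le> d" "k = k0 + (- d)" "k + 1 = k0 + (1 - d)" using that by (auto simp: d_def)
    have "int t * 1 \<le> int t * d" using d(1) by (intro mult_left_mono) auto
    then have "0 \<le> 2 * (int t * d) - (int t + B)" using B by linarith
    then show "?q (k + 1) \<le> ?q k" unfolding d(3) unfolding d(2) q by (simp add: algebra_simps)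
  qed
  have var: "(\<Sum>k\<in>{- (int n + 2)..<int n + 2}. \<bar>?f (k + 1) - ?f k\<bar>) \<le> 2 * ?f k0"
    by (rule unimodal_variation[of ?f k0]) (use up down core_weight_nonneg in auto)
  have S0: "0 \<le> (\<Sum>k\<in>core_box n. ?f k)" by (intro sum_nonneg core_weight_nonneg)
  have "2 * ?f k0 \<le> 4 / real J * (\<Sum>k\<in>core_box n. ?f k) + 2 * real (multipartitions t W)"
  proof (cases "?q k0 \<le> int n")
    case False
    then have "?f k0 = 0" by (simp add: core_weight_def)
    then show ?thesis using S0 by simp
  next
    case le: True
    define w0 where "w0 = nat ((int n - ?q k0) div int t)"
    have f0: "?f k0 = real (multipartitions t w0)" using le by (simp add: core_weight_def w0_def)
    show ?thesis
    proof (cases "W \<le> w0")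
      case False
      then have "?f k0 \<le> real (multipartitions t W)" unfolding f0 using mono by simp
      then show ?thesis using S0 by (simp add: add_increasing)
    next
      case True
      \<comment> \<open>\<open>j\<close> steps from the minimum raise the form by at most
        \<open>t * (j * j + j)\<close>, hence lower the quotient size by at most
        \<open>j * j + j\<close>; this is the origin of the range \<open>J * J + J\<close> of
        shifts.\<close>
      have half: "?f k0 \<le> 2 * ?f (k0 + int j)" if "j < J" for j
      proof -
        have jj: "j * j + j \<le> J * J + J" using that by (intro add_mono mult_mono) auto
        have "B * int j \<le> int t * int j" using B by (intro mult_right_mono) auto
        then have qj: "?q (k0 + int j) \<le> ?q k0 + int t * int (j * j + j)"
          unfolding q by (simp add: algebra_simps)
        have w0: "int w0 = (int n - ?q k0) div int t" using le t by (simp add: w0_def pos_imp_zdiv_nonneg_iff)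
        have "int w0 - int (j * j + j) = (int n - ?q k0 + (- int (j * j + j)) * int t) div int t"
        proof -
          have "int t \<noteq> 0" using t by simp
          then show ?thesis
            unfolding w0 using div_mult_self1[of "int t" "int n - ?q k0" "- int (j * j + j)"] by linarith
        qed
        also have "\<dots> \<le> (int n - ?q (k0 + int j)) div int t"
        proof (rule zdiv_mono1)
          have "int n - ?q k0 + (- int (j * j + j)) * int t = int n - (?q k0 + int t * int (j * j + j))"
            by (simp add: algebra_simps)
          then show "int n - ?q k0 + (- int (j * j + j)) * int t \<le> int n - ?q (k0 + int j)" using qj by linarith
        qed (use t in simp)
        finally have le': "int w0 - int (j * j + j) \<le> (int n - ?q (k0 + int j)) div int t" .
        have "j * j + j \<le> w0" using jj W(1) True by linarith
        then have "0 \<le> (int n - ?q (k0 + int j)) div int t" using le' by linarith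
        then have "?q (k0 + int j) \<le> int n" using t by (simp add: pos_imp_zdiv_nonneg_iff)
        moreover have "w0 - (j * j + j) \<le> nat ((int n - ?q (k0 + int j)) div int t)" using le' by linarith
        ultimately have "real (multipartitions t (w0 - (j * j + j))) \<le> ?f (k0 + int j)"
          using mono by (simp add: core_weight_def)
        then show ?thesis using W(2)[OF True jj] unfolding f0 by linarith
      qed
      have pos: "0 < ?f k0" unfolding f0 using sg by (simp add: slowly_growing_def)
      have "real J * ?f k0 = (\<Sum>j<J. ?f k0)" by simp
      also have "\<dots> \<le> (\<Sum>j<J. 2 * ?f (k0 + int j))" by (intro sum_mono half) simp
      also have "\<dots> = 2 * (\<Sum>k\<in>(\<lambda>j. k0 + int j) ` {..<J}. ?f k)"
        by (subst sum.reindex) (auto simp: inj_on_def sum_distrib_left)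
      also have "(\<Sum>k\<in>(\<lambda>j. k0 + int j) ` {..<J}. ?f k) \<le> (\<Sum>k\<in>core_box n. ?f k)"
      proof (rule sum_mono2)
        show "(\<lambda>j. k0 + int j) ` {..<J} \<subseteq> core_box n"
        proof
          fix k assume "k \<in> (\<lambda>j. k0 + int j) ` {..<J}"
          then have "?f k \<noteq> 0" using half pos by force
          then show "k \<in> core_box n" using core_weight_support[of t n "y(i := k)" i] i by (auto simp: core_box_def)
        qed
      qed (auto simp: core_box_def core_weight_nonneg)
      finally have "?f k0 \<le> 2 * (\<Sum>k\<in>core_box n. ?f k) / real J" using J by (simp add: field_simps)
      then show ?thesis by (simp add: add_increasing2)
    qed
  qed
  with var show ?thesis by linarith
qed

lemma sum_PiE_insert:
  assumes "i \<notin> I"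
  shows "(\<Sum>y\<in>PiE (insert i I) B. h y) = (\<Sum>z\<in>PiE I B. \<Sum>k\<in>B i. h (z(i := k)))"
proof -
  have "(\<Sum>y\<in>PiE (insert i I) B. h y) = (\<Sum>p\<in>B i \<times> PiE I B. h ((\<lambda>(k, z). z(i := k)) p))"
    unfolding PiE_insert_eq by (rule sum.reindex[OF inj_combinator[OF assms], unfolded o_def])
  also have "\<dots> = (\<Sum>k\<in>B i. \<Sum>z\<in>PiE I B. h (z(i := k)))"
    unfolding sum.cartesian_product by (simp add: case_prod_unfold)
  also have "\<dots> = (\<Sum>z\<in>PiE I B. \<Sum>k\<in>B i. h (z(i := k)))" by (rule sum.swap)
  finally show ?thesis .
qed

section \<open>Comparison of the residue classes\<close>

definition class_weight :: "nat \<Rightarrow> int \<Rightarrow> nat \<Rightarrow> (nat \<Rightarrow> int) \<Rightarrow> real" where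
  "class_weight t m n \<rho> = (\<Sum>y\<in>PiE {1..<t} (\<lambda>i. {k \<in> core_box n. [k = \<rho> i] (mod m)}). core_weight t n y)"

definition total_weight :: "nat \<Rightarrow> nat \<Rightarrow> real" where
  "total_weight t n = (\<Sum>y\<in>PiE {1..<t} (\<lambda>_. core_box n). core_weight t n y)"

lemma card_core_box: "card (core_box n) = 2 * n + 5"
  by (auto simp: core_box_def)

lemma class_weight_cong:
  assumes "\<And>i. i \<in> {1..<t} \<Longrightarrow> \<rho> i = \<sigma> i"
  shows "class_weight t m n \<rho> = class_weight t m n \<sigma>"
  unfolding class_weight_def using assms by (intro sum.cong PiE_cong) auto

text \<open>Adds up the line estimate over the remaining coordinates: the main error is a share
  \<open>4 / J\<close> of the total, and the constant is paid once per line, of which there are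
  polynomially many in \<open>n\<close>.\<close>

lemma class_weight_step:
  assumes t: "t > 1" and i: "i \<in> {1..<t}" and J: "J > 0"
    and W: "J * J + J \<le> W" "\<And>w s. w \<ge> W \<Longrightarrow> s \<le> J * J + J \<Longrightarrow> real (multipartitions t w) \<le> 2 * real (multipartitions t (w - s))"
  shows "\<bar>class_weight t m n \<rho> - class_weight t m n (\<rho>(i := \<rho> i + 1))\<bar>
    \<le> 4 / real J * total_weight t n + 2 * real (multipartitions t W) * real (2 * n + 5) ^ t"
proof -
  let ?I = "{1..<t} - {i}"
  have I: "{1..<t} = insert i ?I" "i \<notin> ?I" using i by auto
  let ?Z = "\<lambda>\<rho> j. {k \<in> core_box n. [k = \<rho> j] (mod m)}"
  let ?h = "core_weight t n"
  let ?A = "PiE ?I (?Z \<rho>)"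
  have fin: "finite (PiE ?I (\<lambda>_. core_box n))" by (intro finite_PiE) (auto simp: core_box_def)
  have sub: "?A \<subseteq> PiE ?I (\<lambda>_. core_box n)" by (intro PiE_mono) auto
  have c1: "class_weight t m n \<rho> = (\<Sum>z\<in>?A. \<Sum>k | k \<in> core_box n \<and> [k = \<rho> i] (mod m). ?h (z(i := k)))"
    unfolding class_weight_def by (subst I(1), subst sum_PiE_insert[OF I(2)]) simp
  have "PiE ?I (?Z (\<rho>(i := \<rho> i + 1))) = ?A" by (intro PiE_cong) auto
  then have c2: "class_weight t m n (\<rho>(i := \<rho> i + 1)) = (\<Sum>z\<in>?A. \<Sum>k | k \<in> core_box n \<and> [k = \<rho> i + 1] (mod m). ?h (z(i := k)))"
    unfolding class_weight_def by (subst I(1), subst sum_PiE_insert[OF I(2)]) simp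
  have box: "core_box n = {- (int n + 2)..int n + 2}" by (auto simp: core_box_def)
  have zero: "?h (z(i := - (int n + 2))) = 0" "?h (z(i := int n + 2)) = 0" for z
    using core_weight_support[of t n "z(i := - (int n + 2))" i] core_weight_support[of t n "z(i := int n + 2)" i] i
    by (auto simp del: core_weight_support)
  have line: "\<bar>(\<Sum>k | k \<in> core_box n \<and> [k = \<rho> i] (mod m). ?h (z(i := k))) - (\<Sum>k | k \<in> core_box n \<and> [k = \<rho> i + 1] (mod m). ?h (z(i := k)))\<bar>
      \<le> 4 / real J * (\<Sum>k\<in>core_box n. ?h (z(i := k))) + 2 * real (multipartitions t W)" for z
  proof -
    have "\<bar>(\<Sum>k | k \<in> core_box n \<and> [k = \<rho> i] (mod m). ?h (z(i := k))) - (\<Sum>k | k \<in> core_box n \<and> [k = \<rho> i + 1] (mod m). ?h (z(i := k)))\<bar>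
      \<le> (\<Sum>k\<in>{- (int n + 2)..<int n + 2}. \<bar>?h (z(i := k + 1)) - ?h (z(i := k))\<bar>)"
      unfolding box by (rule residue_shift_bound) (use zero in auto)
    also have "\<dots> \<le> 4 / real J * (\<Sum>k\<in>core_box n. ?h (z(i := k))) + 2 * real (multipartitions t W)"
      by (rule core_weight_line[OF t i J W])
    finally show ?thesis .
  qed
  have "\<bar>class_weight t m n \<rho> - class_weight t m n (\<rho>(i := \<rho> i + 1))\<bar>
    \<le> (\<Sum>z\<in>?A. 4 / real J * (\<Sum>k\<in>core_box n. ?h (z(i := k))) + 2 * real (multipartitions t W))"
    unfolding c1 c2 sum_subtractf[symmetric] by (rule order_trans[OF sum_abs sum_mono[OF line]])
  also have "\<dots> \<le> (\<Sum>z\<in>PiE ?I (\<lambda>_. core_box n). 4 / real J * (\<Sum>k\<in>core_box n. ?h (z(i := k))) + 2 * real (multipartitions t W))"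
  proof (rule sum_mono2[OF fin sub])
    show "0 \<le> 4 / real J * (\<Sum>k\<in>core_box n. ?h (z(i := k))) + 2 * real (multipartitions t W)" for z
      by (intro add_nonneg_nonneg mult_nonneg_nonneg sum_nonneg core_weight_nonneg) simp_all
  qed
  also have "\<dots> = 4 / real J * total_weight t n + 2 * real (multipartitions t W) * real (card (PiE ?I (\<lambda>_. core_box n)))"
    unfolding sum.distrib sum_distrib_left[symmetric] total_weight_def
    by (subst I(1), subst sum_PiE_insert[OF I(2)]) simp
  finally have main: "\<bar>class_weight t m n \<rho> - class_weight t m n (\<rho>(i := \<rho> i + 1))\<bar>
    \<le> 4 / real J * total_weight t n + 2 * real (multipartitions t W) * real (card (PiE ?I (\<lambda>_. core_box n)))" .
  have card: "card (PiE ?I (\<lambda>_. core_box n)) = (2 * n + 5) ^ card ?I"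
    by (simp add: card_PiE card_core_box)
  have "real (card (PiE ?I (\<lambda>_. core_box n))) \<le> real (2 * n + 5) ^ t"
  proof -
    have "card ?I \<le> card {1..<t}" by (intro card_mono) auto
    then have "real (2 * n + 5) ^ card ?I \<le> real (2 * n + 5) ^ t" by (intro power_increasing) auto
    then show ?thesis unfolding card by (simp only: of_nat_power)
  qed
  then have "2 * real (multipartitions t W) * real (card (PiE ?I (\<lambda>_. core_box n)))
      \<le> 2 * real (multipartitions t W) * real (2 * n + 5) ^ t"
    by (intro mult_left_mono) auto
  with main show ?thesis by linarith
qed

lemma core_form_zero: "t > 0 \<Longrightarrow> core_form t (\<lambda>i\<in>{1..<t}. 0) = 0"
  by (simp add: core_form_eq)

lemma total_weight_ge:
  assumes "t > 1" shows "real (multipartitions t (n div t)) \<le> total_weight t n"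
proof -
  have "core_weight t n (\<lambda>i\<in>{1..<t}. 0) \<le> total_weight t n"
    unfolding total_weight_def
    by (rule member_le_sum) (auto simp: core_weight_nonneg core_box_def intro!: finite_PiE)
  moreover have "core_weight t n (\<lambda>i\<in>{1..<t}. 0) = real (multipartitions t (n div t))"
    unfolding core_weight_def using assms core_form_zero[of t] by (simp add: nat_div_distrib)
  ultimately show ?thesis by simp
qed

lemma multipartitions_pos: "t > 0 \<Longrightarrow> 0 < multipartitions t w"
  using slowly_growing_multipartitions[of "t - 1"] by (simp add: slowly_growing_def)

lemma total_weight_pos: "t > 1 \<Longrightarrow> 0 < total_weight t n"
  using total_weight_ge[of t n] multipartitions_pos[of t "n div t"] by linarith

text \<open>The zero vector alone contributes at least the number of partitions of
  \<open>n div t\<close>, which outgrows every polynomial.\<close>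

lemma polynomial_over_total_weight:
  assumes t: "t > 1"
  shows "(\<lambda>n. real (2 * n + 5) ^ t / total_weight t n) \<longlonglongrightarrow> 0"
proof (rule Lim_null_comparison)
  \<comment> \<open>From \<open>2 * n + 5 \<le> 2 * (2 * t + 5) * (n div t)\<close> for
    \<open>n \<ge> t\<close>.\<close>
  let ?C = "real (2 * (2 * t + 5)) ^ t"
  have fl: "filterlim (\<lambda>n. n div t) at_top sequentially"
    unfolding filterlim_at_top
  proof
    fix Z show "\<forall>\<^sub>F n in sequentially. Z \<le> n div t"
      by (rule eventually_sequentiallyI[of "Z * t"]) (use t in \<open>simp add: less_eq_div_iff_mult_less_eq\<close>)
  qed
  have "(\<lambda>n. ?C * (real (n div t) ^ t / real (card (partitions_of (n div t))))) \<longlonglongrightarrow> ?C * 0"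
    by (intro tendsto_mult tendsto_const filterlim_compose[OF polynomial_over_partitions fl])
  then show "(\<lambda>n. ?C * (real (n div t) ^ t / real (card (partitions_of (n div t))))) \<longlonglongrightarrow> 0" by simp
  show "\<forall>\<^sub>F n in sequentially. norm (real (2 * n + 5) ^ t / total_weight t n)
      \<le> ?C * (real (n div t) ^ t / real (card (partitions_of (n div t))))"
    using eventually_ge_at_top[of t]
  proof eventually_elim
    fix n assume n: "t \<le> n"
    let ?w = "n div t"
    have w: "1 \<le> ?w" using n t by (simp add: less_eq_div_iff_mult_less_eq)
    have "n < t * (?w + 1)" using t by (metis Suc_eq_plus1 dividend_less_times_div div_greater_zero_iff less_le_trans mult_Suc_right n zero_less_one add.commute less_trans)
    then have "2 * n + 5 \<le> 2 * (t * (?w + 1)) + 5 * 1" by simp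
    also have "\<dots> \<le> 2 * (t * (?w + ?w)) + 5 * (2 * ?w)" using w by (intro add_mono mult_mono) auto
    also have "\<dots> = 2 * (2 * t + 5) * ?w" by (simp add: algebra_simps)
    finally have "real (2 * n + 5) \<le> real (2 * (2 * t + 5)) * real ?w" by (metis of_nat_le_iff of_nat_mult)
    then have "real (2 * n + 5) ^ t \<le> ?C * real ?w ^ t"
      unfolding power_mult_distrib[symmetric] by (intro power_mono) auto
    moreover have "real (card (partitions_of ?w)) \<le> total_weight t n"
    proof -
      have "real (card (partitions_of ?w)) \<le> real (multipartitions t ?w)"
        using partitions_le_multipartitions[of ?w "t - 1"] t by simp
      then show ?thesis using total_weight_ge[OF t, of n] by linarith
    qed
    moreover have "0 < real (card (partitions_of ?w))" using card_partitions_pos by simp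
    ultimately have "real (2 * n + 5) ^ t / total_weight t n \<le> ?C * real ?w ^ t / real (card (partitions_of ?w))"
      by (intro frac_le) auto
    then show "norm (real (2 * n + 5) ^ t / total_weight t n) \<le> ?C * (real ?w ^ t / real (card (partitions_of ?w)))"
      using total_weight_pos[OF t, of n] by simp
  qed
qed

definition class_equiv :: "nat \<Rightarrow> int \<Rightarrow> (nat \<Rightarrow> int) \<Rightarrow> (nat \<Rightarrow> int) \<Rightarrow> bool" where
  "class_equiv t m \<rho> \<sigma> \<longleftrightarrow> (\<lambda>n. (class_weight t m n \<rho> - class_weight t m n \<sigma>) / total_weight t n) \<longlonglongrightarrow> 0"

lemma class_equiv_refl: "class_equiv t m \<rho> \<rho>" by (simp add: class_equiv_def)

lemma class_equiv_sym: "class_equiv t m \<rho> \<sigma> \<Longrightarrow> class_equiv t m \<sigma> \<rho>"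
  unfolding class_equiv_def by (drule tendsto_minus) (simp add: diff_divide_distrib)

lemma class_equiv_trans: "class_equiv t m \<rho> \<sigma> \<Longrightarrow> class_equiv t m \<sigma> \<tau> \<Longrightarrow> class_equiv t m \<rho> \<tau>"
  unfolding class_equiv_def by (drule (1) tendsto_add) (simp add: diff_divide_distrib)

text \<open>The order of choices matters: \<open>J\<close> from the accuracy, then the threshold
  from \<open>J\<close> by slow growth, and only then \<open>n\<close>. So the polynomial term has a
  fixed coefficient and vanishes against the total.\<close>

lemma class_equiv_step:
  assumes t: "t > 1" and i: "i \<in> {1..<t}"
  shows "class_equiv t m \<rho> (\<rho>(i := \<rho> i + 1))"
  unfolding class_equiv_def
proof (rule tendstoI)
  fix \<eta> :: real assume \<eta>: "0 < \<eta>"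
  define J where "J = nat \<lceil>8 / \<eta>\<rceil> + 1"
  have J: "J > 0" "8 / \<eta> < real J" unfolding J_def by (simp, linarith)
  then have J2: "4 / real J < \<eta> / 2" using \<eta> by (simp add: field_simps)
  have sg: "slowly_growing (multipartitions t)" using slowly_growing_multipartitions[of "t - 1"] t by simp
  obtain W where W: "\<And>w s. w \<ge> W \<Longrightarrow> s \<le> J * J + J \<Longrightarrow> real (multipartitions t w) \<le> 2 * real (multipartitions t (w - s))"
    using slowly_growing_shift[OF sg, of "J * J + J"] unfolding eventually_sequentially by blast
  define V where "V = max W (J * J + J)"
  have V: "J * J + J \<le> V" "\<And>w s. w \<ge> V \<Longrightarrow> s \<le> J * J + J \<Longrightarrow> real (multipartitions t w) \<le> 2 * real (multipartitions t (w - s))"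
    using W by (auto simp: V_def)
  have "(\<lambda>n. 2 * real (multipartitions t V) * (real (2 * n + 5) ^ t / total_weight t n)) \<longlonglongrightarrow> 2 * real (multipartitions t V) * 0"
    by (intro tendsto_mult tendsto_const polynomial_over_total_weight[OF t])
  then have "\<forall>\<^sub>F n in sequentially. 2 * real (multipartitions t V) * (real (2 * n + 5) ^ t / total_weight t n) < \<eta> / 2"
    by (rule order_tendstoD) (use \<eta> in simp)
  then show "\<forall>\<^sub>F n in sequentially. dist ((class_weight t m n \<rho> - class_weight t m n (\<rho>(i := \<rho> i + 1))) / total_weight t n) 0 < \<eta>"
  proof eventually_elim
    fix n assume small: "2 * real (multipartitions t V) * (real (2 * n + 5) ^ t / total_weight t n) < \<eta> / 2"
    have T: "0 < total_weight t n" by (rule total_weight_pos[OF t])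
    have "\<bar>class_weight t m n \<rho> - class_weight t m n (\<rho>(i := \<rho> i + 1))\<bar> / total_weight t n
      \<le> (4 / real J * total_weight t n + 2 * real (multipartitions t V) * real (2 * n + 5) ^ t) / total_weight t n"
      using T by (intro divide_right_mono class_weight_step[OF t i J(1) V]) auto
    also have "\<dots> = 4 / real J + 2 * real (multipartitions t V) * (real (2 * n + 5) ^ t / total_weight t n)"
      using T by (simp add: add_divide_distrib)
    also have "\<dots> < \<eta>" using small J2 by linarith
    finally show "dist ((class_weight t m n \<rho> - class_weight t m n (\<rho>(i := \<rho> i + 1))) / total_weight t n) 0 < \<eta>"
      using T by (simp add: abs_divide)
  qed
qed

lemma class_equiv_coordinate:
  assumes t: "t > 1" and i: "i \<in> {1..<t}"
  shows "class_equiv t m \<rho> (\<rho>(i := c))"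
proof -
  have steps: "class_equiv t m \<rho> (\<rho>(i := \<rho> i + int k))" for \<rho> k
  proof (induction k)
    case (Suc k)
    have "(\<rho>(i := \<rho> i + int k))(i := (\<rho>(i := \<rho> i + int k)) i + 1) = \<rho>(i := \<rho> i + int (Suc k))" by auto
    then show ?case using class_equiv_trans[OF Suc class_equiv_step[OF t i, of m "\<rho>(i := \<rho> i + int k)"]] by (simp only:)
  qed (simp add: class_equiv_refl)
  show ?thesis
  proof (cases "\<rho> i \<le> c")
    case True
    then show ?thesis using steps[of \<rho> "nat (c - \<rho> i)"] by simp
  next
    case False
    then show ?thesis using class_equiv_sym[OF steps[of "\<rho>(i := c)" "nat (\<rho> i - c)"]] by simp
  qed
qed

lemma class_equiv_all:
  assumes t: "t > 1" shows "class_equiv t m \<rho> \<sigma>"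
proof -
  have "class_equiv t m \<rho> (\<lambda>i. if i \<in> A then \<sigma> i else \<rho> i)" if "A \<subseteq> {1..<t}" for A
    using finite_subset[OF that finite_atLeastLessThan] that
  proof (induction A rule: finite_induct)
    case (insert i A)
    let ?\<tau> = "\<lambda>j. if j \<in> A then \<sigma> j else \<rho> j"
    have "?\<tau>(i := \<sigma> i) = (\<lambda>j. if j \<in> insert i A then \<sigma> j else \<rho> j)" by auto
    then show ?case
      using class_equiv_trans[OF _ class_equiv_coordinate[OF t, of i m ?\<tau> "\<sigma> i"]] insert by simp
  qed (simp add: class_equiv_refl)
  from this[of "{1..<t}"] have "class_equiv t m \<rho> (\<lambda>i. if i \<in> {1..<t} then \<sigma> i else \<rho> i)" by simp
  moreover have "class_weight t m n (\<lambda>i. if i \<in> {1..<t} then \<sigma> i else \<rho> i) = class_weight t m n \<sigma>" for n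
    by (rule class_weight_cong) simp
  ultimately show ?thesis by (simp add: class_equiv_def)
qed

abbreviation residue_vectors :: "nat \<Rightarrow> int \<Rightarrow> (nat \<Rightarrow> int) set" where
  "residue_vectors t m \<equiv> {1..<t} \<rightarrow>\<^sub>E {0..<m}"

lemma sum_core_weight_classes:
  assumes m: "m > 0" and P: "\<And>y z. (\<And>i. i \<in> {1..<t} \<Longrightarrow> [y i = z i] (mod m)) \<Longrightarrow> P y \<longleftrightarrow> P z"
  shows "(\<Sum>y \<in> {y \<in> {1..<t} \<rightarrow>\<^sub>E core_box n. P y}. core_weight t n y)
    = (\<Sum>\<rho> \<in> {\<rho> \<in> residue_vectors t m. P \<rho>}. class_weight t m n \<rho>)"
proof -
  let ?S = "{y \<in> {1..<t} \<rightarrow>\<^sub>E core_box n. P y}" and ?T = "{\<rho> \<in> residue_vectors t m. P \<rho>}"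
  let ?g = "\<lambda>y. \<lambda>i\<in>{1..<t}. y i mod m"
  have finS: "finite ?S" and finT: "finite ?T" by (auto intro!: finite_PiE simp: core_box_def)
  have Pg: "P (?g y) \<longleftrightarrow> P y" for y by (rule P) (simp add: cong_def)
  have "?g ` ?S \<subseteq> ?T" using m Pg by (auto simp: PiE_iff)
  then have "(\<Sum>\<rho>\<in>?T. \<Sum>y | y \<in> ?S \<and> ?g y = \<rho>. core_weight t n y) = (\<Sum>y\<in>?S. core_weight t n y)"
    by (rule sum.group[OF finS finT])
  moreover have "{y. y \<in> ?S \<and> ?g y = \<rho>} = PiE {1..<t} (\<lambda>i. {k \<in> core_box n. [k = \<rho> i] (mod m)})" if "\<rho> \<in> ?T" for \<rho>
  proof
    show "{y. y \<in> ?S \<and> ?g y = \<rho>} \<subseteq> PiE {1..<t} (\<lambda>i. {k \<in> core_box n. [k = \<rho> i] (mod m)})"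
    proof
      fix y assume y: "y \<in> {y. y \<in> ?S \<and> ?g y = \<rho>}"
      then have "\<rho> i = y i mod m" if "i \<in> {1..<t}" for i using that by auto
      then have "[y i = \<rho> i] (mod m)" if "i \<in> {1..<t}" for i using that by (simp add: cong_def)
      then show "y \<in> PiE {1..<t} (\<lambda>i. {k \<in> core_box n. [k = \<rho> i] (mod m)})" using y by (simp add: PiE_iff)
    qed
    show "PiE {1..<t} (\<lambda>i. {k \<in> core_box n. [k = \<rho> i] (mod m)}) \<subseteq> {y. y \<in> ?S \<and> ?g y = \<rho>}"
    proof
      fix y assume y: "y \<in> PiE {1..<t} (\<lambda>i. {k \<in> core_box n. [k = \<rho> i] (mod m)})"
      have c: "[y i = \<rho> i] (mod m)" if "i \<in> {1..<t}" for i using y that by (auto simp: PiE_iff)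
      have "P y" using P[of y \<rho>] c \<open>\<rho> \<in> ?T\<close> by simp
      moreover have "?g y = \<rho>"
      proof (rule PiE_ext[of _ "{1..<t}" "\<lambda>_. UNIV"])
        fix i assume i: "i \<in> {1..<t}"
        have "\<rho> i \<in> {0..<m}" using \<open>\<rho> \<in> ?T\<close> i by (auto simp: PiE_iff)
        then have "\<rho> i mod m = \<rho> i" by simp
        moreover have "y i mod m = \<rho> i mod m" using c[OF i] unfolding cong_iff_dvd_diff mod_eq_dvd_iff .
        ultimately show "?g y i = \<rho> i" using i by simp
      qed (use \<open>\<rho> \<in> ?T\<close> in \<open>auto simp: PiE_iff\<close>)
      ultimately show "y \<in> {y. y \<in> ?S \<and> ?g y = \<rho>}" using y by (simp add: PiE_iff)
    qed
  qed
  ultimately show ?thesis unfolding class_weight_def by simp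
qed

text \<open>The shares of the finitely many classes are asymptotically equal and add up to
  1.\<close>

lemma class_weight_tendsto:
  assumes t: "t > 1" and m: "m > 0"
  shows "(\<lambda>n. class_weight t m n \<rho> / total_weight t n) \<longlonglongrightarrow> 1 / real_of_int m ^ (t - 1)"
proof -
  let ?R = "residue_vectors t m"
  let ?c = "real (card ?R)"
  have c: "?c = real_of_int m ^ (t - 1)" using m by (simp add: card_PiE)
  then have cpos: "0 < ?c" using m by simp
  have total: "total_weight t n = (\<Sum>\<sigma>\<in>?R. class_weight t m n \<sigma>)" for n
    using sum_core_weight_classes[OF m, of t "\<lambda>_. True" n] by (simp add: total_weight_def)
  have "(\<lambda>n. \<Sum>\<sigma>\<in>?R. (class_weight t m n \<rho> - class_weight t m n \<sigma>) / total_weight t n) \<longlonglongrightarrow> (\<Sum>\<sigma>\<in>?R. 0)"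
    by (rule tendsto_sum) (use class_equiv_all[OF t] in \<open>simp add: class_equiv_def\<close>)
  moreover have "(\<Sum>\<sigma>\<in>?R. (class_weight t m n \<rho> - class_weight t m n \<sigma>) / total_weight t n) = ?c * (class_weight t m n \<rho> / total_weight t n) - 1" for n
    unfolding sum_divide_distrib[symmetric] sum_subtractf total[symmetric]
    using total_weight_pos[OF t, of n] by (simp add: diff_divide_distrib)
  ultimately have "(\<lambda>n. ?c * (class_weight t m n \<rho> / total_weight t n) - 1) \<longlonglongrightarrow> 0" by simp
  then have "(\<lambda>n. (?c * (class_weight t m n \<rho> / total_weight t n) - 1 + 1) / ?c) \<longlonglongrightarrow> (0 + 1) / ?c"
    using cpos by (intro tendsto_intros) auto
  moreover have "(?c * x - 1 + 1) / ?c = x" for x using cpos by simp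
  ultimately show ?thesis by (simp only: c add_0_left)
qed

text \<open>The condition may vary with \<open>n\<close>, so a difference tends to 0 where a limit
  need not exist. Bounding by the sum of the errors of all classes makes the estimate uniform in the
  condition.\<close>

lemma weighted_residue_density:
  assumes t: "t > 1" and m: "m > 0"
    and P: "\<And>n y z. (\<And>i. i \<in> {1..<t} \<Longrightarrow> [y i = z i] (mod m)) \<Longrightarrow> P n y \<longleftrightarrow> P n z"
  shows "(\<lambda>n. (\<Sum>y \<in> {y \<in> {1..<t} \<rightarrow>\<^sub>E core_box n. P n y}. core_weight t n y) / total_weight t n
    - real (card {\<rho> \<in> residue_vectors t m. P n \<rho>}) / real_of_int m ^ (t - 1)) \<longlonglongrightarrow> 0"
proof (rule Lim_null_comparison)
  let ?R = "residue_vectors t m"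
  let ?d = "\<lambda>n \<rho>. class_weight t m n \<rho> / total_weight t n - 1 / real_of_int m ^ (t - 1)"
  have fin: "finite ?R" by (intro finite_PiE) auto
  have "(\<lambda>n. ?d n \<rho>) \<longlonglongrightarrow> 0" for \<rho>
    using LIM_zero[OF class_weight_tendsto[OF t m]] by simp
  then have "(\<lambda>n. \<Sum>\<rho>\<in>?R. \<bar>?d n \<rho>\<bar>) \<longlonglongrightarrow> (\<Sum>\<rho>\<in>?R. 0)"
    by (intro tendsto_sum tendsto_rabs_zero)
  then show "(\<lambda>n. \<Sum>\<rho>\<in>?R. \<bar>?d n \<rho>\<bar>) \<longlonglongrightarrow> 0" by simp
  show "\<forall>\<^sub>F n in sequentially. norm ((\<Sum>y \<in> {y \<in> {1..<t} \<rightarrow>\<^sub>E core_box n. P n y}. core_weight t n y) / total_weight t n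
    - real (card {\<rho> \<in> ?R. P n \<rho>}) / real_of_int m ^ (t - 1)) \<le> (\<Sum>\<rho>\<in>?R. \<bar>?d n \<rho>\<bar>)"
  proof (rule eventuallyI)
    fix n
    have "(\<Sum>y \<in> {y \<in> {1..<t} \<rightarrow>\<^sub>E core_box n. P n y}. core_weight t n y) = (\<Sum>\<rho> \<in> {\<rho> \<in> ?R. P n \<rho>}. class_weight t m n \<rho>)"
      by (rule sum_core_weight_classes[OF m P])
    then have "(\<Sum>y \<in> {y \<in> {1..<t} \<rightarrow>\<^sub>E core_box n. P n y}. core_weight t n y) / total_weight t n
      - real (card {\<rho> \<in> ?R. P n \<rho>}) / real_of_int m ^ (t - 1) = (\<Sum>\<rho> \<in> {\<rho> \<in> ?R. P n \<rho>}. ?d n \<rho>)"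
      by (simp add: sum_subtractf sum_divide_distrib)
    also have "norm \<dots> \<le> (\<Sum>\<rho> \<in> {\<rho> \<in> ?R. P n \<rho>}. \<bar>?d n \<rho>\<bar>)" unfolding real_norm_def by (rule sum_abs)
    also have "\<dots> \<le> (\<Sum>\<rho>\<in>?R. \<bar>?d n \<rho>\<bar>)" by (rule sum_mono2[OF fin]) auto
    finally show "norm ((\<Sum>y \<in> {y \<in> {1..<t} \<rightarrow>\<^sub>E core_box n. P n y}. core_weight t n y) / total_weight t n
      - real (card {\<rho> \<in> ?R. P n \<rho>}) / real_of_int m ^ (t - 1)) \<le> (\<Sum>\<rho>\<in>?R. \<bar>?d n \<rho>\<bar>)" .
  qed
qed

section \<open>Gauss sums\<close>

locale odd_prime =
  fixes p :: nat
  assumes prime: "prime p" and odd: "odd p"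
begin

lemma p_gt_2: "2 < p"
  using prime odd prime_ge_2_nat[of p] by (cases "p = 2") auto

lemma prime_int: "prime (int p)" using prime by simp

lemma dvd_mult_iff: "int p dvd a * b \<longleftrightarrow> int p dvd a \<or> int p dvd b"
  by (rule prime_dvd_mult_iff[OF prime_int])

lemma not_dvd_2: "\<not> int p dvd 2"
  using p_gt_2 zdvd_imp_le[of "int p" 2] by auto

lemma dvd_residue: "k \<in> {0..<int p} \<Longrightarrow> int p dvd k \<Longrightarrow> k = 0"
  using zdvd_imp_le[of "int p" k] by force

definition ee :: "int \<Rightarrow> complex" where
  "ee k = cis (2 * pi * real_of_int k / real p)"

lemma ee_add: "ee (k + l) = ee k * ee l"
  unfolding ee_def cis_mult by (simp add: distrib_left add_divide_distrib)

lemma ee_0 [simp]: "ee 0 = 1" by (simp add: ee_def)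

lemma ee_dvd: assumes "int p dvd k" shows "ee k = 1"
proof -
  obtain l where l: "k = int p * l" using assms by (rule dvdE)
  have "2 * pi * real_of_int k / real p = 2 * pi * real_of_int l" using p_gt_2 by (simp add: l)
  then show ?thesis unfolding ee_def by (simp only: cis_multiple_2pi Ints_of_int)
qed

lemma ee_cong: assumes "int p dvd k - l" shows "ee k = ee l"
  using ee_add[of "k - l" l] ee_dvd[OF assms] by simp

lemma ee_eq_1: assumes "ee k = 1" shows "int p dvd k"
proof -
  have "cos (2 * pi * real_of_int k / real p) = 1" using arg_cong[OF assms, of Re] by (simp add: ee_def)
  then obtain n :: int where "2 * pi * real_of_int k / real p = of_int n * 2 * pi" using cos_one_2pi_int by blast
  then have "real_of_int k = real_of_int (n * int p)" using p_gt_2 by (simp add: field_simps)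
  then have "k = n * int p" by (simp only: of_int_eq_iff)
  then show ?thesis by simp
qed

lemma ee_power: "ee k ^ n = ee (int n * k)"
  by (induction n) (simp_all add: ee_add[symmetric] algebra_simps)

definition periodic :: "(int \<Rightarrow> 'a) \<Rightarrow> bool" where
  "periodic F \<longleftrightarrow> (\<forall>k l. int p dvd k - l \<longrightarrow> F k = F l)"

lemma periodic_mod: "periodic F \<Longrightarrow> F (k mod int p) = F k"
proof -
  assume F: "periodic F"
  have "int p dvd k mod int p - k" unfolding mod_eq_dvd_iff[symmetric] by simp
  with F show ?thesis unfolding periodic_def by blast
qed

text \<open>An affine map with invertible slope permutes the residues; the substitutions in the
  character sums below are instances.\<close>

lemma sum_periodic_affine:
  fixes F :: "int \<Rightarrow> 'a :: comm_monoid_add"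
  assumes F: "periodic F" and a: "\<not> int p dvd a"
  shows "(\<Sum>k\<in>{0..<int p}. F (a * k + s)) = (\<Sum>k\<in>{0..<int p}. F k)"
proof -
  let ?f = "\<lambda>k. (a * k + s) mod int p"
  have inj: "inj_on ?f {0..<int p}"
  proof (rule inj_onI)
    fix k l assume k: "k \<in> {0..<int p}" and l: "l \<in> {0..<int p}" and "?f k = ?f l"
    then have "int p dvd (a * k + s) - (a * l + s)" by (simp only: mod_eq_dvd_iff)
    then have "int p dvd a * (k - l)" by (simp add: algebra_simps)
    then have "int p dvd k - l" using a dvd_mult_iff by blast
    then have "k mod int p = l mod int p" by (simp only: mod_eq_dvd_iff)
    then show "k = l" using k l by simp
  qed
  have "?f ` {0..<int p} \<subseteq> {0..<int p}" using p_gt_2 by auto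
  then have "?f ` {0..<int p} = {0..<int p}" by (rule endo_inj_surj[OF finite_atLeastLessThan_int _ inj])
  then have "bij_betw ?f {0..<int p} {0..<int p}" using inj by (simp add: bij_betw_def)
  from sum.reindex_bij_betw[OF this, of F] show ?thesis by (simp add: periodic_mod[OF F])
qed

lemma periodic_ee: "periodic (\<lambda>k. ee (k * a))"
  unfolding periodic_def
proof (intro allI impI)
  fix k l assume "int p dvd k - l"
  then have "int p dvd (k - l) * a" by simp
  then show "ee (k * a) = ee (l * a)" by (intro ee_cong) (simp add: algebra_simps)
qed

text \<open>Shifting the summation by 1 multiplies the sum by \<open>ee a\<close>, so it vanishes
  unless \<open>ee a = 1\<close>.\<close>

lemma sum_ee: "(\<Sum>k\<in>{0..<int p}. ee (k * a)) = (if int p dvd a then of_nat p else 0)"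
proof (cases "int p dvd a")
  case True
  then have "ee (k * a) = 1" for k by (intro ee_dvd) simp
  then show ?thesis using True by simp
next
  case False
  let ?S = "\<Sum>k\<in>{0..<int p}. ee (k * a)"
  have "\<not> int p dvd 1" using p_gt_2 zdvd_imp_le[of "int p" 1] by auto
  then have "?S = (\<Sum>k\<in>{0..<int p}. ee ((1 * k + 1) * a))"
    by (rule sum_periodic_affine[OF periodic_ee, symmetric])
  also have "\<dots> = ?S * ee a" unfolding sum_distrib_right by (simp add: distrib_right ee_add)
  finally have "?S * (ee a - 1) = 0" by (simp add: algebra_simps)
  moreover have "ee a \<noteq> 1" using ee_eq_1 False by blast
  ultimately show ?thesis using False by simp
qed

section \<open>The Legendre symbol as a multiplicative character\<close>

abbreviation eta :: "int \<Rightarrow> int" where "eta a \<equiv> Legendre a (int p)"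

lemma eta_0_iff: "eta a = 0 \<longleftrightarrow> int p dvd a"
  by (auto simp: Legendre_def cong_0_iff)

lemma eta_values: "eta a = 0 \<or> eta a = 1 \<or> eta a = -1"
  by (auto simp: Legendre_def)

lemma eta_sq: "\<not> int p dvd a \<Longrightarrow> eta a * eta a = 1"
  using eta_values[of a] eta_0_iff[of a] by auto

lemma eta_cong: assumes "int p dvd a - b" shows "eta a = eta b"
proof -
  have "[a = b] (mod int p)" using assms by (simp add: cong_iff_dvd_diff)
  then have "[a = 0] (mod int p) \<longleftrightarrow> [b = 0] (mod int p)" "QuadRes (int p) a \<longleftrightarrow> QuadRes (int p) b"
    unfolding QuadRes_def using cong_sym cong_trans by blast+
  then show ?thesis by (simp add: Legendre_def)
qed

text \<open>Two such values differ by at most 2, which is less than \<open>p\<close>. This upgrades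
  Euler's criterion from congruences to equations.\<close>

lemma eta_unique:
  assumes "int p dvd x - y" "x \<in> {-1, 0, 1}" "y \<in> {-1, 0, 1}"
  shows "x = y"
proof (rule ccontr)
  assume "x \<noteq> y"
  then have "int p \<le> \<bar>x - y\<bar>" using assms(1) by (intro zdvd_imp_le) auto
  then show False using assms(2,3) p_gt_2 by auto
qed

lemma eta_mult: "eta (a * b) = eta a * eta b"
proof (rule eta_unique)
  have e: "[eta x = x ^ ((p - 1) div 2)] (mod int p)" for x by (rule euler_criterion[OF prime p_gt_2])
  have "[eta a * eta b = (a * b) ^ ((p - 1) div 2)] (mod int p)"
    unfolding power_mult_distrib by (rule cong_mult[OF e e])
  then have "[eta (a * b) = eta a * eta b] (mod int p)" using e[of "a * b"] cong_sym cong_trans by blast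
  then show "int p dvd eta (a * b) - eta a * eta b" by (simp add: cong_iff_dvd_diff)
qed (use eta_values[of a] eta_values[of b] eta_values[of "a * b"] in auto)

lemma eta_1: "eta 1 = 1"
  using eta_mult[of 1 1] eta_values[of 1] eta_0_iff[of 1] p_gt_2 zdvd_imp_le[of "int p" 1] by auto

lemma eta_square: "\<not> int p dvd a \<Longrightarrow> eta (a * a) = 1"
  by (simp add: eta_mult eta_sq)

lemma card_square_roots:
  "int (card {v \<in> {0..<int p}. int p dvd v * v - u}) = 1 + eta u"
proof (cases "int p dvd u")
  case True
  have "{v \<in> {0..<int p}. int p dvd v * v - u} = {0}"
  proof -
    have "int p dvd v * v - u \<longleftrightarrow> int p dvd v" for v
      using True dvd_mult_iff[of v v] by (simp add: dvd_diff_left_iff dvd_diff_right_iff)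
    then show ?thesis using dvd_residue p_gt_2 by auto
  qed
  then show ?thesis using True eta_0_iff[of u] by simp
next
  case u: False
  show ?thesis
  proof (cases "QuadRes (int p) u")
    case True
    then obtain y where "[y ^ 2 = u] (mod int p)" by (auto simp: QuadRes_def)
    then have y: "int p dvd y * y - u" by (simp add: cong_iff_dvd_diff power2_eq_square)
    have py: "\<not> int p dvd y"
    proof
      assume "int p dvd y"
      then have "int p dvd y * y" by simp
      then have "int p dvd y * y - (y * y - u)" using y by (rule dvd_diff)
      then show False using u by simp
    qed
    have iff: "int p dvd v * v - u \<longleftrightarrow> v = y mod int p \<or> v = (- y) mod int p" if v: "v \<in> {0..<int p}" for v
    proof -
      have "int p dvd v * v - u \<longleftrightarrow> int p dvd (v * v - u) - (y * y - u)"
        using dvd_diff[OF _ y, of "v * v - u"] dvd_add[OF _ y, of "(v * v - u) - (y * y - u)"] by auto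
      also have "(v * v - u) - (y * y - u) = (v - y) * (v - (- y))" by (simp add: algebra_simps)
      also have "int p dvd (v - y) * (v - (- y)) \<longleftrightarrow> v mod int p = y mod int p \<or> v mod int p = (- y) mod int p"
        unfolding dvd_mult_iff mod_eq_dvd_iff ..
      finally show ?thesis using v by simp
    qed
    have "{v \<in> {0..<int p}. int p dvd v * v - u} = {y mod int p, (- y) mod int p}"
    proof (intro Set.set_eqI iffI)
      fix v assume "v \<in> {v \<in> {0..<int p}. int p dvd v * v - u}"
      then show "v \<in> {y mod int p, (- y) mod int p}" using iff by blast
    next
      fix v assume v: "v \<in> {y mod int p, (- y) mod int p}"
      then have "v \<in> {0..<int p}" using p_gt_2 by auto
      then show "v \<in> {v \<in> {0..<int p}. int p dvd v * v - u}" using iff v by blast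
    qed
    moreover have "y mod int p \<noteq> (- y) mod int p"
    proof
      assume "y mod int p = (- y) mod int p"
      then have "int p dvd y - (- y)" by (simp only: mod_eq_dvd_iff)
      then have "int p dvd 2 * y" by simp
      then show False using py not_dvd_2 dvd_mult_iff by blast
    qed
    moreover have "eta u = 1" using True u by (simp add: Legendre_def cong_0_iff)
    ultimately show ?thesis by simp
  next
    case False
    have "\<not> int p dvd v * v - u" for v
      using False by (auto simp: QuadRes_def cong_iff_dvd_diff power2_eq_square)
    moreover have "eta u = -1" using False u by (simp add: Legendre_def cong_0_iff)
    ultimately show ?thesis by simp
  qed
qed

section \<open>Quadratic Gauss sums and their square\<close>

definition gauss_sum :: "int \<Rightarrow> complex" where
  "gauss_sum a = (\<Sum>v\<in>{0..<int p}. ee (a * (v * v)))"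

definition tau :: "int \<Rightarrow> complex" where
  "tau a = (\<Sum>u\<in>{0..<int p}. of_int (eta u) * ee (u * a))"

text \<open>Groups the summands by the value of the square; \<open>card_square_roots\<close> counts
  each fibre.\<close>

lemma sum_squares:
  fixes F :: "int \<Rightarrow> complex"
  assumes F: "periodic F"
  shows "(\<Sum>v\<in>{0..<int p}. F (v * v)) = (\<Sum>u\<in>{0..<int p}. of_int (1 + eta u) * F u)"
proof -
  let ?g = "\<lambda>v::int. v * v mod int p"
  have "(\<Sum>u\<in>{0..<int p}. \<Sum>v | v \<in> {0..<int p} \<and> ?g v = u. F (v * v)) = (\<Sum>v\<in>{0..<int p}. F (v * v))"
    by (rule sum.group) (use p_gt_2 in auto)
  moreover have "(\<Sum>v | v \<in> {0..<int p} \<and> ?g v = u. F (v * v)) = of_int (1 + eta u) * F u" if u: "u \<in> {0..<int p}" for u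
  proof -
    have "?g v = u \<longleftrightarrow> int p dvd v * v - u" for v
      unfolding mod_eq_dvd_iff[symmetric] using u by simp
    moreover have "F (v * v) = F u" if "int p dvd v * v - u" for v
      using F that unfolding periodic_def by blast
    ultimately have "(\<Sum>v | v \<in> {0..<int p} \<and> ?g v = u. F (v * v)) = of_int (int (card {v \<in> {0..<int p}. int p dvd v * v - u})) * F u"
      by simp
    then show ?thesis unfolding card_square_roots .
  qed
  ultimately show ?thesis by simp
qed

lemma sum_eta: "(\<Sum>u\<in>{0..<int p}. eta u) = 0"
proof -
  have "(\<Sum>v\<in>{0..<int p}. (\<lambda>_. 1::complex) (v * v)) = (\<Sum>u\<in>{0..<int p}. of_int (1 + eta u) * 1)"
    by (rule sum_squares) (simp add: periodic_def)
  then have "complex_of_int (\<Sum>u\<in>{0..<int p}. eta u) = of_int 0" by (simp add: sum.distrib)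
  then show ?thesis by (simp only: of_int_eq_iff)
qed

lemma tau_eq: "tau a = of_int (eta a) * tau 1"
proof (cases "int p dvd a")
  case True
  then have "ee (u * a) = 1" for u by (intro ee_dvd) simp
  then have "tau a = of_int (\<Sum>u\<in>{0..<int p}. eta u)" by (simp add: tau_def)
  then show ?thesis using True eta_0_iff[of a] by (simp add: sum_eta)
next
  case False
  let ?F = "\<lambda>u. of_int (eta u) * ee u"
  have per: "periodic ?F" unfolding periodic_def using eta_cong ee_cong by metis
  have "tau 1 = (\<Sum>u\<in>{0..<int p}. ?F (a * u + 0))"
    using sum_periodic_affine[OF per False, of 0] by (simp add: tau_def)
  also have "\<dots> = of_int (eta a) * tau a"
    unfolding tau_def sum_distrib_left by (simp add: eta_mult mult_ac)
  finally have "of_int (eta a) * tau 1 = of_int (eta a * eta a) * tau a" by simp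
  then show ?thesis by (simp add: eta_sq[OF False])
qed

lemma gauss_sum_eq: assumes "\<not> int p dvd a" shows "gauss_sum a = of_int (eta a) * tau 1"
proof -
  have "gauss_sum a = (\<Sum>v\<in>{0..<int p}. (\<lambda>k. ee (k * a)) (v * v))" by (simp add: gauss_sum_def mult_ac)
  also have "\<dots> = (\<Sum>u\<in>{0..<int p}. of_int (1 + eta u) * ee (u * a))" by (rule sum_squares[OF periodic_ee])
  also have "\<dots> = (\<Sum>u\<in>{0..<int p}. ee (u * a)) + tau a" by (simp add: tau_def distrib_right sum.distrib)
  finally show ?thesis using assms by (simp add: sum_ee tau_eq[of a])
qed

text \<open>Evaluates \<open>gauss_sum 1 * gauss_sum (-1)\<close>: after the substitution
  \<open>v = s + u\<close> the exponent \<open>u * u - v * v\<close> is linear in \<open>u\<close>,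
  and summing over \<open>u\<close> leaves only \<open>s = 0\<close>.\<close>

lemma tau_sq: "tau 1 ^ 2 = of_int (eta (-1)) * of_nat p"
proof -
  have one: "\<not> int p dvd 1" "\<not> int p dvd -1" using p_gt_2 zdvd_imp_le[of "int p" 1] by auto
  have per: "periodic (\<lambda>v. ee (-1 * (v * v)))"
    unfolding periodic_def
  proof (intro allI impI)
    fix k l assume "int p dvd k - l"
    then have "int p dvd (k - l) * (- (k + l))" by simp
    then show "ee (-1 * (k * k)) = ee (-1 * (l * l))" by (intro ee_cong) (simp add: algebra_simps)
  qed
  have "gauss_sum 1 * gauss_sum (-1) = (\<Sum>u\<in>{0..<int p}. ee (u * u) * (\<Sum>v\<in>{0..<int p}. ee (-1 * (v * v))))"
    unfolding gauss_sum_def sum_distrib_right by simp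
  also have "\<dots> = (\<Sum>u\<in>{0..<int p}. ee (u * u) * (\<Sum>s\<in>{0..<int p}. ee (-1 * ((1 * s + u) * (1 * s + u)))))"
    by (simp only: sum_periodic_affine[OF per one(1)])
  also have "\<dots> = (\<Sum>u\<in>{0..<int p}. \<Sum>s\<in>{0..<int p}. ee (- (s * s)) * ee (u * (- 2 * s)))"
    unfolding sum_distrib_left ee_add[symmetric] by (intro sum.cong refl arg_cong[of _ _ ee]) (simp add: algebra_simps)
  also have "\<dots> = (\<Sum>s\<in>{0..<int p}. ee (- (s * s)) * (\<Sum>u\<in>{0..<int p}. ee (u * (- 2 * s))))"
    by (subst sum.swap) (simp only: sum_distrib_left)
  also have "\<dots> = (\<Sum>s\<in>{0..<int p}. if s = 0 then of_nat p else 0)"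
  proof (intro sum.cong refl)
    fix s assume s: "s \<in> {0..<int p}"
    have "int p dvd - 2 * s \<longleftrightarrow> s = 0"
      using dvd_mult_iff[of "-2" s] not_dvd_2 dvd_residue[OF s] by auto
    then show "ee (- (s * s)) * (\<Sum>u\<in>{0..<int p}. ee (u * (- 2 * s))) = (if s = 0 then of_nat p else 0)"
      by (simp only: sum_ee) simp
  qed
  also have "\<dots> = of_nat p" using p_gt_2 by simp
  finally have "of_int (eta (-1)) * (tau 1) ^ 2 = of_nat p"
    using gauss_sum_eq[OF one(1)] gauss_sum_eq[OF one(2)] by (simp add: eta_1 power2_eq_square mult_ac)
  then have "of_int (eta (-1) * eta (-1)) * (tau 1) ^ 2 = of_int (eta (-1)) * of_nat p" by (simp add: mult.assoc)
  then show ?thesis by (simp add: eta_sq[OF one(2)])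
qed

text \<open>Completes the square; writing the linear coefficient as \<open>2 * a * c\<close>
  provides the shift \<open>c\<close> without an inverse modulo \<open>p\<close>.\<close>

lemma quadratic_sum:
  assumes a: "\<not> int p dvd a"
  shows "(\<Sum>v\<in>{0..<int p}. ee (a * (v * v) + 2 * a * c * v)) = ee (- (a * (c * c))) * gauss_sum a"
proof -
  have one: "\<not> int p dvd 1" using p_gt_2 zdvd_imp_le[of "int p" 1] by auto
  have per: "periodic (\<lambda>v. ee (a * (v * v)))"
    unfolding periodic_def
  proof (intro allI impI)
    fix k l assume "int p dvd k - l"
    then have "int p dvd (k - l) * (a * (k + l))" by simp
    then show "ee (a * (k * k)) = ee (a * (l * l))" by (intro ee_cong) (simp add: algebra_simps)
  qed
  have "gauss_sum a = (\<Sum>v\<in>{0..<int p}. ee (a * ((1 * v + c) * (1 * v + c))))"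
    unfolding gauss_sum_def by (rule sum_periodic_affine[OF per one, symmetric])
  then have "ee (- (a * (c * c))) * gauss_sum a = (\<Sum>v\<in>{0..<int p}. ee (- (a * (c * c))) * ee (a * ((1 * v + c) * (1 * v + c))))"
    by (simp only: sum_distrib_left)
  also have "\<dots> = (\<Sum>v\<in>{0..<int p}. ee (a * (v * v) + 2 * a * c * v))"
    unfolding ee_add[symmetric] by (intro sum.cong refl arg_cong[of _ _ ee]) (simp add: algebra_simps)
  finally show ?thesis ..
qed

text \<open>Detecting both congruences by additive characters reduces the count to quadratic Gauss sums.\<close>

lemma card_linear_quadratic:
  fixes s :: "nat \<Rightarrow> int"
  assumes A: "\<not> int p dvd A" and t: "\<not> p dvd t"
  defines "X \<equiv> {..<t} \<rightarrow>\<^sub>E {0..<int p}"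
  shows "of_nat p ^ 2 * of_nat (card {x \<in> X. int p dvd (\<Sum>r<t. A * x r + s r) \<and> int p dvd (\<Sum>r<t. (A * x r + s r) * (A * x r + s r)) - c})
    = of_nat p ^ t + tau 1 ^ (t + 1) * of_int (eta (- int t)) * (\<Sum>\<alpha>\<in>{1..<int p}. of_int (eta \<alpha>) ^ (t + 1) * ee (\<alpha> * (- c)))"
proof -
  let ?R = "{0..<int p}"
  let ?L = "\<lambda>x. \<Sum>r<t. A * x r + s r" and ?G = "\<lambda>x. \<Sum>r<t. (A * x r + s r) * (A * x r + s r)"
  let ?H = "\<lambda>\<alpha> \<beta>. \<Sum>v\<in>?R. ee (\<alpha> * (v * v) + \<beta> * v)"
  have finX: "finite X" unfolding X_def by (intro finite_PiE) auto
  have tp: "\<not> int p dvd int t" using t by simp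
  have ee_sum: "ee (sum f B) = (\<Prod>r\<in>B. ee (f r))" if "finite B" for f and B :: "nat set"
    using that by (induction B rule: finite_induct) (auto simp: ee_add)
  have "of_nat p ^ 2 * of_nat (card {x \<in> X. int p dvd ?L x \<and> int p dvd ?G x - c})
      = (\<Sum>x\<in>X. (if int p dvd ?L x then of_nat p else 0) * (if int p dvd ?G x - c then of_nat p else (0::complex)))"
  proof -
    have "(\<Sum>x\<in>X. (if int p dvd ?L x then of_nat p else 0) * (if int p dvd ?G x - c then of_nat p else (0::complex)))
      = (\<Sum>x\<in>X. if int p dvd ?L x \<and> int p dvd ?G x - c then of_nat p ^ 2 else (0::complex))"
      by (intro sum.cong) (auto simp: power2_eq_square)
    also have "\<dots> = (\<Sum>x\<in>{x \<in> X. int p dvd ?L x \<and> int p dvd ?G x - c}. of_nat p ^ 2)"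
      using finX by (simp add: sum.If_cases Int_def)
    finally show ?thesis by (simp add: mult.commute)
  qed
  also have "\<dots> = (\<Sum>x\<in>X. (\<Sum>\<beta>\<in>?R. ee (\<beta> * ?L x)) * (\<Sum>\<alpha>\<in>?R. ee (\<alpha> * (?G x - c))))"
    by (simp only: sum_ee)
  also have "\<dots> = (\<Sum>x\<in>X. \<Sum>\<alpha>\<in>?R. \<Sum>\<beta>\<in>?R. ee (\<alpha> * (- c)) * ee (\<alpha> * ?G x + \<beta> * ?L x))"
    unfolding sum_product by (subst sum.swap) (intro sum.cong refl, simp only: ee_add[symmetric], simp add: algebra_simps)
  also have "\<dots> = (\<Sum>\<alpha>\<in>?R. \<Sum>\<beta>\<in>?R. ee (\<alpha> * (- c)) * (\<Sum>x\<in>X. ee (\<alpha> * ?G x + \<beta> * ?L x)))"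
    unfolding sum_distrib_left by (subst sum.swap, rule sum.cong[OF refl], rule sum.swap)
  also have "\<dots> = (\<Sum>\<alpha>\<in>?R. \<Sum>\<beta>\<in>?R. ee (\<alpha> * (- c)) * ?H \<alpha> \<beta> ^ t)"
  proof -
    \<comment> \<open>The sum over vectors factors over the coordinates, and invertibility of
      \<open>A\<close> makes every factor independent of the shift \<open>s r\<close>.\<close>
    have "(\<Sum>x\<in>X. ee (\<alpha> * ?G x + \<beta> * ?L x)) = ?H \<alpha> \<beta> ^ t" for \<alpha> \<beta>
    proof -
      let ?F = "\<lambda>v. ee (\<alpha> * (v * v) + \<beta> * v)"
      have per: "periodic ?F" unfolding periodic_def
      proof (intro allI impI)
        fix k l assume "int p dvd k - l"
        then have "int p dvd (k - l) * (\<alpha> * (k + l) + \<beta>)" by simp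
        then show "?F k = ?F l" by (intro ee_cong) (simp add: algebra_simps)
      qed
      have "\<alpha> * ?G x + \<beta> * ?L x = (\<Sum>r<t. \<alpha> * ((A * x r + s r) * (A * x r + s r)) + \<beta> * (A * x r + s r))" for x
        by (simp only: sum_distrib_left sum.distrib[symmetric])
      then have "(\<Sum>x\<in>X. ee (\<alpha> * ?G x + \<beta> * ?L x)) = (\<Sum>x\<in>X. \<Prod>r<t. ?F (A * x r + s r))"
        by (simp only: ee_sum[OF finite_lessThan])
      also have "\<dots> = (\<Prod>r<t. \<Sum>v\<in>?R. ?F (A * v + s r))"
        unfolding X_def by (rule prod_sum_PiE[symmetric]) auto
      also have "\<dots> = ?H \<alpha> \<beta> ^ t" by (simp only: sum_periodic_affine[OF per A] prod_constant card_lessThan)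
      finally show ?thesis .
    qed
    then show ?thesis by simp
  qed
  \<comment> \<open>\<open>\<alpha> = 0\<close> yields the main term \<open>p ^ t\<close>, the other
    \<open>\<alpha>\<close> yield Gauss sums.\<close>
  also have "?R = insert 0 {1..<int p}" using p_gt_2 by auto
  also have "(\<Sum>\<alpha>\<in>insert 0 {1..<int p}. \<Sum>\<beta>\<in>insert 0 {1..<int p}. ee (\<alpha> * (- c)) * (\<Sum>v\<in>insert 0 {1..<int p}. ee (\<alpha> * (v * v) + \<beta> * v)) ^ t)
      = (\<Sum>\<beta>\<in>?R. ?H 0 \<beta> ^ t) + (\<Sum>\<alpha>\<in>{1..<int p}. ee (\<alpha> * (- c)) * (\<Sum>\<beta>\<in>?R. ?H \<alpha> \<beta> ^ t))"
    unfolding \<open>?R = insert 0 {1..<int p}\<close> sum_distrib_left by simp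
  also have "(\<Sum>\<beta>\<in>?R. ?H 0 \<beta> ^ t) = of_nat p ^ t"
  proof -
    have "?H 0 \<beta> = (if \<beta> = 0 then of_nat p else 0)" if "\<beta> \<in> ?R" for \<beta>
      using sum_ee[of \<beta>] dvd_residue[OF that] by (auto simp: mult.commute)
    then have "(\<Sum>\<beta>\<in>?R. ?H 0 \<beta> ^ t) = (\<Sum>\<beta>\<in>?R. (if \<beta> = 0 then of_nat p else 0) ^ t)" by simp
    also have "\<dots> = (\<Sum>\<beta>\<in>?R. if \<beta> = 0 then of_nat p ^ t else 0)"
      using t by (intro sum.cong) (auto simp: power_0_left intro: gr0I)
    finally show ?thesis using p_gt_2 by simp
  qed
  also have "(\<Sum>\<alpha>\<in>{1..<int p}. ee (\<alpha> * (- c)) * (\<Sum>\<beta>\<in>?R. ?H \<alpha> \<beta> ^ t))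
      = (\<Sum>\<alpha>\<in>{1..<int p}. ee (\<alpha> * (- c)) * (tau 1 ^ (t + 1) * of_int (eta (- int t)) * of_int (eta \<alpha>) ^ (t + 1)))"
  proof (intro sum.cong refl arg_cong2[of _ _ _ _ "(*)"])
    fix \<alpha> assume \<alpha>: "\<alpha> \<in> {1..<int p}"
    have a: "\<not> int p dvd \<alpha>"
    proof
      assume "int p dvd \<alpha>"
      then have "\<alpha> = 0" by (rule dvd_residue[rotated]) (use \<alpha> in simp)
      then show False using \<alpha> by simp
    qed
    have a2: "\<not> int p dvd 2 * \<alpha>" using a not_dvd_2 dvd_mult_iff by blast
    have ta: "\<not> int p dvd - (int t * \<alpha>)" using a tp dvd_mult_iff by (simp add: dvd_mult_iff)
    have per: "periodic (\<lambda>\<beta>. ?H \<alpha> \<beta> ^ t)" unfolding periodic_def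
    proof (intro allI impI arg_cong[of _ _ "\<lambda>x. x ^ t"] sum.cong refl)
      fix k l v assume "int p dvd k - l"
      then have "int p dvd (k - l) * v" by simp
      then show "ee (\<alpha> * (v * v) + k * v) = ee (\<alpha> * (v * v) + l * v)" by (intro ee_cong) (simp add: algebra_simps)
    qed
    \<comment> \<open>\<open>\<beta> = 2 * \<alpha> * c\<close> brings each factor into the form of
      \<open>quadratic_sum\<close>. The \<open>t\<close> phases multiply to \<open>ee\<close> of
      \<open>- (t * \<alpha>) * (c * c)\<close>, so the sum over \<open>c\<close> is one more Gauss
      sum, nondegenerate because \<open>p\<close> does not divide \<open>t\<close>.\<close>
    have "(\<Sum>\<beta>\<in>?R. ?H \<alpha> \<beta> ^ t) = (\<Sum>c\<in>?R. ?H \<alpha> (2 * \<alpha> * c + 0) ^ t)"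
      by (rule sum_periodic_affine[OF per a2, symmetric])
    also have "\<dots> = (\<Sum>c\<in>?R. ee ((- (int t * \<alpha>)) * (c * c)) * gauss_sum \<alpha> ^ t)"
      by (simp only: add_0_right quadratic_sum[OF a] power_mult_distrib ee_power) (simp add: mult_ac)
    also have "\<dots> = gauss_sum (- (int t * \<alpha>)) * gauss_sum \<alpha> ^ t"
      unfolding gauss_sum_def[of "- (int t * \<alpha>)"] sum_distrib_right ..
    also have "\<dots> = tau 1 ^ (t + 1) * of_int (eta (- int t)) * of_int (eta \<alpha>) ^ (t + 1)"
    proof -
      have "eta (- (int t * \<alpha>)) = eta (- int t) * eta \<alpha>" using eta_mult[of "- int t" \<alpha>] by simp
      then show ?thesis unfolding gauss_sum_eq[OF a] gauss_sum_eq[OF ta] by (simp add: power_mult_distrib mult_ac)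
    qed
    finally show "(\<Sum>\<beta>\<in>?R. ?H \<alpha> \<beta> ^ t) = tau 1 ^ (t + 1) * of_int (eta (- int t)) * of_int (eta \<alpha>) ^ (t + 1)" .
  qed
  also have "\<dots> = tau 1 ^ (t + 1) * of_int (eta (- int t)) * (\<Sum>\<alpha>\<in>{1..<int p}. of_int (eta \<alpha>) ^ (t + 1) * ee (\<alpha> * (- c)))"
    unfolding sum_distrib_left by (simp add: mult_ac)
  finally show ?thesis .
qed

lemma eta_minus_1: "eta (-1) = (-1) ^ ((p - 1) div 2)"
proof (rule eta_unique)
  show "int p dvd eta (-1) - (-1) ^ ((p - 1) div 2)"
    using euler_criterion[OF prime p_gt_2, of "-1"] by (simp add: cong_iff_dvd_diff)
  show "(-1) ^ ((p - 1) div 2) \<in> {-1, 0, 1::int}" by (cases "even ((p - 1) div 2)") auto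
qed (use eta_values in auto)

text \<open>By Gauss's lemma: with \<open>h = (p - 1) div 2\<close>, the doubled residues beyond
  half of \<open>p\<close> come from \<open>h div 2 < x \<le> h\<close>, so there are
  \<open>h - h div 2\<close> of them.\<close>

lemma eta_2: "eta 2 = (-1) ^ ((p - 1) div 2 - (p - 1) div 2 div 2)"
proof -
  have "GAUSS p 2"
    by unfold_locales (use prime p_gt_2 not_dvd_2 in \<open>auto simp: cong_0_iff\<close>)
  then interpret GAUSS p 2 .
  define h where "h = (p - 1) div 2"
  have p: "p = 2 * h + 1" using odd p_gt_2 by (auto simp: h_def elim!: oddE)
  have half: "(int p - 1) div 2 = int h" by (simp add: p)
  have "E = (\<lambda>x. 2 * int x) ` {h div 2 + 1..h}"
  proof (intro Set.set_eqI iffI)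
    fix y assume "y \<in> E"
    then obtain x where x: "0 < x" "x \<le> int h" "y = x * 2 mod int p" "int h < y"
      by (auto simp: E_def C_def B_def A_def half)
    have "y = 2 * x" using x(1-3) by (simp add: p)
    then show "y \<in> (\<lambda>x. 2 * int x) ` {h div 2 + 1..h}"
      using x by (intro image_eqI[of _ _ "nat x"]) auto
  next
    fix y assume "y \<in> (\<lambda>x. 2 * int x) ` {h div 2 + 1..h}"
    then obtain x where x: "h div 2 + 1 \<le> x" "x \<le> h" "y = 2 * int x" by auto
    have "y = int x * 2 mod int p" using x(2,3) by (simp add: p)
    moreover have "int x \<in> A" using x(1,2) by (simp add: A_def half)
    ultimately have "y \<in> C" by (auto simp: C_def B_def)
    moreover have "int h < y" using x(1,3) by linarith
    ultimately show "y \<in> E" by (simp add: E_def half)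
  qed
  moreover have "inj_on (\<lambda>x. 2 * int x) {h div 2 + 1..h}" by (auto simp: inj_on_def)
  ultimately have "card E = h - h div 2" by (simp add: card_image)
  then show ?thesis using gauss_lemma by (simp add: h_def)
qed

end

section \<open>The density of the quadratic congruence\<close>

text \<open>As \<open>w\<close> is invertible modulo \<open>k\<close>, the steps
  \<open>g * w\<close> visit all \<open>k\<close> classes modulo \<open>k * g\<close> above one
  class modulo \<open>g\<close>. The bijection \<open>T\<close> carries each of these classes onto
  the next, so they are equally large.\<close>

lemma card_shift_residues:
  fixes c :: "'a \<Rightarrow> int"
  assumes fin: "finite R" and bij: "bij_betw T R R"
    and shift: "\<And>\<rho>. \<rho> \<in> R \<Longrightarrow> [c (T \<rho>) = c \<rho> + g * w] (mod (k * g))"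
    and k: "k > 0" and g: "g > 0" and w: "coprime w k"
  shows "nat k * card {\<rho> \<in> R. [c \<rho> = r] (mod (k * g))} = card {\<rho> \<in> R. [c \<rho> = r] (mod g)}"
proof -
  let ?M = "k * g"
  have step: "card {\<rho> \<in> R. [c \<rho> = r + g * w] (mod ?M)} = card {\<rho> \<in> R. [c \<rho> = r] (mod ?M)}" for r
  proof -
    have "bij_betw T {\<rho> \<in> R. [c \<rho> = r] (mod ?M)} {\<rho> \<in> R. [c \<rho> = r + g * w] (mod ?M)}"
    proof (rule bij_betw_Collect[OF bij])
      fix \<rho> assume "\<rho> \<in> R"
      from shift[OF this] have "[c (T \<rho>) = r + g * w] (mod ?M) \<longleftrightarrow> [c \<rho> + g * w = r + g * w] (mod ?M)"
        using cong_sym cong_trans by blast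
      then show "[c (T \<rho>) = r + g * w] (mod ?M) = [c \<rho> = r] (mod ?M)" by (simp add: cong_iff_dvd_diff)
    qed
    then show ?thesis by (rule bij_betw_same_card[symmetric])
  qed
  have steps: "card {\<rho> \<in> R. [c \<rho> = r + int j * (g * w)] (mod ?M)} = card {\<rho> \<in> R. [c \<rho> = r] (mod ?M)}" for j
  proof (induction j)
    case (Suc j)
    have "r + int (Suc j) * (g * w) = (r + int j * (g * w)) + g * w" by (simp add: algebra_simps)
    then show ?case using step[of "r + int j * (g * w)"] Suc by (simp only:)
  qed simp
  \<comment> \<open>Exactly one \<open>j < k\<close> solves \<open>j * w = y\<close> modulo
    \<open>k\<close>; double counting over \<open>j\<close> then gives the claim.\<close>
  have inner: "card {j \<in> {..<nat k}. [x = r + int j * (g * w)] (mod ?M)} = (if [x = r] (mod g) then 1 else 0)" for x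
  proof (cases "[x = r] (mod g)")
    case False
    have "\<not> [x = r + int j * (g * w)] (mod ?M)" for j
    proof
      assume "[x = r + int j * (g * w)] (mod ?M)"
      then have "g dvd x - (r + int j * (g * w))" unfolding cong_iff_dvd_diff by (rule dvd_mult_right)
      moreover have "g dvd int j * (g * w)" by simp
      ultimately have "g dvd (x - (r + int j * (g * w))) + int j * (g * w)" by (rule dvd_add)
      then show False using False by (simp add: cong_iff_dvd_diff)
    qed
    then show ?thesis using False by simp
  next
    case True
    then obtain y where y: "x - r = g * y" unfolding cong_iff_dvd_diff by (rule dvdE)
    have iff: "[x = r + int j * (g * w)] (mod ?M) \<longleftrightarrow> [int j * w = y] (mod k)" for j
    proof -
      have "x - (r + int j * (g * w)) = g * (y - int j * w)" using y by (simp add: algebra_simps)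
      then have "[x = r + int j * (g * w)] (mod ?M) \<longleftrightarrow> g * k dvd g * (y - int j * w)"
        unfolding cong_iff_dvd_diff by (simp only: mult.commute[of k])
      also have "\<dots> \<longleftrightarrow> k dvd y - int j * w" using g by simp
      finally show ?thesis unfolding cong_iff_dvd_diff by (simp add: dvd_diff_commute)
    qed
    obtain v where v: "[w * v = 1] (mod k)" using cong_solve_coprime_int[OF w] by blast
    have uniq: "[int j * w = y] (mod k) \<longleftrightarrow> j = nat ((v * y) mod k)" if j: "j < nat k" for j
    proof
      assume "[int j * w = y] (mod k)"
      then have "[int j * (w * v) = v * y] (mod k)"
        using cong_scalar_right[of "int j * w" y k v] by (simp add: mult_ac)
      moreover have "[int j * (w * v) = int j * 1] (mod k)" using v by (rule cong_scalar_left)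
      ultimately have "[int j = v * y] (mod k)" using cong_sym cong_trans by (metis mult.right_neutral)
      then have "int j mod k = (v * y) mod k" unfolding cong_iff_dvd_diff mod_eq_dvd_iff .
      moreover have "int j mod k = int j" using j by simp
      ultimately show "j = nat ((v * y) mod k)" by simp
    next
      assume "j = nat ((v * y) mod k)"
      then have "int j = (v * y) mod k" using k by simp
      then have "[int j = v * y] (mod k)" by simp
      then have "[int j * w = v * y * w] (mod k)" by (rule cong_scalar_right)
      moreover have "[v * y * w = y] (mod k)" using cong_scalar_left[OF v, of y] by (simp add: mult_ac)
      ultimately show "[int j * w = y] (mod k)" by (rule cong_trans)
    qed
    have "nat ((v * y) mod k) < nat k" using k by (simp add: nat_less_iff)
    then have "{j \<in> {..<nat k}. [int j * w = y] (mod k)} = {nat ((v * y) mod k)}" using uniq by blast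
    then show ?thesis using True by (simp add: iff)
  qed
  have "nat k * card {\<rho> \<in> R. [c \<rho> = r] (mod ?M)} = (\<Sum>j<nat k. card {\<rho> \<in> R. [c \<rho> = r + int j * (g * w)] (mod ?M)})"
    by (simp add: steps)
  also have "\<dots> = (\<Sum>j<nat k. \<Sum>\<rho>\<in>R. if [c \<rho> = r + int j * (g * w)] (mod ?M) then 1 else 0)"
    using fin by (simp add: sum.If_cases Int_def)
  also have "\<dots> = (\<Sum>\<rho>\<in>R. \<Sum>j<nat k. if [c \<rho> = r + int j * (g * w)] (mod ?M) then 1 else 0)" by (rule sum.swap)
  also have "\<dots> = (\<Sum>\<rho>\<in>R. card {j \<in> {..<nat k}. [c \<rho> = r + int j * (g * w)] (mod ?M)})"
    by (simp add: sum.If_cases Int_def)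
  also have "\<dots> = card {\<rho> \<in> R. [c \<rho> = r] (mod g)}"
    unfolding inner using fin by (simp add: sum.If_cases Int_def)
  finally show ?thesis .
qed

section \<open>Distribution of the core size over residue classes\<close>

lemma cong_iff_of_cong:
  fixes x y r m :: int
  assumes "[x = y] (mod m)" shows "[x = r] (mod m) \<longleftrightarrow> [y = r] (mod m)"
  using cong_trans[OF assms] cong_trans[OF cong_sym[OF assms]] by blast

text \<open>A single triangular term need not have period \<open>m\<close> when \<open>m\<close> is
  even, but \<open>core_form_line\<close> shows that a step \<open>d\<close> in one coordinate
  changes the form by a multiple of \<open>d\<close>. Hence the coordinates are exchanged one at a
  time.\<close>

lemma core_form_cong:
  assumes "\<And>i. i \<in> {1..<t} \<Longrightarrow> [y i = z i] (mod m)"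
  shows "[core_form t y = core_form t z] (mod m)"
proof (cases "t > 0")
  case t: True
  have "[core_form t y = core_form t (\<lambda>i. if i \<in> A then z i else y i)] (mod m)" if "A \<subseteq> {1..<t}" for A
    using finite_subset[OF that finite_atLeastLessThan] that
  proof (induction A rule: finite_induct)
    case (insert i A)
    let ?u = "\<lambda>j. if j \<in> A then z j else y j"
    have i: "i \<in> {1..<t}" using insert by simp
    obtain d where d: "z i - y i = m * d"
      using cong_sym[OF assms[OF i]] unfolding cong_iff_dvd_diff by (rule dvdE)
    have u: "(\<lambda>j. if j \<in> insert i A then z j else y j) = ?u(i := y i + m * d)" using d insert by auto
    have "?u(i := y i) = ?u" using insert by auto
    then have "core_form t (?u(i := y i + m * d)) = core_form t ?u + m * (int t * d * (m * d)
      + int t * d * (2 * y i + (\<Sum>j\<in>{1..<t} - {i}. ?u j)) + int i * d)"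
      using core_form_line[OF i, of ?u "y i" "m * d"] by (simp add: algebra_simps)
    then have "[core_form t ?u = core_form t (?u(i := y i + m * d))] (mod m)" by (simp add: cong_iff_dvd_diff)
    then show ?case unfolding u using insert cong_trans by blast
  qed simp
  from this[of "{1..<t}"] have "[core_form t y = core_form t (\<lambda>i. if i \<in> {1..<t} then z i else y i)] (mod m)" by simp
  moreover have "core_form t (\<lambda>i. if i \<in> {1..<t} then z i else y i) = core_form t z"
    unfolding core_form_eq[OF t] by simp
  ultimately show ?thesis by simp
next
  case False
  then show ?thesis by (simp add: core_form_def core_size_def)
qed

text \<open>Coordinate 1 is singled out because its linear coefficient in the core size is 1: a
  shift by \<open>d\<close> changes the form by \<open>d\<close> times a number congruent to 1
  modulo \<open>t\<close>.\<close>

definition shift_1 :: "int \<Rightarrow> int \<Rightarrow> (nat \<Rightarrow> int) \<Rightarrow> nat \<Rightarrow> int" where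
  "shift_1 m d y = y(1 := (y 1 + d) mod m)"

lemma bij_betw_shift_1:
  assumes t: "t > 1" and m: "m > 0"
  shows "bij_betw (shift_1 m d) (residue_vectors t m) (residue_vectors t m)"
proof (rule bij_betw_byWitness[of _ "shift_1 m (- d)"])
  have inv: "shift_1 m (- d) (shift_1 m d y) = y" if y: "y \<in> residue_vectors t m" for y d
  proof -
    have "y 1 \<in> {0..<m}" using PiE_mem[OF y, of 1] t by simp
    then have "((y 1 + d) mod m - d) mod m = y 1" by (simp add: mod_diff_left_eq)
    then show ?thesis by (simp add: shift_1_def)
  qed
  show "\<forall>y\<in>residue_vectors t m. shift_1 m (- d) (shift_1 m d y) = y" using inv by blast
  show "\<forall>y\<in>residue_vectors t m. shift_1 m d (shift_1 m (- d) y) = y" using inv[of _ "- d"] by simp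
  have mem: "shift_1 m d y \<in> residue_vectors t m" if "y \<in> residue_vectors t m" for y d
    using that t m unfolding shift_1_def by (auto simp: PiE_iff extensional_def)
  show "shift_1 m d ` residue_vectors t m \<subseteq> residue_vectors t m"
    "shift_1 m (- d) ` residue_vectors t m \<subseteq> residue_vectors t m" using mem by blast+
qed

lemma core_form_shift_1:
  assumes t: "t > 1"
  shows "\<exists>e. [core_form t (shift_1 m d y) = core_form t y + d * (int t * (d + e) + 1)] (mod m)"
proof -
  have i: "1 \<in> {1..<t}" using t by simp
  have "[core_form t (shift_1 m d y) = core_form t (y(1 := y 1 + d))] (mod m)"
    by (rule core_form_cong) (simp add: shift_1_def)
  moreover have "core_form t (y(1 := y 1 + d)) = core_form t y + d * (int t * (d + (2 * y 1 + (\<Sum>j\<in>{1..<t} - {1}. y j))) + 1)"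
    using core_form_line[OF i, of y "y 1" d] by (simp add: algebra_simps)
  ultimately show ?thesis by auto
qed

lemma finite_residue_vectors: "finite (residue_vectors t m)"
  by (intro finite_PiE) auto

text \<open>A unit shift of coordinate 1 changes the form by 1 modulo \<open>t\<close>, so all
  residues modulo \<open>t\<close> are equally frequent.\<close>

lemma card_core_form_mod_t:
  assumes t: "t > 1" and b: "b > 0"
  shows "t * card {\<rho> \<in> residue_vectors t (int t * int b). [core_form t \<rho> = r] (mod int t)} = (t * b) ^ (t - 1)"
proof -
  let ?m = "int t * int b"
  have "nat (int t) * card {\<rho> \<in> residue_vectors t ?m. [core_form t \<rho> = r] (mod (int t * 1))}
      = card {\<rho> \<in> residue_vectors t ?m. [core_form t \<rho> = r] (mod 1)}"
  proof (rule card_shift_residues[where T = "shift_1 ?m 1" and w = 1])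
    show "bij_betw (shift_1 ?m 1) (residue_vectors t ?m) (residue_vectors t ?m)"
      by (rule bij_betw_shift_1[OF t]) (use t b in simp)
    fix \<rho> :: "nat \<Rightarrow> int"
    obtain e where "[core_form t (shift_1 ?m 1 \<rho>) = core_form t \<rho> + 1 * (int t * (1 + e) + 1)] (mod ?m)"
      using core_form_shift_1[OF t] by blast
    then have "int t * int b dvd core_form t (shift_1 ?m 1 \<rho>) - (core_form t \<rho> + 1 * (int t * (1 + e) + 1))"
      by (simp only: cong_iff_dvd_diff)
    then have "int t dvd core_form t (shift_1 ?m 1 \<rho>) - (core_form t \<rho> + 1 * (int t * (1 + e) + 1))"
      by (rule dvd_mult_left)
    moreover have "int t dvd int t * (1 + e)" by simp
    ultimately have "int t dvd (core_form t (shift_1 ?m 1 \<rho>) - (core_form t \<rho> + 1 * (int t * (1 + e) + 1))) + int t * (1 + e)"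
      by (rule dvd_add)
    then show "[core_form t (shift_1 ?m 1 \<rho>) = core_form t \<rho> + 1 * 1] (mod (int t * 1))"
      unfolding cong_iff_dvd_diff by (simp add: algebra_simps)
  qed (use t finite_residue_vectors in auto)
  moreover have "card (residue_vectors t ?m) = (t * b) ^ (t - 1)"
    by (simp add: card_PiE nat_mult_distrib)
  ultimately show ?thesis by (simp add: cong_iff_dvd_diff)
qed

text \<open>As \<open>t * b\<close> divides \<open>t * t\<close>, a shift by \<open>t\<close>
  changes the form by \<open>t\<close> modulo \<open>t * b\<close>; hence the \<open>b\<close> lifts
  of a class modulo \<open>t\<close> are equally frequent. This is the case in which the constant is
  \<open>1 / b\<close>.\<close>

lemma card_core_form_dvd:
  assumes t: "t > 1" and b: "b > 0" and dvd: "b dvd t"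
  shows "b * card {\<rho> \<in> residue_vectors t (int t * int b). [core_form t \<rho> = r] (mod (int t * int b))}
    = card {\<rho> \<in> residue_vectors t (int t * int b). [core_form t \<rho> = r] (mod int t)}"
proof -
  let ?m = "int t * int b"
  have "nat (int b) * card {\<rho> \<in> residue_vectors t ?m. [core_form t \<rho> = r] (mod (int b * int t))}
      = card {\<rho> \<in> residue_vectors t ?m. [core_form t \<rho> = r] (mod int t)}"
  proof (rule card_shift_residues[where T = "shift_1 ?m (int t)" and w = 1])
    show "bij_betw (shift_1 ?m (int t)) (residue_vectors t ?m) (residue_vectors t ?m)"
      by (rule bij_betw_shift_1[OF t]) (use t b in simp)
    fix \<rho> :: "nat \<Rightarrow> int"
    obtain e where e: "[core_form t (shift_1 ?m (int t) \<rho>) = core_form t \<rho> + int t * (int t * (int t + e) + 1)] (mod ?m)"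
      using core_form_shift_1[OF t] by blast
    obtain s where s: "int t = int b * s" using dvd by (metis int_dvd_int_iff dvdE)
    have "int t * (int t * (int t + e)) = int t * ((int b * s) * (int t + e))" by (simp only: s[symmetric])
    then have "int t * (int t * (int t + e)) = ?m * (s * (int t + e))" by (simp only: mult.assoc)
    then have "?m dvd int t * (int t * (int t + e))" by (rule dvdI)
    moreover have "?m dvd core_form t (shift_1 ?m (int t) \<rho>) - (core_form t \<rho> + int t * (int t * (int t + e) + 1))"
      using e by (simp only: cong_iff_dvd_diff)
    ultimately have "?m dvd int t * (int t * (int t + e)) + (core_form t (shift_1 ?m (int t) \<rho>) - (core_form t \<rho> + int t * (int t * (int t + e) + 1)))"
      by (rule dvd_add)
    then show "[core_form t (shift_1 ?m (int t) \<rho>) = core_form t \<rho> + int t * 1] (mod (int b * int t))"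
      unfolding cong_iff_dvd_diff by (simp add: algebra_simps)
  qed (use t b finite_residue_vectors in auto)
  then show ?thesis by (simp add: mult.commute)
qed

text \<open>A shift by \<open>b\<close> preserves the form modulo \<open>b\<close> and adds the unit
  \<open>b\<close> modulo \<open>t\<close>. Within a class modulo \<open>b\<close> the residues
  modulo \<open>t\<close> are therefore uniform, and the two conditions combine by
  coprimality.\<close>

lemma card_core_form_coprime:
  assumes t: "t > 1" and b: "b > 0" and cop: "coprime b t"
  shows "t * card {\<rho> \<in> residue_vectors t (int t * int b). [core_form t \<rho> = r] (mod (int t * int b))}
    = card {\<rho> \<in> residue_vectors t (int t * int b). [core_form t \<rho> = r] (mod int b)}"
proof -
  let ?m = "int t * int b"
  let ?R = "{\<rho> \<in> residue_vectors t ?m. [core_form t \<rho> = r] (mod int b)}"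
  have sh: "\<exists>e. [core_form t (shift_1 ?m (int b) \<rho>) = core_form t \<rho> + int b * (int t * (int b + e) + 1)] (mod ?m)" for \<rho>
    by (rule core_form_shift_1[OF t])
  have modb: "[core_form t (shift_1 ?m (int b) \<rho>) = core_form t \<rho>] (mod int b)" for \<rho>
  proof -
    obtain e where "?m dvd core_form t (shift_1 ?m (int b) \<rho>) - (core_form t \<rho> + int b * (int t * (int b + e) + 1))"
      using sh[of \<rho>] by (auto simp only: cong_iff_dvd_diff)
    then have "int b dvd core_form t (shift_1 ?m (int b) \<rho>) - (core_form t \<rho> + int b * (int t * (int b + e) + 1))"
      by (rule dvd_mult_right)
    then have "int b dvd (core_form t (shift_1 ?m (int b) \<rho>) - (core_form t \<rho> + int b * (int t * (int b + e) + 1))) + int b * (int t * (int b + e) + 1)"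
      by (intro dvd_add) auto
    then show ?thesis by (simp add: cong_iff_dvd_diff)
  qed
  have modt: "[core_form t (shift_1 ?m (int b) \<rho>) = core_form t \<rho> + int b] (mod int t)" for \<rho>
  proof -
    obtain e where "?m dvd core_form t (shift_1 ?m (int b) \<rho>) - (core_form t \<rho> + int b * (int t * (int b + e) + 1))"
      using sh[of \<rho>] by (auto simp only: cong_iff_dvd_diff)
    then have "int t dvd core_form t (shift_1 ?m (int b) \<rho>) - (core_form t \<rho> + int b * (int t * (int b + e) + 1))"
      by (rule dvd_mult_left)
    then have "int t dvd (core_form t (shift_1 ?m (int b) \<rho>) - (core_form t \<rho> + int b * (int t * (int b + e) + 1))) + int t * (int b * (int b + e))"
      by (intro dvd_add) auto
    then show ?thesis by (simp add: cong_iff_dvd_diff algebra_simps)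
  qed
  have "nat (int t) * card {\<rho> \<in> ?R. [core_form t \<rho> = r] (mod (int t * 1))} = card {\<rho> \<in> ?R. [core_form t \<rho> = r] (mod 1)}"
  proof (rule card_shift_residues[where T = "shift_1 ?m (int b)" and w = "int b"])
    have "bij_betw (shift_1 ?m (int b)) (residue_vectors t ?m) (residue_vectors t ?m)"
      by (rule bij_betw_shift_1[OF t]) (use t b in simp)
    then show "bij_betw (shift_1 ?m (int b)) ?R ?R"
      by (rule bij_betw_Collect) (use modb cong_sym cong_trans in blast)
    show "[core_form t (shift_1 ?m (int b) \<rho>) = core_form t \<rho> + 1 * int b] (mod (int t * 1))" for \<rho>
      using modt[of \<rho>] by simp
  qed (use t cop finite_residue_vectors in auto)
  moreover have "[core_form t \<rho> = r] (mod ?m) \<longleftrightarrow> [core_form t \<rho> = r] (mod int b) \<and> [core_form t \<rho> = r] (mod int t)" for \<rho>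
  proof -
    have c: "coprime (int t) (int b)" using cop by (simp add: coprime_commute)
    show ?thesis unfolding cong_iff_dvd_diff
    proof
      assume "?m dvd core_form t \<rho> - r"
      then show "int b dvd core_form t \<rho> - r \<and> int t dvd core_form t \<rho> - r"
        by (intro conjI) (rule dvd_mult_right, assumption, rule dvd_mult_left)
    next
      assume "int b dvd core_form t \<rho> - r \<and> int t dvd core_form t \<rho> - r"
      then show "?m dvd core_form t \<rho> - r" using c by (simp add: divides_mult)
    qed
  qed
  ultimately show ?thesis by (simp add: conj_assoc)
qed

text \<open>Both sides are limits of the same weighted average, once sorted modulo
  \<open>t * b\<close> and once modulo \<open>b\<close>; uniqueness of limits replaces a count of
  the fibres of the reduction.\<close>

lemma density_change_modulus:
  assumes t: "t > 1" and b: "b > 0"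
  shows "real (card {\<rho> \<in> residue_vectors t (int t * int b). [core_form t \<rho> = r] (mod int b)}) / real (t * b) ^ (t - 1)
    = real (card {\<rho> \<in> residue_vectors t (int b). [core_form t \<rho> = r] (mod int b)}) / real b ^ (t - 1)"
proof -
  let ?f = "\<lambda>n. (\<Sum>y \<in> {y \<in> {1..<t} \<rightarrow>\<^sub>E core_box n. [core_form t y = r] (mod int b)}. core_weight t n y) / total_weight t n"
  have per: "[core_form t y = r] (mod int b) \<longleftrightarrow> [core_form t z = r] (mod int b)"
    if "\<And>i. i \<in> {1..<t} \<Longrightarrow> [y i = z i] (mod int b)" for y z
    by (rule cong_iff_of_cong[OF core_form_cong[OF that]])
  have per': "[core_form t y = r] (mod int b) \<longleftrightarrow> [core_form t z = r] (mod int b)"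
    if "\<And>i. i \<in> {1..<t} \<Longrightarrow> [y i = z i] (mod (int t * int b))" for y z
    by (rule per) (use that in \<open>auto simp: cong_iff_dvd_diff intro: dvd_mult_right\<close>)
  have 1: "?f \<longlonglongrightarrow> real (card {\<rho> \<in> residue_vectors t (int b). [core_form t \<rho> = r] (mod int b)}) / real_of_int (int b) ^ (t - 1)"
    by (rule LIM_zero_cancel, rule weighted_residue_density[OF t]) (use b per in auto)
  have 2: "?f \<longlonglongrightarrow> real (card {\<rho> \<in> residue_vectors t (int t * int b). [core_form t \<rho> = r] (mod int b)}) / real_of_int (int t * int b) ^ (t - 1)"
    by (rule LIM_zero_cancel, rule weighted_residue_density[OF t]) (use t b per' in auto)
  show ?thesis using LIMSEQ_unique[OF 1 2] by simp
qed

section \<open>Diagonalising the core size modulo a prime\<close>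

lemma sum_centered: "(\<Sum>r<t. 2 * int r - int t + 1) = 0"
proof -
  have "2 * (\<Sum>r<t. int r) = int t * (int t - 1)"
    by (induction t) (simp_all add: algebra_simps)
  moreover have "(\<Sum>r<t. 2 * int r - int t + 1) = 2 * (\<Sum>r<t. int r) - int t * int t + int t"
    by (simp only: sum.distrib sum_subtractf sum_distrib_left) simp
  ultimately show ?thesis by (simp add: algebra_simps)
qed

lemma sum_centered_squares:
  "3 * (\<Sum>r<t. (2 * int r - int t + 1) * (2 * int r - int t + 1)) = int t * (int t ^ 2 - 1)"
proof -
  have 1: "2 * (\<Sum>r<t. int r) = int t * (int t - 1)"
    by (induction t) (simp_all add: algebra_simps)
  have 2: "6 * (\<Sum>r<t. int r * int r) = int t * (int t - 1) * (2 * int t - 1)"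
    by (induction t) (simp_all add: algebra_simps)
  define T where "T = int t - 1"
  have "(2 * int r - int t + 1) * (2 * int r - int t + 1) = 4 * (int r * int r) - 4 * T * int r + T * T" for r
    by (simp add: T_def algebra_simps)
  then have "3 * (\<Sum>r<t. (2 * int r - int t + 1) * (2 * int r - int t + 1))
      = 2 * (6 * (\<Sum>r<t. int r * int r)) - 6 * T * (2 * (\<Sum>r<t. int r)) + 3 * int t * T * T"
    by (simp add: sum.distrib sum_subtractf sum_distrib_left[symmetric])
  then show ?thesis unfolding 1 2 by (simp add: T_def algebra_simps power2_eq_square)
qed

text \<open>Completing the square turns the core size into a sum of squares on the hyperplane of
  vectors with sum 0.\<close>

lemma core_size_squares:
  assumes "(\<Sum>r<t. x r) = 0"
  shows "(\<Sum>r<t. (2 * int t * x r + (2 * int r - int t + 1)) * (2 * int t * x r + (2 * int r - int t + 1)))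
    = 8 * int t * core_size t x + (\<Sum>r<t. (2 * int r - int t + 1) * (2 * int r - int t + 1))"
proof -
  let ?s = "\<lambda>r. 2 * int r - int t + 1"
  have "8 * int t * (int t * (x r * (x r - 1) div 2) + int r * x r)
      = (2 * int t * x r + ?s r) * (2 * int t * x r + ?s r) - ?s r * ?s r - 4 * int t * x r" for r
  proof -
    have "even (x r * (x r - 1))" by simp
    then obtain T where T: "x r * (x r - 1) = 2 * T" by (rule evenE)
    have "8 * int t * (int t * T + int r * x r) = 4 * int t * int t * (2 * T) + 8 * int t * int r * x r"
      by (simp add: algebra_simps)
    also have "\<dots> = (2 * int t * x r + ?s r) * (2 * int t * x r + ?s r) - ?s r * ?s r - 4 * int t * x r"
      unfolding T[symmetric] by (simp add: algebra_simps)
    finally show ?thesis unfolding T by simp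
  qed
  then have "8 * int t * core_size t x = (\<Sum>r<t. (2 * int t * x r + ?s r) * (2 * int t * x r + ?s r) - ?s r * ?s r - 4 * int t * x r)"
    unfolding core_size_def sum_distrib_left by (simp only:)
  also have "\<dots> = (\<Sum>r<t. (2 * int t * x r + ?s r) * (2 * int t * x r + ?s r)) - (\<Sum>r<t. ?s r * ?s r) - 4 * int t * (\<Sum>r<t. x r)"
    by (simp only: sum_subtractf sum_distrib_left)
  finally show ?thesis using assms by simp
qed

context odd_prime
begin

text \<open>Reducing \<open>core_ext\<close> modulo \<open>p\<close> parametrises the vectors whose
  sum vanishes modulo \<open>p\<close>. The linear condition is this hyperplane because
  \<open>2 * t\<close> is invertible and the centred shifts sum to 0; the quadratic one is
  \<open>core_size_squares\<close> with \<open>8 * t\<close> invertible.\<close>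

lemma card_core_form_prime:
  assumes t: "t > 1" and ndvd: "\<not> p dvd t"
  shows "card {\<rho> \<in> residue_vectors t (int p). [core_form t \<rho> = v] (mod int p)}
    = card {x \<in> {..<t} \<rightarrow>\<^sub>E {0..<int p}. int p dvd (\<Sum>r<t. 2 * int t * x r + (2 * int r - int t + 1)) \<and>
       int p dvd (\<Sum>r<t. (2 * int t * x r + (2 * int r - int t + 1)) * (2 * int t * x r + (2 * int r - int t + 1)))
         - (8 * int t * v + (\<Sum>r<t. (2 * int r - int t + 1) * (2 * int r - int t + 1)))}"
    (is "card ?A = card ?B")
proof -
  let ?s = "\<lambda>r. 2 * int r - int t + 1"
  let ?L = "\<lambda>x. \<Sum>r<t. 2 * int t * x r + ?s r" and ?G = "\<lambda>x. \<Sum>r<t. (2 * int t * x r + ?s r) * (2 * int t * x r + ?s r)"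
  let ?E = "\<Sum>r<t. ?s r * ?s r"
  let ?f = "\<lambda>\<rho>. \<lambda>r\<in>{..<t}. core_ext t \<rho> r mod int p"
  have p0: "int p > 0" using p_gt_2 by simp
  have t8: "\<not> int p dvd 8 * int t" and t2: "\<not> int p dvd 2 * int t"
  proof -
    have "\<not> int p dvd int t" using ndvd by simp
    moreover have "(8::int) = 2 * (2 * 2)" by simp
    ultimately show "\<not> int p dvd 8 * int t" "\<not> int p dvd 2 * int t" using not_dvd_2 by (simp_all only: dvd_mult_iff simp_thms)
  qed
  have L: "?L x = 2 * int t * (\<Sum>r<t. x r)" for x
    using sum_centered[of t] by (simp only: sum.distrib sum_distrib_left add_0_right)
  have fr: "int p dvd ?f \<rho> r - core_ext t \<rho> r" if "r < t" for \<rho> r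
    using that unfolding mod_eq_dvd_iff[symmetric] by simp
  have Lf: "int p dvd ?L (?f \<rho>)" for \<rho>
  proof -
    have "int p dvd (\<Sum>r<t. ?f \<rho> r - core_ext t \<rho> r)" by (rule dvd_sum) (use fr in blast)
    then have "int p dvd (\<Sum>r<t. ?f \<rho> r)" using core_ext_sum[of t \<rho>] t by (simp only: sum_subtractf) simp
    then show ?thesis unfolding L by (rule dvd_mult)
  qed
  have Gf: "int p dvd ?G (?f \<rho>) - (8 * int t * v + ?E) \<longleftrightarrow> int p dvd core_form t \<rho> - v" for \<rho>
  proof -
    let ?X = "core_ext t \<rho>"
    have "int p dvd ?G (?f \<rho>) - ?G ?X"
      unfolding sum_subtractf[symmetric]
    proof (rule dvd_sum)
      fix r assume "r \<in> {..<t}"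
      then have "int p dvd ?f \<rho> r - ?X r" using fr by blast
      then have "int p dvd (?f \<rho> r - ?X r) * (2 * int t * (2 * int t * ?f \<rho> r + ?s r + (2 * int t * ?X r + ?s r)))" by (rule dvd_mult2)
      moreover have "(a - b) * (c * (c * a + s + (c * b + s))) = (c * a + s) * (c * a + s) - (c * b + s) * (c * b + s)" for a b c s :: int
        by (simp add: algebra_simps)
      ultimately show "int p dvd (2 * int t * ?f \<rho> r + ?s r) * (2 * int t * ?f \<rho> r + ?s r) - (2 * int t * ?X r + ?s r) * (2 * int t * ?X r + ?s r)"
        by (simp only:)
    qed
    moreover have GX: "?G ?X = 8 * int t * core_form t \<rho> + ?E"
      unfolding core_form_def by (rule core_size_squares[OF core_ext_sum]) (use t in simp)
    ultimately have d: "int p dvd ?G (?f \<rho>) - (8 * int t * core_form t \<rho> + ?E)" by simp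
    have e: "?G (?f \<rho>) - (8 * int t * v + ?E) = (?G (?f \<rho>) - (8 * int t * core_form t \<rho> + ?E)) + 8 * int t * (core_form t \<rho> - v)"
      by (simp add: algebra_simps)
    have "int p dvd ?G (?f \<rho>) - (8 * int t * v + ?E) \<longleftrightarrow> int p dvd 8 * int t * (core_form t \<rho> - v)"
      unfolding e by (rule dvd_add_right_iff[OF d])
    then show ?thesis using t8 dvd_mult_iff by blast
  qed
  have rf: "restrict (?f \<rho>) {1..<t} = \<rho>" if "\<rho> \<in> residue_vectors t (int p)" for \<rho>
  proof (rule PiE_ext[of _ "{1..<t}" "\<lambda>_. UNIV"])
    fix i assume i: "i \<in> {1..<t}"
    then have "\<rho> i \<in> {0..<int p}" using that by (rule PiE_mem[rotated])
    then show "restrict (?f \<rho>) {1..<t} i = \<rho> i" using i by (simp add: core_ext_def)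
  qed (use that in \<open>auto simp: PiE_iff\<close>)
  have fr': "?f (restrict x {1..<t}) = x" if x: "x \<in> {..<t} \<rightarrow>\<^sub>E {0..<int p}" "int p dvd ?L x" for x
  proof (rule PiE_ext[of _ "{..<t}" "\<lambda>_. UNIV"])
    fix i assume i: "i \<in> {..<t}"
    have xi: "x i mod int p = x i" using PiE_mem[OF x(1) i] by simp
    show "?f (restrict x {1..<t}) i = x i"
    proof (cases "i = 0")
      case False
      then show ?thesis using i xi by (simp add: core_ext_def)
    next
      case True
      have "int p dvd (\<Sum>r<t. x r)" using x(2) t2 dvd_mult_iff unfolding L by blast
      then have "int p dvd - (\<Sum>r\<in>{1..<t}. x r) - x 0"
        using sum_lessThan_split_0[of t x] t by (simp add: dvd_diff_commute algebra_simps dvd_minus_iff[of _ "x 0 + _", symmetric])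
      then have "(- (\<Sum>r\<in>{1..<t}. x r)) mod int p = x 0 mod int p" by (simp only: mod_eq_dvd_iff)
      then show ?thesis using True i xi by (simp add: core_ext_def)
    qed
  qed (use x in \<open>auto simp: PiE_iff\<close>)
  have "bij_betw ?f ?A ?B"
  proof (rule bij_betw_byWitness[of _ "\<lambda>x. restrict x {1..<t}"])
    show "\<forall>\<rho>\<in>?A. restrict (?f \<rho>) {1..<t} = \<rho>" using rf by simp
    show "\<forall>x\<in>?B. ?f (restrict x {1..<t}) = x" using fr' by simp
    show "?f ` ?A \<subseteq> ?B"
    proof (rule image_subsetI)
      fix \<rho> assume "\<rho> \<in> ?A"
      then have "int p dvd core_form t \<rho> - v" by (simp add: cong_iff_dvd_diff)
      moreover have "?f \<rho> \<in> {..<t} \<rightarrow>\<^sub>E {0..<int p}" using p0 by simp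
      ultimately show "?f \<rho> \<in> ?B" using Lf[of \<rho>] Gf[of \<rho>] unfolding mem_Collect_eq by (intro conjI) simp_all
    qed
    show "(\<lambda>x. restrict x {1..<t}) ` ?B \<subseteq> ?A"
    proof (rule image_subsetI)
      fix x assume x: "x \<in> ?B"
      have "restrict x {1..<t} \<in> residue_vectors t (int p)" using x by (auto simp: PiE_iff)
      moreover have "?f (restrict x {1..<t}) = x" using x by (intro fr') simp_all
      then have "int p dvd core_form t (restrict x {1..<t}) - v" using Gf[of "restrict x {1..<t}"] x by simp
      ultimately show "restrict x {1..<t} \<in> ?A" by (simp add: cong_iff_dvd_diff)
    qed
  qed
  then show ?thesis by (rule bij_betw_same_card)
qed

lemma minus_one_powi: "(-1 :: complex) powi n = (-1) ^ nat \<bar>n\<bar>"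
  by (simp add: power_int_def)

text \<open>The character sum left by \<open>card_linear_quadratic\<close> carries
  \<open>eta \<alpha>\<close> to the power \<open>t + 1\<close>. For odd \<open>t\<close> this power
  is 1 and the sum gives \<open>indicator_I\<close>; for even \<open>t\<close> it is
  \<open>eta \<alpha>\<close> and the sum gives a further Gauss sum with a Legendre symbol.\<close>

lemma c_hook_eq:
  assumes t: "t > 1" and ndvd: "\<not> p dvd t"
  shows "c_hook t a p n = of_nat (card {\<rho> \<in> residue_vectors t (int p). [core_form t \<rho> = int n - int t * int a] (mod int p)})
    / of_nat p ^ (t - 1)"
proof -
  define M where "M = card {\<rho> \<in> residue_vectors t (int p). [core_form t \<rho> = int n - int t * int a] (mod int p)}"
  define E where "E = (\<Sum>r<t. (2 * int r - int t + 1) * (2 * int r - int t + 1))"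
  define C where "C = 8 * int t * (int n - int t * int a) + E"
  define H where "H = hook_arg a p t n"
  define h where "h = (p - 1) div 2"
  have p: "p = 2 * h + 1" using odd p_gt_2 by (auto simp: h_def elim!: oddE)
  have pz: "complex_of_nat p \<noteq> 0" using p_gt_2 by simp
  have tp: "\<not> int p dvd int t" using ndvd by simp
  have t2: "\<not> int p dvd 2 * int t" using tp not_dvd_2 dvd_mult_iff by blast
  have m1: "\<not> int p dvd -1" using p_gt_2 zdvd_imp_le[of "int p" 1] by auto
  \<comment> \<open>Three times \<open>E\<close> is \<open>t * (t\<^sup>2 - 1)\<close>, which
    cancels against the fraction in \<open>hook_arg\<close> up to a multiple of the square of
    \<open>p\<close>. The factor 3 is cancelled over the integers, so that \<open>p = 3\<close> is
    covered.\<close>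
  have CH: "int p dvd C + 8 * int t * H"
  proof -
    obtain D where D: "(1 - int t ^ 2) * (1 - int p ^ 2) = 24 * D"
      using hook_arg_exact[OF prime odd ndvd] by (rule dvdE)
    have Heq: "H = D + int a * int t - int n" by (simp add: H_def hook_arg_def D)
    have E: "3 * E = int t * (int t ^ 2 - 1)" using sum_centered_squares[of t] by (simp only: E_def)
    have "3 * (C + 8 * int t * H) = 3 * E + int t * (24 * D)" unfolding C_def Heq by (simp add: algebra_simps)
    also have "\<dots> = (3 * E) * int p ^ 2"
      unfolding D[symmetric] E by (simp add: algebra_simps)
    also have "\<dots> = 3 * (int p * (E * int p))" by (simp add: power2_eq_square)
    finally have "3 * (C + 8 * int t * H) = 3 * (int p * (E * int p))" .
    moreover have "X = Y" if "3 * X = 3 * Y" for X Y :: int using that by simp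
    ultimately have "C + 8 * int t * H = int p * (E * int p)" by blast
    then show ?thesis by simp
  qed
  have dvdC: "int p dvd C \<longleftrightarrow> int p dvd H"
  proof -
    have t8: "\<not> int p dvd 8 * int t"
    proof -
      have "(8::int) * int t = 2 * (2 * (2 * int t))" by simp
      then show ?thesis using t2 not_dvd_2 by (simp only: dvd_mult_iff simp_thms)
    qed
    have "int p dvd C \<longleftrightarrow> int p dvd 8 * int t * H" using CH dvd_add_left_iff dvd_add_right_iff by blast
    then show ?thesis using t8 dvd_mult_iff by blast
  qed
  have main: "of_nat p ^ 2 * of_nat M = of_nat p ^ t + tau 1 ^ (t + 1) * of_int (eta (- int t)) * (\<Sum>\<alpha>\<in>{1..<int p}. of_int (eta \<alpha>) ^ (t + 1) * ee (\<alpha> * (- C)))"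
    unfolding M_def card_core_form_prime[OF t ndvd] C_def E_def
    by (rule card_linear_quadratic[OF t2 ndvd])
  have range: "{0..<int p} = insert 0 {1..<int p}" using p_gt_2 by auto
  have eta_nz: "\<not> int p dvd \<alpha>" if "\<alpha> \<in> {1..<int p}" for \<alpha>
  proof
    assume "int p dvd \<alpha>"
    then have "\<alpha> = 0" by (rule dvd_residue[rotated]) (use that in simp)
    then show False using that by simp
  qed
  have eta_m1: "eta (-1) = (-1) ^ h" unfolding h_def by (rule eta_minus_1)
  have eta_t: "eta (- int t) = eta (-1) * eta (int t)" using eta_mult[of "-1" "int t"] by simp
  have inv_p: "1 / of_nat p * of_nat p ^ (t + 1) = (of_nat p ^ t :: complex)" using pz by simp
  have "c_hook t a p n * of_nat p ^ (t + 1) = of_nat p ^ 2 * of_nat M"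
  proof (cases "odd t")
    case True
    then obtain k' where k': "t = 2 * k' + 1" by (rule oddE)
    define k where "k = k' + 1"
    have k: "t + 1 = 2 * k" "k \<ge> 1" by (simp_all add: k' k_def)
    have "(\<Sum>\<alpha>\<in>{1..<int p}. of_int (eta \<alpha>) ^ (t + 1) * ee (\<alpha> * (- C))) = (\<Sum>\<alpha>\<in>{1..<int p}. ee (\<alpha> * (- C)))"
    proof (intro sum.cong refl)
      fix \<alpha> assume "\<alpha> \<in> {1..<int p}"
      then have "eta \<alpha> ^ 2 = 1" using eta_sq[OF eta_nz] by (simp add: power2_eq_square)
      then have "eta \<alpha> ^ (t + 1) = 1" unfolding k(1) power_mult by simp
      then have "complex_of_int (eta \<alpha>) ^ (t + 1) = 1" by (metis of_int_1 of_int_power)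
      then show "of_int (eta \<alpha>) ^ (t + 1) * ee (\<alpha> * (- C)) = ee (\<alpha> * (- C))" by simp
    qed
    also have "\<dots> = of_int (indicator_I a p t n)"
    proof -
      have "1 + (\<Sum>\<alpha>\<in>{1..<int p}. ee (\<alpha> * (- C))) = (if int p dvd - C then of_nat p else 0)"
        using sum_ee[of "- C"] unfolding range by simp
      then have s: "(\<Sum>\<alpha>\<in>{1..<int p}. ee (\<alpha> * (- C))) = (if int p dvd C then of_nat p else 0) - 1"
        by (simp add: algebra_simps)
      have "[hook_arg a p t n = 0] (mod int p) \<longleftrightarrow> int p dvd C"
        using dvdC by (simp add: H_def cong_0_iff)
      then show ?thesis unfolding s indicator_I_def by simp
    qed
    finally have S: "(\<Sum>\<alpha>\<in>{1..<int p}. of_int (eta \<alpha>) ^ (t + 1) * ee (\<alpha> * (- C))) = of_int (indicator_I a p t n)" .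
    have tau_pow: "tau 1 ^ (t + 1) = of_int (eta (-1)) ^ k * of_nat p ^ k"
      unfolding k(1) power_mult tau_sq by (rule power_mult_distrib)
    \<comment> \<open>With \<open>t = 2 * k' + 1\<close> and \<open>p = 2 * h + 1\<close> the
      exponent is \<open>- (k' * h)\<close>, \<open>(-1) ^ h\<close> is the Legendre symbol of -1,
      and \<open>k + 1\<close> has the parity of \<open>k'\<close>.\<close>
    have e1: "(-1 :: complex) powi ((1 - int t) * (int p - 1) div 4) = of_int (eta (-1)) ^ (k + 1)"
    proof -
      have "(1 - int t) * (int p - 1) = 4 * (- (int k' * int h))" by (simp add: k' p algebra_simps)
      then have "(1 - int t) * (int p - 1) div 4 = - (int k' * int h)" by simp
      then have "(-1 :: complex) powi ((1 - int t) * (int p - 1) div 4) = (-1) ^ (k' * h)"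
        unfolding minus_one_powi by (simp add: nat_mult_distrib abs_mult)
      also have "\<dots> = ((-1) ^ h) ^ k'" by (simp add: power_mult[symmetric] mult.commute)
      also have "\<dots> = ((-1) ^ h) ^ (k + 1)"
      proof -
        have "((-1::complex) ^ h) ^ 2 = 1" by (simp add: power_mult[symmetric] mult.commute)
        then show ?thesis by (simp add: k_def power2_eq_square)
      qed
      finally show ?thesis unfolding eta_m1 by simp
    qed
    have e2: "of_nat p powi (- ((int t + 1) div 2)) * of_nat p ^ (t + 1) = (of_nat p ^ k :: complex)"
    proof -
      have "(int t + 1) div 2 = int k" by (simp add: k' k_def)
      then have "of_nat p powi (- ((int t + 1) div 2)) = inverse (of_nat p ^ k :: complex)" by (simp add: power_int_minus)
      moreover have "(of_nat p :: complex) ^ (t + 1) = of_nat p ^ k * of_nat p ^ k" unfolding k(1) by (simp add: mult_2 power_add)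
      ultimately show ?thesis using pz by simp
    qed
    have "c_hook t a p n * of_nat p ^ (t + 1) = of_nat p ^ t
        + (-1) powi ((1 - int t) * (int p - 1) div 4) * of_int (indicator_I a p t n)
          * (of_nat p powi (- ((int t + 1) div 2)) * of_nat p ^ (t + 1)) * of_int (eta (int t))"
      unfolding c_hook_def if_not_P[OF ndvd] if_P[OF True] distrib_right inv_p by (simp only: mult_ac)
    also have "\<dots> = of_nat p ^ 2 * of_nat M"
      unfolding main S tau_pow e1 e2 eta_t by (simp add: mult_ac)
    finally show ?thesis .
  next
    case False
    then obtain k where k: "t = 2 * k" by (auto elim: evenE)
    have odd_pow: "eta \<alpha> ^ (t + 1) = eta \<alpha>" for \<alpha>
      unfolding k using eta_values[of \<alpha>] by (auto simp: power_add power_mult)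
    have "(\<Sum>\<alpha>\<in>{1..<int p}. of_int (eta \<alpha>) ^ (t + 1) * ee (\<alpha> * (- C))) = (\<Sum>\<alpha>\<in>{1..<int p}. of_int (eta \<alpha>) * ee (\<alpha> * (- C)))"
      unfolding of_int_power[symmetric] odd_pow ..
    also have "\<dots> = tau (- C)" unfolding tau_def range using eta_0_iff[of 0] by simp
    also have "\<dots> = of_int (eta (- C)) * tau 1" by (rule tau_eq)
    finally have S: "(\<Sum>\<alpha>\<in>{1..<int p}. of_int (eta \<alpha>) ^ (t + 1) * ee (\<alpha> * (- C))) = of_int (eta (- C)) * tau 1" .
    \<comment> \<open>The further factor \<open>tau 1\<close> comes from the character sum just
      evaluated, which makes the total exponent \<open>t + 2\<close> even.\<close>
    have tau_pow: "tau 1 ^ (t + 1) * tau 1 = of_int (eta (-1)) ^ (k + 1) * of_nat p ^ (k + 1)"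
    proof -
      have "tau 1 ^ (t + 1) * tau 1 = (tau 1 ^ 2) ^ (k + 1)" unfolding k power_mult[symmetric] by (simp add: power_add mult_ac)
      then show ?thesis unfolding tau_sq by (simp only: power_mult_distrib)
    qed
    \<comment> \<open>\<open>t * C\<close> is congruent to \<open>- 2 * H\<close> times the square
      of \<open>2 * t\<close>, and the square drops out of the Legendre symbol.\<close>
    have eta_prod: "eta (- int t) * eta (- C) = eta (-1) * eta 2 * eta H"
    proof -
      have "eta (- int t) * eta (- C) = eta (int t * C)" by (simp add: eta_mult[symmetric])
      also have "\<dots> = eta ((-1 * 2 * H) * ((2 * int t) * (2 * int t)))"
      proof (rule eta_cong)
        have "int t * C - (-1 * 2 * H) * ((2 * int t) * (2 * int t)) = int t * (C + 8 * int t * H)" by (simp add: algebra_simps)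
        then show "int p dvd int t * C - (-1 * 2 * H) * ((2 * int t) * (2 * int t))" using CH by simp
      qed
      also have "\<dots> = eta (-1 * 2 * H)" unfolding eta_mult[of "-1 * 2 * H"] eta_square[OF t2] by simp
      also have "\<dots> = eta (-1) * eta 2 * eta H" by (simp only: eta_mult)
      finally show ?thesis .
    qed
    have e1: "\<i> powi ((1 - int t) * (int p - 1) div 2) * eps p = of_int (eta (-1)) ^ k * of_int (eta 2)"
    proof -
      have "(1 - int t) * (int p - 1) = 2 * (int h + (-2) * (int k * int h))" by (simp add: k p algebra_simps)
      then have "(1 - int t) * (int p - 1) div 2 = int h + (-2) * (int k * int h)" by simp
      then have "\<i> powi ((1 - int t) * (int p - 1) div 2) = \<i> powi (int h) * \<i> powi ((-2) * (int k * int h))"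
        by (simp only:) (rule power_int_add, simp)
      also have "\<i> powi ((-2) * (int k * int h)) = (\<i> powi (-2)) powi (int k * int h)" by (rule power_int_mult)
      also have "\<i> powi (-2) = -1" by (simp add: power_int_minus)
      also have "(-1 :: complex) powi (int k * int h) = ((-1) ^ h) ^ k"
        unfolding minus_one_powi by (simp add: nat_mult_distrib abs_mult power_mult[symmetric] mult.commute)
      also have "\<i> powi (int h) = \<i> ^ h" by simp
      finally have 1: "\<i> powi ((1 - int t) * (int p - 1) div 2) = \<i> ^ h * ((-1) ^ h) ^ k" .
      \<comment> \<open>This product is 1 or -1 depending on \<open>p\<close> modulo 8, in
        accordance with the Legendre symbol of 2.\<close>
      have 2: "\<i> ^ h * eps p = of_int (eta 2)"
      proof (cases "even h")
        case True
        then obtain j where j: "h = 2 * j" by (rule evenE)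
        have "[p = 1] (mod 4)" by (simp add: p j unique_euclidean_semiring_class.cong_def)
        then have "\<i> ^ h * eps p = (-1) ^ j" by (simp add: eps_def j power_mult)
        then show ?thesis unfolding eta_2 h_def[symmetric] by (simp add: j)
      next
        case False
        then obtain j where j: "h = 2 * j + 1" by (rule oddE)
        have "p mod 4 = 3" unfolding p j by presburger
        then have "\<not> [p = 1] (mod 4)" by (simp add: unique_euclidean_semiring_class.cong_def)
        then have "\<i> ^ h * eps p = (-1) ^ (j + 1)" by (simp add: eps_def j power_mult power_add mult.commute[of _ \<i>])
        moreover have "h - h div 2 = j + 1" by (simp add: j)
        ultimately show ?thesis unfolding eta_2 h_def[symmetric] by (simp only: of_int_power of_int_minus of_int_1)
      qed
      have "\<i> powi ((1 - int t) * (int p - 1) div 2) * eps p = ((-1) ^ h) ^ k * (\<i> ^ h * eps p)" unfolding 1 by (simp only: mult_ac)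
      then show ?thesis unfolding 2 eta_m1 by simp
    qed
    have e2: "of_nat p powi (- (int t div 2)) * of_nat p ^ (t + 1) = (of_nat p ^ (k + 1) :: complex)"
    proof -
      have "of_nat p powi (- (int t div 2)) = inverse (of_nat p ^ k :: complex)" by (simp add: k power_int_minus)
      moreover have "(of_nat p :: complex) ^ (t + 1) = of_nat p ^ k * of_nat p ^ (k + 1)" by (simp add: k mult_2 power_add)
      ultimately show ?thesis using pz by simp
    qed
    have sq: "of_int (eta (-1)) * of_int (eta (-1)) = (1::complex)"
      unfolding of_int_mult[symmetric] eta_sq[OF m1] by simp
    have "c_hook t a p n * of_nat p ^ (t + 1) = of_nat p ^ t
        + (\<i> powi ((1 - int t) * (int p - 1) div 2) * eps p)
          * (of_nat p powi (- (int t div 2)) * of_nat p ^ (t + 1)) * of_int (eta H)"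
      unfolding c_hook_def H_def if_not_P[OF ndvd] if_not_P[OF False] distrib_right inv_p by (simp only: mult_ac)
    also have "\<dots> = of_nat p ^ t + of_int (eta (-1)) ^ k * of_int (eta 2) * of_nat p ^ (k + 1) * of_int (eta H)"
      unfolding e1 e2 ..
    also have "\<dots> = of_nat p ^ t + (tau 1 ^ (t + 1) * tau 1) * of_int (eta (- int t) * eta (- C))"
      unfolding tau_pow eta_prod of_int_mult power_Suc2[of "of_int (eta (-1))", unfolded Suc_eq_plus1] using sq by (simp add: mult_ac)
    also have "\<dots> = of_nat p ^ 2 * of_nat M"
      unfolding main S by (simp add: mult_ac)
    finally show ?thesis .
  qed
  moreover have "(of_nat p :: complex) ^ (t + 1) = of_nat p ^ 2 * of_nat p ^ (t - 1)"
    using t by (simp add: power_add[symmetric])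
  ultimately have "of_nat p ^ 2 * (c_hook t a p n * of_nat p ^ (t - 1)) = (of_nat p ^ 2 * of_nat M :: complex)" by (simp only: mult.left_commute)
  then have "c_hook t a p n * of_nat p ^ (t - 1) = of_nat M" using pz by simp
  then show ?thesis unfolding M_def using pz by (simp add: eq_divide_eq)
qed

end

text \<open>The factor \<open>t\<close> makes this a conditional density: the vectors with core size
  congruent to \<open>n\<close> modulo \<open>t\<close> have density \<open>1 / t\<close> and
  account for all partitions of \<open>n\<close>.\<close>

definition hook_density :: "nat \<Rightarrow> nat \<Rightarrow> nat \<Rightarrow> nat \<Rightarrow> real" where
  "hook_density t a b n = real t * real (card {\<rho> \<in> residue_vectors t (int t * int b).
     [core_form t \<rho> = int n - int t * int a] (mod (int t * int b))}) / real (t * b) ^ (t - 1)"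

text \<open>If \<open>b\<close> divides \<open>t\<close>, the lifts from \<open>t\<close> to
  \<open>t * b\<close> are uniform and the value is \<open>1 / b\<close>. Otherwise the condition
  modulo \<open>t\<close> splits off with density \<open>1 / t\<close> and the condition modulo
  \<open>b\<close> is counted by Gauss sums. In particular the complex constant is a nonnegative
  real.\<close>

lemma c_hook_hook_density:
  assumes t: "t > 1" and b: "prime b" "odd b"
  shows "c_hook t a b n = of_real (hook_density t a b n)"
proof -
  have b0: "b > 0" using b(1) prime_gt_0_nat by blast
  let ?r = "int n - int t * int a"
  let ?N = "card {\<rho> \<in> residue_vectors t (int t * int b). [core_form t \<rho> = ?r] (mod (int t * int b))}"
  show ?thesis
  proof (cases "b dvd t")
    case True
    have "real (t * (b * ?N)) = real (t * b) ^ (t - 1)"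
      unfolding card_core_form_dvd[OF t b0 True] card_core_form_mod_t[OF t b0] by simp
    then have "real t * (real b * real ?N) = real (t * b) ^ (t - 1)" by (simp only: of_nat_mult)
    moreover have "0 < real (t * b) ^ (t - 1)" using t b0 by simp
    moreover have cancel: "x * y / K = 1 / B" if "x * (B * y) = K" "0 < K" "0 < B" for x y K B :: real
      using that by (simp add: frac_eq_eq mult_ac)
    ultimately have "hook_density t a b n = 1 / real b"
      unfolding hook_density_def using b0 by (intro cancel) (simp_all only: of_nat_0_less_iff)
    then show ?thesis using True by (simp add: c_hook_def)
  next
    case False
    interpret odd_prime b by unfold_locales (rule b)+
    have cop: "coprime b t" using prime_imp_coprime_nat[OF b(1) False] .
    have "hook_density t a b n = real (card {\<rho> \<in> residue_vectors t (int b). [core_form t \<rho> = ?r] (mod int b)}) / real b ^ (t - 1)"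
      unfolding hook_density_def density_change_modulus[OF t b0, symmetric] card_core_form_coprime[OF t b0 cop, symmetric]
      by simp
    then show ?thesis unfolding c_hook_eq[OF t False] by simp
  qed
qed

section \<open>From densities to the asymptotic formula\<close>

lemma p_hook_weight:
  assumes "t > 0" "b > 0"
  shows "real (p_hook t a b n) = (\<Sum>y \<in> {y \<in> {1..<t} \<rightarrow>\<^sub>E core_box n. [core_form t y = int n - int t * int a] (mod (int t * int b))}. core_weight t n y)"
  unfolding p_hook_core_quotient[OF assms] using sum_core_vectors[OF assms(1), of n "\<lambda>c. [c = int n - int t * int a] (mod (int t * int b))"]
  by simp

lemma p_hook_density:
  assumes t: "t > 1" and b: "b > 0"
  shows "(\<lambda>n. real (p_hook t a b n) / total_weight t n - hook_density t a b n / real t) \<longlonglongrightarrow> 0"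
proof -
  let ?P = "\<lambda>n y. [core_form t y = int n - int t * int a] (mod (int t * int b))"
  have "(\<lambda>n. (\<Sum>y \<in> {y \<in> {1..<t} \<rightarrow>\<^sub>E core_box n. ?P n y}. core_weight t n y) / total_weight t n
    - real (card {\<rho> \<in> residue_vectors t (int t * int b). ?P n \<rho>}) / real_of_int (int t * int b) ^ (t - 1)) \<longlonglongrightarrow> 0"
    by (rule weighted_residue_density[OF t]) (use t b in simp, rule cong_iff_of_cong[OF core_form_cong])
  moreover have "(\<Sum>y \<in> {y \<in> {1..<t} \<rightarrow>\<^sub>E core_box n. ?P n y}. core_weight t n y) = real (p_hook t a b n)" for n
    by (rule p_hook_weight[symmetric]) (use t b in auto)
  moreover have "real (card {\<rho> \<in> residue_vectors t (int t * int b). ?P n \<rho>}) / real_of_int (int t * int b) ^ (t - 1) = hook_density t a b n / real t" for n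
    using t by (simp add: hook_density_def)
  ultimately show ?thesis by (simp only:)
qed

text \<open>The case \<open>b = 1\<close>, where the density is 1, calibrates the total of the
  rounded weights against the number of partitions.\<close>

lemma partitions_total_weight:
  assumes t: "t > 1"
  shows "(\<lambda>n. real (card (partitions_of n)) / total_weight t n) \<longlonglongrightarrow> 1 / real t"
proof -
  have "hook_density t 0 1 n = 1" for n
  proof -
    have "real (t * card {\<rho> \<in> residue_vectors t (int t * int 1). [core_form t \<rho> = int n] (mod int t)}) = real ((t * 1) ^ (t - 1))"
      by (simp only: card_core_form_mod_t[OF t zero_less_one])
    then show ?thesis using t unfolding hook_density_def by simp
  qed
  moreover have "p_hook t 0 1 n = card (partitions_of n)" for n by (simp add: p_hook_def)
  ultimately have "(\<lambda>n. real (card (partitions_of n)) / total_weight t n - 1 / real t) \<longlonglongrightarrow> 0"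
    using p_hook_density[OF t zero_less_one, of 0] by simp
  then show ?thesis by (rule LIM_zero_cancel)
qed

text \<open>Without admissible residue vectors there are no admissible core vectors. At such
  \<open>n\<close> the asymptotic equivalence requires the count to vanish exactly, so a limit would
  not do.\<close>

lemma p_hook_eq_0:
  assumes t: "t > 1" and b: "b > 0" and "hook_density t a b n = 0"
  shows "p_hook t a b n = 0"
proof -
  let ?P = "\<lambda>y. [core_form t y = int n - int t * int a] (mod (int t * int b))"
  have "card {\<rho> \<in> residue_vectors t (int t * int b). ?P \<rho>} = 0"
    using assms by (simp add: hook_density_def)
  then have empty: "{\<rho> \<in> residue_vectors t (int t * int b). ?P \<rho>} = {}"
    using finite_residue_vectors by simp
  have "real (p_hook t a b n) = (\<Sum>\<rho> \<in> {\<rho> \<in> residue_vectors t (int t * int b). ?P \<rho>}. class_weight t (int t * int b) n \<rho>)"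
    unfolding p_hook_weight[OF less_trans[OF zero_less_one t] b]
    by (rule sum_core_weight_classes) (use t b in simp, rule cong_iff_of_cong[OF core_form_cong])
  then show ?thesis unfolding empty by simp
qed

text \<open>The density is an integer multiple of a constant independent of \<open>n\<close>. This
  lower bound turns an additive error into a relative one.\<close>

lemma hook_density_gap:
  assumes t: "t > 1" and b: "b > 0" and "hook_density t a b n \<noteq> 0"
  shows "real t / real (t * b) ^ (t - 1) \<le> hook_density t a b n"
proof -
  let ?N = "card {\<rho> \<in> residue_vectors t (int t * int b). [core_form t \<rho> = int n - int t * int a] (mod (int t * int b))}"
  have "?N \<noteq> 0" using assms(3) unfolding hook_density_def by (intro notI) simp
  then have "1 \<le> real ?N" by simp
  then have "real t * 1 / real (t * b) ^ (t - 1) \<le> real t * real ?N / real (t * b) ^ (t - 1)"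
    by (intro divide_right_mono mult_left_mono) auto
  then show ?thesis unfolding hook_density_def by simp
qed

theorem theorem1p14:
  fixes t a b :: nat
  assumes "t > 1" and "prime b" and "odd b" and "a < b"
  shows "(\<lambda>n::nat. of_nat (p_hook t a b n) :: complex) \<sim>[at_top]
           (\<lambda>n. c_hook t a b n / of_real (4 * sqrt 3 * real n)
                  * of_real (exp (pi * sqrt (2 * real n / 3))))"
proof -
  have t: "t > 1" and b: "b > 0" using assms prime_gt_0_nat by auto
  define H where "H n = exp (pi * sqrt (2 * real n / 3)) / (4 * sqrt 3 * real n)" for n :: nat
  define c where "c = hook_density t a b"
  define \<delta> where "\<delta> = real t / real (t * b) ^ (t - 1)"
  have \<delta>: "0 < \<delta>" using t b by (simp add: \<delta>_def)
  let ?p = "\<lambda>n. real (card (partitions_of n))" and ?q = "\<lambda>n. real (p_hook t a b n)" and ?T = "total_weight t"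
  have pT: "(\<lambda>n. ?p n / ?T n) \<longlonglongrightarrow> 1 / real t" by (rule partitions_total_weight[OF t])
  have cB: "\<bar>c n\<bar> \<le> real t" for n
  proof -
    let ?R = "residue_vectors t (int t * int b)"
    have "card {\<rho> \<in> ?R. [core_form t \<rho> = int n - int t * int a] (mod (int t * int b))} \<le> card ?R"
      by (intro card_mono finite_residue_vectors) auto
    also have "card ?R = (t * b) ^ (t - 1)" by (simp add: card_PiE nat_mult_distrib)
    finally have "real (card {\<rho> \<in> ?R. [core_form t \<rho> = int n - int t * int a] (mod (int t * int b))}) \<le> real (t * b) ^ (t - 1)"
      by (simp only: of_nat_le_iff flip: of_nat_power)
    moreover have "0 < real (t * b) ^ (t - 1)" using t b by simp
    ultimately have "real t * real (card {\<rho> \<in> ?R. [core_form t \<rho> = int n - int t * int a] (mod (int t * int b))}) / real (t * b) ^ (t - 1) \<le> real t"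
      by (simp add: pos_divide_le_eq mult_left_mono)
    then show ?thesis by (simp add: c_def hook_density_def)
  qed
  \<comment> \<open>The equidistribution error, rescaled from the total weight to the
    Hardy--Ramanujan main term.\<close>
  have "(\<lambda>n. (?q n / ?T n - c n / real t) / (?p n / ?T n) * (?p n / H n)) \<longlonglongrightarrow> 0 / (1 / real t) * 1"
    unfolding c_def H_def using t by (intro tendsto_mult tendsto_divide p_hook_density[OF t b] pT partitions_asymp) auto
  then have lim1: "(\<lambda>n. (?q n / ?T n - c n / real t) / (?p n / ?T n) * (?p n / H n)) \<longlonglongrightarrow> 0" by simp
  have "(\<lambda>n. (1 / real t) / (?p n / ?T n) * (?p n / H n) - 1) \<longlonglongrightarrow> (1 / real t) / (1 / real t) * 1 - 1"
    unfolding H_def using t by (intro tendsto_diff tendsto_mult tendsto_divide tendsto_const pT partitions_asymp) auto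
  then have lim2: "(\<lambda>n. (1 / real t) / (?p n / ?T n) * (?p n / H n) - 1) \<longlonglongrightarrow> 0" using t by simp
  \<comment> \<open>\<open>c n\<close> depends on \<open>n\<close> and need not converge; it is kept
    as a bounded factor of an error tending to 0.\<close>
  have "(\<lambda>n. c n * ((1 / real t) / (?p n / ?T n) * (?p n / H n) - 1)) \<longlonglongrightarrow> 0"
  proof (rule Lim_null_comparison)
    show "(\<lambda>n. real t * \<bar>(1 / real t) / (?p n / ?T n) * (?p n / H n) - 1\<bar>) \<longlonglongrightarrow> 0"
      using tendsto_mult[OF tendsto_const[of "real t"] tendsto_rabs[OF lim2]] by simp
    show "\<forall>\<^sub>F n in sequentially. norm (c n * ((1 / real t) / (?p n / ?T n) * (?p n / H n) - 1))
        \<le> real t * \<bar>(1 / real t) / (?p n / ?T n) * (?p n / H n) - 1\<bar>"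
      unfolding real_norm_def abs_mult by (intro eventuallyI mult_right_mono cB) simp
  qed
  from tendsto_add[OF lim1 this]
  have "(\<lambda>n. (?q n / ?T n - c n / real t) / (?p n / ?T n) * (?p n / H n) + c n * ((1 / real t) / (?p n / ?T n) * (?p n / H n) - 1)) \<longlonglongrightarrow> 0" by simp
  moreover have "(?q n / ?T n - c n / real t) / (?p n / ?T n) * (?p n / H n) + c n * ((1 / real t) / (?p n / ?T n) * (?p n / H n) - 1) = ?q n / H n - c n" for n
  proof -
    have "(q / T - c / t) / (p / T) * (p / H) + c * ((1 / t) / (p / T) * (p / H) - 1) = q / H - c"
      if "0 < p" "0 < T" for p T q c t H :: real
    proof -
      have "(q / T - c / t) / (p / T) * (p / H) = q / H - c * ((1 / t) / (p / T) * (p / H))"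
        using that by (simp add: diff_divide_distrib left_diff_distrib)
      then show ?thesis by (simp add: right_diff_distrib)
    qed
    then show ?thesis using card_partitions_pos[of n] total_weight_pos[OF t, of n] by simp
  qed
  ultimately have lim: "(\<lambda>n. ?q n / H n - c n) \<longlonglongrightarrow> 0" by (simp only:)
  have g: "c_hook t a b n / of_real (4 * sqrt 3 * real n) * of_real (exp (pi * sqrt (2 * real n / 3))) = of_real (c n * H n)" for n
    unfolding c_hook_hook_density[OF t assms(2,3)] c_def H_def by simp
  show ?thesis unfolding g asymp_equiv_def
  proof (rule LIM_zero_cancel, rule Lim_null_comparison)
    show "(\<lambda>n. \<bar>?q n / H n - c n\<bar> / \<delta>) \<longlonglongrightarrow> 0" using tendsto_divide[OF tendsto_rabs[OF lim] tendsto_const[of \<delta>]] \<delta> by simp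
    show "\<forall>\<^sub>F n in sequentially. norm ((if of_nat (p_hook t a b n) = (0::complex) \<and> complex_of_real (c n * H n) = 0 then 1
        else of_nat (p_hook t a b n) / complex_of_real (c n * H n)) - 1) \<le> \<bar>?q n / H n - c n\<bar> / \<delta>"
      using eventually_gt_at_top[of 0]
    proof eventually_elim
      fix n :: nat assume n: "0 < n"
      have H: "0 < H n" using n by (simp add: H_def)
      show "norm ((if of_nat (p_hook t a b n) = (0::complex) \<and> complex_of_real (c n * H n) = 0 then 1
        else of_nat (p_hook t a b n) / complex_of_real (c n * H n)) - 1) \<le> \<bar>?q n / H n - c n\<bar> / \<delta>"
      \<comment> \<open>For vanishing density both sides are 0 and the quotient counts as 1 by the
        convention in \<open>asymp_equiv_def\<close>; otherwise \<open>\<delta>\<close> bounds the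
        denominator from below.\<close>
      proof (cases "c n = 0")
        case True
        then have "p_hook t a b n = 0" unfolding c_def by (rule p_hook_eq_0[OF t b])
        then show ?thesis using True \<delta> by simp
      next
        case False
        then have gap: "\<delta> \<le> c n" unfolding \<delta>_def c_def by (rule hook_density_gap[OF t b])
        have "of_nat (p_hook t a b n) / of_real (c n * H n) - (1::complex) = of_real ((?q n / H n - c n) / c n)"
          using False H by (simp add: field_simps)
        then have "norm (of_nat (p_hook t a b n) / of_real (c n * H n) - (1::complex)) = \<bar>?q n / H n - c n\<bar> / c n"
          using gap \<delta> by (simp only: norm_of_real abs_divide abs_of_pos[OF less_le_trans[OF \<delta> gap]])
        also have "\<dots> \<le> \<bar>?q n / H n - c n\<bar> / \<delta>" using gap \<delta> by (intro divide_left_mono) auto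
        finally have "norm (of_nat (p_hook t a b n) / of_real (c n * H n) - (1::complex)) \<le> \<bar>?q n / H n - c n\<bar> / \<delta>" .
        moreover have "complex_of_real (c n * H n) \<noteq> 0" using False H by simp
        ultimately show ?thesis by (simp only: simp_thms if_False)
      qed
    qed
  qed
qed

end
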